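(* The universal Euler characteristic $\widehat\chi_U\colon U_0\to U_1$ is the unique morphism from the initial object to the terminal object in $\mathrm{biHH}(\mathrm{Adj})\simeq(\Lambda_\infty)^{\lhd\rhd}$.
   Context: $\mathrm{Adj}$ is the free strict 2-category generated by an adjunction: objects $0,1$, 1-cells $f\colon 0\to1$, $g\colon1\to0$, 2-cells $u\colon U_0\Rightarrow gf$, $c\colon fg\Rightarrow U_1$ (where $U_i$ is the identity 1-cell of $i$), subject to the triangle identities. For a bicategory $\mathcal B$, $\mathrm{biHH}(\mathcal B)$ is the colimit, in the $(2,1)$-category $\mathrm{Cat}$ of small categories, functors and natural isomorphisms (i.e. the pseudo-colimit), of the pseudofunctor $\mathrm{biN}^{cy}_\bullet(\mathcal B)\colon\Delta_{\le2}^{op}\to\mathrm{Cat}$ ($\Delta_{\le 2}$ the full subcategory of the simplex category on $[0],[1],[2]$) with $[n]\mapsto\coprod_{X_0,\dots,X_n}\mathcal B(X_0,X_1)\times\cdots\times\mathcal B(X_n,X_0)$, where, writing $F\ast G$ for "first $F$, then $G$", $d_0(F,G)=F\ast G$, $d_1(F,G)=G\ast F$, $d_0(F,G,H)=(F\ast G,H)$, $d_1(F,G,H)=(F,G\ast H)$, $d_2(F,G,H)=(H\ast F,G)$, $s_0(F)=(F,U_{X_0})$, $s_0(F,G)=(F,U_{X_1},G)$, $s_1(F,G)=(F,G,U_{X_0})$, with coherence isomorphisms from the associators and unitors. In particular endomorphism 1-cells of $\mathcal B$ give objects of $\mathrm{biHH}(\mathcal B)$, 2-cells between them give morphisms, and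 there are canonical isomorphisms $F\ast G\cong G\ast F$. The universal Euler characteristic is the morphism $\widehat\chi_U\colon U_0\xrightarrow{u}gf\xrightarrow{\cong}fg\xrightarrow{c}U_1$ in $\mathrm{biHH}(\mathrm{Adj})$. $\Lambda_\infty$ is the paracyclic category: objects $[0],[1],[2],\dots$, and morphisms $[n]\to[m]$ are the weakly monotone functions $\phi\colon\mathbb Z\to\mathbb Z$ with $\phi(l+n+1)=\phi(l)+m+1$ for all $l$. $(-)^{\lhd}$ and $(-)^{\rhd}$ denote adjoining a new initial, respectively terminal, object. *)

theory Defs
  imports Main "HOL-Library.FuncSet"
begin

section \<open>Categories, functors, natural isomorphisms\<close>

record ('o, 'm) cat =
  Ob :: "'o set"
  Ar :: "'m set"
  Dom :: "'m \<Rightarrow> 'o"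
  Cod :: "'m \<Rightarrow> 'o"
  Idt :: "'o \<Rightarrow> 'm"
  Cmp :: "'m \<Rightarrow> 'm \<Rightarrow> 'm"  \<comment> \<open>\<open>Cmp C g f\<close> is \<open>g\<close> after \<open>f\<close>\<close>

definition in_hom :: "('o, 'm) cat \<Rightarrow> 'm \<Rightarrow> 'o \<Rightarrow> 'o \<Rightarrow> bool" where
  "in_hom C h x y \<longleftrightarrow> h \<in> Ar C \<and> Dom C h = x \<and> Cod C h = y"

locale category =
  fixes C :: "('o, 'm) cat"
  assumes dom_ob: "h \<in> Ar C \<Longrightarrow> Dom C h \<in> Ob C"
    and cod_ob: "h \<in> Ar C \<Longrightarrow> Cod C h \<in> Ob C"
    and idt_hom: "x \<in> Ob C \<Longrightarrow> in_hom C (Idt C x) x x"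
    and cmp_hom: "in_hom C h x y \<Longrightarrow> in_hom C k y z \<Longrightarrow> in_hom C (Cmp C k h) x z"
    and cmp_idt: "in_hom C h x y \<Longrightarrow> Cmp C h (Idt C x) = h"
    and idt_cmp: "in_hom C h x y \<Longrightarrow> Cmp C (Idt C y) h = h"
    and cmp_assoc: "in_hom C h x y \<Longrightarrow> in_hom C k y z \<Longrightarrow> in_hom C l z w \<Longrightarrow>
      Cmp C l (Cmp C k h) = Cmp C (Cmp C l k) h"

definition inverse_pair :: "('o, 'm) cat \<Rightarrow> 'm \<Rightarrow> 'm \<Rightarrow> bool" where
  "inverse_pair C h k \<longleftrightarrow> h \<in> Ar C \<and> in_hom C k (Cod C h) (Dom C h) \<and>
     Cmp C k h = Idt C (Dom C h) \<and> Cmp C h k = Idt C (Cod C h)"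

definition is_iso :: "('o, 'm) cat \<Rightarrow> 'm \<Rightarrow> bool" where
  "is_iso C h \<longleftrightarrow> (\<exists>k. inverse_pair C h k)"

definition inv_ar :: "('o, 'm) cat \<Rightarrow> 'm \<Rightarrow> 'm" where
  "inv_ar C h = (THE k. inverse_pair C h k)"

definition initial_ob :: "('o, 'm) cat \<Rightarrow> 'o \<Rightarrow> bool" where
  "initial_ob C x \<longleftrightarrow> x \<in> Ob C \<and> (\<forall>y \<in> Ob C. \<exists>!h. in_hom C h x y)"

definition terminal_ob :: "('o, 'm) cat \<Rightarrow> 'o \<Rightarrow> bool" where
  "terminal_ob C y \<longleftrightarrow> y \<in> Ob C \<and> (\<forall>x \<in> Ob C. \<exists>!h. in_hom C h x y)"

record ('o, 'm, 'p, 'n) fctr =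
  FOb :: "'o \<Rightarrow> 'p"
  FAr :: "'m \<Rightarrow> 'n"

definition is_functor :: "('o, 'm) cat \<Rightarrow> ('p, 'n) cat \<Rightarrow> ('o, 'm, 'p, 'n) fctr \<Rightarrow> bool" where
  "is_functor C D F \<longleftrightarrow> category C \<and> category D \<and>
     (\<forall>x \<in> Ob C. FOb F x \<in> Ob D) \<and>
     (\<forall>h x y. in_hom C h x y \<longrightarrow> in_hom D (FAr F h) (FOb F x) (FOb F y)) \<and>
     (\<forall>x \<in> Ob C. FAr F (Idt C x) = Idt D (FOb F x)) \<and>
     (\<forall>h k x y z. in_hom C h x y \<longrightarrow> in_hom C k y z \<longrightarrow>
        FAr F (Cmp C k h) = Cmp D (FAr F k) (FAr F h))"

definition fid :: "('o, 'm, 'o, 'm) fctr" where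
  "fid = \<lparr> FOb = (\<lambda>x. x), FAr = (\<lambda>h. h) \<rparr>"

definition fcomp :: "('p, 'n, 'q, 'l) fctr \<Rightarrow> ('o, 'm, 'p, 'n) fctr \<Rightarrow> ('o, 'm, 'q, 'l) fctr" where
  "fcomp G F = \<lparr> FOb = (\<lambda>x. FOb G (FOb F x)), FAr = (\<lambda>h. FAr G (FAr F h)) \<rparr>"

definition nat_iso :: "('o, 'm) cat \<Rightarrow> ('p, 'n) cat \<Rightarrow> ('o, 'm, 'p, 'n) fctr \<Rightarrow>
    ('o, 'm, 'p, 'n) fctr \<Rightarrow> ('o \<Rightarrow> 'n) \<Rightarrow> bool" where
  "nat_iso C D F G \<eta> \<longleftrightarrow> is_functor C D F \<and> is_functor C D G \<and>
     (\<forall>x \<in> Ob C. in_hom D (\<eta> x) (FOb F x) (FOb G x) \<and> is_iso D (\<eta> x)) \<and>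
     (\<forall>h x y. in_hom C h x y \<longrightarrow> Cmp D (FAr G h) (\<eta> x) = Cmp D (\<eta> y) (FAr F h))"

definition equivalent_cats :: "('o, 'm) cat \<Rightarrow> ('p, 'n) cat \<Rightarrow> bool" where
  "equivalent_cats C D \<longleftrightarrow> (\<exists>F G \<eta> \<epsilon>.
     is_functor C D F \<and> is_functor D C G \<and>
     nat_iso C C fid (fcomp G F) \<eta> \<and> nat_iso D D (fcomp F G) fid \<epsilon>)"

section \<open>Pseudo-colimits in the (2,1)-category of small categories\<close>

text \<open>
  A pseudofunctor from the opposite of \<open>J\<close> to categories. An arrow \<open>a\<close> from \<open>i\<close> to \<open>j\<close> of \<open>J\<close> gives
  a functor \<open>PMap P a\<close> from \<open>PCat P j\<close> to \<open>PCat P i\<close>. For composable \<open>b\<close>, \<open>a\<close> (first \<open>b\<close>) the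
  compositor \<open>PComp P a b\<close> goes from \<open>PMap b \<circ> PMap a\<close> to \<open>PMap (a \<circ> b)\<close>, and the unitor
  \<open>PUnit P j\<close> goes from the identity of \<open>PCat P j\<close> to \<open>PMap (id j)\<close>.
\<close>

record ('j, 'k, 'o, 'm) psfun =
  PCat :: "'j \<Rightarrow> ('o, 'm) cat"
  PMap :: "'k \<Rightarrow> ('o, 'm, 'o, 'm) fctr"
  PComp :: "'k \<Rightarrow> 'k \<Rightarrow> 'o \<Rightarrow> 'm"
  PUnit :: "'j \<Rightarrow> 'o \<Rightarrow> 'm"

record ('j, 'k, 'o, 'm, 'c, 'd) cocone =
  Leg :: "'j \<Rightarrow> ('o, 'm, 'c, 'd) fctr"
  LegIso :: "'k \<Rightarrow> 'o \<Rightarrow> 'd"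

definition pseudo_cocone :: "('j, 'k) cat \<Rightarrow> ('j, 'k, 'o, 'm) psfun \<Rightarrow> ('c, 'd) cat \<Rightarrow>
    ('j, 'k, 'o, 'm, 'c, 'd) cocone \<Rightarrow> bool" where
  "pseudo_cocone J P D L \<longleftrightarrow>
     (\<forall>j \<in> Ob J. is_functor (PCat P j) D (Leg L j)) \<and>
     (\<forall>a i j. in_hom J a i j \<longrightarrow>
        nat_iso (PCat P j) D (Leg L j) (fcomp (Leg L i) (PMap P a)) (LegIso L a)) \<and>
     (\<forall>j \<in> Ob J. \<forall>x \<in> Ob (PCat P j). LegIso L (Idt J j) x = FAr (Leg L j) (PUnit P j x)) \<and>
     (\<forall>a b i j k. in_hom J b i j \<longrightarrow> in_hom J a j k \<longrightarrow> (\<forall>x \<in> Ob (PCat P k).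
        LegIso L (Cmp J a b) x =
          Cmp D (FAr (Leg L i) (PComp P a b x))
            (Cmp D (LegIso L b (FOb (PMap P a) x)) (LegIso L a x))))"

definition cocone_iso :: "('j, 'k) cat \<Rightarrow> ('j, 'k, 'o, 'm) psfun \<Rightarrow> ('c, 'd) cat \<Rightarrow>
    ('j, 'k, 'o, 'm, 'c, 'd) cocone \<Rightarrow> ('j, 'k, 'o, 'm, 'c, 'd) cocone \<Rightarrow>
    ('j \<Rightarrow> 'o \<Rightarrow> 'd) \<Rightarrow> bool" where
  "cocone_iso J P D L M \<mu> \<longleftrightarrow>
     (\<forall>j \<in> Ob J. nat_iso (PCat P j) D (Leg L j) (Leg M j) (\<mu> j)) \<and>
     (\<forall>a i j. in_hom J a i j \<longrightarrow> (\<forall>x \<in> Ob (PCat P j).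
        Cmp D (LegIso M a x) (\<mu> j x) = Cmp D (\<mu> i (FOb (PMap P a) x)) (LegIso L a x)))"

definition push_cocone :: "('c, 'd, 'e, 'f) fctr \<Rightarrow> ('j, 'k, 'o, 'm, 'c, 'd) cocone \<Rightarrow>
    ('j, 'k, 'o, 'm, 'e, 'f) cocone" where
  "push_cocone H L = \<lparr> Leg = (\<lambda>j. fcomp H (Leg L j)), LegIso = (\<lambda>a x. FAr H (LegIso L a x)) \<rparr>"

text \<open>
  \<open>C\<close> with cocone \<open>L\<close> is a colimit in the (2,1)-category sense: for every \<open>D\<close>, pushing \<open>L\<close> forward is
  an equivalence from the groupoid of functors \<open>C \<rightarrow> D\<close> and natural isomorphisms to the groupoid of
  pseudo-cocones with vertex \<open>D\<close> (essentially surjective, then fully faithful). HOL cannot quantify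
  over all types inside a definition, so \<open>D\<close> ranges over the categories with the same object and
  arrow types as \<open>C\<close>: this pair of types is the universe of small categories.
\<close>

definition pseudo_colimit :: "('j, 'k) cat \<Rightarrow> ('j, 'k, 'o, 'm) psfun \<Rightarrow> ('c, 'd) cat \<Rightarrow>
    ('j, 'k, 'o, 'm, 'c, 'd) cocone \<Rightarrow> bool" where
  "pseudo_colimit J P C L \<longleftrightarrow> category C \<and> pseudo_cocone J P C L \<and>
     (\<forall>D :: ('c, 'd) cat. category D \<longrightarrow>
        (\<forall>M. pseudo_cocone J P D M \<longrightarrow>
           (\<exists>H \<mu>. is_functor C D H \<and> cocone_iso J P D (push_cocone H L) M \<mu>)) \<and>
        (\<forall>H K \<mu>. is_functor C D H \<longrightarrow> is_functor C D K \<longrightarrow>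
           cocone_iso J P D (push_cocone H L) (push_cocone K L) \<mu> \<longrightarrow>
           (\<exists>\<eta>. nat_iso C D H K \<eta> \<and>
              (\<forall>j \<in> Ob J. \<forall>x \<in> Ob (PCat P j). \<eta> (FOb (Leg L j) x) = \<mu> j x) \<and>
              (\<forall>\<eta>'. nat_iso C D H K \<eta>' \<and>
                 (\<forall>j \<in> Ob J. \<forall>x \<in> Ob (PCat P j). \<eta>' (FOb (Leg L j) x) = \<mu> j x) \<longrightarrow>
                 (\<forall>x \<in> Ob C. \<eta>' x = \<eta> x)))))"

section \<open>Bicategories\<close>

text \<open>
  \<open>Cells\<close> is the coproduct of all hom-categories: its objects are the 1-cells, its arrows the 2-cells.
  Horizontal composition is diagrammatic: \<open>HC1 B F G\<close> is first \<open>F\<close>, then \<open>G\<close>.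
\<close>

record ('x, 'f, 'a) bicat =
  Obj0 :: "'x set"
  Cells :: "('f, 'a) cat"
  Src :: "'f \<Rightarrow> 'x"
  Tgt :: "'f \<Rightarrow> 'x"
  Unt :: "'x \<Rightarrow> 'f"
  HC1 :: "'f \<Rightarrow> 'f \<Rightarrow> 'f"
  HC2 :: "'a \<Rightarrow> 'a \<Rightarrow> 'a"
  Assoc :: "'f \<Rightarrow> 'f \<Rightarrow> 'f \<Rightarrow> 'a"  \<comment> \<open>from \<open>(F * G) * H\<close> to \<open>F * (G * H)\<close>\<close>
  LUnit :: "'f \<Rightarrow> 'a"  \<comment> \<open>from \<open>U * F\<close> to \<open>F\<close>\<close>
  RUnit :: "'f \<Rightarrow> 'a"  \<comment> \<open>from \<open>F * U\<close> to \<open>F\<close>\<close>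

definition one_cell :: "('x, 'f, 'a) bicat \<Rightarrow> 'f \<Rightarrow> 'x \<Rightarrow> 'x \<Rightarrow> bool" where
  "one_cell B F X Y \<longleftrightarrow> F \<in> Ob (Cells B) \<and> Src B F = X \<and> Tgt B F = Y"

locale bicategory =
  fixes B :: "('x, 'f, 'a) bicat"
  assumes cells: "category (Cells B)"
    and src_obj: "F \<in> Ob (Cells B) \<Longrightarrow> Src B F \<in> Obj0 B"
    and tgt_obj: "F \<in> Ob (Cells B) \<Longrightarrow> Tgt B F \<in> Obj0 B"
    and par_src: "in_hom (Cells B) a F F' \<Longrightarrow> Src B F = Src B F'"
    and par_tgt: "in_hom (Cells B) a F F' \<Longrightarrow> Tgt B F = Tgt B F'"
    and unt: "X \<in> Obj0 B \<Longrightarrow> one_cell B (Unt B X) X X"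
    and hc1: "one_cell B F X Y \<Longrightarrow> one_cell B G Y Z \<Longrightarrow> one_cell B (HC1 B F G) X Z"
    and hc2: "in_hom (Cells B) a F F' \<Longrightarrow> in_hom (Cells B) b G G' \<Longrightarrow> Tgt B F = Src B G \<Longrightarrow>
      in_hom (Cells B) (HC2 B a b) (HC1 B F G) (HC1 B F' G')"
    and hc2_idt: "one_cell B F X Y \<Longrightarrow> one_cell B G Y Z \<Longrightarrow>
      HC2 B (Idt (Cells B) F) (Idt (Cells B) G) = Idt (Cells B) (HC1 B F G)"
    and hc2_cmp: "in_hom (Cells B) a F F' \<Longrightarrow> in_hom (Cells B) a' F' F'' \<Longrightarrow>
      in_hom (Cells B) b G G' \<Longrightarrow> in_hom (Cells B) b' G' G'' \<Longrightarrow> Tgt B F = Src B G \<Longrightarrow>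
      HC2 B (Cmp (Cells B) a' a) (Cmp (Cells B) b' b) = Cmp (Cells B) (HC2 B a' b') (HC2 B a b)"
    and assoc_iso: "one_cell B F X Y \<Longrightarrow> one_cell B G Y Z \<Longrightarrow> one_cell B H Z W \<Longrightarrow>
      in_hom (Cells B) (Assoc B F G H) (HC1 B (HC1 B F G) H) (HC1 B F (HC1 B G H)) \<and>
      is_iso (Cells B) (Assoc B F G H)"
    and assoc_nat: "in_hom (Cells B) a F F' \<Longrightarrow> in_hom (Cells B) b G G' \<Longrightarrow>
      in_hom (Cells B) c H H' \<Longrightarrow> Tgt B F = Src B G \<Longrightarrow> Tgt B G = Src B H \<Longrightarrow>
      Cmp (Cells B) (Assoc B F' G' H') (HC2 B (HC2 B a b) c) =
      Cmp (Cells B) (HC2 B a (HC2 B b c)) (Assoc B F G H)"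
    and lunit_iso: "one_cell B F X Y \<Longrightarrow>
      in_hom (Cells B) (LUnit B F) (HC1 B (Unt B X) F) F \<and> is_iso (Cells B) (LUnit B F)"
    and lunit_nat: "in_hom (Cells B) a F F' \<Longrightarrow>
      Cmp (Cells B) (LUnit B F') (HC2 B (Idt (Cells B) (Unt B (Src B F))) a) =
      Cmp (Cells B) a (LUnit B F)"
    and runit_iso: "one_cell B F X Y \<Longrightarrow>
      in_hom (Cells B) (RUnit B F) (HC1 B F (Unt B Y)) F \<and> is_iso (Cells B) (RUnit B F)"
    and runit_nat: "in_hom (Cells B) a F F' \<Longrightarrow>
      Cmp (Cells B) (RUnit B F') (HC2 B a (Idt (Cells B) (Unt B (Tgt B F)))) =
      Cmp (Cells B) a (RUnit B F)"
    and pentagon: "one_cell B F X Y \<Longrightarrow> one_cell B G Y Z \<Longrightarrow> one_cell B H Z W \<Longrightarrow>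
      one_cell B K W V \<Longrightarrow>
      Cmp (Cells B) (Assoc B F G (HC1 B H K)) (Assoc B (HC1 B F G) H K) =
      Cmp (Cells B) (HC2 B (Idt (Cells B) F) (Assoc B G H K))
        (Cmp (Cells B) (Assoc B F (HC1 B G H) K) (HC2 B (Assoc B F G H) (Idt (Cells B) K)))"
    and triangle: "one_cell B F X Y \<Longrightarrow> one_cell B G Y Z \<Longrightarrow>
      Cmp (Cells B) (HC2 B (Idt (Cells B) F) (LUnit B G)) (Assoc B F (Unt B Y) G) =
      HC2 B (RUnit B F) (Idt (Cells B) G)"

text \<open>
  Composites of composable lists, bracketed to the right. The first argument is the object at which
  the list starts; it matters only for the empty list, whose composite is the unit 1-cell there.
\<close>

fun comp1 :: "('x, 'f, 'a) bicat \<Rightarrow> 'x \<Rightarrow> 'f list \<Rightarrow> 'f" where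
  "comp1 B X [] = Unt B X"
| "comp1 B X [F] = F"
| "comp1 B X (F # G # Fs) = HC1 B F (comp1 B (Tgt B F) (G # Fs))"

fun comp2 :: "('x, 'f, 'a) bicat \<Rightarrow> 'x \<Rightarrow> 'a list \<Rightarrow> 'a" where
  "comp2 B X [] = Idt (Cells B) (Unt B X)"
| "comp2 B X [a] = a"
| "comp2 B X (a # b # as) = HC2 B a (comp2 B (Tgt B (Dom (Cells B) a)) (b # as))"

text \<open>
  The coherence isomorphism from \<open>comp1 X Fs * comp1 Y Gs\<close> to \<open>comp1 X (Fs @ Gs)\<close>, where \<open>Fs\<close> runs
  from \<open>X\<close> to \<open>Y\<close>.
\<close>

fun append_iso :: "('x, 'f, 'a) bicat \<Rightarrow> 'x \<Rightarrow> 'f list \<Rightarrow> 'x \<Rightarrow> 'f list \<Rightarrow> 'a" where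
  "append_iso B X [] Y Gs = LUnit B (comp1 B Y Gs)"
| "append_iso B X (F # Fs) Y [] = RUnit B (comp1 B X (F # Fs))"
| "append_iso B X [F] Y (G # Gs) = Idt (Cells B) (HC1 B F (comp1 B Y (G # Gs)))"
| "append_iso B X (F # F' # Fs) Y (G # Gs) =
     Cmp (Cells B)
       (HC2 B (Idt (Cells B) F) (append_iso B (Tgt B F) (F' # Fs) Y (G # Gs)))
       (Assoc B F (comp1 B (Tgt B F) (F' # Fs)) (comp1 B Y (G # Gs)))"

text \<open>
  For consecutive segments \<open>(X\<^sub>1, Fs\<^sub>1), \<dots>, (X\<^sub>k, Fs\<^sub>k)\<close>, each a list with its starting object, the
  coherence isomorphism from the composite of the \<open>comp1 X\<^sub>i Fs\<^sub>i\<close> to the composite of the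
  concatenation.
\<close>

fun concat_iso :: "('x, 'f, 'a) bicat \<Rightarrow> 'x \<Rightarrow> ('x \<times> 'f list) list \<Rightarrow> 'a" where
  "concat_iso B X [] = Idt (Cells B) (Unt B X)"
| "concat_iso B X [(Y, Fs)] = Idt (Cells B) (comp1 B Y Fs)"
| "concat_iso B X ((Y, Fs) # (Z, Gs) # ps) =
     Cmp (Cells B)
       (append_iso B Y Fs Z (concat (Gs # map snd ps)))
       (HC2 B (Idt (Cells B) (comp1 B Y Fs)) (concat_iso B Z ((Z, Gs) # ps)))"

section \<open>The cyclic nerve and biHH\<close>

text \<open>An arrow \<open>(m, \<phi>, n)\<close> is the monotone map \<open>\<phi>\<close> from \<open>[m]\<close> to \<open>[n]\<close>.\<close>

type_synonym smap = "nat \<times> (nat \<Rightarrow> nat) \<times> nat"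

definition simplex_upto :: "nat \<Rightarrow> (nat, smap) cat" where
  "simplex_upto N = \<lparr>
     Ob = {..N},
     Ar = {(m, \<phi>, n). m \<le> N \<and> n \<le> N \<and> \<phi> \<in> {..m} \<rightarrow>\<^sub>E {..n} \<and> mono_on {..m} \<phi>},
     Dom = (\<lambda>(m, \<phi>, n). m),
     Cod = (\<lambda>(m, \<phi>, n). n),
     Idt = (\<lambda>n. (n, restrict id {..n}, n)),
     Cmp = (\<lambda>(m', \<psi>, n) (k, \<phi>, m). (k, compose {..k} \<psi> \<phi>, n)) \<rparr>"

text \<open>\<open>face i n\<close> is the injection \<open>[n] \<rightarrow> [n + 1]\<close> missing \<open>i\<close>, \<open>degen i n\<close> the surjection
  \<open>[n + 1] \<rightarrow> [n]\<close> hitting \<open>i\<close> twice; they induce \<open>d\<^sub>i\<close> and \<open>s\<^sub>i\<close>.\<close>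

definition face :: "nat \<Rightarrow> nat \<Rightarrow> smap" where
  "face i n = (n, \<lambda>j \<in> {..n}. if j < i then j else Suc j, Suc n)"

definition degen :: "nat \<Rightarrow> nat \<Rightarrow> smap" where
  "degen i n = (Suc n, \<lambda>j \<in> {..Suc n}. if j \<le> i then j else j - 1, n)"

text \<open>
  An object \<open>[F\<^sub>0, \<dots>, F\<^sub>n]\<close> of level \<open>n\<close> is a cyclically composable list. Its objects
  \<open>X\<^sub>i = Src F\<^sub>i\<close> are determined by it, so this is the coproduct over all \<open>X\<^sub>0, \<dots>, X\<^sub>n\<close>.
\<close>

definition cyclic_list :: "('x, 'f, 'a) bicat \<Rightarrow> nat \<Rightarrow> 'f list \<Rightarrow> bool" where
  "cyclic_list B n Fs \<longleftrightarrow> length Fs = Suc n \<and> set Fs \<subseteq> Ob (Cells B) \<and>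
     (\<forall>i \<le> n. Tgt B (Fs ! i) = Src B (Fs ! (Suc i mod Suc n)))"

definition nerve_cat :: "('x, 'f, 'a) bicat \<Rightarrow> nat \<Rightarrow> ('f list, 'a list) cat" where
  "nerve_cat B n = \<lparr>
     Ob = {Fs. cyclic_list B n Fs},
     Ar = {as. set as \<subseteq> Ar (Cells B) \<and> cyclic_list B n (map (Dom (Cells B)) as)},
     Dom = map (Dom (Cells B)),
     Cod = map (Cod (Cells B)),
     Idt = map (Idt (Cells B)),
     Cmp = map2 (Cmp (Cells B)) \<rparr>"

text \<open>
  Place \<open>F\<^sub>i\<close> on the edge from vertex \<open>i - 1\<close> to vertex \<open>i\<close> of the cycle with vertices \<open>0, \<dots>, n\<close>, and
  \<open>F\<^sub>0\<close> on the edge from \<open>n\<close> to \<open>0\<close>. A map \<open>\<phi> : [m] \<rightarrow> [n]\<close> sends the list \<open>F\<close> to the list of length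
  \<open>m + 1\<close> whose entry \<open>j\<close> is the composite of the edges from \<open>\<phi> (j - 1)\<close> to \<open>\<phi> j\<close>, where entry \<open>0\<close>
  goes from \<open>\<phi> m\<close> through \<open>F\<^sub>0\<close> to \<open>\<phi> 0\<close>.
\<close>

fun seg_start :: "smap \<Rightarrow> nat \<Rightarrow> nat" where
  "seg_start (m, \<phi>, n) j = (if j = 0 then \<phi> m else \<phi> (j - 1))"

fun seg_edges :: "smap \<Rightarrow> nat \<Rightarrow> nat list" where
  "seg_edges (m, \<phi>, n) j =
     (if j = 0 then [Suc (\<phi> m)..<Suc n] @ [0..<Suc (\<phi> 0)] else [Suc (\<phi> (j - 1))..<Suc (\<phi> j)])"

definition seg :: "('x, 'f, 'a) bicat \<Rightarrow> smap \<Rightarrow> 'f list \<Rightarrow> nat \<Rightarrow> 'x \<times> 'f list" where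
  "seg B a Fs j = (Tgt B (Fs ! seg_start a j), map (\<lambda>i. Fs ! i) (seg_edges a j))"

definition nerve_map :: "('x, 'f, 'a) bicat \<Rightarrow> smap \<Rightarrow> ('f list, 'a list, 'f list, 'a list) fctr" where
  "nerve_map B a = \<lparr>
     FOb = (\<lambda>Fs. map (\<lambda>j. case seg B a Fs j of (X, Gs) \<Rightarrow> comp1 B X Gs) [0..<Suc (fst a)]),
     FAr = (\<lambda>as. map (\<lambda>j. comp2 B (Tgt B (Dom (Cells B) (as ! seg_start a j)))
                            (map (\<lambda>i. as ! i) (seg_edges a j))) [0..<Suc (fst a)]) \<rparr>"

definition cyclic_nerve :: "('x, 'f, 'a) bicat \<Rightarrow> (nat, smap, 'f list, 'a list) psfun" where
  "cyclic_nerve B = \<lparr>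
     PCat = nerve_cat B,
     PMap = nerve_map B,
     PComp = (\<lambda>a b Fs.
       map (\<lambda>j. concat_iso B (Tgt B (FOb (nerve_map B a) Fs ! seg_start b j))
                  (map (seg B a Fs) (seg_edges b j))) [0..<Suc (fst b)]),
     PUnit = (\<lambda>n Fs. map (Idt (Cells B)) Fs) \<rparr>"

lemma nerve_map_faces:
  "FOb (nerve_map B (face 0 0)) [F, G] = [HC1 B F G]"
  "FOb (nerve_map B (face 1 0)) [F, G] = [HC1 B G F]"
  "FOb (nerve_map B (face 0 1)) [F, G, H] = [HC1 B F G, H]"
  "FOb (nerve_map B (face 1 1)) [F, G, H] = [F, HC1 B G H]"
  "FOb (nerve_map B (face 2 1)) [F, G, H] = [HC1 B H F, G]"
  by (simp_all add: nerve_map_def face_def seg_def upt_rec)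

lemma nerve_map_degens:
  "FOb (nerve_map B (degen 0 0)) [F] = [F, Unt B (Tgt B F)]"
  "FOb (nerve_map B (degen 0 1)) [F, G] = [F, Unt B (Tgt B F), G]"
  "FOb (nerve_map B (degen 1 1)) [F, G] = [F, G, Unt B (Tgt B G)]"
  by (simp_all add: nerve_map_def degen_def seg_def upt_rec)

type_synonym ('f, 'a, 'c, 'd) hh_cocone = "(nat, smap, 'f list, 'a list, 'c, 'd) cocone"

definition is_biHH :: "('x, 'f, 'a) bicat \<Rightarrow> ('c, 'd) cat \<Rightarrow> ('f, 'a, 'c, 'd) hh_cocone \<Rightarrow> bool" where
  "is_biHH B C L \<longleftrightarrow> pseudo_colimit (simplex_upto 2) (cyclic_nerve B) C L"

definition hh_ob :: "('f, 'a, 'c, 'd) hh_cocone \<Rightarrow> 'f \<Rightarrow> 'c" where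
  "hh_ob L F = FOb (Leg L 0) [F]"

definition hh_ar :: "('f, 'a, 'c, 'd) hh_cocone \<Rightarrow> 'a \<Rightarrow> 'd" where
  "hh_ar L a = FAr (Leg L 0) [a]"

text \<open>The canonical isomorphism from \<open>F * G = d\<^sub>0 (F, G)\<close> through \<open>(F, G)\<close> to \<open>G * F = d\<^sub>1 (F, G)\<close>.\<close>

definition hh_swap :: "('c, 'd) cat \<Rightarrow> ('f, 'a, 'c, 'd) hh_cocone \<Rightarrow> 'f \<Rightarrow> 'f \<Rightarrow> 'd" where
  "hh_swap C L F G =
     Cmp C (LegIso L (face 1 0) [F, G]) (inv_ar C (LegIso L (face 0 0) [F, G]))"

section \<open>The free adjunction\<close>

datatype adj_ob = Ob0 | Ob1

datatype adj_gen = Gf | Gg  \<comment> \<open>the generating 1-cells \<open>f : 0 \<rightarrow> 1\<close> and \<open>g : 1 \<rightarrow> 0\<close>\<close>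

fun gen_src :: "adj_gen \<Rightarrow> adj_ob" where
  "gen_src Gf = Ob0"
| "gen_src Gg = Ob1"

fun gen_tgt :: "adj_gen \<Rightarrow> adj_ob" where
  "gen_tgt Gf = Ob1"
| "gen_tgt Gg = Ob0"

text \<open>1-cells are paths in the graph, in diagrammatic order, together with their source.\<close>

type_synonym adj_cell = "adj_ob \<times> adj_gen list"

fun is_path :: "adj_ob \<Rightarrow> adj_gen list \<Rightarrow> bool" where
  "is_path X [] \<longleftrightarrow> True"
| "is_path X (h # hs) \<longleftrightarrow> gen_src h = X \<and> is_path (gen_tgt h) hs"

fun path_end :: "adj_ob \<Rightarrow> adj_gen list \<Rightarrow> adj_ob" where
  "path_end X [] = X"
| "path_end X (h # hs) = path_end (gen_tgt h) hs"

definition adj_cells :: "adj_cell set" where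
  "adj_cells = {(X, hs). is_path X hs}"

definition adj_tgt :: "adj_cell \<Rightarrow> adj_ob" where
  "adj_tgt F = path_end (fst F) (snd F)"

definition adj_unit :: "adj_ob \<Rightarrow> adj_cell" where
  "adj_unit X = (X, [])"

definition adj_comp :: "adj_cell \<Rightarrow> adj_cell \<Rightarrow> adj_cell" where
  "adj_comp F G = (fst F, snd F @ snd G)"

definition cell_f :: adj_cell where
  "cell_f = (Ob0, [Gf])"

definition cell_g :: adj_cell where
  "cell_g = (Ob1, [Gg])"

text \<open>
  2-cells are terms in the generators \<open>u\<close>, \<open>c\<close>, identities, vertical composites \<open>TV t s\<close> (\<open>t\<close> after
  \<open>s\<close>) and horizontal composites \<open>TH s t\<close> (diagrammatic), modulo the axioms of a strict 2-category
  and the triangle identities.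
\<close>

datatype adj_tm = TId adj_cell | TU | TC | TV adj_tm adj_tm | TH adj_tm adj_tm

inductive adj_hom :: "adj_tm \<Rightarrow> adj_cell \<Rightarrow> adj_cell \<Rightarrow> bool" where
  "F \<in> adj_cells \<Longrightarrow> adj_hom (TId F) F F"
| "adj_hom TU (adj_unit Ob0) (adj_comp cell_f cell_g)"
| "adj_hom TC (adj_comp cell_g cell_f) (adj_unit Ob1)"
| "adj_hom s F G \<Longrightarrow> adj_hom t G H \<Longrightarrow> adj_hom (TV t s) F H"
| "adj_hom s F F' \<Longrightarrow> adj_hom t G G' \<Longrightarrow> adj_tgt F = fst G \<Longrightarrow>
     adj_hom (TH s t) (adj_comp F G) (adj_comp F' G')"

inductive adj_eq :: "adj_tm \<Rightarrow> adj_tm \<Rightarrow> bool" where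
  refl: "adj_hom t F G \<Longrightarrow> adj_eq t t"
| sym: "adj_eq s t \<Longrightarrow> adj_eq t s"
| trans: "adj_eq s t \<Longrightarrow> adj_eq t r \<Longrightarrow> adj_eq s r"
| cong_v: "adj_eq s s' \<Longrightarrow> adj_eq t t' \<Longrightarrow> adj_hom s F G \<Longrightarrow> adj_hom t G H \<Longrightarrow>
    adj_eq (TV t s) (TV t' s')"
| cong_h: "adj_eq s s' \<Longrightarrow> adj_eq t t' \<Longrightarrow> adj_hom s F F' \<Longrightarrow> adj_hom t G G' \<Longrightarrow>
    adj_tgt F = fst G \<Longrightarrow> adj_eq (TH s t) (TH s' t')"
| v_id: "adj_hom t F G \<Longrightarrow> adj_eq (TV t (TId F)) t"
| id_v: "adj_hom t F G \<Longrightarrow> adj_eq (TV (TId G) t) t"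
| v_assoc: "adj_hom r F G \<Longrightarrow> adj_hom s G H \<Longrightarrow> adj_hom t H K \<Longrightarrow>
    adj_eq (TV t (TV s r)) (TV (TV t s) r)"
| h_unit: "adj_hom t F G \<Longrightarrow> adj_eq (TH t (TId (adj_unit (adj_tgt F)))) t"
| unit_h: "adj_hom t F G \<Longrightarrow> adj_eq (TH (TId (adj_unit (fst F))) t) t"
| h_assoc: "adj_hom r F F' \<Longrightarrow> adj_hom s G G' \<Longrightarrow> adj_hom t H H' \<Longrightarrow>
    adj_tgt F = fst G \<Longrightarrow> adj_tgt G = fst H \<Longrightarrow> adj_eq (TH (TH r s) t) (TH r (TH s t))"
| h_id: "F \<in> adj_cells \<Longrightarrow> G \<in> adj_cells \<Longrightarrow> adj_tgt F = fst G \<Longrightarrow>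
    adj_eq (TH (TId F) (TId G)) (TId (adj_comp F G))"
| interchange: "adj_hom s F F' \<Longrightarrow> adj_hom s' F' F'' \<Longrightarrow> adj_hom t G G' \<Longrightarrow> adj_hom t' G' G'' \<Longrightarrow>
    adj_tgt F = fst G \<Longrightarrow> adj_eq (TH (TV s' s) (TV t' t)) (TV (TH s' t') (TH s t))"
| triangle_f: "adj_eq (TV (TH (TId cell_f) TC) (TH TU (TId cell_f))) (TId cell_f)"
| triangle_g: "adj_eq (TV (TH TC (TId cell_g)) (TH (TId cell_g) TU)) (TId cell_g)"

definition adj_class :: "adj_tm \<Rightarrow> adj_tm set" where
  "adj_class t = {s. adj_eq t s}"

definition adj_two_cells :: "(adj_cell, adj_tm set) cat" where
  "adj_two_cells = \<lparr>
     Ob = adj_cells,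
     Ar = {adj_class t | t F G. adj_hom t F G},
     Dom = (\<lambda>a. THE F. \<exists>t \<in> a. \<exists>G. adj_hom t F G),
     Cod = (\<lambda>a. THE G. \<exists>t \<in> a. \<exists>F. adj_hom t F G),
     Idt = (\<lambda>F. adj_class (TId F)),
     Cmp = (\<lambda>b a. {r. \<exists>s \<in> a. \<exists>t \<in> b. adj_eq (TV t s) r}) \<rparr>"

definition adj :: "(adj_ob, adj_cell, adj_tm set) bicat" where
  "adj = \<lparr>
     Obj0 = UNIV,
     Cells = adj_two_cells,
     Src = fst,
     Tgt = adj_tgt,
     Unt = adj_unit,
     HC1 = adj_comp,
     HC2 = (\<lambda>a b. {r. \<exists>s \<in> a. \<exists>t \<in> b. adj_eq (TH s t) r}),
     Assoc = (\<lambda>F G H. adj_class (TId (adj_comp F (adj_comp G H)))),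
     LUnit = (\<lambda>F. adj_class (TId F)),
     RUnit = (\<lambda>F. adj_class (TId F)) \<rparr>"

lemma path_end_append: "path_end X (hs @ ks) = path_end (path_end X hs) ks"
  by (induction hs arbitrary: X) auto

lemma is_path_append: "is_path X (hs @ ks) \<longleftrightarrow> is_path X hs \<and> is_path (path_end X hs) ks"
  by (induction hs arbitrary: X) auto

lemma adj_comp_cell: "F \<in> adj_cells \<Longrightarrow> G \<in> adj_cells \<Longrightarrow> adj_tgt F = fst G \<Longrightarrow>
    adj_comp F G \<in> adj_cells \<and> fst (adj_comp F G) = fst F \<and> adj_tgt (adj_comp F G) = adj_tgt G"
  by (auto simp: adj_cells_def adj_comp_def adj_tgt_def is_path_append path_end_append)

lemma adj_comp_assoc: "adj_comp (adj_comp F G) H = adj_comp F (adj_comp G H)"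
  by (simp add: adj_comp_def)

lemma adj_comp_unit [simp]: "adj_comp F (adj_unit X) = F" "adj_comp (adj_unit (fst F)) F = F"
  by (simp_all add: adj_comp_def adj_unit_def)

lemma adj_hom_cells: "adj_hom t F G \<Longrightarrow>
    F \<in> adj_cells \<and> G \<in> adj_cells \<and> fst F = fst G \<and> adj_tgt F = adj_tgt G"
proof (induction rule: adj_hom.induct)
  case (5 s F F' t G G')
  then show ?case using adj_comp_cell by metis
qed (auto simp: adj_cells_def adj_comp_def adj_unit_def adj_tgt_def cell_f_def cell_g_def)

lemma adj_hom_unique: "adj_hom t F G \<Longrightarrow> adj_hom t F' G' \<Longrightarrow> F' = F \<and> G' = G"
proof (induction arbitrary: F' G' rule: adj_hom.induct)
  case (1 F) from 1(2) show ?case by cases auto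
next
  case 2 then show ?case by cases auto
next
  case 3 then show ?case by cases auto
next
  case (4 s F G t H) from 4(5) 4(3,4) show ?case by cases blast
next
  case (5 s F F1 t G G1) from 5(6) 5(4,5) show ?case by cases blast
qed

lemma hom_h: "adj_hom s F F' \<Longrightarrow> adj_hom t G G' \<Longrightarrow> adj_tgt F = fst G \<Longrightarrow> K = adj_comp F G \<Longrightarrow>
    K' = adj_comp F' G' \<Longrightarrow> adj_hom (TH s t) K K'"
  by (simp add: adj_hom.intros)

lemma adj_eq_hom: "adj_eq s t \<Longrightarrow> \<exists>F G. adj_hom s F G \<and> adj_hom t F G"
proof (induction rule: adj_eq.induct)
  case (trans s t r) then show ?case using adj_hom_unique by metis
next
  case (cong_v s s' t t' F G H) then show ?case
    using adj_hom_unique adj_hom.intros(4) by metis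
next
  case (cong_h s s' t t' F F' G G') then show ?case
    using adj_hom_unique adj_hom.intros(5) by metis
next
  case (v_assoc r F G s H t K) then show ?case using adj_hom.intros(4) by meson
next
  case (h_unit t F G)
  have "adj_unit (adj_tgt F) \<in> adj_cells" by (simp add: adj_unit_def adj_cells_def)
  then have "adj_hom (TH t (TId (adj_unit (adj_tgt F)))) F G"
    using h_unit by (intro hom_h[OF h_unit adj_hom.intros(1)]) (auto simp: adj_unit_def adj_comp_def)
  then show ?case using h_unit by blast
next
  case (unit_h t F G)
  have "adj_unit (fst F) \<in> adj_cells" by (simp add: adj_unit_def adj_cells_def)
  then have "adj_hom (TH (TId (adj_unit (fst F))) t) F G"
    using adj_hom_cells[OF unit_h]
    by (intro hom_h[OF adj_hom.intros(1) unit_h])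
      (auto simp: adj_unit_def adj_comp_def adj_tgt_def intro: prod_eqI)
  then show ?case using unit_h by blast
next
  case (h_assoc r F F' s G G' t H H')
  have "adj_hom (TH (TH r s) t) (adj_comp (adj_comp F G) H) (adj_comp (adj_comp F' G') H')"
    using h_assoc adj_comp_cell adj_hom_cells by (intro adj_hom.intros) metis+
  moreover have "adj_hom (TH r (TH s t)) (adj_comp F (adj_comp G H)) (adj_comp F' (adj_comp G' H'))"
    using h_assoc adj_comp_cell adj_hom_cells by (intro adj_hom.intros) metis+
  ultimately show ?case unfolding adj_comp_assoc by blast
next
  case (h_id F G) then show ?case by (meson adj_comp_cell adj_hom.intros(1,5))
next
  case (interchange s F F' s' F'' t G G' t' G'')
  then have "adj_tgt F' = fst G'" using adj_hom_cells by metis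
  then show ?case using interchange by (meson adj_hom.intros(4,5))
next
  case triangle_f
  have f: "adj_hom (TId cell_f) cell_f cell_f"
    by (intro adj_hom.intros) (simp add: adj_cells_def cell_f_def)
  have "adj_hom (TH (TId cell_f) TC) (adj_comp cell_f (adj_comp cell_g cell_f)) cell_f"
    by (rule hom_h[OF f adj_hom.intros(3)])
      (auto simp: adj_tgt_def adj_comp_def adj_unit_def cell_f_def cell_g_def)
  moreover have "adj_hom (TH TU (TId cell_f)) cell_f (adj_comp cell_f (adj_comp cell_g cell_f))"
    by (rule hom_h[OF adj_hom.intros(2) f])
      (auto simp: adj_tgt_def adj_comp_def adj_unit_def cell_f_def cell_g_def)
  ultimately show ?case using f adj_hom.intros(4) by blast
next
  case triangle_g
  have g: "adj_hom (TId cell_g) cell_g cell_g"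
    by (intro adj_hom.intros) (simp add: adj_cells_def cell_g_def)
  have "adj_hom (TH TC (TId cell_g)) (adj_comp cell_g (adj_comp cell_f cell_g)) cell_g"
    by (rule hom_h[OF adj_hom.intros(3) g])
      (auto simp: adj_tgt_def adj_comp_def adj_unit_def cell_f_def cell_g_def)
  moreover have "adj_hom (TH (TId cell_g) TU) cell_g (adj_comp cell_g (adj_comp cell_f cell_g))"
    by (rule hom_h[OF g adj_hom.intros(2)])
      (auto simp: adj_tgt_def adj_comp_def adj_unit_def cell_f_def cell_g_def)
  ultimately show ?case using g adj_hom.intros(4) by blast
qed (blast intro: adj_hom.intros dest: adj_hom_cells)+

lemma class_eq: "adj_class s = adj_class t" if "adj_eq s t"
  using adj_eq.trans adj_eq.sym that unfolding adj_class_def by (intro Collect_cong) metis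

lemma mem_class: "s \<in> adj_class t \<Longrightarrow> adj_hom t F G \<Longrightarrow> adj_hom s F G"
  using adj_eq_hom adj_hom_unique unfolding adj_class_def mem_Collect_eq by metis

lemma class_dom_cod: "adj_hom t F G \<Longrightarrow>
    Dom adj_two_cells (adj_class t) = F \<and> Cod adj_two_cells (adj_class t) = G"
proof -
  assume t: "adj_hom t F G"
  have m: "t \<in> adj_class t" using adj_eq.refl[OF t] by (simp add: adj_class_def)
  have u: "F' = F \<and> G' = G" if "s \<in> adj_class t" "adj_hom s F' G'" for s F' G'
    using mem_class[OF that(1) t] adj_hom_unique that(2) by blast
  have "(THE F. \<exists>s \<in> adj_class t. \<exists>G. adj_hom s F G) = F"
    "(THE G. \<exists>s \<in> adj_class t. \<exists>F. adj_hom s F G) = G"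
    by (rule the_equality; use m t u in blast)+
  then show ?thesis by (simp add: adj_two_cells_def)
qed

lemmas class_dom = conjunct1[OF class_dom_cod] and class_cod = conjunct2[OF class_dom_cod]

lemma class_hom: "adj_hom t F G \<Longrightarrow> in_hom adj_two_cells (adj_class t) F G"
proof -
  assume t: "adj_hom t F G"
  then have "adj_class t \<in> Ar adj_two_cells" unfolding adj_two_cells_def cat.select_convs by blast
  with class_dom_cod[OF t] show ?thesis by (simp add: in_hom_def)
qed

lemma in_hom_classE:
  assumes "in_hom adj_two_cells a F G" obtains t where "a = adj_class t" "adj_hom t F G"
proof -
  obtain t F' G' where t: "a = adj_class t" "adj_hom t F' G'"
    using assms by (auto simp: in_hom_def adj_two_cells_def)
  then have "F' = F" "G' = G"
    using assms class_dom class_cod by (auto simp: in_hom_def)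
  with t that show ?thesis by blast
qed

lemma class_cmp: "adj_hom s F G \<Longrightarrow> adj_hom t G H \<Longrightarrow>
    Cmp adj_two_cells (adj_class t) (adj_class s) = adj_class (TV t s)"
  unfolding adj_two_cells_def adj_class_def cat.select_convs mem_Collect_eq
  by (blast intro: adj_eq.trans[OF adj_eq.cong_v] adj_eq.refl)

lemma class_hc: "adj_hom s F F' \<Longrightarrow> adj_hom t G G' \<Longrightarrow> adj_tgt F = fst G \<Longrightarrow>
    HC2 adj (adj_class s) (adj_class t) = adj_class (TH s t)"
  unfolding adj_def adj_class_def bicat.select_convs mem_Collect_eq
  by (blast intro: adj_eq.trans[OF adj_eq.cong_h] adj_eq.refl)

lemma category_adj: "category adj_two_cells"
proof
  fix h assume "h \<in> Ar adj_two_cells"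
  then obtain t F G where t: "h = adj_class t" "adj_hom t F G" by (auto simp: adj_two_cells_def)
  have "Ob adj_two_cells = adj_cells" by (simp add: adj_two_cells_def)
  then show "Dom adj_two_cells h \<in> Ob adj_two_cells" "Cod adj_two_cells h \<in> Ob adj_two_cells"
    using adj_hom_cells[OF t(2)] class_dom[OF t(2)] class_cod[OF t(2)] t(1) by simp_all
next
  fix x assume "x \<in> Ob adj_two_cells"
  then show "in_hom adj_two_cells (Idt adj_two_cells x) x x"
    using class_hom[OF adj_hom.intros(1)] by (simp add: adj_two_cells_def)
next
  fix h k x y z assume h: "in_hom adj_two_cells h x y" and k: "in_hom adj_two_cells k y z"
  obtain s where s: "h = adj_class s" "adj_hom s x y" using h by (rule in_hom_classE)
  obtain t where t: "k = adj_class t" "adj_hom t y z" using k by (rule in_hom_classE)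
  show "in_hom adj_two_cells (Cmp adj_two_cells k h) x z"
    unfolding s t class_cmp[OF s(2) t(2)] by (rule class_hom[OF adj_hom.intros(4)[OF s(2) t(2)]])
next
  fix h x y assume "in_hom adj_two_cells h x y"
  then obtain t where t: "h = adj_class t" "adj_hom t x y" by (rule in_hom_classE)
  then have c: "x \<in> adj_cells" "y \<in> adj_cells" using adj_hom_cells by auto
  have i: "Idt adj_two_cells z = adj_class (TId z)" for z by (simp add: adj_two_cells_def)
  show "Cmp adj_two_cells h (Idt adj_two_cells x) = h"
    using t c by (simp add: i class_cmp[OF adj_hom.intros(1)] class_eq[OF adj_eq.v_id])
  show "Cmp adj_two_cells (Idt adj_two_cells y) h = h"
    using t c by (simp add: i class_cmp[OF _ adj_hom.intros(1)] class_eq[OF adj_eq.id_v])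
next
  fix h k l x y z w
  assume h: "in_hom adj_two_cells h x y" and k: "in_hom adj_two_cells k y z"
    and l: "in_hom adj_two_cells l z w"
  obtain r where r: "h = adj_class r" "adj_hom r x y" using h by (rule in_hom_classE)
  obtain s where s: "k = adj_class s" "adj_hom s y z" using k by (rule in_hom_classE)
  obtain t where t: "l = adj_class t" "adj_hom t z w" using l by (rule in_hom_classE)
  note rs = adj_hom.intros(4)[OF r(2) s(2)] and st = adj_hom.intros(4)[OF s(2) t(2)]
  show "Cmp adj_two_cells l (Cmp adj_two_cells k h) = Cmp adj_two_cells (Cmp adj_two_cells l k) h"
    unfolding r(1) s(1) t(1) class_cmp[OF r(2) s(2)] class_cmp[OF s(2) t(2)]
      class_cmp[OF rs t(2)] class_cmp[OF r(2) st]
    by (rule class_eq[OF adj_eq.v_assoc[OF r(2) s(2) t(2)]])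
qed

lemma adj_sel [simp]: "Cells adj = adj_two_cells" "Src adj = fst" "Tgt adj = adj_tgt"
  "Unt adj = adj_unit" "HC1 adj = adj_comp" "Obj0 adj = UNIV"
  "Assoc adj F G H = adj_class (TId (adj_comp F (adj_comp G H)))"
  "LUnit adj F = adj_class (TId F)" "RUnit adj F = adj_class (TId F)"
  "Idt adj_two_cells F = adj_class (TId F)" "Ob adj_two_cells = adj_cells"
  by (simp_all add: adj_def adj_two_cells_def)

lemma id_iso: "F \<in> adj_cells \<Longrightarrow> is_iso adj_two_cells (adj_class (TId F))"
proof -
  assume "F \<in> adj_cells"
  then have h: "in_hom adj_two_cells (adj_class (TId F)) F F"
    using class_hom adj_hom.intros(1) by blast
  then have "Cmp adj_two_cells (adj_class (TId F)) (adj_class (TId F)) = adj_class (TId F)"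
    using category.cmp_idt[OF category_adj h] by simp
  with h show ?thesis
    unfolding is_iso_def inverse_pair_def by (intro exI[of _ "adj_class (TId F)"]) (auto simp: in_hom_def)
qed

lemma unit_cell [simp]: "adj_unit X \<in> adj_cells" "fst (adj_unit X) = X" "adj_tgt (adj_unit X) = X"
  by (simp_all add: adj_unit_def adj_cells_def adj_tgt_def)

lemma bicategory_adj: "bicategory adj"
proof -
  note hid = adj_hom.intros(1)
  note cid = category.cmp_idt[OF category_adj, simplified]
    and idc = category.idt_cmp[OF category_adj, simplified]
  have hu: "HC2 adj (adj_class (TId (adj_unit (fst F)))) a = a"
    "HC2 adj a (adj_class (TId (adj_unit (adj_tgt F)))) = a"
    if h: "in_hom adj_two_cells a F G" for a F G
  proof -
    obtain t where t: "a = adj_class t" "adj_hom t F G" by (rule in_hom_classE[OF h])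
    show "HC2 adj (adj_class (TId (adj_unit (fst F)))) a = a"
      "HC2 adj a (adj_class (TId (adj_unit (adj_tgt F)))) = a"
      using t class_hc[OF hid t(2), of "adj_unit (fst F)"] class_hc[OF t(2) hid, of "adj_unit (adj_tgt F)"]
        class_eq[OF adj_eq.h_unit[OF t(2)]] class_eq[OF adj_eq.unit_h[OF t(2)]] by simp_all
  qed
  have hi: "HC2 adj (adj_class (TId F)) (adj_class (TId G)) = adj_class (TId (adj_comp F G))"
    if "F \<in> adj_cells" "G \<in> adj_cells" "adj_tgt F = fst G" for F G
    using that class_hc[OF hid hid] class_eq[OF adj_eq.h_id] by simp
  have hc: "in_hom adj_two_cells (HC2 adj a b) (adj_comp F G) (adj_comp F' G')"
    if a: "in_hom adj_two_cells a F F'" and b: "in_hom adj_two_cells b G G'"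
      and FG: "adj_tgt F = fst G" for a b F F' G G'
  proof -
    obtain s where s: "a = adj_class s" "adj_hom s F F'" by (rule in_hom_classE[OF a])
    obtain t where t: "b = adj_class t" "adj_hom t G G'" by (rule in_hom_classE[OF b])
    show ?thesis unfolding s(1) t(1) class_hc[OF s(2) t(2) FG]
      by (rule class_hom[OF adj_hom.intros(5)[OF s(2) t(2) FG]])
  qed
  have ii: "Cmp adj_two_cells (adj_class (TId F)) (adj_class (TId F)) = adj_class (TId F)"
    if "F \<in> adj_cells" for F
    using that class_cmp[OF hid hid] class_eq[OF adj_eq.v_id[OF hid]] by simp
  have cells: "F \<in> adj_cells" "F' \<in> adj_cells" "fst F = fst F'" "adj_tgt F = adj_tgt F'"
    if "in_hom adj_two_cells a F F'" for a F F'
    by (rule in_hom_classE[OF that], use adj_hom_cells in blast)+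
  have ha: "HC2 adj (HC2 adj a b) c = HC2 adj a (HC2 adj b c)"
    if h: "in_hom adj_two_cells a F F'" "in_hom adj_two_cells b G G'" "in_hom adj_two_cells c H H'"
      "adj_tgt F = fst G" "adj_tgt G = fst H" for a b c F F' G G' H H'
  proof -
    obtain r where r: "a = adj_class r" "adj_hom r F F'" by (rule in_hom_classE[OF h(1)])
    obtain s where s: "b = adj_class s" "adj_hom s G G'" by (rule in_hom_classE[OF h(2)])
    obtain t where t: "c = adj_class t" "adj_hom t H H'" by (rule in_hom_classE[OF h(3)])
    have e: "adj_tgt (adj_comp F G) = fst H" "adj_tgt F = fst (adj_comp G H)"
      using h(4,5) adj_comp_cell cells[OF h(1)] cells[OF h(2)] cells[OF h(3)] by simp_all
    note rs = adj_hom.intros(5)[OF r(2) s(2) h(4)] and st = adj_hom.intros(5)[OF s(2) t(2) h(5)]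
    show ?thesis
      unfolding r(1) s(1) t(1) class_hc[OF r(2) s(2) h(4)] class_hc[OF s(2) t(2) h(5)]
        class_hc[OF rs t(2) e(1)] class_hc[OF r(2) st e(2)]
      by (rule class_eq[OF adj_eq.h_assoc[OF r(2) s(2) t(2) h(4,5)]])
  qed
  have ic: "HC2 adj (Cmp adj_two_cells a' a) (Cmp adj_two_cells b' b) =
      Cmp adj_two_cells (HC2 adj a' b') (HC2 adj a b)"
    if h: "in_hom adj_two_cells a F F'" "in_hom adj_two_cells a' F' F''"
      "in_hom adj_two_cells b G G'" "in_hom adj_two_cells b' G' G''" "adj_tgt F = fst G"
    for a a' b b' F F' F'' G G' G''
  proof -
    obtain s where s: "a = adj_class s" "adj_hom s F F'" by (rule in_hom_classE[OF h(1)])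
    obtain s' where s': "a' = adj_class s'" "adj_hom s' F' F''" by (rule in_hom_classE[OF h(2)])
    obtain t where t: "b = adj_class t" "adj_hom t G G'" by (rule in_hom_classE[OF h(3)])
    obtain t' where t': "b' = adj_class t'" "adj_hom t' G' G''" by (rule in_hom_classE[OF h(4)])
    have e: "adj_tgt F' = fst G'" using h(5) cells(4)[OF h(1)] cells(3)[OF h(3)] by simp
    note ss = adj_hom.intros(4)[OF s(2) s'(2)] and tt = adj_hom.intros(4)[OF t(2) t'(2)]
      and st = adj_hom.intros(5)[OF s(2) t(2) h(5)] and st' = adj_hom.intros(5)[OF s'(2) t'(2) e]
    show ?thesis
      unfolding s(1) t(1) s'(1) t'(1) class_cmp[OF s(2) s'(2)] class_cmp[OF t(2) t'(2)]
        class_hc[OF ss tt h(5)] class_hc[OF s(2) t(2) h(5)] class_hc[OF s'(2) t'(2) e]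
        class_cmp[OF st st']
      by (rule class_eq[OF adj_eq.interchange[OF s(2) s'(2) t(2) t'(2) h(5)]])
  qed
  have ih: "F \<in> adj_cells \<Longrightarrow> in_hom adj_two_cells (adj_class (TId F)) F F" for F
    using class_hom[OF hid] .
  have cc: "adj_comp F G \<in> adj_cells" "fst (adj_comp F G) = fst F" "adj_tgt (adj_comp F G) = adj_tgt G"
    if "F \<in> adj_cells" "G \<in> adj_cells" "adj_tgt F = fst G" for F G
    using adj_comp_cell that by blast+
  show ?thesis
    apply (rule bicategory.intro; (unfold one_cell_def adj_sel)?)
    subgoal by (rule category_adj)
    subgoal by simp
    subgoal by simp
    subgoal by (rule cells(3))
    subgoal by (rule cells(4))
    subgoal by simp
    subgoal by (simp add: cc)
    subgoal by (rule hc)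
    subgoal by (simp add: hi)
    subgoal by (rule ic)
    subgoal by (simp add: cc id_iso ih adj_comp_assoc)
    subgoal premises p for a F F' b G G' c H H'
    proof -
      note c3 = cells[OF p(1)] cells[OF p(2)] cells[OF p(3)] p(4,5)
      have "in_hom adj_two_cells (HC2 adj a (HC2 adj b c)) (adj_comp F (adj_comp G H))
          (adj_comp F' (adj_comp G' H'))"
        by (intro hc p) (use c3 cc in simp)
      then show ?thesis using ha[OF p] idc cid by simp
    qed
    subgoal premises p for F X Y
    proof -
      have "F \<in> adj_cells" "X = fst F" using p by simp_all
      then show ?thesis using ih id_iso by simp
    qed
    subgoal for a F F' using hu(1)[of a F F'] idc[of a F F'] cid[of a F F'] by simp
    subgoal premises p for F X Y
    proof -
      have "F \<in> adj_cells" "Y = adj_tgt F" using p by simp_all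
      then show ?thesis using ih id_iso by simp
    qed
    subgoal for a F F' using hu(2)[of a F F'] idc[of a F F'] cid[of a F F'] by simp
    subgoal premises p for F X Y G Z H W K V
    proof -
      have c: "F \<in> adj_cells" "G \<in> adj_cells" "H \<in> adj_cells" "K \<in> adj_cells"
        "adj_tgt F = fst G" "adj_tgt G = fst H" "adj_tgt H = fst K" using p by simp_all
      show ?thesis using c by (simp add: hi cc ii adj_comp_assoc)
    qed
    subgoal premises p for F X Y G
    proof -
      have c: "F \<in> adj_cells" "G \<in> adj_cells" "adj_tgt F = fst G" "Y = fst G" using p by simp_all
      show ?thesis unfolding c(4) adj_comp_unit hi[OF c(1-3)] by (rule ii[OF cc(1)[OF c(1-3)]])
    qed
    done
qed

definition two_cell_u :: "adj_tm set" where
  "two_cell_u = adj_class TU"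

definition two_cell_c :: "adj_tm set" where
  "two_cell_c = adj_class TC"

text \<open>In the classical order, \<open>gf\<close> is \<open>f * g\<close> and \<open>fg\<close> is \<open>g * f\<close>.\<close>

definition universal_euler_char ::
    "('c, 'd) cat \<Rightarrow> (adj_cell, adj_tm set, 'c, 'd) hh_cocone \<Rightarrow> 'd" where
  "universal_euler_char C L =
     Cmp C (hh_ar L two_cell_c) (Cmp C (hh_swap C L cell_f cell_g) (hh_ar L two_cell_u))"

section \<open>The paracyclic category and cones\<close>

definition paracyclic :: "(nat, nat \<times> (int \<Rightarrow> int) \<times> nat) cat" where
  "paracyclic = \<lparr>
     Ob = UNIV,
     Ar = {(n, \<phi>, m). mono \<phi> \<and> (\<forall>l. \<phi> (l + int n + 1) = \<phi> l + int m + 1)},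
     Dom = (\<lambda>(n, \<phi>, m). n),
     Cod = (\<lambda>(n, \<phi>, m). m),
     Idt = (\<lambda>n. (n, id, n)),
     Cmp = (\<lambda>(m', \<psi>, k) (n, \<phi>, m). (n, \<psi> \<circ> \<phi>, k)) \<rparr>"

definition op_cat :: "('o, 'm) cat \<Rightarrow> ('o, 'm) cat" where
  "op_cat C = \<lparr> Ob = Ob C, Ar = Ar C, Dom = Cod C, Cod = Dom C, Idt = Idt C,
     Cmp = (\<lambda>k h. Cmp C h k) \<rparr>"

text \<open>The new initial object is \<open>None\<close>, and \<open>Inr x\<close> is the arrow from it to \<open>x\<close>.\<close>

fun cone_cod :: "('o, 'm) cat \<Rightarrow> 'm + 'o option \<Rightarrow> 'o option" where
  "cone_cod C (Inl h) = Some (Cod C h)"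
| "cone_cod C (Inr x) = x"

fun cone_cmp :: "('o, 'm) cat \<Rightarrow> 'm + 'o option \<Rightarrow> 'm + 'o option \<Rightarrow> 'm + 'o option" where
  "cone_cmp C (Inl k) (Inl h) = Inl (Cmp C k h)"
| "cone_cmp C k (Inr x) = Inr (cone_cod C k)"
| "cone_cmp C (Inr y) (Inl h) = undefined"

definition left_cone :: "('o, 'm) cat \<Rightarrow> ('o option, 'm + 'o option) cat" where
  "left_cone C = \<lparr>
     Ob = insert None (Some ` Ob C),
     Ar = Inl ` Ar C \<union> Inr ` insert None (Some ` Ob C),
     Dom = case_sum (\<lambda>h. Some (Dom C h)) (\<lambda>x. None),
     Cod = cone_cod C,
     Idt = case_option (Inr None) (\<lambda>x. Inl (Idt C x)),
     Cmp = cone_cmp C \<rparr>"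

definition right_cone :: "('o, 'm) cat \<Rightarrow> ('o option, 'm + 'o option) cat" where
  "right_cone C = op_cat (left_cone (op_cat C))"

end

theory Submission
  imports Defs "HOL-Library.Countable_Set"
begin

text \<open>
  A pseudo-cocone under the cyclic nerve of \<open>Adj\<close> amounts to a functor \<open>t\<close> on the endomorphism 1-cells
  together with natural isomorphisms \<open>F * G \<rightarrow> G * F\<close> subject to one cocycle law
  (\<open>trace_of_cocone\<close>, \<open>cocone_of_trace\<close>); such data are called traces below. They are weaker than a
  symmetric trace: moving \<open>G\<close> to the front and then \<open>F\<close> to the front is a full turn of the cyclic word
  and need not be trivial. So biHH of \<open>Adj\<close> carries the universal trace, and the task is to see
  that the universal trace takes values in the paracyclic category with two cone points.
  
  The 2-cells of \<open>Adj\<close> are string diagrams in a strip whose regions are labelled \<open>0\<close> and \<open>1\<close>. Following a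
  region with label \<open>1\<close> from the source, it never ends: \<open>u\<close> creates such a region and \<open>c\<close> merges two of
  them. Hence a 2-cell gives a monotone map between the regions with label \<open>1\<close> of its source and its
  target. Every 2-cell is a horizontal composite of copies of \<open>u\<close>, \<open>c\<close> and the identities of \<open>f\<close>
  and \<open>g\<close> (\<open>hom2_row\<close>), and such a composite can be read off from its monotone map; so the
  2-cells are exactly the monotone maps that respect the boundary regions (\<open>two_cell_eqI\<close>,
  \<open>two_cell_exists\<close>).
  
  Closing the strip to an annulus and passing to the universal cover turns a 2-cell between cyclic words
  into a periodic monotone map of the integers, that is, an arrow of the paracyclic category, and the
  swap \<open>F * G \<rightarrow> G * F\<close> into a shift. The cyclic words without a region with label \<open>1\<close>, resp. without a
  letter but with label \<open>1\<close>, are \<open>U\<^sub>0\<close> and \<open>U\<^sub>1\<close>; no other word leads into the former or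
  out of the latter, and they become the cone points. This is the trace \<open>paracyclic_trace\<close>.
  
  It is universal because a periodic monotone map is uniquely a shift after a map fixing \<open>0\<close>, and the latter
  are the 2-cells between the powers of \<open>g * f\<close>. Given any trace, this prescribes the action of all
  paracyclic arrows. It is functorial because commuting a shift past a map fixing \<open>0\<close> is the naturality
  of the swap (\<open>rotate_1\<close>), and it extends to the cone points because \<open>u\<close> and \<open>c\<close> are invariant
  under rotation (\<open>rot_act_unit\<close>, \<open>act_counit_rot\<close>). The powers of \<open>f * g\<close> are compared with those of
  \<open>g * f\<close> by one swap (\<open>straighten\<close>).
  
  In the cone, \<open>U\<^sub>0\<close> is initial and \<open>U\<^sub>1\<close> terminal, so the Euler characteristic is the only arrow between
  them.
\<close>

section \<open>The strict 2-category structure of the free adjunction\<close>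

abbreviation vertical :: "adj_tm set \<Rightarrow> adj_tm set \<Rightarrow> adj_tm set" (infixr "\<bullet>" 70) where
  "b \<bullet> a \<equiv> Cmp adj_two_cells b a"

abbreviation horizontal :: "adj_tm set \<Rightarrow> adj_tm set \<Rightarrow> adj_tm set" (infixr "\<star>" 75) where
  "a \<star> b \<equiv> HC2 adj a b"

abbreviation ide :: "adj_cell \<Rightarrow> adj_tm set" where
  "ide F \<equiv> adj_class (TId F)"

abbreviation hom2 :: "adj_tm set \<Rightarrow> adj_cell \<Rightarrow> adj_cell \<Rightarrow> bool" where
  "hom2 \<equiv> in_hom adj_two_cells"

lemma hom2_cells:
  assumes "hom2 a F G"
  shows "F \<in> adj_cells" "G \<in> adj_cells" "fst F = fst G" "adj_tgt F = adj_tgt G"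
  using in_hom_classE[OF assms] adj_hom_cells by metis+

lemma ide_hom: "F \<in> adj_cells \<Longrightarrow> hom2 (ide F) F F"
  using category.idt_hom[OF category_adj] by simp

lemma hom2_v: "hom2 a F G \<Longrightarrow> hom2 b G H \<Longrightarrow> hom2 (b \<bullet> a) F H"
  by (rule category.cmp_hom[OF category_adj])

lemma ide_v: "hom2 a F G \<Longrightarrow> ide G \<bullet> a = a" and v_ide: "hom2 a F G \<Longrightarrow> a \<bullet> ide F = a"
  using category.cmp_idt[OF category_adj] category.idt_cmp[OF category_adj] by simp_all

lemma v_assoc: "hom2 a F G \<Longrightarrow> hom2 b G H \<Longrightarrow> hom2 c H K \<Longrightarrow> c \<bullet> (b \<bullet> a) = (c \<bullet> b) \<bullet> a"
  by (rule category.cmp_assoc[OF category_adj])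

lemma hom2_h: "hom2 a F F' \<Longrightarrow> hom2 b G G' \<Longrightarrow> adj_tgt F = fst G \<Longrightarrow>
    hom2 (a \<star> b) (adj_comp F G) (adj_comp F' G')"
  using bicategory.hc2[OF bicategory_adj] by simp

lemma interchange2: "hom2 a F F' \<Longrightarrow> hom2 a' F' F'' \<Longrightarrow> hom2 b G G' \<Longrightarrow> hom2 b' G' G'' \<Longrightarrow>
    adj_tgt F = fst G \<Longrightarrow> (a' \<star> b') \<bullet> (a \<star> b) = (a' \<bullet> a) \<star> (b' \<bullet> b)"
  using bicategory.hc2_cmp[OF bicategory_adj, of a F F' a' F'' b G G' b' G''] by simp

lemma ide_h_ide: "F \<in> adj_cells \<Longrightarrow> G \<in> adj_cells \<Longrightarrow> adj_tgt F = fst G \<Longrightarrow>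
    ide F \<star> ide G = ide (adj_comp F G)"
  using class_hc[OF adj_hom.intros(1) adj_hom.intros(1)] class_eq[OF adj_eq.h_id] by simp

lemma unit_h2: "hom2 a F G \<Longrightarrow> X = fst F \<Longrightarrow> ide (adj_unit X) \<star> a = a"
  and h2_unit: "hom2 a F G \<Longrightarrow> Y = adj_tgt F \<Longrightarrow> a \<star> ide (adj_unit Y) = a"
proof -
  assume h: "hom2 a F G"
  obtain t where t: "a = adj_class t" "adj_hom t F G" by (rule in_hom_classE[OF h])
  show "X = fst F \<Longrightarrow> ide (adj_unit X) \<star> a = a" "Y = adj_tgt F \<Longrightarrow> a \<star> ide (adj_unit Y) = a"
    using t class_hc[OF adj_hom.intros(1) t(2), of "adj_unit (fst F)"]
      class_hc[OF t(2) adj_hom.intros(1), of "adj_unit (adj_tgt F)"]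
      class_eq[OF adj_eq.h_unit[OF t(2)]] class_eq[OF adj_eq.unit_h[OF t(2)]] by simp_all
qed

lemma h2_assoc:
  assumes h: "hom2 a F F'" "hom2 b G G'" "hom2 c H H'" "adj_tgt F = fst G" "adj_tgt G = fst H"
  shows "(a \<star> b) \<star> c = a \<star> (b \<star> c)"
proof -
  obtain r where r: "a = adj_class r" "adj_hom r F F'" by (rule in_hom_classE[OF h(1)])
  obtain s where s: "b = adj_class s" "adj_hom s G G'" by (rule in_hom_classE[OF h(2)])
  obtain t where t: "c = adj_class t" "adj_hom t H H'" by (rule in_hom_classE[OF h(3)])
  have e: "adj_tgt (adj_comp F G) = fst H" "adj_tgt F = fst (adj_comp G H)"
    using h(4,5) adj_comp_cell hom2_cells[OF h(1)] hom2_cells[OF h(2)] hom2_cells[OF h(3)] by simp_all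
  note rs = adj_hom.intros(5)[OF r(2) s(2) h(4)] and st = adj_hom.intros(5)[OF s(2) t(2) h(5)]
  show ?thesis
    unfolding r(1) s(1) t(1) class_hc[OF r(2) s(2) h(4)] class_hc[OF s(2) t(2) h(5)]
      class_hc[OF rs t(2) e(1)] class_hc[OF r(2) st e(2)]
    by (rule class_eq[OF adj_eq.h_assoc[OF r(2) s(2) t(2) h(4,5)]])
qed

abbreviation cf :: adj_cell where "cf \<equiv> (Ob0, [Gf])"
abbreviation cg :: adj_cell where "cg \<equiv> (Ob1, [Gg])"

lemma hom2_u: "hom2 two_cell_u (Ob0, []) (Ob0, [Gf, Gg])"
  and hom2_c: "hom2 two_cell_c (Ob1, [Gg, Gf]) (Ob1, [])"
  using class_hom[OF adj_hom.intros(2)] class_hom[OF adj_hom.intros(3)]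
  by (simp_all add: two_cell_u_def two_cell_c_def adj_comp_def adj_unit_def cell_f_def cell_g_def)

lemma triangle_f2: "(ide cf \<star> two_cell_c) \<bullet> (two_cell_u \<star> ide cf) = ide cf"
  and triangle_g2: "(two_cell_c \<star> ide cg) \<bullet> (ide cg \<star> two_cell_u) = ide cg"
proof -
  have f: "adj_hom (TId cf) cf cf" and g: "adj_hom (TId cg) cg cg"
    by (rule adj_hom.intros; simp add: adj_cells_def)+
  have u: "adj_hom TU (Ob0, []) (Ob0, [Gf, Gg])" and c: "adj_hom TC (Ob1, [Gg, Gf]) (Ob1, [])"
    using adj_hom.intros(2,3) by (simp_all add: adj_comp_def adj_unit_def cell_f_def cell_g_def)
  have "adj_hom (TH (TId cf) TC) (Ob0, [Gf, Gg, Gf]) cf" "adj_hom (TH TU (TId cf)) cf (Ob0, [Gf, Gg, Gf])"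
    "adj_hom (TH TC (TId cg)) (Ob1, [Gg, Gf, Gg]) cg" "adj_hom (TH (TId cg) TU) cg (Ob1, [Gg, Gf, Gg])"
    by (rule hom_h[OF f c] hom_h[OF u f] hom_h[OF c g] hom_h[OF g u];
        simp add: adj_comp_def adj_tgt_def)+
  note * = class_cmp[OF this(2,1)] class_cmp[OF this(4,3)]
  show "(ide cf \<star> two_cell_c) \<bullet> (two_cell_u \<star> ide cf) = ide cf"
    using *(1) class_hc[OF f c] class_hc[OF u f] class_eq[OF adj_eq.triangle_f]
    by (simp add: two_cell_u_def two_cell_c_def adj_tgt_def cell_f_def)
  show "(two_cell_c \<star> ide cg) \<bullet> (ide cg \<star> two_cell_u) = ide cg"
    using *(2) class_hc[OF g u] class_hc[OF c g] class_eq[OF adj_eq.triangle_g]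
    by (simp add: two_cell_u_def two_cell_c_def adj_tgt_def cell_g_def)
qed

section \<open>Normal forms of 2-cells\<close>

text \<open>
  A row is a horizontal composite of the pieces \<open>f\<close>, \<open>g\<close>, \<open>u\<close>, \<open>c\<close>, with \<open>f\<close> and \<open>g\<close> standing for identity
  2-cells. Rows are normal forms: vertical composition is never needed.
\<close>

datatype piece = PF | PG | PU | PC

fun psrc :: "piece \<Rightarrow> adj_ob" where
  "psrc PF = Ob0" | "psrc PG = Ob1" | "psrc PU = Ob0" | "psrc PC = Ob1"

fun ptgt :: "piece \<Rightarrow> adj_ob" where
  "ptgt PF = Ob1" | "ptgt PG = Ob0" | "ptgt PU = Ob0" | "ptgt PC = Ob1"

fun pdom :: "piece \<Rightarrow> adj_gen list" where
  "pdom PF = [Gf]" | "pdom PG = [Gg]" | "pdom PU = []" | "pdom PC = [Gg, Gf]"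

fun pcod :: "piece \<Rightarrow> adj_gen list" where
  "pcod PF = [Gf]" | "pcod PG = [Gg]" | "pcod PU = [Gf, Gg]" | "pcod PC = []"

fun pcell :: "piece \<Rightarrow> adj_tm set" where
  "pcell PF = ide cf" | "pcell PG = ide cg" | "pcell PU = two_cell_u" | "pcell PC = two_cell_c"

fun row_path :: "adj_ob \<Rightarrow> piece list \<Rightarrow> bool" where
  "row_path X [] \<longleftrightarrow> True"
| "row_path X (l # r) \<longleftrightarrow> psrc l = X \<and> row_path (ptgt l) r"

fun row_end :: "adj_ob \<Rightarrow> piece list \<Rightarrow> adj_ob" where
  "row_end X [] = X"
| "row_end X (l # r) = row_end (ptgt l) r"

fun row_dom :: "piece list \<Rightarrow> adj_gen list" where
  "row_dom [] = []"
| "row_dom (l # r) = pdom l @ row_dom r"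

fun row_cod :: "piece list \<Rightarrow> adj_gen list" where
  "row_cod [] = []"
| "row_cod (l # r) = pcod l @ row_cod r"

fun row_cell :: "adj_ob \<Rightarrow> piece list \<Rightarrow> adj_tm set" where
  "row_cell X [] = ide (adj_unit X)"
| "row_cell X (l # r) = pcell l \<star> row_cell (ptgt l) r"

lemma adj_tgt_pair [simp]: "adj_tgt (X, w) = path_end X w"
  by (simp add: adj_tgt_def)

lemma adj_comp_pair [simp]: "adj_comp (X, v) (Y, w) = (X, v @ w)"
  by (simp add: adj_comp_def)

lemma adj_cells_pair [simp]: "(X, w) \<in> adj_cells \<longleftrightarrow> is_path X w"
  by (simp add: adj_cells_def)

lemma adj_unit_pair: "adj_unit X = (X, [])"
  by (simp add: adj_unit_def)

lemma pcell_hom: "hom2 (pcell l) (psrc l, pdom l) (psrc l, pcod l)"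
  by (cases l) (auto intro: ide_hom hom2_u hom2_c)

lemma piece_path_end: "path_end (psrc l) (pdom l) = ptgt l" "path_end (psrc l) (pcod l) = ptgt l"
  by (cases l; simp)+

lemma row_hom: "row_path X r \<Longrightarrow> hom2 (row_cell X r) (X, row_dom r) (X, row_cod r) \<and>
    path_end X (row_dom r) = row_end X r \<and> path_end X (row_cod r) = row_end X r"
proof (induction r arbitrary: X)
  case Nil
  then show ?case using ide_hom[of "(X, [])"] by (simp add: adj_unit_pair)
next
  case (Cons l r)
  then show ?case
    using hom2_h[OF pcell_hom, of "row_cell (ptgt l) r" "(ptgt l, row_dom r)" "(ptgt l, row_cod r)" l]
    by (auto simp: path_end_append piece_path_end)
qed

lemma row_append: "row_path X (r @ s) \<longleftrightarrow> row_path X r \<and> row_path (row_end X r) s"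
  "row_end X (r @ s) = row_end (row_end X r) s"
  "row_dom (r @ s) = row_dom r @ row_dom s" "row_cod (r @ s) = row_cod r @ row_cod s"
  by (induction r arbitrary: X) auto

lemma row_cell_append: "row_path X r \<Longrightarrow> row_path (row_end X r) s \<Longrightarrow>
    row_cell X (r @ s) = row_cell X r \<star> row_cell (row_end X r) s"
proof (induction r arbitrary: X)
  case Nil
  then show ?case using unit_h2 row_hom by fastforce
next
  case (Cons l r)
  then have "(pcell l \<star> row_cell (ptgt l) r) \<star> row_cell (row_end (ptgt l) r) s =
      pcell l \<star> (row_cell (ptgt l) r \<star> row_cell (row_end (ptgt l) r) s)"
    using row_hom[of "ptgt l" r] row_hom[of "row_end (ptgt l) r" s] h2_assoc[OF pcell_hom[of l]]
    by (auto simp: piece_path_end)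
  with Cons show ?case by simp
qed

text \<open>
  A unit below a counit that shares the letter \<open>f\<close> with it is straightened by the triangle identity, once \<open>p\<close>
  and \<open>q\<close> have been moved out of the way by interchange. The next lemma is its mirror image.
\<close>

lemma zigzag_f:
  assumes q: "hom2 q (Ob1, w) (Ob1, w')" and p: "hom2 p (Ob0, v) (Ob0, Gf # w)"
  shows "(ide cf \<star> (two_cell_c \<star> q)) \<bullet> (two_cell_u \<star> p) = (ide cf \<star> q) \<bullet> p"
proof -
  have w: "is_path Ob1 w" using hom2_cells(1)[OF q] by simp
  have f: "hom2 (ide cf) cf cf" by (simp add: ide_hom)
  have U: "hom2 (ide (adj_unit Ob0)) (Ob0, []) (Ob0, [])" using ide_hom by (simp add: adj_unit_pair)
  have iw: "hom2 (ide (Ob1, w)) (Ob1, w) (Ob1, w)" and ifw: "hom2 (ide (Ob0, Gf # w)) (Ob0, Gf # w) (Ob0, Gf # w)"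
    using w by (simp_all add: ide_hom)
  have fc: "hom2 (ide cf \<star> two_cell_c) (Ob0, [Gf, Gg, Gf]) cf"
    and uf: "hom2 (two_cell_u \<star> ide cf) cf (Ob0, [Gf, Gg, Gf])"
    using hom2_h[OF f hom2_c] hom2_h[OF hom2_u f] by simp_all
  have uw: "hom2 (two_cell_u \<star> ide (Ob0, Gf # w)) (Ob0, Gf # w) (Ob0, Gf # Gg # Gf # w)"
    using hom2_h[OF hom2_u ifw] by simp
  have fcq: "hom2 ((ide cf \<star> two_cell_c) \<star> q) (Ob0, Gf # Gg # Gf # w) (Ob0, Gf # w')"
    using hom2_h[OF fc q] by simp
  have "two_cell_u \<star> p = (two_cell_u \<star> ide (Ob0, Gf # w)) \<bullet> (ide (adj_unit Ob0) \<star> p)"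
    using interchange2[OF U hom2_u p ifw] v_ide[OF hom2_u] ide_v[OF p] by (simp add: adj_unit_pair)
  also have "ide (adj_unit Ob0) \<star> p = p" using unit_h2[OF p] by simp
  finally have "(ide cf \<star> (two_cell_c \<star> q)) \<bullet> (two_cell_u \<star> p) =
      ((ide cf \<star> two_cell_c) \<star> q) \<bullet> (two_cell_u \<star> ide (Ob0, Gf # w)) \<bullet> p"
    using h2_assoc[OF f hom2_c q] by simp
  also have "\<dots> = (((ide cf \<star> two_cell_c) \<star> q) \<bullet> (two_cell_u \<star> ide (Ob0, Gf # w))) \<bullet> p"
    by (rule v_assoc[OF p uw fcq])
  also have "two_cell_u \<star> ide (Ob0, Gf # w) = (two_cell_u \<star> ide cf) \<star> ide (Ob1, w)"
    using h2_assoc[OF hom2_u f iw] ide_h_ide[of cf "(Ob1, w)"] w by simp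
  also have "((ide cf \<star> two_cell_c) \<star> q) \<bullet> ((two_cell_u \<star> ide cf) \<star> ide (Ob1, w)) = ide cf \<star> q"
    using interchange2[OF uf fc iw q] triangle_f2 v_ide[OF q] by simp
  finally show ?thesis .
qed

lemma zigzag_g:
  assumes q: "hom2 q (Ob1, Gg # w) (Ob1, w')" and p: "hom2 p (Ob0, v) (Ob0, w)"
  shows "(two_cell_c \<star> q) \<bullet> (ide cg \<star> (two_cell_u \<star> p)) = q \<bullet> (ide cg \<star> p)"
proof -
  have w: "is_path Ob0 w" using hom2_cells(2)[OF p] by simp
  have g: "hom2 (ide cg) cg cg" by (simp add: ide_hom)
  have U: "hom2 (ide (adj_unit Ob1)) (Ob1, []) (Ob1, [])" using ide_hom by (simp add: adj_unit_pair)
  have iw: "hom2 (ide (Ob0, w)) (Ob0, w) (Ob0, w)" and igw: "hom2 (ide (Ob1, Gg # w)) (Ob1, Gg # w) (Ob1, Gg # w)"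
    using w by (simp_all add: ide_hom)
  have gu: "hom2 (ide cg \<star> two_cell_u) cg (Ob1, [Gg, Gf, Gg])"
    and cgg: "hom2 (two_cell_c \<star> ide cg) (Ob1, [Gg, Gf, Gg]) cg"
    using hom2_h[OF g hom2_u] hom2_h[OF hom2_c g] by simp_all
  have cw: "hom2 (two_cell_c \<star> ide (Ob1, Gg # w)) (Ob1, Gg # Gf # Gg # w) (Ob1, Gg # w)"
    using hom2_h[OF hom2_c igw] by simp
  have gup: "hom2 ((ide cg \<star> two_cell_u) \<star> p) (Ob1, Gg # v) (Ob1, Gg # Gf # Gg # w)"
    using hom2_h[OF gu p] by simp
  have "two_cell_c \<star> q = (ide (adj_unit Ob1) \<star> q) \<bullet> (two_cell_c \<star> ide (Ob1, Gg # w))"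
    using interchange2[OF hom2_c U igw q] ide_v[OF hom2_c] v_ide[OF q] by (simp add: adj_unit_pair)
  also have "ide (adj_unit Ob1) \<star> q = q" using unit_h2[OF q] by simp
  finally have "(two_cell_c \<star> q) \<bullet> (ide cg \<star> (two_cell_u \<star> p)) =
      (q \<bullet> (two_cell_c \<star> ide (Ob1, Gg # w))) \<bullet> ((ide cg \<star> two_cell_u) \<star> p)"
    using h2_assoc[OF g hom2_u p] by simp
  also have "\<dots> = q \<bullet> (two_cell_c \<star> ide (Ob1, Gg # w)) \<bullet> ((ide cg \<star> two_cell_u) \<star> p)"
    by (rule v_assoc[OF gup cw q, symmetric])
  also have "two_cell_c \<star> ide (Ob1, Gg # w) = (two_cell_c \<star> ide cg) \<star> ide (Ob0, w)"
    using h2_assoc[OF hom2_c g iw] ide_h_ide[of cg "(Ob0, w)"] w by simp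
  also have "((two_cell_c \<star> ide cg) \<star> ide (Ob0, w)) \<bullet> ((ide cg \<star> two_cell_u) \<star> p) = ide cg \<star> p"
    using interchange2[OF gu cgg p iw] triangle_g2 ide_v[OF p] by simp
  finally show ?thesis .
qed

text \<open>
  Compare the leftmost pieces of the upper row \<open>q\<close> and the lower row \<open>p\<close>. A \<open>u\<close> at the left end of \<open>q\<close> or
  a \<open>c\<close> at the left end of \<open>p\<close> can be split off, and so can a matching letter, a \<open>u\<close> of \<open>p\<close> whose letters
  survive in \<open>q\<close>, and a \<open>c\<close> of \<open>q\<close> whose letters come from \<open>p\<close>. What remains is a letter created by \<open>p\<close>
  and destroyed by \<open>q\<close>; there a zigzag disappears. Each step shortens the pair.
\<close>

lemma rows_compose:
  "row_path X p \<Longrightarrow> row_path X q \<Longrightarrow> row_cod p = row_dom q \<Longrightarrow>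
    \<exists>r. row_path X r \<and> row_cell X r = row_cell X q \<bullet> row_cell X p"
proof (induction "length p + length q" arbitrary: X p q rule: less_induct)
  case less
  note hp = row_hom[OF less(2), THEN conjunct1] and hq = row_hom[OF less(3), THEN conjunct1]
  have f: "hom2 (ide cf) cf cf" and g: "hom2 (ide cg) cg cg" by (simp_all add: ide_hom)
  have U: "hom2 (ide (adj_unit X)) (X, []) (X, [])" for X using ide_hom by (simp add: adj_unit_pair)
  show ?case
  proof (cases X)
    case Ob0
    show ?thesis
    proof (cases q)
      case Nil
      with less(4) less(2) Ob0 have "p = []" by (cases p rule: row_cod.cases; cases "hd p") auto
      with Nil show ?thesis using v_ide[OF U] by (intro exI[of _ "[]"]) (simp add: adj_unit_pair)
    next
      case (Cons l q')
      with less(3) Ob0 consider "q = PU # q'" "row_path Ob0 q'" | "q = PF # q'" "row_path Ob1 q'"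
        by (cases l) auto
      then show ?thesis
      proof cases
        case 1
        then obtain r where r: "row_path Ob0 r" "row_cell Ob0 r = row_cell Ob0 q' \<bullet> row_cell Ob0 p"
          using less(1)[of p q' Ob0] less(2,4) Ob0 by auto
        have hq': "hom2 (row_cell Ob0 q') (Ob0, row_cod p) (Ob0, row_cod q')"
          using row_hom[OF 1(2)] less(4) 1(1) by simp
        have "row_cell Ob0 (PU # r) = (two_cell_u \<star> row_cell Ob0 q') \<bullet> (ide (adj_unit Ob0) \<star> row_cell Ob0 p)"
          using interchange2[OF U hom2_u hp hq'[folded Ob0]] v_ide[OF hom2_u] r Ob0
          by (simp add: adj_unit_pair)
        also have "ide (adj_unit Ob0) \<star> row_cell Ob0 p = row_cell Ob0 p"
          using unit_h2[OF hp] Ob0 by simp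
        finally show ?thesis using 1 r Ob0 by (intro exI[of _ "PU # r"]) simp
      next
        case 2
        from less(4) 2 obtain l' p' where p: "p = l' # p'" by (cases p) auto
        with less(2) Ob0 consider "p = PF # p'" "row_path Ob1 p'" | "p = PU # p'" "row_path Ob0 p'"
          by (cases l') auto
        then show ?thesis
        proof cases
          case p: 1
          then obtain r where r: "row_path Ob1 r" "row_cell Ob1 r = row_cell Ob1 q' \<bullet> row_cell Ob1 p'"
            using less(1)[of p' q' Ob1] less(4) 2 by auto
          have e: "row_dom q' = row_cod p'" using less(4) 2 p by simp
          have "row_cell Ob0 (PF # r) = row_cell Ob0 q \<bullet> row_cell Ob0 p"
            using interchange2[OF f f row_hom[OF p(2), THEN conjunct1]
                row_hom[OF 2(2), THEN conjunct1, unfolded e]] v_ide[OF f] r p 2 by simp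
          then show ?thesis using r Ob0 by (intro exI[of _ "PF # r"]) simp
        next
          case p: 2
          have e: "row_dom q' = Gg # row_cod p'" using less(4) 2 p by simp
          then obtain l2 q2 where q': "q' = l2 # q2" by (cases q') auto
          with 2(2) consider "q' = PG # q2" "row_path Ob0 q2" | "q' = PC # q2" "row_path Ob1 q2"
            by (cases l2) auto
          then show ?thesis
          proof cases
            case q2: 1
            then have e2: "row_dom q2 = row_cod p'" using e by simp
            then obtain r where r: "row_path Ob0 r" "row_cell Ob0 r = row_cell Ob0 q2 \<bullet> row_cell Ob0 p'"
              using less(1)[of p' q2 Ob0] 2 p q2 by auto
            note h2 = row_hom[OF q2(2), THEN conjunct1, unfolded e2] and h3 = row_hom[OF p(2), THEN conjunct1]
            have fg: "hom2 (ide cf \<star> ide cg) (Ob0, [Gf, Gg]) (Ob0, [Gf, Gg])"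
              using hom2_h[OF f g] by simp
            have "row_cell Ob0 q \<bullet> row_cell Ob0 p = ((ide cf \<star> ide cg) \<star> row_cell Ob0 q2) \<bullet>
                (two_cell_u \<star> row_cell Ob0 p')"
              using 2 p q2 h2_assoc[OF f g h2] by simp
            also have "\<dots> = ((ide cf \<star> ide cg) \<bullet> two_cell_u) \<star> row_cell Ob0 r"
              using interchange2[OF hom2_u fg h3 h2] r by simp
            also have "(ide cf \<star> ide cg) \<bullet> two_cell_u = two_cell_u"
              using ide_h_ide[of cf cg] ide_v[OF hom2_u] by simp
            finally show ?thesis using r Ob0 by (intro exI[of _ "PU # r"]) simp
          next
            case q2: 2
            then have e2: "row_cod p' = Gf # row_dom q2" using e by simp
            then obtain r where r: "row_path Ob0 r"
              "row_cell Ob0 r = row_cell Ob0 (PF # q2) \<bullet> row_cell Ob0 p'"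
              using less(1)[of p' "PF # q2" Ob0] 2 p q2 by auto
            note h2 = row_hom[OF q2(2), THEN conjunct1] and h3 = row_hom[OF p(2), THEN conjunct1, unfolded e2]
            have "row_cell Ob0 q \<bullet> row_cell Ob0 p = row_cell Ob0 r"
              using zigzag_f[OF h2 h3] r 2 p q2 by simp
            then show ?thesis using r Ob0 by (intro exI[of _ r]) simp
          qed
        qed
      qed
    qed
  next
    case Ob1
    have C: ?thesis if p: "p = PC # p'" for p'
    proof -
      have p': "row_path Ob1 p'" "row_cod p' = row_dom q" using less(2,4) p by simp_all
      then obtain r where r: "row_path Ob1 r" "row_cell Ob1 r = row_cell Ob1 q \<bullet> row_cell Ob1 p'"
        using less(1)[of p' q Ob1] less(3) p Ob1 by auto
      note hp' = row_hom[OF p'(1), THEN conjunct1, unfolded p'(2)]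
      have "row_cell Ob1 q \<bullet> row_cell Ob1 p = (ide (adj_unit Ob1) \<star> row_cell Ob1 q) \<bullet>
          (two_cell_c \<star> row_cell Ob1 p')"
        using unit_h2[OF hq] p Ob1 by simp
      also have "\<dots> = two_cell_c \<star> row_cell Ob1 r"
        using interchange2[OF hom2_c U hp' hq[unfolded Ob1]] r ide_v[OF hom2_c] by (simp add: adj_unit_pair)
      finally show ?thesis using r Ob1 by (intro exI[of _ "PC # r"]) simp
    qed
    show ?thesis
    proof (cases q)
      case Nil
      then show ?thesis using less(2,4) ide_v[OF hp] by (intro exI[of _ p]) (simp add: adj_unit_pair)
    next
      case (Cons l q')
      then have "row_dom q \<noteq> []" using less(3) Ob1 by (cases l) auto
      then obtain l' p' where p: "p = l' # p'" using less(4) by (cases p) auto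
      with less(2) Ob1 consider "p = PC # p'" | "p = PG # p'" "row_path Ob0 p'" by (cases l') auto
      then show ?thesis
      proof cases
        case p: 2
        from Cons less(3) Ob1 consider "q = PG # q'" "row_path Ob0 q'" | "q = PC # q'" "row_path Ob1 q'"
          by (cases l) auto
        then show ?thesis
        proof cases
          case 1
          then obtain r where r: "row_path Ob0 r" "row_cell Ob0 r = row_cell Ob0 q' \<bullet> row_cell Ob0 p'"
            using less(1)[of p' q' Ob0] less(4) p by auto
          have e: "row_dom q' = row_cod p'" using less(4) 1 p by simp
          have "row_cell Ob1 (PG # r) = row_cell Ob1 q \<bullet> row_cell Ob1 p"
            using interchange2[OF g g row_hom[OF p(2), THEN conjunct1]
                row_hom[OF 1(2), THEN conjunct1, unfolded e]] v_ide[OF g] r p 1 by simp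
          then show ?thesis using r Ob1 by (intro exI[of _ "PG # r"]) simp
        next
          case 2
          have e: "row_cod p' = Gf # row_dom q'" using less(4) 2 p by simp
          then obtain l2 p2 where p': "p' = l2 # p2" by (cases p') auto
          with p(2) consider "p' = PF # p2" "row_path Ob1 p2" | "p' = PU # p2" "row_path Ob0 p2"
            by (cases l2) auto
          then show ?thesis
          proof cases
            case p2: 1
            then have e2: "row_cod p2 = row_dom q'" using e by simp
            then obtain r where r: "row_path Ob1 r" "row_cell Ob1 r = row_cell Ob1 q' \<bullet> row_cell Ob1 p2"
              using less(1)[of p2 q' Ob1] 2 p p2 by auto
            note h2 = row_hom[OF p2(2), THEN conjunct1, unfolded e2] and h3 = row_hom[OF 2(2), THEN conjunct1]
            have gf: "hom2 (ide cg \<star> ide cf) (Ob1, [Gg, Gf]) (Ob1, [Gg, Gf])"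
              using hom2_h[OF g f] by simp
            have "row_cell Ob1 q \<bullet> row_cell Ob1 p = (two_cell_c \<star> row_cell Ob1 q') \<bullet>
               ((ide cg \<star> ide cf) \<star> row_cell Ob1 p2)"
              using 2 p p2 h2_assoc[OF g f h2] by simp
            also have "\<dots> = (two_cell_c \<bullet> (ide cg \<star> ide cf)) \<star> row_cell Ob1 r"
              using interchange2[OF gf hom2_c h2 h3] r by simp
            also have "two_cell_c \<bullet> (ide cg \<star> ide cf) = two_cell_c"
              using ide_h_ide[of cg cf] v_ide[OF hom2_c] by simp
            finally show ?thesis using r Ob1 by (intro exI[of _ "PC # r"]) simp
          next
            case p2: 2
            then have e2: "row_dom q' = Gg # row_cod p2" using e by simp
            then obtain r where r: "row_path Ob1 r"
              "row_cell Ob1 r = row_cell Ob1 q' \<bullet> row_cell Ob1 (PG # p2)"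
              using less(1)[of "PG # p2" q' Ob1] 2 p p2 by auto
            note h2 = row_hom[OF p2(2), THEN conjunct1] and h3 = row_hom[OF 2(2), THEN conjunct1, unfolded e2]
            have "row_cell Ob1 q \<bullet> row_cell Ob1 p = row_cell Ob1 r"
              using zigzag_g[OF h3 h2] r 2 p p2 by simp
            then show ?thesis using r Ob1 by (intro exI[of _ r]) simp
          qed
        qed
      qed (rule C)
    qed
  qed
qed

lemma row_ide: "is_path X w \<Longrightarrow> \<exists>r. row_path X r \<and> row_cell X r = ide (X, w)"
proof (induction w arbitrary: X)
  case Nil
  then show ?case by (intro exI[of _ "[]"]) (simp add: adj_unit_pair)
next
  case (Cons h w)
  then obtain r where r: "row_path (gen_tgt h) r" "row_cell (gen_tgt h) r = ide (gen_tgt h, w)" by auto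
  define l where "l = (case h of Gf \<Rightarrow> PF | Gg \<Rightarrow> PG)"
  have l: "pcell l = ide (X, [h])" "psrc l = X" "ptgt l = gen_tgt h"
    using Cons(2) by (auto simp: l_def split: adj_gen.split)
  then show ?case using r Cons(2) ide_h_ide[of "(X, [h])" "(gen_tgt h, w)"]
    by (intro exI[of _ "l # r"]) simp
qed

lemma adj_hom_row: "adj_hom t F G \<Longrightarrow> \<exists>r. row_path (fst F) r \<and> row_cell (fst F) r = adj_class t"
proof (induction rule: adj_hom.induct)
  case (1 F)
  then show ?case using row_ide[of "fst F" "snd F"] by (cases F) simp
next
  case 2
  have "row_cell Ob0 [PU] = adj_class TU"
    using h2_unit[OF hom2_u] by (simp add: two_cell_u_def)
  then show ?case by (intro exI[of _ "[PU]"]) (simp add: adj_unit_pair)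
next
  case 3
  have "row_cell Ob1 [PC] = adj_class TC"
    using h2_unit[OF hom2_c] by (simp add: two_cell_c_def)
  then show ?case by (intro exI[of _ "[PC]"]) (simp add: adj_unit_pair cell_g_def cell_f_def)
next
  case (4 s F G t H)
  have e: "fst F = fst G" using adj_hom_cells[OF 4(1)] by simp
  obtain p q where p: "row_path (fst F) p" "row_cell (fst F) p = adj_class s"
    and q: "row_path (fst F) q" "row_cell (fst F) q = adj_class t" using 4 e by auto
  have "G = (fst F, row_cod p)" "G = (fst F, row_dom q)"
    using row_hom[OF p(1)] row_hom[OF q(1)] class_hom[OF 4(1)] class_hom[OF 4(2)] p(2) q(2)
    by (auto simp: in_hom_def)
  then have "row_cod p = row_dom q" by simp
  from rows_compose[OF p(1) q(1) this] show ?case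
    using class_cmp[OF 4(1,2)] p(2) q(2) by simp
next
  case (5 s F F' t G G')
  then obtain p q where p: "row_path (fst F) p" "row_cell (fst F) p = adj_class s"
    and q: "row_path (fst G) q" "row_cell (fst G) q = adj_class t" by auto
  have "F = (fst F, row_dom p)" using row_hom[OF p(1)] class_hom[OF 5(1)] p(2)
    by (auto simp: in_hom_def)
  then have "row_end (fst F) p = fst G" using row_hom[OF p(1)] 5(3) by (metis adj_tgt_pair)
  then show ?case using p q class_hc[OF 5(1,2,3)] row_cell_append[OF p(1), of q]
    by (intro exI[of _ "p @ q"]) (auto simp: row_append adj_comp_def)
qed

lemma hom2_row:
  assumes "hom2 a (X, v) (X', w)"
  obtains r where "row_path X r" "a = row_cell X r" "row_dom r = v" "row_cod r = w"
proof -
  obtain t where t: "a = adj_class t" "adj_hom t (X, v) (X', w)" by (rule in_hom_classE[OF assms])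
  obtain r where r: "row_path X r" "row_cell X r = a" using adj_hom_row[OF t(2)] t(1) by auto
  then show ?thesis using that row_hom[OF r(1)] assms by (auto simp: in_hom_def)
qed

section \<open>2-cells as maps of regions\<close>

text \<open>
  Each region with label \<open>1\<close> of a word, except one at its right end, is followed by a letter \<open>g\<close>. So
  these regions are numbered from \<open>0\<close>, and \<open>gcount\<close> is the index of the right end region if that has label \<open>1\<close>.
\<close>

definition gcount :: "adj_cell \<Rightarrow> nat" where
  "gcount F = count_list (snd F) Gg"

lemma gcount_simps [simp]: "gcount (X, []) = 0" "gcount (X, h # w) = (if h = Gg then 1 else 0) + gcount (X, w)"
  "gcount (X, v @ w) = gcount (X, v) + gcount (X, w)" "gcount (adj_comp F G) = gcount F + gcount G"
  "gcount (adj_unit X) = 0"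
  by (auto simp: gcount_def adj_comp_def adj_unit_def)

lemma gcount_source: "gcount (X, w) = gcount (Y, w)"
  by (simp add: gcount_def)

text \<open>
  Juxtaposition of region maps, where \<open>a\<close> and \<open>b\<close> are the numbers of letters \<open>g\<close> in source and target of the
  left factor. If the factors share a region with label \<open>1\<close>, its index is \<open>a\<close> and \<open>\<psi>\<close> decides.
\<close>

definition beside :: "nat \<Rightarrow> nat \<Rightarrow> (nat \<Rightarrow> nat) \<Rightarrow> (nat \<Rightarrow> nat) \<Rightarrow> nat \<Rightarrow> nat" where
  "beside a b \<phi> \<psi> i = (if i < a then \<phi> i else b + \<psi> (i - a))"

fun tm_dom :: "adj_tm \<Rightarrow> adj_cell" where
  "tm_dom (TId F) = F" | "tm_dom TU = adj_unit Ob0" | "tm_dom TC = adj_comp cell_g cell_f"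
| "tm_dom (TV t s) = tm_dom s" | "tm_dom (TH s t) = adj_comp (tm_dom s) (tm_dom t)"

fun tm_cod :: "adj_tm \<Rightarrow> adj_cell" where
  "tm_cod (TId F) = F" | "tm_cod TU = adj_comp cell_f cell_g" | "tm_cod TC = adj_unit Ob1"
| "tm_cod (TV t s) = tm_cod t" | "tm_cod (TH s t) = adj_comp (tm_cod s) (tm_cod t)"

text \<open>
  The map on regions, continued by a translation beyond the right end. With this convention identities
  become \<open>id\<close> and vertical composites become composites of functions, whatever the word. The unit
  creates a region with index \<open>0\<close>, the counit merges the regions with indices \<open>0\<close> and \<open>1\<close>.
\<close>

fun tm_map :: "adj_tm \<Rightarrow> nat \<Rightarrow> nat" where
  "tm_map (TId F) = id" | "tm_map TU = Suc" | "tm_map TC = (\<lambda>i. i - 1)"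
| "tm_map (TV t s) = tm_map t \<circ> tm_map s"
| "tm_map (TH s t) = beside (gcount (tm_dom s)) (gcount (tm_cod s)) (tm_map s) (tm_map t)"

lemma tm_dom_cod: "adj_hom t F G \<Longrightarrow> tm_dom t = F \<and> tm_cod t = G"
  by (induction rule: adj_hom.induct) auto

text \<open>
  A boundary region with label \<open>1\<close> stays at the boundary. If the right end region has label \<open>0\<close>, then
  \<open>gcount\<close> is not the index of a region and must not be a value.
\<close>

definition region_map :: "adj_cell \<Rightarrow> adj_cell \<Rightarrow> (nat \<Rightarrow> nat) \<Rightarrow> bool" where
  "region_map F G \<phi> \<longleftrightarrow> mono \<phi> \<and> (\<forall>i. \<phi> (gcount F + i) = gcount G + i) \<and>
     (fst F = Ob1 \<longrightarrow> \<phi> 0 = 0) \<and> (adj_tgt F = Ob0 \<longrightarrow> (\<forall>i < gcount F. \<phi> i < gcount G))"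

lemma region_mapD:
  assumes "region_map F G \<phi>"
  shows "mono \<phi>" "\<phi> (gcount F + i) = gcount G + i" "\<phi> (gcount F) = gcount G"
    "fst F = Ob1 \<Longrightarrow> \<phi> 0 = 0" "adj_tgt F = Ob0 \<Longrightarrow> i < gcount F \<Longrightarrow> \<phi> i < gcount G"
    "i < gcount F \<Longrightarrow> \<phi> i \<le> gcount G"
proof -
  show m: "mono \<phi>" and c: "\<phi> (gcount F + i) = gcount G + i" for i using assms by (auto simp: region_map_def)
  show *: "\<phi> (gcount F) = gcount G" using c[of 0] by simp
  show "fst F = Ob1 \<Longrightarrow> \<phi> 0 = 0" "adj_tgt F = Ob0 \<Longrightarrow> i < gcount F \<Longrightarrow> \<phi> i < gcount G"
    using assms by (auto simp: region_map_def)
  show "i < gcount F \<Longrightarrow> \<phi> i \<le> gcount G" using monoD[OF m, of i "gcount F"] * by simp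
qed

lemma region_map_id: "region_map F F id"
  by (simp add: region_map_def mono_def)

lemma region_map_comp:
  assumes "region_map F G \<phi>" "region_map G H \<psi>" "fst F = fst G" "adj_tgt F = adj_tgt G"
  shows "region_map F H (\<psi> \<circ> \<phi>)"
  using assms by (auto simp: region_map_def mono_def)


lemma no_g_from_Ob1: "is_path Ob1 w \<Longrightarrow> gcount (X, w) = 0 \<Longrightarrow> w = []"
proof (cases w)
  case (Cons h w')
  then show "is_path Ob1 w \<Longrightarrow> gcount (X, w) = 0 \<Longrightarrow> w = []" by (cases h) auto
qed simp

lemma no_g_to_Ob0: "is_path X w \<Longrightarrow> path_end X w = Ob0 \<Longrightarrow> gcount (Y, w) = 0 \<Longrightarrow> w = [] \<and> X = Ob0"
proof (induction w arbitrary: X)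
  case (Cons h w)
  then show ?case by (cases h) auto
qed simp

lemma region_map_beside:
  assumes \<phi>: "region_map F F' \<phi>" and \<psi>: "region_map G G' \<psi>"
    and e: "adj_tgt F = fst G" and F: "F \<in> adj_cells" and G: "G \<in> adj_cells"
  shows "region_map (adj_comp F G) (adj_comp F' G') (beside (gcount F) (gcount F') \<phi> \<psi>)"
proof -
  let ?b = "beside (gcount F) (gcount F') \<phi> \<psi>"
  have 1: "mono ?b"
  proof (rule monoI)
    fix i j :: nat assume ij: "i \<le> j"
    consider "j < gcount F" | "i < gcount F" "gcount F \<le> j" | "gcount F \<le> i" by linarith
    then show "?b i \<le> ?b j"
    proof cases
      case 2
      then show ?thesis using region_mapD(6)[OF \<phi>, of i] by (simp add: beside_def trans_le_add1)
    qed (use ij region_mapD(1)[OF \<phi>] region_mapD(1)[OF \<psi>] in \<open>auto simp: beside_def mono_def\<close>)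
  qed
  have 2: "?b (gcount (adj_comp F G) + i) = gcount (adj_comp F' G') + i" for i
    using region_mapD(2)[OF \<psi>, of i] by (simp add: beside_def add.assoc)
  have 3: "?b 0 = 0" if s: "fst F = Ob1"
  proof (cases "gcount F = 0")
    case True
    then have "gcount F' = 0" using region_mapD(3)[OF \<phi>] region_mapD(4)[OF \<phi> s] by simp
    moreover have "fst G = Ob1"
      using no_g_from_Ob1[of "snd F" "fst F"] True s F e by (cases F) auto
    ultimately show ?thesis using True region_mapD(4)[OF \<psi>] by (simp add: beside_def)
  qed (use region_mapD(4)[OF \<phi> s] in \<open>simp add: beside_def\<close>)
  have 4: "?b i < gcount (adj_comp F' G')"
    if t: "adj_tgt (adj_comp F G) = Ob0" and i: "i < gcount (adj_comp F G)" for i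
  proof -
    have t: "adj_tgt G = Ob0" using t e by (cases F; cases G) (auto simp: path_end_append)
    show ?thesis
    proof (cases "i < gcount F")
      case True
      show ?thesis
      proof (cases "adj_tgt F")
        case Ob0
        then show ?thesis using True region_mapD(5)[OF \<phi> Ob0 True] by (simp add: beside_def)
      next
        case Ob1
        then have "gcount G > 0"
          using no_g_to_Ob0[of "fst G" "snd G" "fst G"] t e G by (cases G) auto
        then have "0 < gcount G'" using region_mapD(5)[OF \<psi> t, of 0] by simp
        then show ?thesis using True region_mapD(6)[OF \<phi> True] by (simp add: beside_def)
      qed
    next
      case False
      then show ?thesis using region_mapD(5)[OF \<psi> t, of "i - gcount F"] i by (simp add: beside_def)
    qed
  qed
  show ?thesis unfolding region_map_def using 1 2 3 4 by (simp add: adj_comp_def)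
qed

lemma adj_hom_region_map: "adj_hom t F G \<Longrightarrow> region_map F G (tm_map t)"
proof (induction rule: adj_hom.induct)
  case (4 s F G t H)
  show ?case unfolding tm_map.simps
    by (rule region_map_comp[OF 4(3,4)]) (use adj_hom_cells[OF 4(1)] in auto)
next
  case (5 s F F' t G G')
  show ?case
    using region_map_beside[OF 5(4,5,3)] adj_hom_cells[OF 5(1)] adj_hom_cells[OF 5(2)]
      tm_dom_cod[OF 5(1)] by simp
qed (auto simp: region_map_id region_map_def mono_def cell_f_def cell_g_def adj_unit_pair gcount_def diff_le_mono)

lemma beside_comp:
  assumes "region_map F F' \<phi>" "region_map F' F'' \<phi>'" "region_map G G' \<psi>" "region_map G' G'' \<psi>'"
    "adj_tgt F = fst G" "fst G = fst G'"
  shows "beside (gcount F) (gcount F'') (\<phi>' \<circ> \<phi>) (\<psi>' \<circ> \<psi>) =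
    beside (gcount F') (gcount F'') \<phi>' \<psi>' \<circ> beside (gcount F) (gcount F') \<phi> \<psi>"
proof
  fix i
  show "beside (gcount F) (gcount F'') (\<phi>' \<circ> \<phi>) (\<psi>' \<circ> \<psi>) i =
    (beside (gcount F') (gcount F'') \<phi>' \<psi>' \<circ> beside (gcount F) (gcount F') \<phi> \<psi>) i"
  proof (cases "i < gcount F")
    case i: True
    show ?thesis
    proof (cases "\<phi> i < gcount F'")
      case False
      \<comment> \<open>the index lands on the region shared by both factors, which then has label \<open>1\<close>\<close>
      with region_mapD(6)[OF assms(1) i] have e: "\<phi> i = gcount F'" by simp
      then have "adj_tgt F = Ob1" using region_mapD(5)[OF assms(1) _ i] by (cases "adj_tgt F") auto
      then show ?thesis using i e region_mapD(3)[OF assms(2)] region_mapD(4)[OF assms(4)] assms(5,6)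
        by (simp add: beside_def)
    qed (use i in \<open>simp add: beside_def\<close>)
  qed (simp add: beside_def)
qed

lemma beside_assoc: "beside (a + b) (a' + b') (beside a a' \<phi> \<psi>) \<chi> = beside a a' \<phi> (beside b b' \<psi> \<chi>)"
  by (auto simp: beside_def fun_eq_iff)

text \<open>
  Soundness of the interpretation: the triangle identities hold because both composites are
  predecessor after successor, up to the position.
\<close>

lemma adj_eq_tm_map: "adj_eq s t \<Longrightarrow> tm_map s = tm_map t"
proof (induction rule: adj_eq.induct)
  case (cong_h s s' t t' F F' G G')
  have "adj_hom s' F F'" using adj_eq_hom[OF cong_h(1)] adj_hom_unique cong_h(3) by metis
  then show ?case using cong_h(3,6,7) by (simp add: tm_dom_cod)
next
  case (h_unit t F G)
  have "tm_map t i = gcount G + (i - gcount F)" if "\<not> i < gcount F" for i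
    using region_mapD(2)[OF adj_hom_region_map[OF h_unit], of "i - gcount F"] that by simp
  then show ?case using tm_dom_cod[OF h_unit] by (simp add: fun_eq_iff beside_def)
next
  case (h_assoc r F F' s G G' t H H')
  then show ?case by (simp add: tm_dom_cod beside_assoc)
next
  case (interchange s F F' s' F'' t G G' t' G'')
  note r = interchange(1-4)[THEN adj_hom_region_map]
  show ?case
    using beside_comp[OF r] adj_hom_cells[OF interchange(3)] interchange(5)
      interchange(1-4)[THEN tm_dom_cod] by simp
qed (auto simp: fun_eq_iff beside_def tm_dom_cod gcount_def cell_f_def cell_g_def adj_unit_def adj_comp_def)

fun row_map :: "piece list \<Rightarrow> nat \<Rightarrow> nat" where
  "row_map [] i = i"
| "row_map (PF # r) i = row_map r i"
| "row_map (PG # r) i = (if i = 0 then 0 else Suc (row_map r (i - 1)))"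
| "row_map (PU # r) i = Suc (row_map r i)"
| "row_map (PC # r) i = (if i = 0 then 0 else row_map r (i - 1))"

lemma row_map_Ob1: "row_path Ob1 r \<Longrightarrow> row_map r 0 = 0"
proof (cases r)
  case (Cons l r')
  then show "row_path Ob1 r \<Longrightarrow> row_map r 0 = 0" by (cases l) auto
qed simp

text \<open>
  Reading the pieces from the left, the map determines each of them: a piece starting at \<open>0\<close> is \<open>u\<close>
  exactly if index \<open>0\<close> is missed, one starting at \<open>1\<close> is \<open>c\<close> exactly if index \<open>1\<close> is sent to \<open>0\<close>.
\<close>

lemma row_unique:
  "row_path X r \<Longrightarrow> row_path X s \<Longrightarrow> row_dom r = row_dom s \<Longrightarrow> row_cod r = row_cod s \<Longrightarrow>
    row_map r = row_map s \<Longrightarrow> r = s"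
proof (induction r arbitrary: X s)
  case Nil
  show ?case
  proof (cases s)
    case (Cons l s')
    then show ?thesis using Nil(3,4) by (cases l) auto
  qed simp
next
  case (Cons l r)
  obtain l' s' where s: "s = l' # s'" using Cons(4,5) by (cases s; cases l) auto
  have m0: "row_map (l # r) i = row_map (l' # s') i" for i using Cons(6) s by simp
  have ll: "l = l'"
    using Cons(2,3) s m0[of 0] m0[of 1] row_map_Ob1[of r] row_map_Ob1[of s']
    by (cases l; cases l') auto
  have "row_map r i = row_map s' i" for i using m0[of i] m0[of "Suc i"] ll by (cases l) auto
  then have "row_map r = row_map s'" by auto
  with Cons(1)[of "ptgt l" s'] Cons(2-5) s ll show ?case by simp
qed

text \<open>
  The same reading, used as a recipe: the value at \<open>0\<close>, resp. at \<open>1\<close>, tells which piece comes first, and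
  deleting it leaves a region map between shorter words.
\<close>

lemma region_map_row:
  "is_path X v \<Longrightarrow> is_path X w \<Longrightarrow> path_end X v = path_end X w \<Longrightarrow> region_map (X, v) (X, w) \<phi> \<Longrightarrow>
    \<exists>r. row_path X r \<and> row_dom r = v \<and> row_cod r = w \<and> row_map r = \<phi>"
proof (induction "length v + length w" arbitrary: X v w \<phi> rule: less_induct)
  case less
  note D = region_mapD[OF less(5), simplified]
  have pos: "gcount (Y, z) > 0" if "z \<noteq> []" "is_path X z" "path_end X z = Ob0" for z X Y
    using no_g_to_Ob0 that by blast
  show ?case
  proof (cases X)
    case Ob0
    show ?thesis
    proof (cases w)
      case Nil
      then have e: "path_end X v = Ob0" using less(4) Ob0 by simp
      have "v = []" using pos[OF _ less(2) e] D(5)[OF e, of 0] Nil by (cases "v = []") auto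
      then show ?thesis using Nil D(2) by (intro exI[of _ "[]"]) (auto simp: fun_eq_iff)
    next
      case (Cons h w1)
      then have w: "w = Gf # w1" "is_path Ob1 w1" using less(3) Ob0 by (cases h; simp)+
      show ?thesis
      proof (cases "\<phi> 0 = 0")
        case True
        have "v \<noteq> []"
        proof
          assume v: "v = []"
          then have "gcount (X, w) = 0" using D(3) True by simp
          then show False using pos[of w X X] less(3,4) v w Ob0 by simp
        qed
        then obtain v1 where v: "v = Gf # v1" "is_path Ob1 v1"
          using less(2) Ob0 by (cases v; cases "hd v") auto
        have "region_map (Ob1, v1) (Ob1, w1) \<phi>"
          using less(5) v w Ob0 True unfolding region_map_def by (simp add: gcount_source[of Ob0 _ Ob1])
        then obtain r where "row_path Ob1 r" "row_dom r = v1" "row_cod r = w1" "row_map r = \<phi>"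
          using less(1)[of v1 w1 Ob1 \<phi>] v w less(4) Ob0 by auto
        then show ?thesis using v w Ob0 by (intro exI[of _ "PF # r"]) (auto simp: fun_eq_iff)
      next
        case False
        then have p: "\<phi> i > 0" for i using monoD[OF D(1), of 0 i] by simp
        have "w1 \<noteq> []"
        proof
          assume "w1 = []"
          then show False using p[of "gcount (X, v)"] D(3) w by simp
        qed
        then obtain w2 where w2: "w1 = Gg # w2" "is_path Ob0 w2" using w(2) by (cases w1; cases "hd w1") auto
        have p': "Suc (\<phi> i - 1) = \<phi> i" for i using p[of i] by simp
        have "region_map (Ob0, v) (Ob0, w2) (\<lambda>i. \<phi> i - 1)"
          unfolding region_map_def
        proof (intro conjI allI impI)
          show "mono (\<lambda>i. \<phi> i - 1)" using D(1) by (simp add: mono_def diff_le_mono)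
          show "\<phi> (gcount (Ob0, v) + i) - 1 = gcount (Ob0, w2) + i" for i
            using D(2)[of i] w w2 Ob0 by simp
          show "\<phi> i - 1 < gcount (Ob0, w2)" if "adj_tgt (Ob0, v) = Ob0" "i < gcount (Ob0, v)" for i
            using D(5)[of i] that w w2 Ob0 p[of i] by simp
        qed simp
        then obtain r where "row_path Ob0 r" "row_dom r = v" "row_cod r = w2" "row_map r = (\<lambda>i. \<phi> i - 1)"
          using less(1)[of v w2 Ob0] w w2 less(2,4) Ob0 by auto
        then show ?thesis using w w2 Ob0 p' by (intro exI[of _ "PU # r"]) (auto simp: fun_eq_iff)
      qed
    qed
  next
    case Ob1
    have 0: "\<phi> 0 = 0" using D(4) Ob1 by simp
    show ?thesis
    proof (cases v)
      case Nil
      then have "gcount (X, w) = 0" using D(3) 0 by simp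
      then have "w = []" using no_g_from_Ob1 less(3) Ob1 by blast
      then show ?thesis using Nil D(2) by (intro exI[of _ "[]"]) (auto simp: fun_eq_iff)
    next
      case (Cons h v1)
      then have v: "v = Gg # v1" "is_path Ob0 v1" using less(2) Ob1 by (cases h; simp)+
      have C: ?thesis if 1: "\<phi> 1 = 0" and f: "v1 = Gf # v2" for v2
      proof -
        have v2: "is_path Ob1 v2" using v f by simp
        have "region_map (Ob1, v2) (Ob1, w) (\<lambda>i. \<phi> (Suc i))"
          unfolding region_map_def
        proof (intro conjI allI impI)
          show "mono (\<lambda>i. \<phi> (Suc i))" using D(1) by (simp add: mono_def)
          show "\<phi> (Suc (gcount (Ob1, v2) + i)) = gcount (Ob1, w) + i" for i
            using D(2)[of i] v f Ob1 by simp
          show "\<phi> (Suc 0) = 0" using 1 by simp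
          show "\<phi> (Suc i) < gcount (Ob1, w)" if "adj_tgt (Ob1, v2) = Ob0" "i < gcount (Ob1, v2)" for i
            using D(5)[of "Suc i"] that v f Ob1 by simp
        qed
        then obtain r where "row_path Ob1 r" "row_dom r = v2" "row_cod r = w" "row_map r = (\<lambda>i. \<phi> (Suc i))"
          using less(1)[of v2 w Ob1] v f v2 less(3,4) Ob1 by auto
        then show ?thesis using v f Ob1 0 by (intro exI[of _ "PC # r"]) (auto simp: fun_eq_iff)
      qed
      have cv: "gcount (X, v) = Suc (gcount (X, v1))" using v by simp
      show ?thesis
      proof (cases w)
        case Nil
        then have "path_end Ob0 v1 = Ob1" using less(4) v Ob1 by simp
        then have "v1 \<noteq> []" by auto
        then obtain v2 where "v1 = Gf # v2" using v(2) by (cases v1; cases "hd v1") auto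
        moreover have "\<phi> 1 = 0" using monoD[OF D(1), of 1 "gcount (X, v)"] D(3) Nil cv by simp
        ultimately show ?thesis using C by simp
      next
        case (Cons h w1)
        then have w: "w = Gg # w1" "is_path Ob0 w1" using less(3) Ob1 by (cases h; simp)+
        show ?thesis
        proof (cases "\<phi> 1 = 0")
          case True
          have "v1 \<noteq> []" using D(3) w v True by auto
          then obtain v2 where "v1 = Gf # v2" using v(2) by (cases v1; cases "hd v1") auto
          with C True show ?thesis by simp
        next
          case False
          then have p: "\<phi> (Suc i) > 0" for i using monoD[OF D(1), of 1 "Suc i"] by simp
          have p': "Suc (\<phi> i - Suc 0) = \<phi> i" if "i > 0" for i using p[of "i - 1"] that by simp
          have "region_map (Ob0, v1) (Ob0, w1) (\<lambda>i. \<phi> (Suc i) - 1)"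
            unfolding region_map_def
          proof (intro conjI allI impI)
            show "mono (\<lambda>i. \<phi> (Suc i) - 1)" using D(1) by (simp add: mono_def diff_le_mono)
            show "\<phi> (Suc (gcount (Ob0, v1) + i)) - 1 = gcount (Ob0, w1) + i" for i
              using D(2)[of i] w v Ob1 by (simp add: gcount_source[of Ob0 _ Ob1])
            show "\<phi> (Suc i) - 1 < gcount (Ob0, w1)"
              if "adj_tgt (Ob0, v1) = Ob0" "i < gcount (Ob0, v1)" for i
              using D(5)[of "Suc i"] that w v Ob1 p[of i] by (simp add: gcount_source[of Ob0 _ Ob1])
          qed simp
          then obtain r where "row_path Ob0 r" "row_dom r = v1" "row_cod r = w1"
            "row_map r = (\<lambda>i. \<phi> (Suc i) - 1)"
            using less(1)[of v1 w1 Ob0] w v less(4) Ob1 by auto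
          then show ?thesis using w v Ob1 p' 0 by (intro exI[of _ "PG # r"]) (auto simp: fun_eq_iff)
        qed
      qed
    qed
  qed
qed

text \<open>
  All representatives of a class have the same map by \<open>adj_eq_tm_map\<close>.
\<close>

definition cell_map :: "adj_tm set \<Rightarrow> nat \<Rightarrow> nat" where
  "cell_map a = tm_map (SOME t. t \<in> a)"

lemma cell_map_class: "adj_hom t F G \<Longrightarrow> cell_map (adj_class t) = tm_map t"
proof -
  assume t: "adj_hom t F G"
  have "(SOME s. s \<in> adj_class t) \<in> adj_class t"
    by (rule someI[of _ t]) (simp add: adj_class_def adj_eq.refl[OF t])
  then show ?thesis using adj_eq_tm_map by (auto simp: cell_map_def adj_class_def)
qed

lemma cell_map_region: "hom2 a F G \<Longrightarrow> region_map F G (cell_map a)"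
  by (erule in_hom_classE) (simp add: cell_map_class adj_hom_region_map)

lemma cell_map_ide [simp]: "F \<in> adj_cells \<Longrightarrow> cell_map (ide F) = id"
  using cell_map_class[OF adj_hom.intros(1)] by simp

lemma cell_map_v: "hom2 a F G \<Longrightarrow> hom2 b G H \<Longrightarrow> cell_map (b \<bullet> a) = cell_map b \<circ> cell_map a"
proof (elim in_hom_classE)
  fix s t assume h: "adj_hom s F G" "adj_hom t G H" and e: "a = adj_class s" "b = adj_class t"
  show ?thesis unfolding e class_cmp[OF h] cell_map_class[OF adj_hom.intros(4)[OF h]]
    using h by (simp add: cell_map_class)
qed

lemma cell_map_h: "hom2 a F F' \<Longrightarrow> hom2 b G G' \<Longrightarrow> adj_tgt F = fst G \<Longrightarrow>
    cell_map (a \<star> b) = beside (gcount F) (gcount F') (cell_map a) (cell_map b)"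
proof (elim in_hom_classE)
  fix s t assume h: "adj_hom s F F'" "adj_hom t G G'" "adj_tgt F = fst G"
    and e: "a = adj_class s" "b = adj_class t"
  show ?thesis unfolding e class_hc[OF h] cell_map_class[OF adj_hom.intros(5)[OF h]]
    using h by (simp add: tm_dom_cod cell_map_class)
qed

lemma cell_map_u: "cell_map two_cell_u = Suc" and cell_map_c: "cell_map two_cell_c = (\<lambda>i. i - 1)"
  using cell_map_class[OF adj_hom.intros(2)] cell_map_class[OF adj_hom.intros(3)]
  by (simp_all add: two_cell_u_def two_cell_c_def)

lemma cell_map_row: "row_path X r \<Longrightarrow> cell_map (row_cell X r) = row_map r"
proof (induction r arbitrary: X)
  case Nil
  then show ?case by (simp add: adj_unit_pair fun_eq_iff)
next
  case (Cons l r)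
  then have "cell_map (row_cell X (l # r)) =
      beside (gcount (X, pdom l)) (gcount (X, pcod l)) (cell_map (pcell l)) (row_map r)"
    using cell_map_h[OF pcell_hom row_hom[THEN conjunct1]] by (simp add: piece_path_end)
  then show ?case by (cases l) (auto simp: fun_eq_iff beside_def cell_map_u cell_map_c)
qed

text \<open>
  Together with the next lemma: a hom-category of \<open>Adj\<close> is the category of region maps.
\<close>

lemma two_cell_eqI:
  assumes "hom2 a F G" "hom2 b F G" "cell_map a = cell_map b"
  shows "a = b"
proof -
  obtain X v X' w where e: "F = (X, v)" "G = (X', w)" by (cases F; cases G)
  obtain r where r: "row_path X r" "a = row_cell X r" "row_dom r = v" "row_cod r = w"
    by (rule hom2_row[OF assms(1)[unfolded e]])
  obtain s where s: "row_path X s" "b = row_cell X s" "row_dom s = v" "row_cod s = w"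
    by (rule hom2_row[OF assms(2)[unfolded e]])
  have "row_map r = row_map s" using assms(3) cell_map_row r s by simp
  then show ?thesis using row_unique[OF r(1) s(1)] r s by simp
qed

lemma two_cell_exists:
  assumes "F \<in> adj_cells" "G \<in> adj_cells" "fst F = fst G" "adj_tgt F = adj_tgt G" "region_map F G \<phi>"
  shows "\<exists>a. hom2 a F G \<and> cell_map a = \<phi>"
proof -
  obtain X v w where e: "F = (X, v)" "G = (X, w)" using assms(3) by (cases F; cases G) auto
  then obtain r where "row_path X r" "row_dom r = v" "row_cod r = w" "row_map r = \<phi>"
    using region_map_row[of X v w \<phi>] assms by auto
  then show ?thesis using row_hom cell_map_row e by blast
qed

section \<open>Strictness of the cyclic nerve of the free adjunction\<close>

fun chain :: "adj_ob \<Rightarrow> adj_cell list \<Rightarrow> adj_ob \<Rightarrow> bool" where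
  "chain X [] Y \<longleftrightarrow> X = Y"
| "chain X (F # Fs) Y \<longleftrightarrow> F \<in> adj_cells \<and> fst F = X \<and> chain (adj_tgt F) Fs Y"

text \<open>
  For chains of composable cells, \<open>glue\<close> and \<open>hprod\<close> agree with \<open>comp1\<close> and \<open>comp2\<close> because units are strict.
  The trailing unit in \<open>hprod\<close> lets both turn concatenation of lists into horizontal composition.
\<close>

definition glue :: "adj_ob \<Rightarrow> adj_cell list \<Rightarrow> adj_cell" where
  "glue X Fs = (X, concat (map snd Fs))"

fun hprod :: "adj_ob \<Rightarrow> adj_tm set list \<Rightarrow> adj_tm set" where
  "hprod X [] = ide (adj_unit X)"
| "hprod X (a # as) = a \<star> hprod (adj_tgt (Dom adj_two_cells a)) as"

lemma glue_simps [simp]: "glue X [] = adj_unit X" "fst (glue X Fs) = X"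
  "fst F = X \<Longrightarrow> glue X (F # Fs) = adj_comp F (glue (adj_tgt F) Fs)"
  by (simp_all add: glue_def adj_unit_def adj_comp_def)

lemma chain_append: "chain X (Fs @ Gs) Z \<longleftrightarrow> (\<exists>Y. chain X Fs Y \<and> chain Y Gs Z)"
  by (induction Fs arbitrary: X) auto

lemma glue_append: "glue X (Fs @ Gs) = adj_comp (glue X Fs) (glue Y Gs)"
  by (simp add: glue_def adj_comp_def)

lemma chain_glue: "chain X Fs Y \<Longrightarrow> glue X Fs \<in> adj_cells \<and> adj_tgt (glue X Fs) = Y"
proof (induction Fs arbitrary: X)
  case (Cons F Fs)
  then show ?case using adj_comp_cell[of F "glue (adj_tgt F) Fs"] by auto
qed simp

lemma comp1_adj: "chain X Fs Y \<Longrightarrow> comp1 adj X Fs = glue X Fs"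
proof (induction adj X Fs rule: comp1.induct)
  case (2 X F)
  then show ?case by (cases F) (simp add: adj_unit_pair)
qed auto

definition cells2 :: "adj_tm set list \<Rightarrow> bool" where
  "cells2 as \<longleftrightarrow> set as \<subseteq> Ar adj_two_cells"

abbreviation doms :: "adj_tm set list \<Rightarrow> adj_cell list" where
  "doms \<equiv> map (Dom adj_two_cells)"

abbreviation cods :: "adj_tm set list \<Rightarrow> adj_cell list" where
  "cods \<equiv> map (Cod adj_two_cells)"

lemma cells2_simps [simp]: "cells2 []" "cells2 (a # as) \<longleftrightarrow> a \<in> Ar adj_two_cells \<and> cells2 as"
  "cells2 (as @ bs) \<longleftrightarrow> cells2 as \<and> cells2 bs"
  by (auto simp: cells2_def)

lemma ar_hom2: "a \<in> Ar adj_two_cells \<Longrightarrow> hom2 a (Dom adj_two_cells a) (Cod adj_two_cells a)"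
  by (simp add: in_hom_def)

lemma hprod_hom: "cells2 as \<Longrightarrow> chain X (doms as) Y \<Longrightarrow>
    hom2 (hprod X as) (glue X (doms as)) (glue X (cods as)) \<and> chain X (cods as) Y"
proof (induction as arbitrary: X)
  case Nil
  then show ?case by (auto intro: ide_hom)
next
  case (Cons a as)
  then have a: "hom2 a (Dom adj_two_cells a) (Cod adj_two_cells a)" by (simp add: ar_hom2)
  let ?Y = "adj_tgt (Dom adj_two_cells a)"
  have IH: "hom2 (hprod ?Y as) (glue ?Y (doms as)) (glue ?Y (cods as)) \<and> chain ?Y (cods as) Y"
    using Cons by auto
  show ?case using hom2_h[OF a conjunct1[OF IH]] IH hom2_cells[OF a] Cons(3) by simp
qed

lemma comp2_adj: "cells2 as \<Longrightarrow> chain X (doms as) Y \<Longrightarrow> comp2 adj X as = hprod X as"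
proof (induction adj X as rule: comp2.induct)
  case (2 X a)
  then show ?case using h2_unit[OF ar_hom2, of a] by auto
qed auto

lemma hprod_ide: "chain X Fs Y \<Longrightarrow> hprod X (map ide Fs) = ide (glue X Fs)"
proof (induction Fs arbitrary: X)
  case (Cons F Fs)
  moreover have "Dom adj_two_cells (ide F) = F"
    using ide_hom[of F] Cons by (simp add: in_hom_def)
  ultimately show ?case
    using ide_h_ide[of F "glue (adj_tgt F) Fs"] chain_glue[of "adj_tgt F" Fs Y] by simp
qed simp

lemma hprod_v: "cells2 as \<Longrightarrow> cells2 bs \<Longrightarrow> doms bs = cods as \<Longrightarrow> chain X (doms as) Y \<Longrightarrow>
    hprod X (map2 (Cmp adj_two_cells) bs as) = hprod X bs \<bullet> hprod X as"
proof (induction as arbitrary: bs X)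
  case Nil
  then show ?case using v_ide[OF ide_hom, of "adj_unit X"] by simp
next
  case (Cons a as)
  then obtain b bs' where bs: "bs = b # bs'" by (cases bs) auto
  have a: "hom2 a (Dom adj_two_cells a) (Cod adj_two_cells a)"
    and b: "hom2 b (Cod adj_two_cells a) (Cod adj_two_cells b)"
    using Cons ar_hom2 bs by (auto simp: in_hom_def)
  let ?Y = "adj_tgt (Dom adj_two_cells a)"
  have Y: "adj_tgt (Dom adj_two_cells b) = ?Y" "adj_tgt (Dom adj_two_cells (b \<bullet> a)) = ?Y"
    using hom2_cells(4)[OF a] hom2_v[OF a b] Cons bs by (auto simp: in_hom_def)
  have c: "chain ?Y (doms as) Y" "cells2 as" "cells2 bs'" "doms bs' = cods as"
    using Cons bs by auto
  have h: "hom2 (hprod ?Y as) (glue ?Y (doms as)) (glue ?Y (cods as))"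
    "hom2 (hprod ?Y bs') (glue ?Y (cods as)) (glue ?Y (cods bs'))"
    using hprod_hom[OF c(2,1)] hprod_hom[of bs' ?Y Y] c by auto
  show ?case using interchange2[OF a b h] Cons(1)[OF c(2,3,4,1)] bs Y by simp
qed

lemma hprod_append: "cells2 as \<Longrightarrow> cells2 bs \<Longrightarrow> chain X (doms as) Y \<Longrightarrow> chain Y (doms bs) Z \<Longrightarrow>
    hprod X (as @ bs) = hprod X as \<star> hprod Y bs"
proof (induction as arbitrary: X)
  case Nil
  then have "hom2 (hprod X bs) (glue X (doms bs)) (glue X (cods bs))" using hprod_hom by simp
  from unit_h2[OF this] Nil show ?case by simp
next
  case (Cons a as)
  then have a: "hom2 a (Dom adj_two_cells a) (Cod adj_two_cells a)" by (simp add: ar_hom2)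
  let ?Y = "adj_tgt (Dom adj_two_cells a)"
  have "hom2 (hprod ?Y as) (glue ?Y (doms as)) (glue ?Y (cods as))"
    "hom2 (hprod Y bs) (glue Y (doms bs)) (glue Y (cods bs))"
    "adj_tgt (glue ?Y (doms as)) = Y"
    using hprod_hom[of as ?Y Y] hprod_hom[of bs Y Z] chain_glue[of ?Y "doms as" Y] Cons by auto
  from h2_assoc[OF a this(1,2)] this(3) Cons show ?case by simp
qed

text \<open>
  Since \<open>Adj\<close> is strict, all coherence isomorphisms of its cyclic nerve are identities.
\<close>

lemma append_iso_adj: "chain X Fs Y \<Longrightarrow> chain Y Gs Z \<Longrightarrow> append_iso adj X Fs Y Gs = ide (glue X (Fs @ Gs))"
proof (induction adj X Fs Y Gs rule: append_iso.induct)
  case (1 X Y Gs)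
  then show ?case by (simp add: comp1_adj)
next
  case (2 X F Fs Y)
  then have "comp1 adj X (F # Fs) = glue X (F # Fs)" by (intro comp1_adj)
  then show ?case by simp
next
  case (3 X F Y G Gs)
  then have "comp1 adj Y (G # Gs) = glue Y (G # Gs)" by (intro comp1_adj)
  then show ?case using 3 by simp
next
  case (4 X F F' Fs Y G Gs)
  let ?Z = "adj_tgt F"
  have c: "chain ?Z (F' # Fs) Y" "F \<in> adj_cells" "fst F = X" using 4 by auto
  have cc: "chain ?Z ((F' # Fs) @ G # Gs) Z" using c(1) 4(3) unfolding chain_append by blast
  have IH: "append_iso adj ?Z (F' # Fs) Y (G # Gs) = ide (glue ?Z ((F' # Fs) @ G # Gs))"
    using 4(1)[OF _ 4(3)] c by simp
  have e: "comp1 adj ?Z (F' # Fs) = glue ?Z (F' # Fs)" "comp1 adj Y (G # Gs) = glue Y (G # Gs)"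
    using comp1_adj[OF c(1)] comp1_adj[OF 4(3)] by auto
  have g: "adj_comp (glue ?Z (F' # Fs)) (glue Y (G # Gs)) = glue ?Z ((F' # Fs) @ G # Gs)"
    by (rule glue_append[symmetric])
  have h: "ide F \<star> ide (glue ?Z ((F' # Fs) @ G # Gs)) = ide (glue X (F # (F' # Fs) @ G # Gs))"
    using ide_h_ide[OF c(2), of "glue ?Z ((F' # Fs) @ G # Gs)"] chain_glue[OF cc] c(3) by simp
  have "glue X (F # (F' # Fs) @ G # Gs) \<in> adj_cells"
    using chain_glue[of X "F # (F' # Fs) @ G # Gs" Z] cc c by auto
  from v_ide[OF ide_hom[OF this]] show ?case
    unfolding append_iso.simps adj_sel IH e g h using c(3) by simp
qed

fun segments :: "adj_ob \<Rightarrow> (adj_ob \<times> adj_cell list) list \<Rightarrow> adj_ob \<Rightarrow> bool" where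
  "segments X [] Z \<longleftrightarrow> X = Z"
| "segments X ((Y, Fs) # ps) Z \<longleftrightarrow> X = Y \<and> (\<exists>W. chain Y Fs W \<and> segments W ps Z)"

lemma segments_chain: "segments X ps Z \<Longrightarrow> chain X (concat (map snd ps)) Z"
  by (induction X ps Z rule: segments.induct) (auto simp: chain_append)

lemma concat_iso_adj: "segments X ps Z \<Longrightarrow> concat_iso adj X ps = ide (glue X (concat (map snd ps)))"
proof (induction adj X ps arbitrary: rule: concat_iso.induct)
  case (2 X Y Fs)
  then show ?case by (auto simp: comp1_adj)
next
  case (3 X Y Fs Z' Gs ps)
  then obtain W where W: "chain Y Fs W" "X = Y" "W = Z'" "segments Z' ((Z', Gs) # ps) Z" by auto
  let ?Hs = "concat (Gs # map snd ps)"
  have c: "chain Z' ?Hs Z" using segments_chain[OF W(4)] by simp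
  have IH: "concat_iso adj Z' ((Z', Gs) # ps) = ide (glue Z' ?Hs)" using 3(1) W by simp
  have a: "append_iso adj Y Fs Z' ?Hs = ide (glue Y (Fs @ ?Hs))"
    using append_iso_adj W(1,3) c by blast
  have h: "ide (glue Y Fs) \<star> ide (glue Z' ?Hs) = ide (glue Y (Fs @ ?Hs))"
    using ide_h_ide chain_glue[OF W(1)] chain_glue[OF c] W(3) glue_append[of Y Fs ?Hs Z'] by simp
  have "glue Y (Fs @ ?Hs) \<in> adj_cells" using chain_glue[of Y "Fs @ ?Hs" Z] W c chain_append by blast
  from v_ide[OF ide_hom[OF this]] show ?case
    unfolding concat_iso.simps a IH adj_sel comp1_adj[OF W(1)] h using W(2) by simp
qed auto

abbreviation vertex_map :: "smap \<Rightarrow> nat \<Rightarrow> nat" where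
  "vertex_map a \<equiv> fst (snd a)"

lemma simplex_hom: "in_hom (simplex_upto N) a m n \<longleftrightarrow> fst a = m \<and> snd (snd a) = n \<and> m \<le> N \<and> n \<le> N \<and>
    vertex_map a \<in> {..m} \<rightarrow>\<^sub>E {..n} \<and> mono_on {..m} (vertex_map a)"
  by (cases a) (auto simp: in_hom_def simplex_upto_def)

lemma simplex_cmp: "Cmp (simplex_upto N) a b =
    (fst b, compose {..fst b} (vertex_map a) (vertex_map b), snd (snd a))"
  by (cases a; cases b) (simp add: simplex_upto_def)

lemma simplex_mono:
  assumes "in_hom (simplex_upto N) a m n" "i \<le> j" "j \<le> m"
  shows "vertex_map a i \<le> vertex_map a j" "vertex_map a j \<le> n"
  using assms by (auto simp: simplex_hom mono_on_def PiE_def Pi_def)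

lemma seg_alt: "fst a = m \<Longrightarrow> snd (snd a) = n \<Longrightarrow>
    seg_start a j = (if j = 0 then vertex_map a m else vertex_map a (j - 1))"
  "fst a = m \<Longrightarrow> snd (snd a) = n \<Longrightarrow> seg_edges a j =
    (if j = 0 then [Suc (vertex_map a m)..<Suc n] @ [0..<Suc (vertex_map a 0)]
     else [Suc (vertex_map a (j - 1))..<Suc (vertex_map a j)])"
  by (cases a; simp)+

lemma cyclic_list_adj: "cyclic_list adj n Fs \<longleftrightarrow> length Fs = Suc n \<and> set Fs \<subseteq> adj_cells \<and>
    (\<forall>i < n. adj_tgt (Fs ! i) = fst (Fs ! Suc i)) \<and> adj_tgt (Fs ! n) = fst (Fs ! 0)"
proof -
  have "(\<forall>i \<le> n. adj_tgt (Fs ! i) = fst (Fs ! (Suc i mod Suc n))) \<longleftrightarrow>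
      (\<forall>i < n. adj_tgt (Fs ! i) = fst (Fs ! Suc i)) \<and> adj_tgt (Fs ! n) = fst (Fs ! 0)"
    by (auto simp: le_less)
  then show ?thesis by (simp add: cyclic_list_def)
qed

lemma cyclic_chain:
  assumes "cyclic_list adj n Fs" "w \<le> n"
  shows "v \<le> w \<Longrightarrow> chain (adj_tgt (Fs ! v)) (map (nth Fs) [Suc v..<Suc w]) (adj_tgt (Fs ! w))"
    and "chain (adj_tgt (Fs ! n)) (map (nth Fs) [0..<Suc w]) (adj_tgt (Fs ! w))"
proof -
  have F: "i \<le> n \<Longrightarrow> Fs ! i \<in> adj_cells" for i using assms(1) by (auto simp: cyclic_list_adj)
  have *: "chain (adj_tgt (Fs ! v)) (map (nth Fs) [Suc v..<Suc w]) (adj_tgt (Fs ! w))" if "v \<le> w" "w \<le> n" for w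
    using that
  proof (induction w rule: dec_induct)
    case (step k)
    then show ?case using assms(1) F[of "Suc k"] by (auto simp: cyclic_list_adj chain_append)
  qed simp
  from *[OF _ assms(2)] show "v \<le> w \<Longrightarrow> chain (adj_tgt (Fs ! v)) (map (nth Fs) [Suc v..<Suc w]) (adj_tgt (Fs ! w))" .
  from assms(2) show "chain (adj_tgt (Fs ! n)) (map (nth Fs) [0..<Suc w]) (adj_tgt (Fs ! w))"
  proof (induction w)
    case 0
    then show ?case using assms(1) F[of 0] by (simp add: cyclic_list_adj)
  next
    case (Suc k)
    then show ?case using assms(1) F[of "Suc k"] by (auto simp: cyclic_list_adj chain_append)
  qed
qed

lemma segment_chain:
  assumes a: "in_hom (simplex_upto N) a m n" and Fs: "cyclic_list adj n Fs" and j: "j \<le> m"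
  shows "chain (adj_tgt (Fs ! seg_start a j)) (map (nth Fs) (seg_edges a j)) (adj_tgt (Fs ! vertex_map a j))"
proof (cases "j = 0")
  case True
  have "vertex_map a m \<le> n" "vertex_map a 0 \<le> n" using simplex_mono[OF a] by auto
  then show ?thesis
    using True cyclic_chain[OF Fs] seg_alt[of a m n] a
    by (auto simp: chain_append simplex_hom simp del: upt_Suc)
next
  case False
  have "vertex_map a j \<le> n" "vertex_map a (j - 1) \<le> vertex_map a j" using simplex_mono[OF a] j by auto
  then show ?thesis
    using False cyclic_chain[OF Fs] seg_alt[of a m n] a by (auto simp: simplex_hom simp del: upt_Suc)
qed

text \<open>
  \<open>pull a\<close> and \<open>pull2 a\<close> are the action of a simplicial map on the objects and arrows of the nerve, written with
  \<open>glue\<close> and \<open>hprod\<close> (\<open>nerve_map_ob\<close>, \<open>nerve_map_ar\<close>).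
\<close>

definition pull :: "smap \<Rightarrow> adj_cell list \<Rightarrow> adj_cell list" where
  "pull a Fs = map (\<lambda>j. glue (adj_tgt (Fs ! seg_start a j)) (map (nth Fs) (seg_edges a j))) [0..<Suc (fst a)]"

definition pull2 :: "smap \<Rightarrow> adj_tm set list \<Rightarrow> adj_tm set list" where
  "pull2 a as = map (\<lambda>j. hprod (adj_tgt (Dom adj_two_cells (as ! seg_start a j))) (map (nth as) (seg_edges a j)))
     [0..<Suc (fst a)]"

lemma seg_bounds:
  assumes a: "in_hom (simplex_upto N) a m n" and j: "j \<le> m"
  shows "seg_start a j \<le> n" "i \<in> set (seg_edges a j) \<Longrightarrow> i \<le> n"
proof -
  have v: "vertex_map a m \<le> n" "vertex_map a 0 \<le> n" "vertex_map a (j - 1) \<le> n" "vertex_map a j \<le> n"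
    using simplex_mono(2)[OF a order_refl] j by auto
  show "seg_start a j \<le> n" using seg_alt[of a m n] a v by (auto simp: simplex_hom)
  show "i \<in> set (seg_edges a j) \<Longrightarrow> i \<le> n"
    using seg_alt[of a m n] a v by (auto simp: simplex_hom split: if_splits)
qed

lemma nerve_map_ob:
  assumes "in_hom (simplex_upto N) a m n" "cyclic_list adj n Fs"
  shows "FOb (nerve_map adj a) Fs = pull a Fs"
proof -
  have "fst a = m" using assms by (simp add: simplex_hom)
  then show ?thesis
    using comp1_adj[OF segment_chain[OF assms]] by (auto simp: nerve_map_def pull_def seg_def)
qed

lemma nerve_ar: "as \<in> Ar (nerve_cat adj n) \<longleftrightarrow> cells2 as \<and> cyclic_list adj n (doms as)"
  by (simp add: nerve_cat_def cells2_def)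

lemma nerve_map_ar:
  assumes a: "in_hom (simplex_upto N) a m n" and as: "as \<in> Ar (nerve_cat adj n)"
  shows "FAr (nerve_map adj a) as = pull2 a as"
    and "j \<le> m \<Longrightarrow> cells2 (map (nth as) (seg_edges a j)) \<and>
      chain (adj_tgt (Dom adj_two_cells (as ! seg_start a j))) (doms (map (nth as) (seg_edges a j)))
        (adj_tgt (Dom adj_two_cells (as ! vertex_map a j)))"
proof -
  have c: "cyclic_list adj n (doms as)" "cells2 as" using as nerve_ar by auto
  then have l: "length as = Suc n" by (simp add: cyclic_list_adj)
  have *: "cells2 (map (nth as) (seg_edges a j)) \<and>
      chain (adj_tgt (Dom adj_two_cells (as ! seg_start a j))) (doms (map (nth as) (seg_edges a j)))
        (adj_tgt (Dom adj_two_cells (as ! vertex_map a j)))" if "j \<le> m" for j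
  proof -
    have e: "map (nth (doms as)) (seg_edges a j) = doms (map (nth as) (seg_edges a j))"
      using seg_bounds(2)[OF a that] l by (auto simp: less_Suc_eq_le)
    have "vertex_map a j \<le> n" using simplex_mono[OF a] that by blast
    moreover have "cells2 (map (nth as) (seg_edges a j))"
      using seg_bounds(2)[OF a that] l c(2) by (fastforce simp: cells2_def)
    ultimately show ?thesis
      using segment_chain[OF a c(1) that, unfolded e] l seg_bounds(1)[OF a that] by (simp del: map_map)
  qed
  have "fst a = m" using a by (simp add: simplex_hom)
  with * have "comp2 adj (adj_tgt (Dom adj_two_cells (as ! seg_start a j))) (map (nth as) (seg_edges a j)) =
      hprod (adj_tgt (Dom adj_two_cells (as ! seg_start a j))) (map (nth as) (seg_edges a j))"
    if "j \<in> set [0..<Suc (fst a)]" for j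
    using comp2_adj that by (metis atLeastLessThan_iff less_Suc_eq_le set_upt)
  then show "FAr (nerve_map adj a) as = pull2 a as"
    unfolding nerve_map_def pull2_def fctr.simps adj_sel by (intro map_cong[OF HOL.refl])
  show "j \<le> m \<Longrightarrow> cells2 (map (nth as) (seg_edges a j)) \<and>
      chain (adj_tgt (Dom adj_two_cells (as ! seg_start a j))) (doms (map (nth as) (seg_edges a j)))
        (adj_tgt (Dom adj_two_cells (as ! vertex_map a j)))" using * .
qed

lemma pull_nth:
  assumes "in_hom (simplex_upto N) a m n" "j \<le> m"
  shows "pull a Fs ! j = glue (adj_tgt (Fs ! seg_start a j)) (map (nth Fs) (seg_edges a j))"
    "length (pull a Fs) = Suc m"
  using assms by (auto simp: pull_def simplex_hom simp del: upt_Suc)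

lemma pull_cyclic:
  assumes a: "in_hom (simplex_upto N) a m n" and Fs: "cyclic_list adj n Fs"
  shows "cyclic_list adj m (pull a Fs)"
    and "j \<le> m \<Longrightarrow> adj_tgt (pull a Fs ! j) = adj_tgt (Fs ! vertex_map a j)"
proof -
  have *: "pull a Fs ! j \<in> adj_cells \<and> fst (pull a Fs ! j) = adj_tgt (Fs ! seg_start a j) \<and>
      adj_tgt (pull a Fs ! j) = adj_tgt (Fs ! vertex_map a j)" if "j \<le> m" for j
    using pull_nth[OF a that] chain_glue[OF segment_chain[OF a Fs that]] by simp
  then show "j \<le> m \<Longrightarrow> adj_tgt (pull a Fs ! j) = adj_tgt (Fs ! vertex_map a j)" by simp
  have l: "length (pull a Fs) = Suc m" using a by (simp add: pull_def simplex_hom)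
  then have "set (pull a Fs) \<subseteq> adj_cells" using * by (auto simp: set_conv_nth less_Suc_eq_le)
  then show "cyclic_list adj m (pull a Fs)"
    using * l seg_alt(1)[of a m n] a by (auto simp: cyclic_list_adj simplex_hom)
qed

lemma cells2_nth: "cells2 as \<Longrightarrow> i < length as \<Longrightarrow>
    hom2 (as ! i) (Dom adj_two_cells (as ! i)) (Cod adj_two_cells (as ! i))"
  by (auto simp: cells2_def intro!: ar_hom2)

lemma cods_doms_nth: "cods as = doms bs \<Longrightarrow> i < length as \<Longrightarrow>
    Cod adj_two_cells (as ! i) = Dom adj_two_cells (bs ! i) \<and> i < length bs"
  by (metis length_map nth_map)

lemma nerve_category: "category (nerve_cat adj n)"
proof -
  interpret A: category adj_two_cells by (rule category_adj)
  have ar: "h \<in> Ar (nerve_cat adj n) \<Longrightarrow> i < length h \<Longrightarrow>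
      hom2 (h ! i) (Dom adj_two_cells (h ! i)) (Cod adj_two_cells (h ! i))" for h i
    by (auto simp: nerve_ar cells2_def intro!: ar_hom2)
  have cod: "cyclic_list adj n (cods h)" if "h \<in> Ar (nerve_cat adj n)" for h
  proof -
    have l: "length h = Suc n" using that by (auto simp: nerve_ar cyclic_list_adj)
    have "Cod adj_two_cells (h ! i) \<in> adj_cells \<and> fst (Cod adj_two_cells (h ! i)) = fst (Dom adj_two_cells (h ! i)) \<and>
      adj_tgt (Cod adj_two_cells (h ! i)) = adj_tgt (Dom adj_two_cells (h ! i))" if "i \<le> n" for i
      using hom2_cells[OF ar[OF \<open>h \<in> Ar (nerve_cat adj n)\<close>, of i]] that l by auto
    then show ?thesis using that l by (auto simp: nerve_ar cyclic_list_adj set_conv_nth less_Suc_eq_le)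
  qed
  have sel: "Dom (nerve_cat adj n) = doms" "Cod (nerve_cat adj n) = cods"
    "Ob (nerve_cat adj n) = {Fs. cyclic_list adj n Fs}" "Idt (nerve_cat adj n) = map ide"
    "Cmp (nerve_cat adj n) = map2 (Cmp adj_two_cells)" by (auto simp: nerve_cat_def)
  have ide: "doms (map ide x) = x \<and> cods (map ide x) = x \<and> cells2 (map ide x)" if "cyclic_list adj n x" for x
  proof -
    have "Dom adj_two_cells (ide F) = F \<and> Cod adj_two_cells (ide F) = F \<and> ide F \<in> Ar adj_two_cells"
      if "F \<in> set x" for F
      using ide_hom[of F] that \<open>cyclic_list adj n x\<close> by (auto simp: cyclic_list_adj in_hom_def)
    then show ?thesis by (auto simp: cells2_def map_idI o_def)
  qed
  have cmp: "doms (map2 (Cmp adj_two_cells) k h) = doms h \<and> cods (map2 (Cmp adj_two_cells) k h) = cods k \<and>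
     cells2 (map2 (Cmp adj_two_cells) k h)" if "cells2 h" "cells2 k" "cods h = doms k" for h k
  proof -
    have l: "length h = length k" using that(3) map_eq_imp_length_eq by blast
    have "hom2 (k ! i \<bullet> h ! i) (Dom adj_two_cells (h ! i)) (Cod adj_two_cells (k ! i))" if "i < length h" for i
      using A.cmp_hom cells2_nth[OF \<open>cells2 h\<close> that] cells2_nth[OF \<open>cells2 k\<close>, of i]
        cods_doms_nth[OF \<open>cods h = doms k\<close> that] by simp
    then show ?thesis using l by (auto simp: cells2_def in_hom_def set_conv_nth intro!: nth_equalityI)
  qed
  show ?thesis
  proof
    fix h k l x y z w assume "in_hom (nerve_cat adj n) h x y" "in_hom (nerve_cat adj n) k y z"
      "in_hom (nerve_cat adj n) l z w"
    then have c: "cells2 h" "cells2 k" "cells2 l" "cods h = doms k" "cods k = doms l"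
      and len: "length h = length k" "length k = length l"
      by (auto simp: in_hom_def sel nerve_ar dest: map_eq_imp_length_eq)
    have "l ! i \<bullet> (k ! i \<bullet> h ! i) = (l ! i \<bullet> k ! i) \<bullet> h ! i" if "i < length h" for i
      using v_assoc[OF cells2_nth[OF c(1) that], of "k ! i" "Cod adj_two_cells (k ! i)" "l ! i"]
        cells2_nth[OF c(2), of i] cells2_nth[OF c(3), of i] cods_doms_nth[OF c(4) that]
        cods_doms_nth[OF c(5), of i] by simp
    then show "Cmp (nerve_cat adj n) l (Cmp (nerve_cat adj n) k h) =
       Cmp (nerve_cat adj n) (Cmp (nerve_cat adj n) l k) h"
      using len by (auto simp: sel intro!: nth_equalityI)
  next
    fix h x y assume "in_hom (nerve_cat adj n) h x y"
    then have h: "h \<in> Ar (nerve_cat adj n)" "x = doms h" "y = cods h" by (auto simp: in_hom_def sel)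
    show "Cmp (nerve_cat adj n) h (Idt (nerve_cat adj n) x) = h"
      "Cmp (nerve_cat adj n) (Idt (nerve_cat adj n) y) h = h"
      using v_ide[OF ar[OF h(1)]] ide_v[OF ar[OF h(1)]] h by (auto simp: sel intro!: nth_equalityI)
  qed (use cod ide cmp in \<open>auto simp: sel in_hom_def nerve_ar\<close>)
qed

lemma pull2_hom:
  assumes a: "in_hom (simplex_upto N) a m n" and as: "as \<in> Ar (nerve_cat adj n)"
  shows "cells2 (pull2 a as)" "doms (pull2 a as) = pull a (doms as)" "cods (pull2 a as) = pull a (cods as)"
proof -
  have l: "length as = Suc n" and c: "cyclic_list adj n (doms as)" using as by (auto simp: nerve_ar cyclic_list_adj)
  have m: "fst a = m" using a by (simp add: simplex_hom)
  have cv: "hom2 (as ! i) (Dom adj_two_cells (as ! i)) (Cod adj_two_cells (as ! i))" if "i \<le> n" for i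
    using as that l by (auto simp: nerve_ar cells2_def intro!: ar_hom2)
  have *: "hom2 (hprod (adj_tgt (Dom adj_two_cells (as ! seg_start a j))) (map (nth as) (seg_edges a j)))
     (pull a (doms as) ! j) (pull a (cods as) ! j)" if j: "j \<le> m" for j
  proof -
    have s: "seg_start a j \<le> n" by (rule seg_bounds(1)[OF a j])
    have "adj_tgt (Dom adj_two_cells (as ! seg_start a j)) = adj_tgt (Cod adj_two_cells (as ! seg_start a j))"
      using hom2_cells(4)[OF cv[OF s]] .
    moreover have "map (nth (doms as)) (seg_edges a j) = doms (map (nth as) (seg_edges a j))"
      "map (nth (cods as)) (seg_edges a j) = cods (map (nth as) (seg_edges a j))"
      using seg_bounds(2)[OF a j] l by (auto simp: less_Suc_eq_le)
    ultimately show ?thesis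
      using nerve_map_ar(2)[OF a as j] hprod_hom pull_nth(1)[OF a j] s l
      by (auto simp del: map_map)
  qed
  show "cells2 (pull2 a as)" using * m by (auto simp: cells2_def pull2_def in_hom_def simp del: upt_Suc)
  show "doms (pull2 a as) = pull a (doms as)" "cods (pull2 a as) = pull a (cods as)"
    using * m pull_nth(2)[OF a order_refl]
    by (auto simp: pull2_def in_hom_def simp del: upt_Suc intro!: nth_equalityI)
qed

lemma nerve_map_functor:
  assumes a: "in_hom (simplex_upto N) a m n"
  shows "is_functor (nerve_cat adj n) (nerve_cat adj m) (nerve_map adj a)"
proof -
  have m: "fst a = m" using a by (simp add: simplex_hom)
  have sel: "Dom (nerve_cat adj n) = doms" "Cod (nerve_cat adj n) = cods"
    "Ob (nerve_cat adj n) = {Fs. cyclic_list adj n Fs}" "Idt (nerve_cat adj n) = map ide"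
    "Cmp (nerve_cat adj n) = map2 (Cmp adj_two_cells)" for n by (auto simp: nerve_cat_def)
  interpret N: category "nerve_cat adj n" by (rule nerve_category)
  have idt: "map ide x \<in> Ar (nerve_cat adj n)" "doms (map ide x) = x" if "cyclic_list adj n x" for x
    using N.idt_hom[of x] that by (auto simp: sel in_hom_def)
  show ?thesis unfolding is_functor_def
  proof (intro conjI allI impI ballI nerve_category)
    fix x assume "x \<in> Ob (nerve_cat adj n)"
    then have x: "cyclic_list adj n x" by (simp add: sel)
    then show "FOb (nerve_map adj a) x \<in> Ob (nerve_cat adj m)"
      using nerve_map_ob[OF a x] pull_cyclic(1)[OF a x] by (simp add: sel)
    have "pull2 a (map ide x) = map ide (pull a x)"
    proof (rule nth_equalityI)
      fix j assume "j < length (pull2 a (map ide x))"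
      then have j: "j \<le> m" using m by (simp add: pull2_def)
      have lx: "length x = Suc n" using x by (simp add: cyclic_list_adj)
      have "seg_start a j \<le> n" "map (nth (map ide x)) (seg_edges a j) = map ide (map (nth x) (seg_edges a j))"
        using seg_bounds[OF a j] lx by (auto simp: less_Suc_eq_le)
      moreover have "Dom adj_two_cells (map ide x ! seg_start a j) = doms (map ide x) ! seg_start a j"
        using lx calculation by simp
      ultimately show "pull2 a (map ide x) ! j = map ide (pull a x) ! j"
        using hprod_ide[OF segment_chain[OF a x j]] j m lx idt(2)[OF x]
        by (simp add: pull2_def pull_def del: upt_Suc map_map)
    qed (simp add: pull2_def pull_def)
    then show "FAr (nerve_map adj a) (Idt (nerve_cat adj n) x) = Idt (nerve_cat adj m) (FOb (nerve_map adj a) x)"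
      using nerve_map_ob[OF a x] nerve_map_ar(1)[OF a idt(1)[OF x]] by (simp add: sel)
  next
    fix h x y assume h: "in_hom (nerve_cat adj n) h x y"
    then have h': "h \<in> Ar (nerve_cat adj n)" "x = doms h" "y = cods h" by (auto simp: in_hom_def sel)
    have "cyclic_list adj n x" "cyclic_list adj n y"
      using N.dom_ob[OF h'(1)] N.cod_ob[OF h'(1)] h' by (auto simp: sel)
    then show "in_hom (nerve_cat adj m) (FAr (nerve_map adj a) h) (FOb (nerve_map adj a) x) (FOb (nerve_map adj a) y)"
      using nerve_map_ob[OF a] nerve_map_ar(1)[OF a h'(1)] pull2_hom[OF a h'(1)] pull_cyclic(1)[OF a] h'
      by (auto simp: in_hom_def sel nerve_ar)
  next
    fix h k x y z assume h: "in_hom (nerve_cat adj n) h x y" "in_hom (nerve_cat adj n) k y z"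
    then have h': "h \<in> Ar (nerve_cat adj n)" "k \<in> Ar (nerve_cat adj n)" "doms k = cods h"
      and kh: "Cmp (nerve_cat adj n) k h \<in> Ar (nerve_cat adj n)" and dkh: "doms (Cmp (nerve_cat adj n) k h) = doms h"
      using N.cmp_hom[OF h] by (auto simp: in_hom_def sel)
    have l: "length h = Suc n" "length k = Suc n"
      using h' map_eq_imp_length_eq[OF h'(3)] by (auto simp: nerve_ar cyclic_list_adj)
    have "pull2 a (map2 (Cmp adj_two_cells) k h) = map2 (Cmp adj_two_cells) (pull2 a k) (pull2 a h)"
    proof (rule nth_equalityI)
      fix j assume "j < length (pull2 a (map2 (Cmp adj_two_cells) k h))"
      then have j: "j \<le> m" using m by (simp add: pull2_def)
      let ?h = "map (nth h) (seg_edges a j)" and ?k = "map (nth k) (seg_edges a j)"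
      let ?s = "seg_start a j"
      have s: "?s \<le> n" by (rule seg_bounds(1)[OF a j])
      have e: "map (nth (map2 (Cmp adj_two_cells) k h)) (seg_edges a j) = map2 (Cmp adj_two_cells) ?k ?h"
        using seg_bounds(2)[OF a j] l
        by (simp add: zip_map_map map_zip_map map_zip_map2 zip_same_conv_map less_Suc_eq_le)
      have dc: "Dom adj_two_cells (k ! i) = Cod adj_two_cells (h ! i)" if "i \<le> n" for i
        using h'(3) that l by (metis less_Suc_eq_le nth_map)
      then have "doms ?k = cods ?h" using seg_bounds(2)[OF a j] by auto
      then have "hprod (adj_tgt (Dom adj_two_cells (h ! ?s))) (map2 (Cmp adj_two_cells) ?k ?h) =
          hprod (adj_tgt (Dom adj_two_cells (h ! ?s))) ?k \<bullet> hprod (adj_tgt (Dom adj_two_cells (h ! ?s))) ?h"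
        using nerve_map_ar(2)[OF a h'(1) j] nerve_map_ar(2)[OF a h'(2) j] hprod_v by blast
      moreover have "adj_tgt (Dom adj_two_cells (k ! ?s)) = adj_tgt (Dom adj_two_cells (h ! ?s))"
        using hom2_cells(4)[OF cells2_nth, of h ?s] dc[OF s] h'(1) s l by (simp add: nerve_ar)
      moreover have "Dom adj_two_cells (map2 (Cmp adj_two_cells) k h ! ?s) = Dom adj_two_cells (h ! ?s)"
        using dkh s l by (metis length_map less_Suc_eq_le nth_map sel(5))
      ultimately show "pull2 a (map2 (Cmp adj_two_cells) k h) ! j =
          map2 (Cmp adj_two_cells) (pull2 a k) (pull2 a h) ! j"
        using j m e by (simp add: pull2_def del: upt_Suc map_map)
    qed (simp add: pull2_def)
    then show "FAr (nerve_map adj a) (Cmp (nerve_cat adj n) k h) =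
        Cmp (nerve_cat adj m) (FAr (nerve_map adj a) k) (FAr (nerve_map adj a) h)"
      using nerve_map_ar(1)[OF a] h' kh by (simp add: sel)
  qed
qed

lemma upt_glue: "v \<le> w \<Longrightarrow> w \<le> x \<Longrightarrow> [Suc v..<Suc w] @ [Suc w..<Suc x] = [Suc v..<Suc x]"
  using upt_add_eq_append[of "Suc v" "Suc w" "x - w"] by simp

lemma upt_glue0: "w \<le> x \<Longrightarrow> [0..<Suc w] @ [Suc w..<Suc x] = [0..<Suc x]"
  using upt_add_eq_append[of 0 "Suc w" "x - w"] by simp

lemma concat_seg_edges:
  assumes a: "in_hom (simplex_upto N) a m n" and "v \<le> w" "w \<le> m"
  shows "concat (map (seg_edges a) [Suc v..<Suc w]) = [Suc (vertex_map a v)..<Suc (vertex_map a w)]"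
  using assms(2,3)
proof (induction w rule: dec_induct)
  case (step k)
  have "vertex_map a v \<le> vertex_map a k" "vertex_map a k \<le> vertex_map a (Suc k)"
    using simplex_mono[OF a] step by auto
  from upt_glue[OF this] show ?case
    using step seg_alt(2)[of a m n "Suc k"] a by (simp add: simplex_hom del: upt_Suc) (simp add: upt_Suc)
qed simp

lemma concat_seg_edges0:
  assumes a: "in_hom (simplex_upto N) a m n" and "w \<le> m"
  shows "concat (map (seg_edges a) [0..<Suc w]) =
    [Suc (vertex_map a m)..<Suc n] @ [0..<Suc (vertex_map a w)]"
proof -
  have "vertex_map a 0 \<le> vertex_map a w" using simplex_mono[OF a] assms by auto
  moreover have "[0..<Suc w] = 0 # [Suc 0..<Suc w]" by (simp add: upt_conv_Cons)
  ultimately show ?thesis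
    using concat_seg_edges[OF a, of 0 w] seg_alt(2)[of a m n 0] a assms(2)
    by (simp add: simplex_hom upt_glue0 del: upt_Suc)
qed

text \<open>
  The arc between consecutive vertices of a composite map is the concatenation of the arcs of \<open>a\<close> over
  the edges that \<open>b\<close> passes. This is why the nerve is functorial on the nose.
\<close>

lemma seg_edges_comp:
  assumes a: "in_hom (simplex_upto N) a m n" and b: "in_hom (simplex_upto N) b k m" and j: "j \<le> k"
  shows "concat (map (seg_edges a) (seg_edges b j)) = seg_edges (Cmp (simplex_upto N) a b) j"
    "seg_start (Cmp (simplex_upto N) a b) j = vertex_map a (seg_start b j)"
proof -
  have c: "fst (Cmp (simplex_upto N) a b) = k" "snd (snd (Cmp (simplex_upto N) a b)) = n"
    "\<And>i. i \<le> k \<Longrightarrow> vertex_map (Cmp (simplex_upto N) a b) i = vertex_map a (vertex_map b i)"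
    using a b by (auto simp: simplex_cmp simplex_hom compose_def)
  have fb: "fst b = k" "snd (snd b) = m" using b by (auto simp: simplex_hom)
  show "seg_start (Cmp (simplex_upto N) a b) j = vertex_map a (seg_start b j)"
    using seg_alt(1)[OF c(1,2)] seg_alt(1)[OF fb] c(3) j by auto
  show "concat (map (seg_edges a) (seg_edges b j)) = seg_edges (Cmp (simplex_upto N) a b) j"
  proof (cases "j = 0")
    case True
    have "vertex_map b k \<le> m" "vertex_map b 0 \<le> m" using simplex_mono[OF b] by auto
    moreover have "vertex_map a (vertex_map b k) \<le> vertex_map a m" "vertex_map a m \<le> n"
      using simplex_mono[OF a calculation(1) order_refl] simplex_mono[OF a order_refl order_refl] by auto
    ultimately show ?thesis
      using concat_seg_edges[OF a, of "vertex_map b k" m] concat_seg_edges0[OF a, of "vertex_map b 0"]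
        seg_alt(2)[OF c(1,2)] seg_alt(2)[OF fb] c(3) True upt_glue
      by (simp del: upt_Suc)
  next
    case False
    have "vertex_map b (j - 1) \<le> vertex_map b j" "vertex_map b j \<le> m" using simplex_mono[OF b] j by auto
    then show ?thesis using concat_seg_edges[OF a] seg_alt(2)[OF c(1,2)] seg_alt(2)[OF fb] c(3) False j
      by (simp del: upt_Suc)
  qed
qed

lemma concat_map_concat: "concat (map (\<lambda>i. concat (map g (f i))) is) = concat (map g (concat (map f is)))"
  by (induction "is") auto

lemma pull_comp:
  assumes a: "in_hom (simplex_upto N) a m n" and b: "in_hom (simplex_upto N) b k m"
    and Fs: "cyclic_list adj n Fs"
  shows "pull b (pull a Fs) = pull (Cmp (simplex_upto N) a b) Fs"
proof (rule nth_equalityI)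
  have k: "fst b = k" "fst (Cmp (simplex_upto N) a b) = k" using b by (auto simp: simplex_hom simplex_cmp)
  then show "length (pull b (pull a Fs)) = length (pull (Cmp (simplex_upto N) a b) Fs)" by (simp add: pull_def)
  fix j assume "j < length (pull b (pull a Fs))"
  then have j: "j \<le> k" using k by (simp add: pull_def)
  have e: "map (nth (pull a Fs)) (seg_edges b j) =
     map (\<lambda>i. glue (adj_tgt (Fs ! seg_start a i)) (map (nth Fs) (seg_edges a i))) (seg_edges b j)"
    using seg_bounds(2)[OF b j] pull_nth(1)[OF a] by auto
  have "adj_tgt (pull a Fs ! seg_start b j) = adj_tgt (Fs ! seg_start (Cmp (simplex_upto N) a b) j)"
    using pull_cyclic(2)[OF a Fs seg_bounds(1)[OF b j]] seg_edges_comp(2)[OF a b j] by simp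
  moreover have "concat (map snd (map (nth (pull a Fs)) (seg_edges b j))) =
     concat (map snd (map (nth Fs) (seg_edges (Cmp (simplex_upto N) a b) j)))"
    unfolding e seg_edges_comp(1)[OF a b j, symmetric]
    using concat_map_concat[of "\<lambda>i. snd (Fs ! i)" "seg_edges a" "seg_edges b j"]
    by (simp add: o_def glue_def)
  ultimately show "pull b (pull a Fs) ! j = pull (Cmp (simplex_upto N) a b) Fs ! j"
    using j k by (simp add: pull_def glue_def del: upt_Suc map_map)
qed

lemma hprod_concat:
  "segments X (map (\<lambda>i. (s i, doms (f i))) is) Z \<Longrightarrow> (\<forall>i \<in> set is. cells2 (f i)) \<Longrightarrow>
    hprod X (map (\<lambda>i. hprod (s i) (f i)) is) = hprod X (concat (map f is))"
proof (induction "is" arbitrary: X)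
  case (Cons i "is")
  have "s i = X \<and> (\<exists>W. chain X (doms (f i)) W \<and> segments W (map (\<lambda>i. (s i, doms (f i))) is) Z)"
    using Cons(2) by simp
  then obtain W where W: "chain X (doms (f i)) W" "s i = X"
    "segments W (map (\<lambda>i. (s i, doms (f i))) is) Z" by blast
  have c: "cells2 (f i)" "cells2 (concat (map f is))" using Cons(3) by (auto simp: cells2_def)
  have d: "chain W (doms (concat (map f is))) Z"
    using segments_chain[OF W(3)] by (simp add: map_concat o_def)
  have "Dom adj_two_cells (hprod X (f i)) = glue X (doms (f i))"
    using hprod_hom[OF c(1) W(1)] by (simp add: in_hom_def)
  then show ?case
    using hprod_append[OF c W(1) d] Cons(1)[OF W(3)] Cons(3) chain_glue[OF W(1)] W(2) by simp
qed simp

lemma segments_append: "segments X (ps @ qs) Z \<longleftrightarrow> (\<exists>Y. segments X ps Y \<and> segments Y qs Z)"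
proof (induction ps arbitrary: X)
  case (Cons p ps)
  then show ?case by (cases p) (simp, blast)
qed simp

lemma segments_upt:
  assumes a: "in_hom (simplex_upto N) a m n" and Fs: "cyclic_list adj n Fs" and "w \<le> m"
  shows "v \<le> w \<Longrightarrow> segments (adj_tgt (Fs ! vertex_map a v))
      (map (\<lambda>i. (adj_tgt (Fs ! seg_start a i), map (nth Fs) (seg_edges a i))) [Suc v..<Suc w])
      (adj_tgt (Fs ! vertex_map a w))"
    "segments (adj_tgt (Fs ! vertex_map a m))
      (map (\<lambda>i. (adj_tgt (Fs ! seg_start a i), map (nth Fs) (seg_edges a i))) [0..<Suc w])
      (adj_tgt (Fs ! vertex_map a w))"
proof -
  have f: "fst a = m" "snd (snd a) = n" using a by (auto simp: simplex_hom)
  show 1: "segments (adj_tgt (Fs ! vertex_map a v))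
      (map (\<lambda>i. (adj_tgt (Fs ! seg_start a i), map (nth Fs) (seg_edges a i))) [Suc v..<Suc w])
      (adj_tgt (Fs ! vertex_map a w))" if "v \<le> w" for v
    using that assms(3)
  proof (induction w rule: dec_induct)
    case (step k)
    then have "segments (adj_tgt (Fs ! vertex_map a k))
        [(adj_tgt (Fs ! seg_start a (Suc k)), map (nth Fs) (seg_edges a (Suc k)))] (adj_tgt (Fs ! vertex_map a (Suc k)))"
      using segment_chain[OF a Fs, of "Suc k"] seg_alt(1)[OF f, of "Suc k"] by auto
    then show ?case using step by (auto simp: segments_append)
  qed simp
  have "segments (adj_tgt (Fs ! vertex_map a m))
        [(adj_tgt (Fs ! seg_start a 0), map (nth Fs) (seg_edges a 0))] (adj_tgt (Fs ! vertex_map a 0))"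
    using segment_chain[OF a Fs, of 0] seg_alt(1)[OF f, of 0] by auto
  moreover have "[0..<Suc w] = [0] @ [Suc 0..<Suc w]" by (simp add: upt_conv_Cons)
  ultimately show "segments (adj_tgt (Fs ! vertex_map a m))
      (map (\<lambda>i. (adj_tgt (Fs ! seg_start a i), map (nth Fs) (seg_edges a i))) [0..<Suc w])
      (adj_tgt (Fs ! vertex_map a w))"
    using 1[of 0] by (auto simp: segments_append simp del: upt_Suc)
qed

lemma segments_seg_edges:
  assumes a: "in_hom (simplex_upto N) a m n" and b: "in_hom (simplex_upto N) b k m"
    and Fs: "cyclic_list adj n Fs" and j: "j \<le> k"
  shows "segments (adj_tgt (Fs ! vertex_map a (seg_start b j)))
      (map (\<lambda>i. (adj_tgt (Fs ! seg_start a i), map (nth Fs) (seg_edges a i))) (seg_edges b j))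
      (adj_tgt (Fs ! vertex_map a (vertex_map b j)))"
proof -
  have fb: "fst b = k" "snd (snd b) = m" using b by (auto simp: simplex_hom)
  have v: "vertex_map b k \<le> m" "vertex_map b 0 \<le> m" "vertex_map b j \<le> m"
    "j \<noteq> 0 \<Longrightarrow> vertex_map b (j - 1) \<le> vertex_map b j" using simplex_mono[OF b] j by auto
  show ?thesis
    using segments_upt[OF a Fs] v seg_alt[OF fb, of j]
    by (cases "j = 0") (auto simp: segments_append simp del: upt_Suc)
qed

text \<open>
  So the nerve of \<open>Adj\<close> is a strict functor, and pseudo-cocones under it satisfy coherence laws
  without correction terms.
\<close>

lemma nerve_compositor:
  assumes a: "in_hom (simplex_upto N) a m n" and b: "in_hom (simplex_upto N) b k m"
    and Fs: "cyclic_list adj n Fs"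
  shows "PComp (cyclic_nerve adj) a b Fs = map ide (pull (Cmp (simplex_upto N) a b) Fs)"
proof -
  let ?c = "Cmp (simplex_upto N) a b"
  have k: "fst b = k" "fst ?c = k" using b by (auto simp: simplex_hom simplex_cmp)
  have "concat_iso adj (adj_tgt (pull a Fs ! seg_start b j)) (map (seg adj a Fs) (seg_edges b j)) =
      ide (glue (adj_tgt (Fs ! seg_start ?c j)) (map (nth Fs) (seg_edges ?c j)))" if j: "j \<le> k" for j
  proof -
    have e1: "adj_tgt (pull a Fs ! seg_start b j) = adj_tgt (Fs ! vertex_map a (seg_start b j))"
      using pull_cyclic(2)[OF a Fs seg_bounds(1)[OF b j]] by simp
    have e2: "seg adj a Fs = (\<lambda>i. (adj_tgt (Fs ! seg_start a i), map (nth Fs) (seg_edges a i)))"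
      by (simp add: seg_def fun_eq_iff)
    show ?thesis
      unfolding e1 e2 concat_iso_adj[OF segments_seg_edges[OF a b Fs j]]
        seg_edges_comp(2)[OF a b j] seg_edges_comp(1)[OF a b j, symmetric]
      by (simp add: o_def map_concat)
  qed
  then show ?thesis
    using k nerve_map_ob[OF a Fs] by (simp add: cyclic_nerve_def pull_def[of ?c] del: upt_Suc)
qed

lemma pull2_comp:
  assumes a: "in_hom (simplex_upto N) a m n" and b: "in_hom (simplex_upto N) b k m"
    and as: "as \<in> Ar (nerve_cat adj n)"
  shows "pull2 b (pull2 a as) = pull2 (Cmp (simplex_upto N) a b) as"
proof (rule nth_equalityI)
  let ?c = "Cmp (simplex_upto N) a b"
  have k: "fst b = k" "fst ?c = k" using b by (auto simp: simplex_hom simplex_cmp)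
  then show "length (pull2 b (pull2 a as)) = length (pull2 ?c as)" by (simp add: pull2_def)
  fix j assume "j < length (pull2 b (pull2 a as))"
  then have j: "j \<le> k" using k by (simp add: pull2_def)
  have l: "length as = Suc n" and D: "cyclic_list adj n (doms as)" using as by (auto simp: nerve_ar cyclic_list_adj)
  have fa: "fst a = m" using a by (simp add: simplex_hom)
  have lp: "length (pull2 a as) = Suc m" using fa by (simp add: pull2_def)
  have e: "map (nth (pull2 a as)) (seg_edges b j) =
     map (\<lambda>i. hprod (adj_tgt (Dom adj_two_cells (as ! seg_start a i))) (map (nth as) (seg_edges a i))) (seg_edges b j)"
    using seg_bounds(2)[OF b j] fa by (simp add: pull2_def less_Suc_eq_le del: upt_Suc)
  have v: "vertex_map a (seg_start b j) \<le> n" using simplex_mono[OF a] seg_bounds(1)[OF b j] by auto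
  have s: "adj_tgt (Dom adj_two_cells (pull2 a as ! seg_start b j)) =
     adj_tgt (Dom adj_two_cells (as ! vertex_map a (seg_start b j)))"
  proof -
    have "Dom adj_two_cells (pull2 a as ! seg_start b j) = pull a (doms as) ! seg_start b j"
      using pull2_hom(2)[OF a as] seg_bounds(1)[OF b j] lp by (metis less_Suc_eq_le nth_map)
    then show ?thesis using pull_cyclic(2)[OF a D seg_bounds(1)[OF b j]] v l by simp
  qed
  have ss: "map (\<lambda>i. (adj_tgt (doms as ! seg_start a i), map (nth (doms as)) (seg_edges a i))) (seg_edges b j) =
     map (\<lambda>i. (adj_tgt (Dom adj_two_cells (as ! seg_start a i)), doms (map (nth as) (seg_edges a i)))) (seg_edges b j)"
    using seg_bounds[OF a seg_bounds(2)[OF b j]] l by (auto simp: less_Suc_eq_le)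
  have "hprod (adj_tgt (Dom adj_two_cells (as ! vertex_map a (seg_start b j)))) (map (nth (pull2 a as)) (seg_edges b j)) =
     hprod (adj_tgt (Dom adj_two_cells (as ! vertex_map a (seg_start b j))))
       (concat (map (\<lambda>i. map (nth as) (seg_edges a i)) (seg_edges b j)))"
    unfolding e
    by (rule hprod_concat)
      (use segments_seg_edges[OF a b D j, unfolded ss] v l nerve_map_ar(2)[OF a as seg_bounds(2)[OF b j]] in auto)
  also have "concat (map (\<lambda>i. map (nth as) (seg_edges a i)) (seg_edges b j)) = map (nth as) (seg_edges ?c j)"
    by (simp add: seg_edges_comp(1)[OF a b j, symmetric] map_concat o_def)
  finally show "pull2 b (pull2 a as) ! j = pull2 ?c as ! j"
    using j k s seg_edges_comp(2)[OF a b j] by (simp add: pull2_def del: upt_Suc map_map)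
qed

section \<open>Computing in a category\<close>

context category
begin

lemma cmp_sel:
  assumes "h \<in> Ar C" "k \<in> Ar C" "Cod C h = Dom C k"
  shows "Cmp C k h \<in> Ar C" "Dom C (Cmp C k h) = Dom C h" "Cod C (Cmp C k h) = Cod C k"
  using cmp_hom[of h "Dom C h" "Cod C h" k "Cod C k"] assms by (auto simp: in_hom_def)

lemma idt_sel: "x \<in> Ob C \<Longrightarrow> Idt C x \<in> Ar C" "x \<in> Ob C \<Longrightarrow> Dom C (Idt C x) = x"
  "x \<in> Ob C \<Longrightarrow> Cod C (Idt C x) = x"
  using idt_hom[of x] by (auto simp: in_hom_def)

lemma assoc: "h \<in> Ar C \<Longrightarrow> k \<in> Ar C \<Longrightarrow> l \<in> Ar C \<Longrightarrow> Cod C h = Dom C k \<Longrightarrow> Cod C k = Dom C l \<Longrightarrow>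
    Cmp C (Cmp C l k) h = Cmp C l (Cmp C k h)"
  using cmp_assoc[of h "Dom C h" "Cod C h" k "Cod C k" l "Cod C l"] by (auto simp: in_hom_def)

lemma unit_laws: "h \<in> Ar C \<Longrightarrow> Dom C h = x \<Longrightarrow> Cmp C h (Idt C x) = h"
  "h \<in> Ar C \<Longrightarrow> Cod C h = y \<Longrightarrow> Cmp C (Idt C y) h = h"
  using cmp_idt[of h x "Cod C h"] idt_cmp[of h "Dom C h" y] by (auto simp: in_hom_def)

lemma inverse_pair_unique: "inverse_pair C h k \<Longrightarrow> inverse_pair C h l \<Longrightarrow> k = l"
proof -
  assume k: "inverse_pair C h k" and l: "inverse_pair C h l"
  have "Cmp C (Cmp C k h) l = Cmp C k (Cmp C h l)"
    using k l by (intro assoc) (auto simp: inverse_pair_def in_hom_def)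
  then show "k = l" using k l by (simp add: inverse_pair_def in_hom_def unit_laws)
qed

lemma inv_ar_eq: "inverse_pair C h k \<Longrightarrow> inv_ar C h = k"
  using inverse_pair_unique by (auto simp: inv_ar_def)

lemma inverse_pair_inv: "is_iso C h \<Longrightarrow> inverse_pair C h (inv_ar C h)"
  using inv_ar_eq by (auto simp: is_iso_def)

lemma iso_sel:
  assumes "is_iso C h"
  shows "h \<in> Ar C" "inv_ar C h \<in> Ar C" "Dom C (inv_ar C h) = Cod C h" "Cod C (inv_ar C h) = Dom C h"
    "Cmp C (inv_ar C h) h = Idt C (Dom C h)" "Cmp C h (inv_ar C h) = Idt C (Cod C h)"
  using inverse_pair_inv[OF assms] by (auto simp: inverse_pair_def in_hom_def)

lemma inverse_pair_sym: "inverse_pair C h k \<Longrightarrow> inverse_pair C k h"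
  by (auto simp: inverse_pair_def in_hom_def)

lemma iso_inv: "is_iso C h \<Longrightarrow> is_iso C (inv_ar C h)"
  using inverse_pair_sym[OF inverse_pair_inv] by (auto simp: is_iso_def)

lemma iso_idt: "x \<in> Ob C \<Longrightarrow> is_iso C (Idt C x)"
  unfolding is_iso_def inverse_pair_def in_hom_def
  by (rule exI[of _ "Idt C x"]) (simp add: idt_sel unit_laws)

lemma cancel:
  assumes "is_iso C h" "k \<in> Ar C"
  shows "Cod C k = Dom C h \<Longrightarrow> Cmp C (inv_ar C h) (Cmp C h k) = k"
    "Cod C k = Cod C h \<Longrightarrow> Cmp C h (Cmp C (inv_ar C h) k) = k"
proof -
  note h = iso_sel[OF assms(1)]
  show "Cod C k = Dom C h \<Longrightarrow> Cmp C (inv_ar C h) (Cmp C h k) = k"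
    by (subst assoc[symmetric]) (simp_all add: h assms(2) unit_laws)
  show "Cod C k = Cod C h \<Longrightarrow> Cmp C h (Cmp C (inv_ar C h) k) = k"
    by (subst assoc[symmetric]) (simp_all add: h assms(2) unit_laws)
qed

lemma iso_cmp:
  assumes h: "is_iso C h" and k: "is_iso C k" and e: "Cod C h = Dom C k"
  shows "is_iso C (Cmp C k h)"
proof -
  note hs = iso_sel[OF h] and ks = iso_sel[OF k]
  have "Cmp C (inv_ar C k) (Cmp C k h) = h" "Cmp C h (Cmp C (inv_ar C h) (inv_ar C k)) = inv_ar C k"
    using cancel(1)[OF k hs(1) e] cancel(2)[OF h ks(2)] ks e by simp_all
  then have "inverse_pair C (Cmp C k h) (Cmp C (inv_ar C h) (inv_ar C k))"
    using e by (simp add: inverse_pair_def in_hom_def cmp_sel assoc hs ks)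
  then show ?thesis by (auto simp: is_iso_def)
qed

text \<open>
  These rules associate composites to the right and cancel inverses; once the domains and
  codomains of the factors are known, they decide most equations between composites.
\<close>

lemmas cats = cmp_sel idt_sel assoc unit_laws iso_sel iso_inv cancel dom_ob cod_ob

lemma move_left:
  assumes "is_iso C h" "k \<in> Ar C" "Cod C k = Dom C h" "Cmp C h k = l"
  shows "k = Cmp C (inv_ar C h) l"
  unfolding assms(4)[symmetric] by (rule cancel(1)[OF assms(1-3), symmetric])

lemma iso_mono:
  assumes "is_iso C h" "k \<in> Ar C" "l \<in> Ar C" "Cod C k = Dom C h" "Cod C l = Dom C h"
    and e: "Cmp C h k = Cmp C h l"
  shows "k = l"
  using cancel(1)[OF assms(1,2,4)] unfolding e cancel(1)[OF assms(1,3,5)] ..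

lemma iso_epi:
  assumes "is_iso C h" "k \<in> Ar C" "l \<in> Ar C" "Dom C k = Cod C h" "Dom C l = Cod C h"
    "Cmp C k h = Cmp C l h"
  shows "k = l"
proof -
  have "Cmp C (Cmp C m h) (inv_ar C h) = m" if "m \<in> Ar C" "Dom C m = Cod C h" for m
    using that iso_sel[OF assms(1)] by (simp add: assoc unit_laws)
  from this[OF assms(2,4)] this[OF assms(3,5)] show ?thesis unfolding assms(6) by simp
qed

lemma pre:
  assumes e: "Cmp C b c = Cmp C d e" and "x \<in> Ar C" "b \<in> Ar C" "c \<in> Ar C" "d \<in> Ar C" "e \<in> Ar C"
    "Cod C x = Dom C c" "Cod C c = Dom C b" "Cod C x = Dom C e" "Cod C e = Dom C d"
  shows "Cmp C b (Cmp C c x) = Cmp C d (Cmp C e x)"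
  using assoc[of x c b] assms(2-) unfolding e by (simp add: assoc)

end

lemma functorD:
  assumes "is_functor C D F"
  shows "category C" "category D" "x \<in> Ob C \<Longrightarrow> FOb F x \<in> Ob D"
    "in_hom C h x y \<Longrightarrow> in_hom D (FAr F h) (FOb F x) (FOb F y)"
    "x \<in> Ob C \<Longrightarrow> FAr F (Idt C x) = Idt D (FOb F x)"
    "in_hom C h x y \<Longrightarrow> in_hom C k y z \<Longrightarrow> FAr F (Cmp C k h) = Cmp D (FAr F k) (FAr F h)"
    "h \<in> Ar C \<Longrightarrow> FAr F h \<in> Ar D" "h \<in> Ar C \<Longrightarrow> Dom D (FAr F h) = FOb F (Dom C h)"
    "h \<in> Ar C \<Longrightarrow> Cod D (FAr F h) = FOb F (Cod C h)"
  using assms unfolding is_functor_def by (auto simp: in_hom_def)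

lemma functor_cmp:
  assumes "is_functor C D F" "h \<in> Ar C" "k \<in> Ar C" "Cod C h = Dom C k"
  shows "FAr F (Cmp C k h) = Cmp D (FAr F k) (FAr F h)"
  using functorD(6)[OF assms(1), of h "Dom C h" "Cod C h" k "Cod C k"] assms by (auto simp: in_hom_def)

lemma functor_inverse_pair:
  assumes "is_functor C D F" "inverse_pair C h k"
  shows "inverse_pair D (FAr F h) (FAr F k)"
proof -
  have h: "h \<in> Ar C" "k \<in> Ar C" "Dom C k = Cod C h" "Cod C k = Dom C h"
    "Cmp C k h = Idt C (Dom C h)" "Cmp C h k = Idt C (Cod C h)"
    using assms(2) by (auto simp: inverse_pair_def in_hom_def)
  interpret C: category C by (rule functorD(1)[OF assms(1)])
  show ?thesis
    using functor_cmp[OF assms(1) h(1,2)] functor_cmp[OF assms(1) h(2,1)] h functorD(5,7,8,9)[OF assms(1)]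
    by (simp add: inverse_pair_def in_hom_def C.dom_ob C.cod_ob)
qed

lemma functor_iso:
  assumes "is_functor C D F" "is_iso C h"
  shows "is_iso D (FAr F h)" "inv_ar D (FAr F h) = FAr F (inv_ar C h)"
proof -
  interpret C: category C by (rule functorD(1)[OF assms(1)])
  interpret D: category D by (rule functorD(2)[OF assms(1)])
  show "is_iso D (FAr F h)" "inv_ar D (FAr F h) = FAr F (inv_ar C h)"
    using functor_inverse_pair[OF assms(1) C.inverse_pair_inv[OF assms(2)]] D.inv_ar_eq
    by (auto simp: is_iso_def)
qed

lemma functor_fcomp: "is_functor C D F \<Longrightarrow> is_functor D E G \<Longrightarrow> is_functor C E (fcomp G F)"
  unfolding is_functor_def fcomp_def fctr.simps by (intro conjI; metis)

lemma functor_fid: "category C \<Longrightarrow> is_functor C C fid"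
  unfolding is_functor_def fid_def by simp

section \<open>Traces on the free adjunction\<close>

definition endo :: "adj_cell \<Rightarrow> bool" where
  "endo F \<longleftrightarrow> F \<in> adj_cells \<and> adj_tgt F = fst F"

definition loop_pair :: "adj_cell \<Rightarrow> adj_cell \<Rightarrow> bool" where
  "loop_pair F G \<longleftrightarrow> F \<in> adj_cells \<and> G \<in> adj_cells \<and> adj_tgt F = fst G \<and> adj_tgt G = fst F"

text \<open>
  The data that a pseudo-cocone leaves on level \<open>0\<close>: a functor on endomorphism 1-cells, and the swap
  \<open>TSw F G\<close> from \<open>F * G\<close> to \<open>G * F\<close>. The cocycle law says that \<open>G * H\<close> is moved to the front by moving first \<open>H\<close>,
  then \<open>G\<close>. The law is not symmetric: it forces the swap of \<open>F\<close> with a unit on the right to be an identity, but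
  the swap of a unit with \<open>F\<close> on the right is a full turn.
\<close>

record ('c, 'd) trace_data =
  TOb :: "adj_cell \<Rightarrow> 'c"
  TAr :: "adj_tm set \<Rightarrow> 'd"
  TSw :: "adj_cell \<Rightarrow> adj_cell \<Rightarrow> 'd"

locale trace = category D for D :: "('c, 'd) cat" +
  fixes s :: "('c, 'd) trace_data"
  assumes t_ob: "endo F \<Longrightarrow> TOb s F \<in> Ob D"
    and t_ar: "hom2 a F G \<Longrightarrow> endo F \<Longrightarrow> in_hom D (TAr s a) (TOb s F) (TOb s G)"
    and t_ide: "endo F \<Longrightarrow> TAr s (ide F) = Idt D (TOb s F)"
    and t_v: "hom2 a F G \<Longrightarrow> hom2 b G H \<Longrightarrow> endo F \<Longrightarrow> TAr s (b \<bullet> a) = Cmp D (TAr s b) (TAr s a)"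
    and t_sw: "loop_pair F G \<Longrightarrow>
      in_hom D (TSw s F G) (TOb s (adj_comp F G)) (TOb s (adj_comp G F)) \<and> is_iso D (TSw s F G)"
    and t_nat: "hom2 a F F' \<Longrightarrow> hom2 b G G' \<Longrightarrow> loop_pair F G \<Longrightarrow>
      Cmp D (TAr s (b \<star> a)) (TSw s F G) = Cmp D (TSw s F' G') (TAr s (a \<star> b))"
    and t_cocycle: "F \<in> adj_cells \<Longrightarrow> G \<in> adj_cells \<Longrightarrow> H \<in> adj_cells \<Longrightarrow> adj_tgt F = fst G \<Longrightarrow>
      adj_tgt G = fst H \<Longrightarrow> adj_tgt H = fst F \<Longrightarrow>
      Cmp D (TSw s (adj_comp H F) G) (TSw s (adj_comp F G) H) = TSw s F (adj_comp G H)"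

lemma endo_comp: "loop_pair F G \<Longrightarrow> endo (adj_comp F G)"
  using adj_comp_cell by (auto simp: endo_def loop_pair_def)

lemma loop_pair_sym: "loop_pair F G \<Longrightarrow> loop_pair G F"
  by (auto simp: loop_pair_def)

lemma loop_pair_unit: "endo F \<Longrightarrow> X = fst F \<Longrightarrow> loop_pair F (adj_unit X)"
  by (auto simp: endo_def loop_pair_def)

context trace
begin

lemma sw_sel:
  assumes "loop_pair F G"
  shows "TSw s F G \<in> Ar D" "Dom D (TSw s F G) = TOb s (adj_comp F G)"
    "Cod D (TSw s F G) = TOb s (adj_comp G F)" "is_iso D (TSw s F G)"
  using t_sw[OF assms] by (auto simp: in_hom_def)

lemma ar_sel:
  assumes "hom2 a F G" "endo F"
  shows "TAr s a \<in> Ar D" "Dom D (TAr s a) = TOb s F" "Cod D (TAr s a) = TOb s G"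
  using t_ar[OF assms] by (auto simp: in_hom_def)

text \<open>An idempotent isomorphism is an identity.\<close>

lemma sw_unit:
  assumes "endo F" "X = fst F"
  shows "TSw s F (adj_unit X) = Idt D (TOb s F)"
proof -
  have l: "loop_pair F (adj_unit X)" by (rule loop_pair_unit[OF assms])
  have u: "adj_comp (adj_unit X) F = F" using assms(2) by simp
  have "Cmp D (TSw s F (adj_unit X)) (TSw s F (adj_unit X)) = TSw s F (adj_unit X)"
    using t_cocycle[of F "adj_unit X" "adj_unit X"] l u by (auto simp: loop_pair_def)
  then have "TSw s F (adj_unit X) = Cmp D (inv_ar D (TSw s F (adj_unit X))) (TSw s F (adj_unit X))"
    using sw_sel[OF l] u by (intro move_left) simp_all
  then show ?thesis using sw_sel[OF l] by (simp add: cats)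
qed

end

definition trace_iso :: "('c, 'd) cat \<Rightarrow> ('c, 'd) trace_data \<Rightarrow> ('c, 'd) trace_data \<Rightarrow> (adj_cell \<Rightarrow> 'd) \<Rightarrow> bool" where
  "trace_iso D s s' \<mu> \<longleftrightarrow>
     (\<forall>F. endo F \<longrightarrow> in_hom D (\<mu> F) (TOb s F) (TOb s' F) \<and> is_iso D (\<mu> F)) \<and>
     (\<forall>a F G. hom2 a F G \<longrightarrow> endo F \<longrightarrow> Cmp D (TAr s' a) (\<mu> F) = Cmp D (\<mu> G) (TAr s a)) \<and>
     (\<forall>F G. loop_pair F G \<longrightarrow>
        Cmp D (TSw s' F G) (\<mu> (adj_comp F G)) = Cmp D (\<mu> (adj_comp G F)) (TSw s F G))"

lemma trace_isoD:
  assumes "trace_iso D s s' \<mu>"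
  shows "endo F \<Longrightarrow> \<mu> F \<in> Ar D" "endo F \<Longrightarrow> Dom D (\<mu> F) = TOb s F" "endo F \<Longrightarrow> Cod D (\<mu> F) = TOb s' F"
    "endo F \<Longrightarrow> is_iso D (\<mu> F)"
    "hom2 a F G \<Longrightarrow> endo F \<Longrightarrow> Cmp D (TAr s' a) (\<mu> F) = Cmp D (\<mu> G) (TAr s a)"
    "loop_pair F G \<Longrightarrow> Cmp D (TSw s' F G) (\<mu> (adj_comp F G)) = Cmp D (\<mu> (adj_comp G F)) (TSw s F G)"
  using assms unfolding trace_iso_def in_hom_def by blast+

definition push_trace :: "('c, 'd, 'e, 'f) fctr \<Rightarrow> ('c, 'd) trace_data \<Rightarrow> ('e, 'f) trace_data" where
  "push_trace H s = \<lparr> TOb = (\<lambda>F. FOb H (TOb s F)), TAr = (\<lambda>a. FAr H (TAr s a)),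
     TSw = (\<lambda>F G. FAr H (TSw s F G)) \<rparr>"

lemma push_trace_sel [simp]: "TOb (push_trace H s) F = FOb H (TOb s F)"
  "TAr (push_trace H s) a = FAr H (TAr s a)" "TSw (push_trace H s) F G = FAr H (TSw s F G)"
  by (simp_all add: push_trace_def)

lemma endo_hom2: "hom2 a F G \<Longrightarrow> endo F \<Longrightarrow> endo G"
  using hom2_cells[of a F G] by (auto simp: endo_def)

lemma loop_pair_hom2: "loop_pair F G \<Longrightarrow> hom2 a F F' \<Longrightarrow> hom2 b G G' \<Longrightarrow> loop_pair F' G'"
  using hom2_cells[of a F F'] hom2_cells[of b G G'] by (auto simp: loop_pair_def)

lemma trace_push:
  assumes t: "trace D s" and H: "is_functor D E H"
  shows "trace E (push_trace H s)"
proof -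
  interpret trace D s by fact
  interpret E: category E by (rule functorD(2)[OF H])
  show ?thesis
  proof
    fix F G a assume a: "hom2 a F G" "endo F"
    show "in_hom E (TAr (push_trace H s) a) (TOb (push_trace H s) F) (TOb (push_trace H s) G)"
      using functorD(4)[OF H t_ar[OF a]] by simp
  next
    fix a F G b K assume a: "hom2 a F G" "hom2 b G K" "endo F"
    show "TAr (push_trace H s) (b \<bullet> a) = Cmp E (TAr (push_trace H s) b) (TAr (push_trace H s) a)"
      using functorD(6)[OF H t_ar[OF a(1,3)] t_ar[OF a(2) endo_hom2[OF a(1,3)]]] t_v[OF a] by simp
  next
    fix F G assume l: "loop_pair F G"
    show "in_hom E (TSw (push_trace H s) F G) (TOb (push_trace H s) (adj_comp F G)) (TOb (push_trace H s) (adj_comp G F)) \<and>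
       is_iso E (TSw (push_trace H s) F G)"
      using functorD(4)[OF H] functor_iso(1)[OF H] t_sw[OF l] by simp
  next
    fix a F F' b G G' assume a: "hom2 a F F'" "hom2 b G G'" and l: "loop_pair F G"
    note l' = loop_pair_hom2[OF l a]
    have h: "hom2 (b \<star> a) (adj_comp G F) (adj_comp G' F')" "hom2 (a \<star> b) (adj_comp F G) (adj_comp F' G')"
      using hom2_h a l by (auto simp: loop_pair_def)
    show "Cmp E (TAr (push_trace H s) (b \<star> a)) (TSw (push_trace H s) F G) =
       Cmp E (TSw (push_trace H s) F' G') (TAr (push_trace H s) (a \<star> b))"
      using t_nat[OF a l] sw_sel[OF l] sw_sel[OF l'] ar_sel[OF h(1) endo_comp[OF loop_pair_sym[OF l]]]
        ar_sel[OF h(2) endo_comp[OF l]]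
      by (simp add: functor_cmp[OF H, symmetric])
  next
    fix F G K assume c: "F \<in> adj_cells" "G \<in> adj_cells" "K \<in> adj_cells" "adj_tgt F = fst G"
      "adj_tgt G = fst K" "adj_tgt K = fst F"
    have l: "loop_pair (adj_comp K F) G" "loop_pair (adj_comp F G) K"
      using c adj_comp_cell by (auto simp: loop_pair_def)
    show "Cmp E (TSw (push_trace H s) (adj_comp K F) G) (TSw (push_trace H s) (adj_comp F G) K) =
       TSw (push_trace H s) F (adj_comp G K)"
      using t_cocycle[OF c] sw_sel[OF l(1)] sw_sel[OF l(2)]
      by (simp add: functor_cmp[OF H, symmetric] adj_comp_assoc)
  qed (use t_ob t_ide functorD(3,5)[OF H] in auto)
qed

lemma trace_iso_trans:
  assumes s: "trace D s" and s': "trace D s'" and s'': "trace D s''"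
    and \<mu>: "trace_iso D s s' \<mu>" and \<nu>: "trace_iso D s' s'' \<nu>"
  shows "trace_iso D s s'' (\<lambda>F. Cmp D (\<nu> F) (\<mu> F))"
proof -
  interpret s: trace D s by fact
  interpret s': trace D s' by fact
  interpret s'': trace D s'' by fact
  note m = trace_isoD(1-4)[OF \<mu>] trace_isoD(1-4)[OF \<nu>]
  note 1 = trace_isoD(5)[OF \<mu>] trace_isoD(5)[OF \<nu>] and 2 = trace_isoD(6)[OF \<mu>] trace_isoD(6)[OF \<nu>]
  show ?thesis unfolding trace_iso_def
  proof (intro conjI allI impI)
    fix F assume "endo F"
    then show "in_hom D (Cmp D (\<nu> F) (\<mu> F)) (TOb s F) (TOb s'' F)" "is_iso D (Cmp D (\<nu> F) (\<mu> F))"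
      using m by (simp_all add: in_hom_def s.cats s.iso_cmp)
  next
    fix a F G assume a: "hom2 a F G" "endo F"
    note G = endo_hom2[OF a]
    have "Cmp D (TAr s'' a) (Cmp D (\<nu> F) (\<mu> F)) = Cmp D (\<nu> G) (Cmp D (TAr s' a) (\<mu> F))"
      using s.pre[OF 1(2)[OF a]] m[OF a(2)] m[OF G] s'.ar_sel[OF a] s''.ar_sel[OF a] by simp
    then show "Cmp D (TAr s'' a) (Cmp D (\<nu> F) (\<mu> F)) = Cmp D (Cmp D (\<nu> G) (\<mu> G)) (TAr s a)"
      using 1(1)[OF a] m[OF a(2)] m[OF G] s.ar_sel[OF a] by (simp add: s.cats)
  next
    fix F G assume l: "loop_pair F G"
    note e = endo_comp[OF l] endo_comp[OF loop_pair_sym[OF l]]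
    have "Cmp D (TSw s'' F G) (Cmp D (\<nu> (adj_comp F G)) (\<mu> (adj_comp F G))) =
        Cmp D (\<nu> (adj_comp G F)) (Cmp D (TSw s' F G) (\<mu> (adj_comp F G)))"
      using s.pre[OF 2(2)[OF l]] m[OF e(1)] m[OF e(2)] s'.sw_sel[OF l] s''.sw_sel[OF l] by simp
    then show "Cmp D (TSw s'' F G) (Cmp D (\<nu> (adj_comp F G)) (\<mu> (adj_comp F G))) =
        Cmp D (Cmp D (\<nu> (adj_comp G F)) (\<mu> (adj_comp G F))) (TSw s F G)"
      using 2(1)[OF l] m[OF e(1)] m[OF e(2)] s.sw_sel[OF l] by (simp add: s.cats)
  qed
qed

lemma trace_iso_sym:
  assumes s: "trace D s" and s': "trace D s'" and \<mu>: "trace_iso D s s' \<mu>"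
  shows "trace_iso D s' s (\<lambda>F. inv_ar D (\<mu> F))"
proof -
  interpret s: trace D s by fact
  interpret s': trace D s' by fact
  note m = trace_isoD(1-4)[OF \<mu>]
  have swap: "Cmp D b (inv_ar D x) = Cmp D (inv_ar D y) c"
    if "Cmp D c x = Cmp D y b" "is_iso D x" "is_iso D y" "b \<in> Ar D" "c \<in> Ar D" "Dom D b = Dom D x"
      "Cod D b = Dom D y" "Dom D c = Cod D x" "Cod D c = Cod D y" for b c x y
  proof -
    have "Cmp D (inv_ar D y) (Cmp D (Cmp D c x) (inv_ar D x)) = Cmp D (inv_ar D y) (Cmp D (Cmp D y b) (inv_ar D x))"
      using that(1) by simp
    then show ?thesis using that(2-) by (simp add: s.cats)
  qed
  show ?thesis unfolding trace_iso_def
  proof (intro conjI allI impI)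
    fix F assume "endo F"
    then show "in_hom D (inv_ar D (\<mu> F)) (TOb s' F) (TOb s F)" "is_iso D (inv_ar D (\<mu> F))"
      using m by (auto simp: in_hom_def s.cats)
  next
    fix a F G assume a: "hom2 a F G" "endo F"
    have "Cmp D (TAr s' a) (\<mu> F) = Cmp D (\<mu> G) (TAr s a)" using \<mu> a unfolding trace_iso_def by blast
    from swap[OF this] show "Cmp D (TAr s a) (inv_ar D (\<mu> F)) = Cmp D (inv_ar D (\<mu> G)) (TAr s' a)"
      using m[OF a(2)] m[OF endo_hom2[OF a]] s.ar_sel[OF a] s'.ar_sel[OF a] by simp
  next
    fix F G assume l: "loop_pair F G"
    have "Cmp D (TSw s' F G) (\<mu> (adj_comp F G)) = Cmp D (\<mu> (adj_comp G F)) (TSw s F G)"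
      using \<mu> l unfolding trace_iso_def by blast
    from swap[OF this] show "Cmp D (TSw s F G) (inv_ar D (\<mu> (adj_comp F G))) = Cmp D (inv_ar D (\<mu> (adj_comp G F))) (TSw s' F G)"
      using m[OF endo_comp[OF l]] m[OF endo_comp[OF loop_pair_sym[OF l]]] s.sw_sel[OF l] s'.sw_sel[OF l] by simp
  qed
qed

lemma trace_iso_push:
  assumes s: "trace D s" and s': "trace D s'" and \<mu>: "trace_iso D s s' \<mu>" and H: "is_functor D E H"
  shows "trace_iso E (push_trace H s) (push_trace H s') (\<lambda>F. FAr H (\<mu> F))"
proof -
  interpret s: trace D s by fact
  interpret s': trace D s' by fact
  note m = trace_isoD(1-4)[OF \<mu>]
  show ?thesis unfolding trace_iso_def
  proof (intro conjI allI impI)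
    fix F assume "endo F"
    then show "in_hom E (FAr H (\<mu> F)) (TOb (push_trace H s) F) (TOb (push_trace H s') F)" "is_iso E (FAr H (\<mu> F))"
      using m functorD(7-9)[OF H] functor_iso(1)[OF H] by (auto simp: in_hom_def)
  next
    fix a F G assume a: "hom2 a F G" "endo F"
    have "Cmp D (TAr s' a) (\<mu> F) = Cmp D (\<mu> G) (TAr s a)" using \<mu> a unfolding trace_iso_def by blast
    then show "Cmp E (TAr (push_trace H s') a) (FAr H (\<mu> F)) = Cmp E (FAr H (\<mu> G)) (TAr (push_trace H s) a)"
      using m[OF a(2)] m[OF endo_hom2[OF a]] s.ar_sel[OF a] s'.ar_sel[OF a]
      by (simp add: functor_cmp[OF H, symmetric])
  next
    fix F G assume l: "loop_pair F G"
    have "Cmp D (TSw s' F G) (\<mu> (adj_comp F G)) = Cmp D (\<mu> (adj_comp G F)) (TSw s F G)"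
      using \<mu> l unfolding trace_iso_def by blast
    then show "Cmp E (TSw (push_trace H s') F G) (FAr H (\<mu> (adj_comp F G))) =
        Cmp E (FAr H (\<mu> (adj_comp G F))) (TSw (push_trace H s) F G)"
      using m[OF endo_comp[OF l]] m[OF endo_comp[OF loop_pair_sym[OF l]]] s.sw_sel[OF l] s'.sw_sel[OF l]
      by (simp add: functor_cmp[OF H, symmetric])
  qed
qed

section \<open>Pseudo-cocones are traces\<close>

\<comment> \<open>1-cells are pairs, and quantifiers over them are better left alone\<close>
declare split_paired_All [simp del] split_paired_Ex [simp del]

text \<open>
  \<open>hub n k\<close> picks vertex \<open>k\<close> of the cycle with vertices \<open>0, \<dots>, n\<close>: it cuts the cycle open there, and the induced
  functor composes all edges, starting after \<open>k\<close>. Likewise \<open>edge n k l\<close> cuts it at \<open>k\<close> and \<open>l\<close>.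
\<close>

definition hub :: "nat \<Rightarrow> nat \<Rightarrow> smap" where
  "hub n k = (0, \<lambda>j \<in> {..0}. k, n)"

definition edge :: "nat \<Rightarrow> nat \<Rightarrow> nat \<Rightarrow> smap" where
  "edge n k l = (1, \<lambda>j \<in> {..1}. if j = 0 then k else l, n)"

lemma hub_hom: "k \<le> n \<Longrightarrow> n \<le> N \<Longrightarrow> in_hom (simplex_upto N) (hub n k) 0 n"
  by (auto simp: simplex_hom hub_def mono_on_def)

lemma edge_hom: "k \<le> l \<Longrightarrow> l \<le> n \<Longrightarrow> n \<le> N \<Longrightarrow> 1 \<le> N \<Longrightarrow> in_hom (simplex_upto N) (edge n k l) 1 n"
  by (auto simp: simplex_hom edge_def mono_on_def)

lemma simplex_idt_hom: "n \<le> N \<Longrightarrow> in_hom (simplex_upto N) (Idt (simplex_upto N) n) n n"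
proof -
  have "Idt (simplex_upto N) n = (n, restrict id {..n}, n)" by (simp add: simplex_upto_def)
  then show "n \<le> N \<Longrightarrow> in_hom (simplex_upto N) (Idt (simplex_upto N) n) n n"
    by (simp add: simplex_hom mono_on_def restrict_PiE_iff)
qed

lemma edge_hub: "Cmp (simplex_upto N) (edge n k l) (hub 1 0) = hub n k"
  "Cmp (simplex_upto N) (edge n k l) (hub 1 1) = hub n l"
  by (auto simp: simplex_cmp edge_def hub_def compose_def fun_eq_iff)

lemma cmp_hub: "in_hom (simplex_upto N) a m n \<Longrightarrow> k \<le> m \<Longrightarrow>
    Cmp (simplex_upto N) a (hub m k) = hub n (vertex_map a k)"
  by (auto simp: simplex_cmp simplex_hom hub_def compose_def fun_eq_iff)

lemma cmp_edge: "in_hom (simplex_upto N) a m n \<Longrightarrow> k \<le> m \<Longrightarrow> l \<le> m \<Longrightarrow>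
    Cmp (simplex_upto N) a (edge m k l) = edge n (vertex_map a k) (vertex_map a l)"
  by (auto simp: simplex_cmp simplex_hom edge_def compose_def fun_eq_iff)

lemma face_hub: "face 1 0 = hub 1 0" "face 0 0 = hub 1 1"
  by (auto simp: face_def hub_def fun_eq_iff)

lemma hub_idt: "Idt (simplex_upto N) 0 = hub 0 0"
  by (auto simp: simplex_upto_def hub_def fun_eq_iff)

lemma pull_hub: "pull (hub n k) Fs = [glue (adj_tgt (Fs ! k)) (map (nth Fs) ([Suc k..<Suc n] @ [0..<Suc k]))]"
  by (simp add: pull_def hub_def del: upt_Suc) (simp add: upt_rec del: upt_Suc)

lemma pull_edge: "pull (edge n k l) Fs = [glue (adj_tgt (Fs ! l)) (map (nth Fs) ([Suc l..<Suc n] @ [0..<Suc k])),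
    glue (adj_tgt (Fs ! k)) (map (nth Fs) [Suc k..<Suc l])]"
proof -
  have "[0..<Suc (fst (edge n k l))] = [0, 1]" by (simp add: edge_def)
  then show ?thesis by (simp add: pull_def edge_def del: upt_Suc)
qed

lemma cyclic_list_0: "cyclic_list adj 0 Fs \<longleftrightarrow> (\<exists>F. Fs = [F] \<and> endo F)"
  by (auto simp: cyclic_list_adj endo_def length_Suc_conv)

lemma cyclic_list_1: "cyclic_list adj 1 Fs \<longleftrightarrow> (\<exists>F G. Fs = [F, G] \<and> loop_pair F G)"
  by (auto simp: cyclic_list_adj loop_pair_def length_Suc_conv)

lemma cyclic_list_2: "F \<in> adj_cells \<Longrightarrow> G \<in> adj_cells \<Longrightarrow> H \<in> adj_cells \<Longrightarrow> adj_tgt F = fst G \<Longrightarrow>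
    adj_tgt G = fst H \<Longrightarrow> adj_tgt H = fst F \<Longrightarrow> cyclic_list adj 2 [F, G, H]"
  by (auto simp: cyclic_list_adj less_Suc_eq numeral_2_eq_2)

lemma pull_hub_0: "endo F \<Longrightarrow> pull (hub 0 0) [F] = [F]"
  by (simp add: pull_hub endo_def)

lemma pull_hub_1: "loop_pair F G \<Longrightarrow> pull (hub 1 1) [F, G] = [adj_comp F G]"
  "loop_pair F G \<Longrightarrow> pull (hub 1 0) [F, G] = [adj_comp G F]"
  by (simp_all add: pull_hub loop_pair_def upt_rec)

lemma nerve_0_hom: "hom2 a F G \<Longrightarrow> endo F \<Longrightarrow> in_hom (nerve_cat adj 0) [a] [F] [G]"
  by (auto simp: in_hom_def nerve_ar cyclic_list_0) (auto simp: nerve_cat_def)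

lemma nerve_1_hom: "hom2 a F F' \<Longrightarrow> hom2 b G G' \<Longrightarrow> loop_pair F G \<Longrightarrow>
    in_hom (nerve_cat adj 1) [a, b] [F, G] [F', G']"
  by (auto simp: in_hom_def nerve_ar cyclic_list_1[unfolded One_nat_def]) (auto simp: nerve_cat_def)

lemma nerve_hom_iff: "in_hom (nerve_cat adj n) as Fs Gs \<longleftrightarrow>
    as \<in> Ar (nerve_cat adj n) \<and> doms as = Fs \<and> cods as = Gs"
  by (simp add: in_hom_def nerve_cat_def)

lemma nerve_0_arE:
  assumes "as \<in> Ar (nerve_cat adj 0)"
  obtains a where "as = [a]" "hom2 a (Dom adj_two_cells a) (Cod adj_two_cells a)" "endo (Dom adj_two_cells a)"
proof -
  have "\<exists>F. doms as = [F] \<and> endo F" "cells2 as" using assms unfolding nerve_ar cyclic_list_0 by simp_all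
  then show ?thesis using that ar_hom2 by (cases as) auto
qed

lemma nerve_1_arE:
  assumes "as \<in> Ar (nerve_cat adj 1)"
  obtains a b where "as = [a, b]" "hom2 a (Dom adj_two_cells a) (Cod adj_two_cells a)"
    "hom2 b (Dom adj_two_cells b) (Cod adj_two_cells b)" "loop_pair (Dom adj_two_cells a) (Dom adj_two_cells b)"
proof -
  have c: "\<exists>F G. doms as = [F, G] \<and> loop_pair F G" "cells2 as"
    using assms unfolding nerve_ar cyclic_list_1 by simp_all
  from c(1) obtain a b where "as = [a, b]" by (cases as rule: list.exhaust; cases "tl as") auto
  then show ?thesis using c that ar_hom2 by simp
qed

lemma pull2_hub: "pull2 (hub n k) as = [hprod (adj_tgt (Dom adj_two_cells (as ! k)))
    (map (nth as) ([Suc k..<Suc n] @ [0..<Suc k]))]"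
  by (simp add: pull2_def hub_def del: upt_Suc) (simp add: upt_rec del: upt_Suc)

lemma pull2_hub_0: "hom2 a F G \<Longrightarrow> endo F \<Longrightarrow> pull2 (hub 0 0) [a] = [a]"
  using h2_unit[of a F G] by (auto simp: pull2_hub endo_def in_hom_def)

lemma pull2_hub_1:
  assumes "hom2 a F F'" "hom2 b G G'"
  shows "pull2 (hub 1 1) [a, b] = [a \<star> b]" "pull2 (hub 1 0) [a, b] = [b \<star> a]"
  using assms h2_unit[OF assms(1)] h2_unit[OF assms(2)] by (simp_all add: pull2_hub in_hom_def upt_rec)

definition trace_of :: "('c, 'd) cat \<Rightarrow> (adj_cell, adj_tm set, 'c, 'd) hh_cocone \<Rightarrow> ('c, 'd) trace_data" where
  "trace_of D M = \<lparr> TOb = hh_ob M, TAr = hh_ar M, TSw = hh_swap D M \<rparr>"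

lemma pseudo_coconeD:
  assumes "pseudo_cocone J P D L"
  shows "j \<in> Ob J \<Longrightarrow> is_functor (PCat P j) D (Leg L j)"
    "in_hom J a i j \<Longrightarrow> nat_iso (PCat P j) D (Leg L j) (fcomp (Leg L i) (PMap P a)) (LegIso L a)"
    "j \<in> Ob J \<Longrightarrow> x \<in> Ob (PCat P j) \<Longrightarrow> LegIso L (Idt J j) x = FAr (Leg L j) (PUnit P j x)"
    "in_hom J b i j \<Longrightarrow> in_hom J a j k \<Longrightarrow> x \<in> Ob (PCat P k) \<Longrightarrow> LegIso L (Cmp J a b) x =
      Cmp D (FAr (Leg L i) (PComp P a b x)) (Cmp D (LegIso L b (FOb (PMap P a) x)) (LegIso L a x))"
  using assms unfolding pseudo_cocone_def by blast+

lemma nerve_sel: "PCat (cyclic_nerve adj) = nerve_cat adj" "PMap (cyclic_nerve adj) = nerve_map adj"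
  "PUnit (cyclic_nerve adj) n Fs = map ide Fs" "Ob (simplex_upto N) = {..N}"
  "Ob (nerve_cat adj n) = {Fs. cyclic_list adj n Fs}" "Idt (nerve_cat adj n) = map ide"
  "Cmp (nerve_cat adj n) = map2 (Cmp adj_two_cells)"
  by (simp_all add: cyclic_nerve_def simplex_upto_def nerve_cat_def fun_eq_iff)

locale cyclic_cocone = category D for D :: "('c, 'd) cat" +
  fixes M :: "(adj_cell, adj_tm set, 'c, 'd) hh_cocone"
  assumes cocone: "pseudo_cocone (simplex_upto 2) (cyclic_nerve adj) D M"
begin

lemma leg: "n \<le> 2 \<Longrightarrow> is_functor (nerve_cat adj n) D (Leg M n)"
  using pseudo_coconeD(1)[OF cocone, unfolded nerve_sel] by simp

lemma leg_nat_iso: "in_hom (simplex_upto 2) a m n \<Longrightarrow>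
    nat_iso (nerve_cat adj n) D (Leg M n) (fcomp (Leg M m) (nerve_map adj a)) (LegIso M a)"
  by (rule pseudo_coconeD(2)[OF cocone, unfolded nerve_sel])

lemma leg_iso:
  assumes a: "in_hom (simplex_upto 2) a m n" and Fs: "cyclic_list adj n Fs"
  shows "LegIso M a Fs \<in> Ar D" "Dom D (LegIso M a Fs) = FOb (Leg M n) Fs"
    "Cod D (LegIso M a Fs) = FOb (Leg M m) (pull a Fs)" "is_iso D (LegIso M a Fs)"
  using leg_nat_iso[OF a] nerve_map_ob[OF a Fs] Fs
  unfolding nat_iso_def in_hom_def nerve_sel fcomp_def fctr.simps by auto

lemma leg_nat:
  assumes a: "in_hom (simplex_upto 2) a m n" and h: "as \<in> Ar (nerve_cat adj n)"
  shows "Cmp D (FAr (Leg M m) (pull2 a as)) (LegIso M a (doms as)) = Cmp D (LegIso M a (cods as)) (FAr (Leg M n) as)"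
  using leg_nat_iso[OF a] h
  unfolding nat_iso_def nerve_hom_iff fcomp_def fctr.simps nerve_map_ar(1)[OF a h, symmetric] by blast

lemma leg_iso_idt:
  assumes "n \<le> 2" and Fs: "cyclic_list adj n Fs"
  shows "LegIso M (Idt (simplex_upto 2) n) Fs = Idt D (FOb (Leg M n) Fs)"
proof -
  have "LegIso M (Idt (simplex_upto 2) n) Fs = FAr (Leg M n) (Idt (nerve_cat adj n) Fs)"
    using pseudo_coconeD(3)[OF cocone, unfolded nerve_sel] assms by (simp add: nerve_sel)
  then show ?thesis using functorD(5)[OF leg[OF assms(1)]] Fs by (simp add: nerve_sel)
qed

lemma leg_iso_cmp:
  assumes a: "in_hom (simplex_upto 2) a m n" and b: "in_hom (simplex_upto 2) b k m"
    and Fs: "cyclic_list adj n Fs"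
  shows "LegIso M (Cmp (simplex_upto 2) a b) Fs = Cmp D (LegIso M b (pull a Fs)) (LegIso M a Fs)"
proof -
  let ?c = "Cmp (simplex_upto 2) a b"
  have k: "k \<le> 2" using b by (simp add: simplex_hom)
  have "LegIso M ?c Fs = Cmp D (FAr (Leg M k) (PComp (cyclic_nerve adj) a b Fs))
      (Cmp D (LegIso M b (pull a Fs)) (LegIso M a Fs))"
    using pseudo_coconeD(4)[OF cocone b a, unfolded nerve_sel] Fs nerve_map_ob[OF a Fs] by simp
  also have "PComp (cyclic_nerve adj) a b Fs = Idt (nerve_cat adj k) (pull b (pull a Fs))"
    using nerve_compositor[OF a b Fs] pull_comp[OF a b Fs] by (simp add: nerve_cat_def)
  also have "FAr (Leg M k) \<dots> = Idt D (FOb (Leg M k) (pull b (pull a Fs)))"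
    using functorD(5)[OF leg[OF k]] pull_cyclic(1)[OF b pull_cyclic(1)[OF a Fs]] by (simp add: nerve_sel)
  finally show ?thesis
    using leg_iso[OF a Fs] leg_iso[OF b pull_cyclic(1)[OF a Fs]] by (simp add: cmp_sel unit_laws)
qed

text \<open>
  Both cuts factor through \<open>edge n k l\<close>, so the isomorphism between the cut at \<open>l\<close> and the cut at \<open>k\<close> is the
  swap of the two arcs.
\<close>

lemma swap_edge:
  assumes "k \<le> l" "l \<le> n" "n \<le> 2" and Fs: "cyclic_list adj n Fs" and e: "pull (edge n k l) Fs = [A, B]"
  shows "Cmp D (hh_swap D M A B) (LegIso M (hub n l) Fs) = LegIso M (hub n k) Fs"
proof -
  have h: "in_hom (simplex_upto 2) (edge n k l) 1 n" using assms by (intro edge_hom) auto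
  have h0: "in_hom (simplex_upto 2) (hub 1 0) 0 1" and h1: "in_hom (simplex_upto 2) (hub 1 1) 0 1"
    by (rule hub_hom; simp)+
  have c: "cyclic_list adj 1 [A, B]" using pull_cyclic(1)[OF h Fs] e by simp
  have "LegIso M (hub n k) Fs = Cmp D (LegIso M (hub 1 0) [A, B]) (LegIso M (edge n k l) Fs)"
    "LegIso M (hub n l) Fs = Cmp D (LegIso M (hub 1 1) [A, B]) (LegIso M (edge n k l) Fs)"
    using leg_iso_cmp[OF h h0 Fs] leg_iso_cmp[OF h h1 Fs] e by (simp_all add: edge_hub[unfolded One_nat_def])
  then show ?thesis
    using leg_iso[OF h Fs] leg_iso[OF h0 c] leg_iso[OF h1 c] e
    unfolding hh_swap_def face_hub by (simp add: cats)
qed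

lemma swap_sel:
  assumes l: "loop_pair F G"
  shows "hh_swap D M F G \<in> Ar D" "Dom D (hh_swap D M F G) = hh_ob M (adj_comp F G)"
    "Cod D (hh_swap D M F G) = hh_ob M (adj_comp G F)" "is_iso D (hh_swap D M F G)"
proof -
  have h0: "in_hom (simplex_upto 2) (hub 1 0) 0 1" and h1: "in_hom (simplex_upto 2) (hub 1 1) 0 1"
    by (rule hub_hom; simp)+
  have c: "cyclic_list adj 1 [F, G]" using l cyclic_list_1 by blast
  show "hh_swap D M F G \<in> Ar D" "Dom D (hh_swap D M F G) = hh_ob M (adj_comp F G)"
    "Cod D (hh_swap D M F G) = hh_ob M (adj_comp G F)" "is_iso D (hh_swap D M F G)"
    using leg_iso[OF h0 c] leg_iso[OF h1 c] pull_hub_1[OF l]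
    unfolding hh_swap_def face_hub by (simp_all add: cats hh_ob_def iso_cmp)
qed

lemma swap_hub:
  assumes l: "loop_pair F G"
  shows "Cmp D (hh_swap D M F G) (LegIso M (hub 1 1) [F, G]) = LegIso M (hub 1 0) [F, G]"
proof -
  have "pull (edge 1 0 1) [F, G] = [F, G]"
    using l by (cases F; cases G) (simp add: pull_edge loop_pair_def glue_def upt_rec)
  then show ?thesis using l cyclic_list_1[of "[F, G]"] by (intro swap_edge) simp_all
qed

text \<open>
  Naturality of the swap is naturality of the cocone isomorphisms of the two faces of level \<open>1\<close>. The
  cocycle law comes from level \<open>2\<close>: cutting at vertex \<open>2\<close>, then \<open>1\<close>, then \<open>0\<close> is the same as going from \<open>2\<close> to \<open>0\<close>.
\<close>

lemma trace_of_cocone: "trace D (trace_of D M)"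
proof
  have h0: "in_hom (simplex_upto 2) (hub 1 0) 0 1" and h1: "in_hom (simplex_upto 2) (hub 1 1) 0 1"
    by (rule hub_hom; simp)+
  note L = leg[of 0, simplified]
  show "TOb (trace_of D M) F \<in> Ob D" if "endo F" for F
    using functorD(3)[OF L] that by (simp add: trace_of_def hh_ob_def nerve_sel cyclic_list_0)
  show "in_hom D (TAr (trace_of D M) a) (TOb (trace_of D M) F) (TOb (trace_of D M) G)"
    if "hom2 a F G" "endo F" for a F G
    using functorD(4)[OF L nerve_0_hom[OF that]] by (simp add: trace_of_def hh_ob_def hh_ar_def)
  show "TAr (trace_of D M) (ide F) = Idt D (TOb (trace_of D M) F)" if "endo F" for F
    using functorD(5)[OF L, of "[F]"] that
    by (simp add: trace_of_def hh_ob_def hh_ar_def nerve_sel cyclic_list_0)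
  show "TAr (trace_of D M) (b \<bullet> a) = Cmp D (TAr (trace_of D M) b) (TAr (trace_of D M) a)"
    if "hom2 a F G" "hom2 b G H" "endo F" for a b F G H
    using functorD(6)[OF L nerve_0_hom[OF that(1,3)] nerve_0_hom[OF that(2) endo_hom2[OF that(1,3)]]]
    by (simp add: trace_of_def hh_ar_def nerve_sel)
  show "in_hom D (TSw (trace_of D M) F G) (TOb (trace_of D M) (adj_comp F G)) (TOb (trace_of D M) (adj_comp G F)) \<and>
      is_iso D (TSw (trace_of D M) F G)" if "loop_pair F G" for F G
    using swap_sel[OF that] by (simp add: trace_of_def in_hom_def)
  show "Cmp D (TAr (trace_of D M) (b \<star> a)) (TSw (trace_of D M) F G) =
      Cmp D (TSw (trace_of D M) F' G') (TAr (trace_of D M) (a \<star> b))"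
    if a: "hom2 a F F'" "hom2 b G G'" and l: "loop_pair F G" for a b F F' G G'
  proof -
    note l' = loop_pair_hom2[OF l a]
    have c: "cyclic_list adj 1 [F, G]" "cyclic_list adj 1 [F', G']" using l l' cyclic_list_1 by blast+
    note n = nerve_1_hom[OF a l]
    have n': "[a, b] \<in> Ar (nerve_cat adj 1)" "doms [a, b] = [F, G]" "cods [a, b] = [F', G']"
      using n by (simp_all only: nerve_hom_iff)
    have e: "Cmp D (hh_ar M (b \<star> a)) (LegIso M (hub 1 0) [F, G]) = Cmp D (LegIso M (hub 1 0) [F', G']) (FAr (Leg M 1) [a, b])"
      "Cmp D (hh_ar M (a \<star> b)) (LegIso M (hub 1 1) [F, G]) = Cmp D (LegIso M (hub 1 1) [F', G']) (FAr (Leg M 1) [a, b])"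
      using leg_nat[OF h0 n'(1)] leg_nat[OF h1 n'(1)] pull2_hub_1[OF a] n'(2,3) by (simp_all only: hh_ar_def)
    have hs: "hom2 (b \<star> a) (adj_comp G F) (adj_comp G' F')" "hom2 (a \<star> b) (adj_comp F G) (adj_comp F' G')"
      using hom2_h a l by (auto simp: loop_pair_def)
    have ar: "in_hom D (hh_ar M (b \<star> a)) (hh_ob M (adj_comp G F)) (hh_ob M (adj_comp G' F'))"
      "in_hom D (hh_ar M (a \<star> b)) (hh_ob M (adj_comp F G)) (hh_ob M (adj_comp F' G'))"
      "in_hom D (FAr (Leg M 1) [a, b]) (FOb (Leg M 1) [F, G]) (FOb (Leg M 1) [F', G'])"
      using functorD(4)[OF L nerve_0_hom[OF hs(1)]] functorD(4)[OF L nerve_0_hom[OF hs(2)]]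
        functorD(4)[OF leg[of 1] n] endo_comp[OF l] endo_comp[OF loop_pair_sym[OF l]]
      by (simp_all add: hh_ar_def hh_ob_def)
    show ?thesis
    proof (rule iso_epi[OF leg_iso(4)[OF h1 c(1)]])
      have "Cmp D (hh_swap D M F' G') (Cmp D (hh_ar M (a \<star> b)) (LegIso M (hub 1 1) [F, G])) =
          Cmp D (Cmp D (hh_swap D M F' G') (LegIso M (hub 1 1) [F', G'])) (FAr (Leg M 1) [a, b])"
        unfolding e using swap_sel[OF l'] leg_iso[OF h1 c(2)] ar pull_hub_1[OF l']
        by (simp add: assoc in_hom_def hh_ob_def)
      also have "\<dots> = Cmp D (hh_ar M (b \<star> a)) (Cmp D (hh_swap D M F G) (LegIso M (hub 1 1) [F, G]))"
        unfolding swap_hub[OF l] swap_hub[OF l'] e ..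
      finally show "Cmp D (Cmp D (TAr (trace_of D M) (b \<star> a)) (TSw (trace_of D M) F G)) (LegIso M (hub 1 1) [F, G]) =
        Cmp D (Cmp D (TSw (trace_of D M) F' G') (TAr (trace_of D M) (a \<star> b))) (LegIso M (hub 1 1) [F, G])"
        using swap_sel[OF l'] swap_sel[OF l] leg_iso[OF h1 c(1)] ar pull_hub_1[OF l]
        by (simp add: trace_of_def assoc in_hom_def hh_ob_def)
    qed (use swap_sel[OF l'] swap_sel[OF l] leg_iso[OF h1 c(1)] ar pull_hub_1[OF l] in
        \<open>simp_all add: trace_of_def cmp_sel in_hom_def hh_ob_def\<close>)
  qed
  show "Cmp D (TSw (trace_of D M) (adj_comp H F) G) (TSw (trace_of D M) (adj_comp F G) H) =
      TSw (trace_of D M) F (adj_comp G H)"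
    if c: "F \<in> adj_cells" "G \<in> adj_cells" "H \<in> adj_cells" "adj_tgt F = fst G" "adj_tgt G = fst H" "adj_tgt H = fst F"
    for F G H
  proof -
    have l: "loop_pair (adj_comp H F) G" "loop_pair (adj_comp F G) H" "loop_pair F (adj_comp G H)"
      using c adj_comp_cell by (auto simp: loop_pair_def)
    note cy = cyclic_list_2[OF c]
    have p: "pull (edge 2 0 2) [F, G, H] = [F, adj_comp G H]" "pull (edge 2 1 2) [F, G, H] = [adj_comp F G, H]"
      "pull (edge 2 0 1) [F, G, H] = [adj_comp H F, G]"
      using c by (cases F; cases G; cases H; simp add: pull_edge glue_def upt_rec)+
    have hq: "in_hom (simplex_upto 2) (hub 2 2) 0 2" by (rule hub_hom) auto
    have q: "pull (hub 2 2) [F, G, H] = [adj_comp F (adj_comp G H)]"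
      using c by (cases F; cases G; cases H; simp add: pull_hub glue_def upt_rec)
    have e: "Cmp D (hh_swap D M F (adj_comp G H)) (LegIso M (hub 2 2) [F, G, H]) = LegIso M (hub 2 0) [F, G, H]"
      "Cmp D (hh_swap D M (adj_comp F G) H) (LegIso M (hub 2 2) [F, G, H]) = LegIso M (hub 2 1) [F, G, H]"
      "Cmp D (hh_swap D M (adj_comp H F) G) (LegIso M (hub 2 1) [F, G, H]) = LegIso M (hub 2 0) [F, G, H]"
      using swap_edge[OF _ _ _ cy p(1)] swap_edge[OF _ _ _ cy p(2)] swap_edge[OF _ _ _ cy p(3)] by auto
    show ?thesis
    proof (rule iso_epi[OF leg_iso(4)[OF hq cy]])
      show "Cmp D (Cmp D (TSw (trace_of D M) (adj_comp H F) G) (TSw (trace_of D M) (adj_comp F G) H)) (LegIso M (hub 2 2) [F, G, H]) =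
        Cmp D (TSw (trace_of D M) F (adj_comp G H)) (LegIso M (hub 2 2) [F, G, H])"
        using swap_sel[OF l(1)] swap_sel[OF l(2)] leg_iso[OF hq cy] q e
        by (simp add: trace_of_def assoc hh_ob_def adj_comp_assoc)
    qed (use swap_sel[OF l(1)] swap_sel[OF l(2)] swap_sel[OF l(3)] leg_iso[OF hq cy] q in
        \<open>simp_all add: trace_of_def cmp_sel hh_ob_def adj_comp_assoc\<close>)
  qed
qed

end


text \<open>
  Equality of the values that matter; outside endomorphism cells and loops the components are arbitrary.
\<close>

definition same_trace :: "('c, 'd) trace_data \<Rightarrow> ('c, 'd) trace_data \<Rightarrow> bool" where
  "same_trace s s' \<longleftrightarrow> (\<forall>F. endo F \<longrightarrow> TOb s F = TOb s' F) \<and>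
     (\<forall>a F G. hom2 a F G \<longrightarrow> endo F \<longrightarrow> TAr s a = TAr s' a) \<and>
     (\<forall>F G. loop_pair F G \<longrightarrow> TSw s F G = TSw s' F G)"

lemma same_trace_sym: "same_trace s s' \<Longrightarrow> same_trace s' s"
  unfolding same_trace_def by metis

lemma trace_iso_cong:
  assumes s: "same_trace s1 s2" and s': "same_trace s1' s2'" and \<mu>: "trace_iso D s1 s1' \<mu>"
  shows "trace_iso D s2 s2' \<mu>"
  unfolding trace_iso_def in_hom_def
proof (intro conjI allI impI)
  fix F assume "endo F"
  then show "\<mu> F \<in> Ar D" "Dom D (\<mu> F) = TOb s2 F" "Cod D (\<mu> F) = TOb s2' F" "is_iso D (\<mu> F)"
    using trace_isoD(1-4)[OF \<mu>] s s' by (simp_all add: same_trace_def)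
next
  fix a F G assume "a \<in> Ar adj_two_cells \<and> Dom adj_two_cells a = F \<and> Cod adj_two_cells a = G" and e: "endo F"
  then have h: "hom2 a F G" by (simp add: in_hom_def)
  have "TAr s1 a = TAr s2 a" "TAr s1' a = TAr s2' a" using s s' h e unfolding same_trace_def by blast+
  then show "Cmp D (TAr s2' a) (\<mu> F) = Cmp D (\<mu> G) (TAr s2 a)" using trace_isoD(5)[OF \<mu> h e] by simp
next
  fix F G assume l: "loop_pair F G"
  have "TSw s1 F G = TSw s2 F G" "TSw s1' F G = TSw s2' F G" using s s' l unfolding same_trace_def by blast+
  then show "Cmp D (TSw s2' F G) (\<mu> (adj_comp F G)) = Cmp D (\<mu> (adj_comp G F)) (TSw s2 F G)"
    using trace_isoD(6)[OF \<mu> l] by simp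
qed

definition level0 :: "('c, 'd) trace_data \<Rightarrow> (adj_cell list, adj_tm set list, 'c, 'd) fctr" where
  "level0 s = \<lparr> FOb = (\<lambda>Fs. TOb s (hd Fs)), FAr = (\<lambda>as. TAr s (hd as)) \<rparr>"

text \<open>
  Level \<open>n\<close> is cut open at vertex \<open>n\<close>. A simplicial map \<open>a\<close> with top vertex \<open>m\<close> moves the cut to \<open>a m\<close>, so its
  isomorphism swaps the two arcs between \<open>n\<close> and \<open>a m\<close>.
\<close>

definition cocone_of :: "('c, 'd) trace_data \<Rightarrow> (adj_cell, adj_tm set, 'c, 'd) hh_cocone" where
  "cocone_of s = \<lparr> Leg = (\<lambda>n. fcomp (level0 s) (nerve_map adj (hub n n))),
     LegIso = (\<lambda>a Fs. let Gs = pull (edge (snd (snd a)) (vertex_map a (fst a)) (snd (snd a))) Fs in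
       TSw s (Gs ! 0) (Gs ! 1)) \<rparr>"

context trace
begin

lemma level0_functor: "is_functor (nerve_cat adj 0) D (level0 s)"
proof -
  interpret N: category "nerve_cat adj 0" by (rule nerve_category)
  have v: "\<exists>a. as = [a] \<and> hom2 a (hd Fs) (hd Gs) \<and> Fs = [hd Fs] \<and> Gs = [hd Gs] \<and> endo (hd Fs)"
    if "in_hom (nerve_cat adj 0) as Fs Gs" for as Fs Gs
    using that unfolding nerve_hom_iff by (elim conjE nerve_0_arE) auto
  show ?thesis unfolding is_functor_def
  proof (intro conjI allI impI ballI nerve_category)
    fix as bs Fs Gs Hs assume "in_hom (nerve_cat adj 0) as Fs Gs" "in_hom (nerve_cat adj 0) bs Gs Hs"
    from v[OF this(1)] v[OF this(2)] obtain a b where "as = [a]" "bs = [b]" "hom2 a (hd Fs) (hd Gs)"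
      "hom2 b (hd Gs) (hd Hs)" "endo (hd Fs)" by blast
    then show "FAr (level0 s) (Cmp (nerve_cat adj 0) bs as) = Cmp D (FAr (level0 s) bs) (FAr (level0 s) as)"
      using t_v[of a "hd Fs" "hd Gs" b "hd Hs"] by (simp add: level0_def nerve_sel)
  next
    fix as Fs Gs assume "in_hom (nerve_cat adj 0) as Fs Gs"
    from v[OF this] obtain a where "as = [a]" "hom2 a (hd Fs) (hd Gs)" "endo (hd Fs)" by blast
    then show "in_hom D (FAr (level0 s) as) (FOb (level0 s) Fs) (FOb (level0 s) Gs)"
      using t_ar[of a "hd Fs" "hd Gs"] by (simp add: level0_def)
  qed (auto simp: level0_def nerve_sel cyclic_list_0 t_ob t_ide category_axioms)
qed

lemma cocone_of_ob: "cyclic_list adj n Fs \<Longrightarrow> FOb (Leg (cocone_of s) n) Fs = TOb s (hd (pull (hub n n) Fs))"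
  using nerve_map_ob[OF hub_hom, of n n n Fs] by (simp add: cocone_of_def fcomp_def level0_def)

lemma cocone_of_ar: "as \<in> Ar (nerve_cat adj n) \<Longrightarrow> FAr (Leg (cocone_of s) n) as = TAr s (hd (pull2 (hub n n) as))"
  using nerve_map_ar(1)[OF hub_hom, of n n n as] by (simp add: cocone_of_def fcomp_def level0_def)

lemma cocone_of_iso: "in_hom (simplex_upto N) a m n \<Longrightarrow> pull (edge n (vertex_map a m) n) Fs = [A, B] \<Longrightarrow>
    LegIso (cocone_of s) a Fs = TSw s A B"
  by (simp add: cocone_of_def simplex_hom Let_def)

lemma edge_pair:
  assumes "k \<le> l" "l \<le> n" "1 \<le> N" "n \<le> N" "cyclic_list adj n Fs"
  obtains A B where "pull (edge n k l) Fs = [A, B]" "loop_pair A B"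
    "pull (hub n l) Fs = [adj_comp A B]" "pull (hub n k) Fs = [adj_comp B A]"
proof -
  have h: "in_hom (simplex_upto N) (edge n k l) 1 n" using assms by (intro edge_hom) auto
  have h0: "in_hom (simplex_upto N) (hub 1 0) 0 1" "in_hom (simplex_upto N) (hub 1 1) 0 1"
    using assms by (auto intro: hub_hom)
  have "cyclic_list adj 1 (pull (edge n k l) Fs)" by (rule pull_cyclic(1)[OF h assms(5)])
  then obtain A B where AB: "pull (edge n k l) Fs = [A, B]" "loop_pair A B" using cyclic_list_1 by blast
  then show ?thesis using that pull_comp[OF h h0(1) assms(5)] pull_comp[OF h h0(2) assms(5)]
      pull_hub_1[OF AB(2)] by (simp add: edge_hub[unfolded One_nat_def])
qed

text \<open>
  A composite of simplicial maps moves the cut twice and divides the cycle into three arcs; the coherence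
  condition is the cocycle law for these arcs.
\<close>

lemma cocone_of_trace: "pseudo_cocone (simplex_upto 2) (cyclic_nerve adj) D (cocone_of s)"
proof -
  have leg: "is_functor (nerve_cat adj n) D (Leg (cocone_of s) n)" if "n \<le> 2" for n
    using functor_fcomp[OF nerve_map_functor[OF hub_hom] level0_functor, of n n n]
    by (simp add: cocone_of_def)
  show ?thesis unfolding pseudo_cocone_def nerve_sel
  proof (intro conjI allI impI ballI)
    fix n :: nat assume "n \<in> {..2}"
    then show "is_functor (nerve_cat adj n) D (Leg (cocone_of s) n)" using leg by simp
  next
    fix a :: smap and m n assume a: "in_hom (simplex_upto 2) a m n"
    then have mn: "m \<le> 2" "n \<le> 2" by (auto simp: simplex_hom)
    have k: "vertex_map a m \<le> n" using simplex_mono[OF a] by auto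
    have hm: "in_hom (simplex_upto 2) (hub m m) 0 m" using mn by (intro hub_hom) auto
    have he: "in_hom (simplex_upto 2) (edge n (vertex_map a m) n) 1 n" using mn k by (intro edge_hom) auto
    have h1: "in_hom (simplex_upto 2) (hub 1 0) 0 1" "in_hom (simplex_upto 2) (hub 1 1) 0 1"
      by (auto intro: hub_hom)
    have c: "Cmp (simplex_upto 2) a (hub m m) = hub n (vertex_map a m)" by (rule cmp_hub[OF a order_refl])
    show "nat_iso (nerve_cat adj n) D (Leg (cocone_of s) n) (fcomp (Leg (cocone_of s) m) (nerve_map adj a)) (LegIso (cocone_of s) a)"
      unfolding nat_iso_def
    proof (intro conjI allI impI ballI)
      show "is_functor (nerve_cat adj n) D (Leg (cocone_of s) n)" by (rule leg[OF mn(2)])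
      show "is_functor (nerve_cat adj n) D (fcomp (Leg (cocone_of s) m) (nerve_map adj a))"
        by (rule functor_fcomp[OF nerve_map_functor[OF a] leg[OF mn(1)]])
    next
      fix Fs assume "Fs \<in> Ob (nerve_cat adj n)"
      then have Fs: "cyclic_list adj n Fs" by (simp add: nerve_sel)
      obtain A B where AB: "pull (edge n (vertex_map a m) n) Fs = [A, B]" "loop_pair A B"
        "pull (hub n n) Fs = [adj_comp A B]" "pull (hub n (vertex_map a m)) Fs = [adj_comp B A]"
        by (rule edge_pair[OF k order_refl one_le_numeral mn(2) Fs])
      have "pull (hub m m) (pull a Fs) = [adj_comp B A]" using pull_comp[OF a hm Fs] c AB(4) by simp
      then show "in_hom D (LegIso (cocone_of s) a Fs) (FOb (Leg (cocone_of s) n) Fs)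
          (FOb (fcomp (Leg (cocone_of s) m) (nerve_map adj a)) Fs)" "is_iso D (LegIso (cocone_of s) a Fs)"
        using t_sw[OF AB(2)] cocone_of_iso[OF a AB(1)] cocone_of_ob[OF Fs] AB(3)
          cocone_of_ob[OF pull_cyclic(1)[OF a Fs]] nerve_map_ob[OF a Fs] by (simp_all add: fcomp_def)
    next
      fix as Fs Gs assume "in_hom (nerve_cat adj n) as Fs Gs"
      then have as: "as \<in> Ar (nerve_cat adj n)" and FG: "doms as = Fs" "cods as = Gs" by (auto simp: nerve_hom_iff)
      have "pull2 (edge n (vertex_map a m) n) as \<in> Ar (nerve_cat adj 1)"
        using functorD(7)[OF nerve_map_functor[OF he] as] nerve_map_ar(1)[OF he as] by simp
      then obtain x y where xy: "pull2 (edge n (vertex_map a m) n) as = [x, y]"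
        "hom2 x (Dom adj_two_cells x) (Cod adj_two_cells x)" "hom2 y (Dom adj_two_cells y) (Cod adj_two_cells y)"
        "loop_pair (Dom adj_two_cells x) (Dom adj_two_cells y)" by (rule nerve_1_arE)
      have p: "pull (edge n (vertex_map a m) n) Fs = [Dom adj_two_cells x, Dom adj_two_cells y]"
        "pull (edge n (vertex_map a m) n) Gs = [Cod adj_two_cells x, Cod adj_two_cells y]"
        using pull2_hom(2,3)[OF he as] xy(1) FG by simp_all
      have am: "pull2 a as \<in> Ar (nerve_cat adj m)"
        using functorD(7)[OF nerve_map_functor[OF a] as] nerve_map_ar(1)[OF a as] by simp
      have "pull2 (hub m m) (pull2 a as) = [y \<star> x]" "pull2 (hub n n) as = [x \<star> y]"
        using pull2_comp[OF a hm as] c pull2_comp[OF he h1(1) as] pull2_comp[OF he h1(2) as] edge_hub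
          pull2_hub_1[OF xy(2,3)] xy(1) by simp_all
      then show "Cmp D (FAr (fcomp (Leg (cocone_of s) m) (nerve_map adj a)) as) (LegIso (cocone_of s) a Fs) =
          Cmp D (LegIso (cocone_of s) a Gs) (FAr (Leg (cocone_of s) n) as)"
        using cocone_of_ar[OF as] cocone_of_ar[OF am] cocone_of_iso[OF a p(1)] cocone_of_iso[OF a p(2)]
          nerve_map_ar(1)[OF a as] t_nat[OF xy(2-4)] by (simp add: fcomp_def)
    qed
  next
    fix n Fs assume n: "n \<in> {..2::nat}" and "Fs \<in> {Fs. cyclic_list adj n Fs}"
    then have Fs: "cyclic_list adj n Fs" by simp
    have i: "in_hom (simplex_upto 2) (Idt (simplex_upto 2) n) n n" "vertex_map (Idt (simplex_upto 2) n) n = n"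
      using n by (simp_all add: simplex_idt_hom) (simp add: simplex_upto_def)
    obtain A B where AB: "pull (edge n n n) Fs = [A, B]" "loop_pair A B" "pull (hub n n) Fs = [adj_comp A B]"
      by (rule edge_pair[OF order_refl order_refl one_le_numeral _ Fs]) (use n in simp)
    have B: "B = adj_unit (adj_tgt A)" and A: "endo A"
    proof -
      have "B = adj_unit (fst B)" using AB(1) by (auto simp: pull_edge adj_unit_def)
      then show "B = adj_unit (adj_tgt A)" using AB(2) by (simp add: loop_pair_def)
      then show "endo A" using AB(2) by (auto simp: loop_pair_def endo_def)
    qed
    have "LegIso (cocone_of s) (Idt (simplex_upto 2) n) Fs = Idt D (FOb (Leg (cocone_of s) n) Fs)"
      using cocone_of_iso[OF i(1), of Fs A B] i(2) AB sw_unit[OF A, of "adj_tgt A"] A B cocone_of_ob[OF Fs]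
      by (simp add: endo_def)
    also have "\<dots> = FAr (Leg (cocone_of s) n) (Idt (nerve_cat adj n) Fs)"
      using functorD(5)[OF leg[of n]] Fs n by (simp add: nerve_sel)
    finally show "LegIso (cocone_of s) (Idt (simplex_upto 2) n) Fs = FAr (Leg (cocone_of s) n) (map ide Fs)"
      by (simp add: nerve_sel)
  next
    fix a b :: smap and k m n Fs
    assume b: "in_hom (simplex_upto 2) b k m" and a: "in_hom (simplex_upto 2) a m n"
      and "Fs \<in> {Fs. cyclic_list adj n Fs}"
    then have Fs: "cyclic_list adj n Fs" by simp
    let ?c = "Cmp (simplex_upto 2) a b" and ?p = "vertex_map a m"
    have kn: "k \<le> 2" "m \<le> 2" "n \<le> 2" using a b by (auto simp: simplex_hom)
    have c: "in_hom (simplex_upto 2) ?c k n" and ck: "vertex_map ?c k = vertex_map a (vertex_map b k)"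
      using a b by (auto simp: simplex_hom simplex_cmp compose_def mono_on_def PiE_def Pi_def)
    let ?q = "vertex_map a (vertex_map b k)"
    have bk: "vertex_map b k \<le> m" using simplex_mono[OF b] by auto
    have qp: "?q \<le> ?p" "?p \<le> n" using simplex_mono[OF a bk order_refl] by auto
    define A where "A = glue (adj_tgt (Fs ! n)) (map (nth Fs) [0..<Suc ?q])"
    define B where "B = glue (adj_tgt (Fs ! ?q)) (map (nth Fs) [Suc ?q..<Suc ?p])"
    define C where "C = glue (adj_tgt (Fs ! ?p)) (map (nth Fs) [Suc ?p..<Suc n])"
    have ch: "chain (adj_tgt (Fs ! n)) (map (nth Fs) [0..<Suc ?q]) (adj_tgt (Fs ! ?q))"
      "chain (adj_tgt (Fs ! ?q)) (map (nth Fs) [Suc ?q..<Suc ?p]) (adj_tgt (Fs ! ?p))"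
      "chain (adj_tgt (Fs ! ?p)) (map (nth Fs) [Suc ?p..<Suc n]) (adj_tgt (Fs ! n))"
      using cyclic_chain[OF Fs] qp by (auto simp del: upt_Suc)
    have ABC: "A \<in> adj_cells" "B \<in> adj_cells" "C \<in> adj_cells" "adj_tgt A = fst B" "adj_tgt B = fst C" "adj_tgt C = fst A"
      using ch[THEN chain_glue] by (simp_all add: A_def B_def C_def del: upt_Suc)
    have p: "pull (edge n ?q n) Fs = [A, adj_comp B C]" "pull (edge n ?p n) Fs = [adj_comp A B, C]"
      "pull (edge n ?q ?p) Fs = [adj_comp C A, B]"
      using qp upt_glue[OF qp] upt_glue0[OF qp(1)]
      by (simp_all add: pull_edge A_def B_def C_def glue_append[symmetric] map_append[symmetric] del: upt_Suc map_append)
    have eb: "in_hom (simplex_upto 2) (edge m (vertex_map b k) m) 1 m" using bk kn by (intro edge_hom) auto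
    have pb: "pull (edge m (vertex_map b k) m) (pull a Fs) = [adj_comp C A, B]"
      using pull_comp[OF a eb Fs] cmp_edge[OF a bk order_refl] p(3) by simp
    have l: "loop_pair (adj_comp C A) B" "loop_pair (adj_comp A B) C"
      using ABC adj_comp_cell by (auto simp: loop_pair_def)
    have "LegIso (cocone_of s) ?c Fs = Cmp D (LegIso (cocone_of s) b (pull a Fs)) (LegIso (cocone_of s) a Fs)"
      using cocone_of_iso[OF c, of Fs A "adj_comp B C"] cocone_of_iso[OF a p(2)] cocone_of_iso[OF b pb] ck p(1)
        t_cocycle[OF ABC] by simp
    also have "\<dots> = Cmp D (FAr (Leg (cocone_of s) k) (map ide (pull ?c Fs)))
       (Cmp D (LegIso (cocone_of s) b (pull a Fs)) (LegIso (cocone_of s) a Fs))"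
    proof -
      have cy: "cyclic_list adj k (pull ?c Fs)" by (rule pull_cyclic(1)[OF c Fs])
      have hk: "in_hom (simplex_upto 2) (hub k k) 0 k" using kn by (intro hub_hom) auto
      obtain A' B' where "pull (edge m (vertex_map b k) m) (pull a Fs) = [A', B']"
        "pull (hub m (vertex_map b k)) (pull a Fs) = [adj_comp B' A']"
        by (rule edge_pair[OF bk order_refl one_le_numeral kn(2) pull_cyclic(1)[OF a Fs]])
      then have "pull (hub k k) (pull ?c Fs) = [adj_comp B (adj_comp C A)]"
        using pull_comp[OF b hk pull_cyclic(1)[OF a Fs]] pull_comp[OF a b Fs] cmp_hub[OF b order_refl] pb by simp
      then have "FAr (Leg (cocone_of s) k) (map ide (pull ?c Fs)) = Idt D (TOb s (adj_comp B (adj_comp C A)))"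
        using functorD(5)[OF leg[OF kn(1)], of "pull ?c Fs"] cy cocone_of_ob[OF cy] by (simp add: nerve_sel)
      then show ?thesis
        using sw_sel[OF l(1)] sw_sel[OF l(2)] cocone_of_iso[OF a p(2)] cocone_of_iso[OF b pb]
        by (simp add: cmp_sel unit_laws adj_comp_assoc)
    qed
    finally show "LegIso (cocone_of s) ?c Fs = Cmp D (FAr (Leg (cocone_of s) k) (PComp (cyclic_nerve adj) a b Fs))
       (Cmp D (LegIso (cocone_of s) b (FOb (nerve_map adj a) Fs)) (LegIso (cocone_of s) a Fs))"
      using nerve_compositor[OF a b Fs] nerve_map_ob[OF a Fs] by simp
  qed
qed

lemma trace_of_cocone_of: "same_trace (trace_of D (cocone_of s)) s"
proof -
  have h: "in_hom (simplex_upto 2) (hub 1 0) 0 1" "in_hom (simplex_upto 2) (hub 1 1) 0 1" by (auto intro: hub_hom)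
  show ?thesis unfolding same_trace_def
  proof (intro conjI allI impI)
    fix F assume "endo F"
    then show "TOb (trace_of D (cocone_of s)) F = TOb s F"
      using cocone_of_ob[of 0 "[F]"] pull_hub_0[of F] by (simp add: trace_of_def hh_ob_def cyclic_list_0)
  next
    fix a F G assume "hom2 a F G" "endo F"
    from nerve_0_hom[OF this] pull2_hub_0[OF this] show "TAr (trace_of D (cocone_of s)) a = TAr s a"
      using cocone_of_ar[of "[a]" 0] by (simp add: trace_of_def hh_ar_def nerve_hom_iff)
  next
    fix F G assume l: "loop_pair F G"
    have p: "pull (edge 1 0 1) [F, G] = [F, G]" "pull (edge 1 1 1) [F, G] = [adj_comp F G, adj_unit (fst F)]"
      using l by (cases F; cases G; simp add: pull_edge loop_pair_def glue_def upt_rec adj_unit_def)+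
    have "LegIso (cocone_of s) (hub 1 0) [F, G] = TSw s F G"
      "LegIso (cocone_of s) (hub 1 1) [F, G] = TSw s (adj_comp F G) (adj_unit (fst F))"
      using cocone_of_iso[OF h(1), of "[F, G]"] cocone_of_iso[OF h(2), of "[F, G]"] p by (simp_all add: hub_def)
    moreover have "TSw s (adj_comp F G) (adj_unit (fst F)) = Idt D (TOb s (adj_comp F G))"
      by (rule sw_unit[OF endo_comp[OF l]]) (simp add: adj_comp_def)
    moreover have ob: "TOb s (adj_comp F G) \<in> Ob D" by (rule t_ob[OF endo_comp[OF l]])
    moreover have "inv_ar D (Idt D (TOb s (adj_comp F G))) = Idt D (TOb s (adj_comp F G))"
      by (rule inv_ar_eq) (simp add: inverse_pair_def in_hom_def idt_sel unit_laws ob)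
    ultimately show "TSw (trace_of D (cocone_of s)) F G = TSw s F G"
      using sw_sel[OF l] by (simp add: trace_of_def hh_swap_def face_hub[unfolded One_nat_def] unit_laws)
  qed
qed

end

lemma pull_hub_endo:
  assumes "k \<le> n" "cyclic_list adj n Fs"
  obtains T where "pull (hub n k) Fs = [T]" "endo T"
proof -
  have "cyclic_list adj 0 (pull (hub n k) Fs)"
    by (rule pull_cyclic(1)[OF hub_hom[OF assms(1) order_refl] assms(2)])
  then show ?thesis using that by (auto simp: cyclic_list_0)
qed

lemma nat_isoD:
  assumes "nat_iso C D F G \<eta>"
  shows "is_functor C D F" "is_functor C D G"
    "x \<in> Ob C \<Longrightarrow> in_hom D (\<eta> x) (FOb F x) (FOb G x)" "x \<in> Ob C \<Longrightarrow> is_iso D (\<eta> x)"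
    "in_hom C h x y \<Longrightarrow> Cmp D (FAr G h) (\<eta> x) = Cmp D (\<eta> y) (FAr F h)"
  using assms unfolding nat_iso_def by blast+

lemma cocone_isoD:
  assumes "cocone_iso J P D L M \<mu>"
  shows "j \<in> Ob J \<Longrightarrow> nat_iso (PCat P j) D (Leg L j) (Leg M j) (\<mu> j)"
    "in_hom J a i j \<Longrightarrow> x \<in> Ob (PCat P j) \<Longrightarrow>
      Cmp D (LegIso M a x) (\<mu> j x) = Cmp D (\<mu> i (FOb (PMap P a) x)) (LegIso L a x)"
  using assms unfolding cocone_iso_def by blast+

text \<open>
  Compatibility with the swap follows from compatibility with the two faces of level \<open>1\<close>, because the
  swap is the quotient of their isomorphisms.
\<close>

lemma trace_iso_of_cocone_iso:
  assumes L: "cyclic_cocone D L" and M: "cyclic_cocone D M"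
    and \<nu>: "cocone_iso (simplex_upto 2) (cyclic_nerve adj) D L M \<nu>"
  shows "trace_iso D (trace_of D L) (trace_of D M) (\<lambda>F. \<nu> 0 [F])"
proof -
  interpret L: cyclic_cocone D L by fact
  interpret M: cyclic_cocone D M by fact
  note n = cocone_isoD(1)[OF \<nu>, unfolded nerve_sel]
  have nu: "\<nu> n Fs \<in> Ar D" "Dom D (\<nu> n Fs) = FOb (Leg L n) Fs" "Cod D (\<nu> n Fs) = FOb (Leg M n) Fs"
    "is_iso D (\<nu> n Fs)" if "n \<le> 2" "cyclic_list adj n Fs" for n Fs
    using nat_isoD(3,4)[OF n, of n Fs] that by (auto simp: in_hom_def nerve_sel)
  have compat: "Cmp D (LegIso M a Fs) (\<nu> n Fs) = Cmp D (\<nu> m (pull a Fs)) (LegIso L a Fs)"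
    if "in_hom (simplex_upto 2) a m n" "cyclic_list adj n Fs" for a m n Fs
    using cocone_isoD(2)[OF \<nu> that(1), unfolded nerve_sel] that nerve_map_ob[OF that] by simp
  show ?thesis unfolding trace_iso_def
  proof (intro conjI allI impI)
    fix F assume "endo F"
    then show "in_hom D (\<nu> 0 [F]) (TOb (trace_of D L) F) (TOb (trace_of D M) F)" "is_iso D (\<nu> 0 [F])"
      using nu[of 0 "[F]"] by (simp_all add: in_hom_def trace_of_def hh_ob_def cyclic_list_0)
  next
    fix a F G assume "hom2 a F G" "endo F"
    from nat_isoD(5)[OF n nerve_0_hom[OF this]]
    show "Cmp D (TAr (trace_of D M) a) (\<nu> 0 [F]) = Cmp D (\<nu> 0 [G]) (TAr (trace_of D L) a)"
      by (simp add: trace_of_def hh_ar_def)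
  next
    fix F G assume l: "loop_pair F G"
    have h: "in_hom (simplex_upto 2) (hub 1 0) 0 1" "in_hom (simplex_upto 2) (hub 1 1) 0 1" by (auto intro: hub_hom)
    have c: "cyclic_list adj 1 [F, G]" using l cyclic_list_1 by blast
    have z: "cyclic_list adj 0 [adj_comp F G]" "cyclic_list adj 0 [adj_comp G F]"
      using endo_comp[OF l] endo_comp[OF loop_pair_sym[OF l]] by (simp_all add: cyclic_list_0)
    note lL = L.leg_iso[OF h(2) c] and lM = M.leg_iso[OF h(2) c] and kL = L.leg_iso[OF h(1) c]
    note e0 = compat[OF h(1) c, unfolded pull_hub_1[OF l]] and e1 = compat[OF h(2) c, unfolded pull_hub_1[OF l]]
    note nz = nu[OF _ z(1)] nu[OF _ z(2)] nu[OF one_le_numeral c]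
    show "Cmp D (TSw (trace_of D M) F G) (\<nu> 0 [adj_comp F G]) = Cmp D (\<nu> 0 [adj_comp G F]) (TSw (trace_of D L) F G)"
    proof (rule L.iso_epi[OF lL(4)])
      have "Cmp D (Cmp D (hh_swap D M F G) (\<nu> 0 [adj_comp F G])) (LegIso L (hub 1 1) [F, G]) =
          Cmp D (hh_swap D M F G) (Cmp D (LegIso M (hub 1 1) [F, G]) (\<nu> 1 [F, G]))"
        unfolding e1 using M.swap_sel[OF l] nz lL pull_hub_1[OF l] by (simp add: L.assoc hh_ob_def)
      also have "\<dots> = Cmp D (Cmp D (hh_swap D M F G) (LegIso M (hub 1 1) [F, G])) (\<nu> 1 [F, G])"
        using M.swap_sel[OF l] nz lM pull_hub_1[OF l] by (simp add: L.assoc hh_ob_def)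
      also have "\<dots> = Cmp D (\<nu> 0 [adj_comp G F]) (Cmp D (hh_swap D L F G) (LegIso L (hub 1 1) [F, G]))"
        unfolding M.swap_hub[OF l] L.swap_hub[OF l] e0 ..
      also have "\<dots> = Cmp D (Cmp D (\<nu> 0 [adj_comp G F]) (hh_swap D L F G)) (LegIso L (hub 1 1) [F, G])"
        using L.swap_sel[OF l] nz lL pull_hub_1[OF l] by (simp add: L.assoc hh_ob_def)
      finally show "Cmp D (Cmp D (TSw (trace_of D M) F G) (\<nu> 0 [adj_comp F G])) (LegIso L (hub 1 1) [F, G]) =
          Cmp D (Cmp D (\<nu> 0 [adj_comp G F]) (TSw (trace_of D L) F G)) (LegIso L (hub 1 1) [F, G])"
        by (simp add: trace_of_def)
    qed (use M.swap_sel[OF l] L.swap_sel[OF l] nz lL pull_hub_1[OF l] in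
        \<open>simp_all add: trace_of_def L.cmp_sel hh_ob_def\<close>)
  qed
qed

text \<open>
  An isomorphism of cocones is determined on level \<open>0\<close>: on level \<open>n\<close> it has to be the conjugate by the
  isomorphism of \<open>hub n n\<close>. Compatibility with a general simplicial map then reduces to compatibility with the
  swap of the two arcs.
\<close>

lemma cocone_iso_of_trace_iso:
  assumes L: "cyclic_cocone D L" and M: "cyclic_cocone D M"
    and \<mu>: "trace_iso D (trace_of D L) (trace_of D M) \<mu>"
  shows "\<exists>\<nu>. cocone_iso (simplex_upto 2) (cyclic_nerve adj) D L M \<nu> \<and> (\<forall>F. endo F \<longrightarrow> \<nu> 0 [F] = \<mu> F)"
proof -
  interpret L: cyclic_cocone D L by fact
  interpret M: cyclic_cocone D M by fact
  define \<nu> where "\<nu> n Fs = Cmp D (inv_ar D (LegIso M (hub n n) Fs))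
      (Cmp D (\<mu> (hd (pull (hub n n) Fs))) (LegIso L (hub n n) Fs))" for n Fs
  have m: "\<mu> F \<in> Ar D" "Dom D (\<mu> F) = FOb (Leg L 0) [F]" "Cod D (\<mu> F) = FOb (Leg M 0) [F]" "is_iso D (\<mu> F)"
    if "endo F" for F using trace_isoD(1-4)[OF \<mu> that] by (simp_all add: trace_of_def hh_ob_def)
  have hn: "in_hom (simplex_upto 2) (hub n n) 0 n" if "n \<le> 2" for n using that by (intro hub_hom) auto
  have nu: "\<nu> n Fs \<in> Ar D \<and> Dom D (\<nu> n Fs) = FOb (Leg L n) Fs \<and> Cod D (\<nu> n Fs) = FOb (Leg M n) Fs \<and> is_iso D (\<nu> n Fs)"
    and nu_eq: "Cmp D (LegIso M (hub n n) Fs) (\<nu> n Fs) = Cmp D (\<mu> (hd (pull (hub n n) Fs))) (LegIso L (hub n n) Fs)"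
    if n: "n \<le> 2" and Fs: "cyclic_list adj n Fs" for n Fs
  proof -
    obtain T where T: "pull (hub n n) Fs = [T]" "endo T" by (rule pull_hub_endo[OF order_refl Fs])
    show "\<nu> n Fs \<in> Ar D \<and> Dom D (\<nu> n Fs) = FOb (Leg L n) Fs \<and> Cod D (\<nu> n Fs) = FOb (Leg M n) Fs \<and> is_iso D (\<nu> n Fs)"
      "Cmp D (LegIso M (hub n n) Fs) (\<nu> n Fs) = Cmp D (\<mu> (hd (pull (hub n n) Fs))) (LegIso L (hub n n) Fs)"
      using m[OF T(2)] T(1) L.leg_iso[OF hn[OF n] Fs] M.leg_iso[OF hn[OF n] Fs]
      by (simp_all add: \<nu>_def L.cats L.iso_cmp)
  qed
  have "cocone_iso (simplex_upto 2) (cyclic_nerve adj) D L M \<nu>"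
    unfolding cocone_iso_def nerve_sel
  proof (intro conjI allI impI ballI)
    fix n :: nat assume "n \<in> {..2}"
    then have n: "n \<le> 2" by simp
    show "nat_iso (nerve_cat adj n) D (Leg L n) (Leg M n) (\<nu> n)"
      unfolding nat_iso_def nerve_sel
    proof (intro conjI allI impI ballI L.leg[OF n] M.leg[OF n])
      fix Fs assume "Fs \<in> {Fs. cyclic_list adj n Fs}"
      then show "in_hom D (\<nu> n Fs) (FOb (Leg L n) Fs) (FOb (Leg M n) Fs)" "is_iso D (\<nu> n Fs)"
        using nu[OF n] by (auto simp: in_hom_def)
    next
      fix as Fs Gs assume h: "in_hom (nerve_cat adj n) as Fs Gs"
      then have as: "as \<in> Ar (nerve_cat adj n)" and FG: "doms as = Fs" "cods as = Gs" by (auto simp: nerve_hom_iff)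
      interpret N: category "nerve_cat adj n" by (rule nerve_category)
      have cy: "cyclic_list adj n Fs" "cyclic_list adj n Gs"
        using N.dom_ob[OF as] N.cod_ob[OF as] h by (auto simp: in_hom_def nerve_sel)
      have "pull2 (hub n n) as \<in> Ar (nerve_cat adj 0)"
        using functorD(7)[OF nerve_map_functor[OF hn[OF n]] as] nerve_map_ar(1)[OF hn[OF n] as] by simp
      then obtain x where x: "pull2 (hub n n) as = [x]" "hom2 x (Dom adj_two_cells x) (Cod adj_two_cells x)"
        "endo (Dom adj_two_cells x)" by (rule nerve_0_arE)
      have p: "pull (hub n n) Fs = [Dom adj_two_cells x]" "pull (hub n n) Gs = [Cod adj_two_cells x]"
        using pull2_hom(2,3)[OF hn[OF n] as] x FG by simp_all
      note e = endo_hom2[OF x(2,3)]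
      have ef: "Cmp D (hh_ar M x) (\<mu> (Dom adj_two_cells x)) = Cmp D (\<mu> (Cod adj_two_cells x)) (hh_ar L x)"
        using trace_isoD(5)[OF \<mu> x(2,3)] by (simp add: trace_of_def)
      have lL: "Cmp D (hh_ar L x) (LegIso L (hub n n) Fs) = Cmp D (LegIso L (hub n n) Gs) (FAr (Leg L n) as)"
        and lM: "Cmp D (hh_ar M x) (LegIso M (hub n n) Fs) = Cmp D (LegIso M (hub n n) Gs) (FAr (Leg M n) as)"
        using L.leg_nat[OF hn[OF n] as] M.leg_nat[OF hn[OF n] as] x(1) FG by (simp_all add: hh_ar_def)
      have t: "in_hom D (hh_ar L x) (FOb (Leg L 0) [Dom adj_two_cells x]) (FOb (Leg L 0) [Cod adj_two_cells x])"
        "in_hom D (hh_ar M x) (FOb (Leg M 0) [Dom adj_two_cells x]) (FOb (Leg M 0) [Cod adj_two_cells x])"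
        using functorD(4)[OF L.leg nerve_0_hom[OF x(2,3)]] functorD(4)[OF M.leg nerve_0_hom[OF x(2,3)]]
        by (simp_all add: hh_ar_def)
      note fL = functorD(4)[OF L.leg[OF n] h] and fM = functorD(4)[OF M.leg[OF n] h]
      note iL = L.leg_iso[OF hn[OF n] cy(1)] L.leg_iso[OF hn[OF n] cy(2)]
        and iM = M.leg_iso[OF hn[OF n] cy(1)] M.leg_iso[OF hn[OF n] cy(2)]
      note nF = nu[OF n cy(1)] nu[OF n cy(2)] and qF = nu_eq[OF n cy(1), unfolded p list.sel] nu_eq[OF n cy(2), unfolded p list.sel]
      note typing_facts = t fL fM iL iM nF m[OF x(3)] m[OF e] p
      show "Cmp D (FAr (Leg M n) as) (\<nu> n Fs) = Cmp D (\<nu> n Gs) (FAr (Leg L n) as)"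
      proof (rule L.iso_mono[OF iM(8)])
        have "Cmp D (LegIso M (hub n n) Gs) (Cmp D (FAr (Leg M n) as) (\<nu> n Fs)) =
            Cmp D (hh_ar M x) (Cmp D (LegIso M (hub n n) Fs) (\<nu> n Fs))"
          by (rule L.pre[OF lM[symmetric]]) (use typing_facts in \<open>simp_all add: in_hom_def\<close>)
        also have "\<dots> = Cmp D (\<mu> (Cod adj_two_cells x)) (Cmp D (hh_ar L x) (LegIso L (hub n n) Fs))"
          unfolding qF by (rule L.pre[OF ef]) (use typing_facts in \<open>simp_all add: in_hom_def\<close>)
        also have "\<dots> = Cmp D (Cmp D (\<mu> (Cod adj_two_cells x)) (LegIso L (hub n n) Gs)) (FAr (Leg L n) as)"
          unfolding lL using typing_facts by (simp add: in_hom_def L.assoc)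
        also have "\<dots> = Cmp D (LegIso M (hub n n) Gs) (Cmp D (\<nu> n Gs) (FAr (Leg L n) as))"
          unfolding qF(2)[symmetric] using typing_facts by (simp add: in_hom_def L.assoc)
        finally show "Cmp D (LegIso M (hub n n) Gs) (Cmp D (FAr (Leg M n) as) (\<nu> n Fs)) =
            Cmp D (LegIso M (hub n n) Gs) (Cmp D (\<nu> n Gs) (FAr (Leg L n) as))" .
      qed (use typing_facts in \<open>simp_all add: in_hom_def L.cmp_sel\<close>)
    qed
  next
    fix a :: smap and i n Fs assume a: "in_hom (simplex_upto 2) a i n" and "Fs \<in> {Fs. cyclic_list adj n Fs}"
    then have Fs: "cyclic_list adj n Fs" by simp
    have ni: "n \<le> 2" "i \<le> 2" using a by (auto simp: simplex_hom)
    let ?k = "vertex_map a i"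
    have k: "?k \<le> n" using simplex_mono[OF a] by auto
    note Gs = pull_cyclic(1)[OF a Fs]
    have c: "Cmp (simplex_upto 2) a (hub i i) = hub n ?k" by (rule cmp_hub[OF a order_refl])
    have hk: "in_hom (simplex_upto 2) (hub n ?k) 0 n" using k ni by (intro hub_hom) auto
    obtain A B where AB: "pull (edge n ?k n) Fs = [A, B]" "loop_pair A B"
      "pull (hub n n) Fs = [adj_comp A B]" "pull (hub n ?k) Fs = [adj_comp B A]"
      by (rule trace.edge_pair[OF L.trace_of_cocone k order_refl one_le_numeral ni(1) Fs])
    have p: "pull (hub i i) (pull a Fs) = [adj_comp B A]" using pull_comp[OF a hn[OF ni(2)] Fs] c AB by simp
    note eL = L.swap_edge[OF k order_refl ni(1) Fs AB(1)] and eM = M.swap_edge[OF k order_refl ni(1) Fs AB(1)]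
    note fL = L.leg_iso_cmp[OF a hn[OF ni(2)] Fs, unfolded c] and fM = M.leg_iso_cmp[OF a hn[OF ni(2)] Fs, unfolded c]
    have sw: "Cmp D (hh_swap D M A B) (\<mu> (adj_comp A B)) = Cmp D (\<mu> (adj_comp B A)) (hh_swap D L A B)"
      using trace_isoD(6)[OF \<mu> AB(2)] by (simp add: trace_of_def)
    note q = nu_eq[OF ni(1) Fs, unfolded AB list.sel] nu_eq[OF ni(2) Gs, unfolded p list.sel]
    note typing_facts = L.leg_iso[OF a Fs] M.leg_iso[OF a Fs] L.leg_iso[OF hn[OF ni(1)] Fs] M.leg_iso[OF hn[OF ni(1)] Fs]
      L.leg_iso[OF hn[OF ni(2)] Gs] M.leg_iso[OF hn[OF ni(2)] Gs] nu[OF ni(1) Fs] nu[OF ni(2) Gs]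
      m[OF endo_comp[OF AB(2)]] m[OF endo_comp[OF loop_pair_sym[OF AB(2)]]] L.swap_sel[OF AB(2)] M.swap_sel[OF AB(2)]
      L.leg_iso[OF hk Fs] M.leg_iso[OF hk Fs] AB p
    have "Cmp D (LegIso M a Fs) (\<nu> n Fs) = Cmp D (\<nu> i (pull a Fs)) (LegIso L a Fs)"
    proof (rule L.iso_mono[OF M.leg_iso(4)[OF hn[OF ni(2)] Gs]])
      have "Cmp D (LegIso M (hub i i) (pull a Fs)) (Cmp D (LegIso M a Fs) (\<nu> n Fs)) =
          Cmp D (hh_swap D M A B) (Cmp D (LegIso M (hub n n) Fs) (\<nu> n Fs))"
        by (rule L.pre[OF fM[symmetric, folded eM]]) (use typing_facts in \<open>simp_all add: hh_ob_def\<close>)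
      also have "\<dots> = Cmp D (\<mu> (adj_comp B A)) (Cmp D (hh_swap D L A B) (LegIso L (hub n n) Fs))"
        unfolding q by (rule L.pre[OF sw]) (use typing_facts in \<open>simp_all add: hh_ob_def\<close>)
      also have "\<dots> = Cmp D (Cmp D (\<mu> (adj_comp B A)) (LegIso L (hub i i) (pull a Fs))) (LegIso L a Fs)"
        unfolding eL fL using typing_facts by (simp add: L.assoc)
      also have "\<dots> = Cmp D (LegIso M (hub i i) (pull a Fs)) (Cmp D (\<nu> i (pull a Fs)) (LegIso L a Fs))"
        unfolding q(2)[symmetric] using typing_facts by (simp add: L.assoc)
      finally show "Cmp D (LegIso M (hub i i) (pull a Fs)) (Cmp D (LegIso M a Fs) (\<nu> n Fs)) =
        Cmp D (LegIso M (hub i i) (pull a Fs)) (Cmp D (\<nu> i (pull a Fs)) (LegIso L a Fs))" .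
    qed (use typing_facts in \<open>simp_all add: L.cmp_sel\<close>)
    then show "Cmp D (LegIso M a Fs) (\<nu> n Fs) = Cmp D (\<nu> i (FOb (nerve_map adj a) Fs)) (LegIso L a Fs)"
      using nerve_map_ob[OF a Fs] by simp
  qed
  moreover have "\<nu> 0 [F] = \<mu> F" if "endo F" for F
  proof -
    have "LegIso K (hub 0 0) [F] = Idt D (FOb (Leg K 0) [F])" if "cyclic_cocone D K" for K
      using cyclic_cocone.leg_iso_idt[OF that, of 0 "[F]"] \<open>endo F\<close> by (simp add: hub_idt cyclic_list_0)
    from this[OF L] this[OF M] have i: "LegIso L (hub 0 0) [F] = Idt D (FOb (Leg L 0) [F])"
      "LegIso M (hub 0 0) [F] = Idt D (FOb (Leg M 0) [F])" .
    have ob: "FOb (Leg M 0) [F] \<in> Ob D"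
      using functorD(3)[OF M.leg[of 0], of "[F]"] that by (simp add: nerve_sel cyclic_list_0)
    have "inv_ar D (Idt D (FOb (Leg M 0) [F])) = Idt D (FOb (Leg M 0) [F])"
      by (rule L.inv_ar_eq) (simp add: inverse_pair_def in_hom_def L.idt_sel L.unit_laws ob)
    then show ?thesis using i m[OF that] pull_hub_0[OF that] by (simp add: \<nu>_def L.unit_laws)
  qed
  ultimately show ?thesis by blast
qed

lemma push_cocone_sel: "Leg (push_cocone H L) n = fcomp H (Leg L n)"
  "LegIso (push_cocone H L) a x = FAr H (LegIso L a x)"
  by (simp_all add: push_cocone_def)

lemma fcomp_sel: "FOb (fcomp G F) x = FOb G (FOb F x)" "FAr (fcomp G F) h = FAr G (FAr F h)"
  by (simp_all add: fcomp_def)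

lemma fcomp_assoc: "fcomp H (fcomp G F) = fcomp (fcomp H G) F"
  by (simp add: fcomp_def)

lemma push_cyclic_cocone:
  assumes L: "cyclic_cocone C L" and H: "is_functor C D H"
  shows "cyclic_cocone D (push_cocone H L)"
proof -
  interpret L: cyclic_cocone C L by fact
  interpret D: category D by (rule functorD(2)[OF H])
  have "pseudo_cocone (simplex_upto 2) (cyclic_nerve adj) D (push_cocone H L)"
    unfolding pseudo_cocone_def nerve_sel push_cocone_sel
  proof (intro conjI allI impI ballI)
    fix n :: nat assume "n \<in> {..2}"
    then show "is_functor (nerve_cat adj n) D (fcomp H (Leg L n))" using functor_fcomp[OF L.leg H] by simp
  next
    fix a :: smap and m n assume a: "in_hom (simplex_upto 2) a m n"
    note N = L.leg_nat_iso[OF a]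
    show "nat_iso (nerve_cat adj n) D (fcomp H (Leg L n)) (fcomp (fcomp H (Leg L m)) (nerve_map adj a))
        (\<lambda>x. FAr H (LegIso L a x))"
      unfolding nat_iso_def fcomp_assoc[symmetric] push_cocone_sel
    proof (intro conjI allI impI ballI functor_fcomp[OF nat_isoD(1)[OF N] H] functor_fcomp[OF nat_isoD(2)[OF N] H])
      fix Fs assume "Fs \<in> Ob (nerve_cat adj n)"
      then show "in_hom D (FAr H (LegIso L a Fs)) (FOb (fcomp H (Leg L n)) Fs)
          (FOb (fcomp H (fcomp (Leg L m) (nerve_map adj a))) Fs)" "is_iso D (FAr H (LegIso L a Fs))"
        using functorD(4)[OF H nat_isoD(3)[OF N]] functor_iso(1)[OF H nat_isoD(4)[OF N]]
        by (simp_all add: fcomp_sel)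
    next
      fix as Fs Gs assume h: "in_hom (nerve_cat adj n) as Fs Gs"
      interpret N: category "nerve_cat adj n" by (rule nerve_category)
      have ob: "Fs \<in> Ob (nerve_cat adj n)" "Gs \<in> Ob (nerve_cat adj n)"
        using h N.dom_ob N.cod_ob by (auto simp: in_hom_def)
      show "Cmp D (FAr (fcomp H (fcomp (Leg L m) (nerve_map adj a))) as) (FAr H (LegIso L a Fs)) =
        Cmp D (FAr H (LegIso L a Gs)) (FAr (fcomp H (Leg L n)) as)"
        using functorD(6)[OF H nat_isoD(3)[OF N ob(1)] functorD(4)[OF nat_isoD(2)[OF N] h]]
          functorD(6)[OF H functorD(4)[OF nat_isoD(1)[OF N] h] nat_isoD(3)[OF N ob(2)]] nat_isoD(5)[OF N h]
        by (simp add: fcomp_sel)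
    qed
  next
    fix n Fs assume "n \<in> {..2::nat}" "Fs \<in> {Fs. cyclic_list adj n Fs}"
    then show "FAr H (LegIso L (Idt (simplex_upto 2) n) Fs) = FAr (fcomp H (Leg L n)) (map ide Fs)"
      using pseudo_coconeD(3)[OF L.cocone, unfolded nerve_sel] by (simp add: fcomp_sel)
  next
    fix a b :: smap and k m n Fs
    assume b: "in_hom (simplex_upto 2) b k m" and a: "in_hom (simplex_upto 2) a m n"
      and "Fs \<in> {Fs. cyclic_list adj n Fs}"
    then have Fs: "cyclic_list adj n Fs" by simp
    let ?c = "Cmp (simplex_upto 2) a b"
    have k: "k \<le> 2" using b by (simp add: simplex_hom)
    have cy: "cyclic_list adj k (pull ?c Fs)"
      using pull_cyclic(1)[OF b pull_cyclic(1)[OF a Fs]] pull_comp[OF a b Fs] by simp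
    have e: "FAr (Leg L k) (PComp (cyclic_nerve adj) a b Fs) = Idt C (FOb (Leg L k) (pull ?c Fs))"
      using functorD(5)[OF L.leg[OF k], of "pull ?c Fs"] cy nerve_compositor[OF a b Fs] by (simp add: nerve_sel)
    have ob: "FOb (Leg L k) (pull ?c Fs) \<in> Ob C" using functorD(3)[OF L.leg[OF k]] cy by (simp add: nerve_sel)
    note i = L.leg_iso[OF a Fs] L.leg_iso[OF b pull_cyclic(1)[OF a Fs]]
    have "Cmp C (Idt C (FOb (Leg L k) (pull ?c Fs))) (Cmp C (LegIso L b (pull a Fs)) (LegIso L a Fs)) =
        LegIso L ?c Fs"
      using L.leg_iso_cmp[OF a b Fs] i pull_comp[OF a b Fs] by (simp add: L.unit_laws L.cmp_sel)
    then show "FAr H (LegIso L ?c Fs) = Cmp D (FAr (fcomp H (Leg L k)) (PComp (cyclic_nerve adj) a b Fs))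
       (Cmp D (FAr H (LegIso L b (FOb (nerve_map adj a) Fs))) (FAr H (LegIso L a Fs)))"
      unfolding fcomp_sel e nerve_map_ob[OF a Fs]
      using i ob pull_comp[OF a b Fs]
      by (simp add: functor_cmp[OF H, symmetric] L.cmp_sel L.idt_sel)
  qed
  then show ?thesis by unfold_locales
qed

lemma trace_of_push:
  assumes L: "cyclic_cocone C L" and H: "is_functor C D H"
  shows "same_trace (trace_of D (push_cocone H L)) (push_trace H (trace_of C L))"
proof -
  interpret L: cyclic_cocone C L by fact
  have h: "in_hom (simplex_upto 2) (hub 1 0) 0 1" "in_hom (simplex_upto 2) (hub 1 1) 0 1" by (auto intro: hub_hom)
  have "hh_swap D (push_cocone H L) F G = FAr H (hh_swap C L F G)" if l: "loop_pair F G" for F G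
  proof -
    have c: "cyclic_list adj 1 [F, G]" using l cyclic_list_1 by blast
    note i = L.leg_iso[OF h(1) c] L.leg_iso[OF h(2) c]
    show ?thesis unfolding hh_swap_def face_hub push_cocone_sel functor_iso(2)[OF H i(8)]
      using i by (simp add: functor_cmp[OF H, symmetric] L.iso_sel)
  qed
  then show ?thesis
    by (simp add: same_trace_def trace_of_def push_trace_def hh_ob_def hh_ar_def push_cocone_sel fcomp_sel)
qed

section \<open>The universal property in terms of traces\<close>

lemma same_trace_refl: "same_trace s s"
  by (simp add: same_trace_def)

text \<open>
  If every object is a value of the trace \<open>s\<close>, universality of \<open>s\<close> among traces makes its cocone a
  pseudo-colimit; surjectivity gives the uniqueness of the induced natural isomorphism.
\<close>

lemma pseudo_colimit_trace:
  fixes C :: "('c, 'd) cat"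
  assumes s: "trace C s"
    and ex: "\<And>(D :: ('c, 'd) cat) s'. trace D s' \<Longrightarrow> \<exists>H \<mu>. is_functor C D H \<and> trace_iso D (push_trace H s) s' \<mu>"
    and un: "\<And>(D :: ('c, 'd) cat) H K \<mu>. is_functor C D H \<Longrightarrow> is_functor C D K \<Longrightarrow>
      trace_iso D (push_trace H s) (push_trace K s) \<mu> \<Longrightarrow>
      \<exists>\<eta>. nat_iso C D H K \<eta> \<and> (\<forall>F. endo F \<longrightarrow> \<eta> (TOb s F) = \<mu> F)"
    and surj: "\<And>x. x \<in> Ob C \<Longrightarrow> \<exists>F. endo F \<and> TOb s F = x"
  shows "is_biHH adj C (cocone_of s)"
proof -
  interpret s: trace C s by fact
  let ?L = "cocone_of s"
  have cL: "cyclic_cocone C ?L" by unfold_locales (rule s.cocone_of_trace)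
  show ?thesis unfolding is_biHH_def pseudo_colimit_def
  proof (intro conjI allI impI)
    show "category C" by unfold_locales
    show "pseudo_cocone (simplex_upto 2) (cyclic_nerve adj) C ?L" by (rule s.cocone_of_trace)
  next
    fix D :: "('c, 'd) cat" and M assume D: "category D" and M: "pseudo_cocone (simplex_upto 2) (cyclic_nerve adj) D M"
    have cM: "cyclic_cocone D M" using D M by (simp add: cyclic_cocone_def cyclic_cocone_axioms_def)
    obtain H \<mu> where H: "is_functor C D H" "trace_iso D (push_trace H s) (trace_of D M) \<mu>"
      using ex[OF cyclic_cocone.trace_of_cocone[OF cM]] by blast
    have "same_trace (push_trace H s) (trace_of D (push_cocone H ?L))"
    proof -
      have "same_trace (push_trace H s) (push_trace H (trace_of C ?L))"
        using s.trace_of_cocone_of unfolding same_trace_def push_trace_sel by metis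
      moreover have "same_trace (push_trace H (trace_of C ?L)) (trace_of D (push_cocone H ?L))"
        by (rule same_trace_sym[OF trace_of_push[OF cL H(1)]])
      ultimately show ?thesis unfolding same_trace_def by metis
    qed
    then have "trace_iso D (trace_of D (push_cocone H ?L)) (trace_of D M) \<mu>"
      using trace_iso_cong[OF _ same_trace_refl H(2)] by blast
    from cocone_iso_of_trace_iso[OF push_cyclic_cocone[OF cL H(1)] cM this]
    show "\<exists>H \<mu>. is_functor C D H \<and> cocone_iso (simplex_upto 2) (cyclic_nerve adj) D (push_cocone H ?L) M \<mu>"
      using H(1) by blast
  next
    fix D :: "('c, 'd) cat" and H K \<mu>
    assume D: "category D" and H: "is_functor C D H" and K: "is_functor C D K"
      and \<mu>: "cocone_iso (simplex_upto 2) (cyclic_nerve adj) D (push_cocone H ?L) (push_cocone K ?L) \<mu>"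
    interpret D: category D by fact
    have push: "same_trace (trace_of D (push_cocone H ?L)) (push_trace H s)" if H: "is_functor C D H" for H
    proof -
      have "same_trace (push_trace H (trace_of C ?L)) (push_trace H s)"
        using s.trace_of_cocone_of unfolding same_trace_def push_trace_sel by metis
      with trace_of_push[OF cL H] show ?thesis unfolding same_trace_def by metis
    qed
    note cH = push_cyclic_cocone[OF cL H] and cK = push_cyclic_cocone[OF cL K]
    have "trace_iso D (push_trace H s) (push_trace K s) (\<lambda>F. \<mu> 0 [F])"
      by (rule trace_iso_cong[OF push[OF H] push[OF K] trace_iso_of_cocone_iso[OF cH cK \<mu>]])
    from un[OF H K this] obtain \<eta> where \<eta>: "nat_iso C D H K \<eta>" "\<And>F. endo F \<Longrightarrow> \<eta> (TOb s F) = \<mu> 0 [F]" by blast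
    have leg: "\<eta> (FOb (Leg ?L n) Fs) = \<mu> n Fs" if n: "n \<le> 2" and Fs: "cyclic_list adj n Fs" for n Fs
    proof -
      obtain T where T: "pull (hub n n) Fs = [T]" "endo T" by (rule pull_hub_endo[OF order_refl Fs])
      have h: "in_hom (simplex_upto 2) (hub n n) 0 n" using n by (intro hub_hom) auto
      obtain A B where AB: "pull (edge n n n) Fs = [A, B]" "loop_pair A B" "pull (hub n n) Fs = [adj_comp A B]"
        by (rule s.edge_pair[OF order_refl order_refl one_le_numeral n Fs])
      have "B = adj_unit (fst B)" using AB(1) by (auto simp: pull_edge adj_unit_def)
      then have B: "B = adj_unit (fst A)" "endo A"
        using AB(2) by (auto simp: loop_pair_def endo_def) (metis unit_cell(3))+
      then have AT: "A = T" using AB(3) T(1) by (metis adj_comp_unit(1) list.inject)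
      have "LegIso ?L (hub n n) Fs = TSw s A B"
        using s.cocone_of_iso[OF h, of Fs A B] AB(1) by (simp add: hub_def)
      then have i: "LegIso ?L (hub n n) Fs = Idt C (TOb s T)" using s.sw_unit[OF T(2)] B(1) AT by simp
      have ob: "FOb (Leg ?L n) Fs = TOb s T" using s.cocone_of_ob[OF Fs] T(1) by simp
      have "Cmp D (FAr K (Idt C (TOb s T))) (\<mu> n Fs) = Cmp D (\<mu> 0 [T]) (FAr H (Idt C (TOb s T)))"
        using cocone_isoD(2)[OF \<mu> h, unfolded nerve_sel push_cocone_sel, of Fs] Fs
        unfolding nerve_map_ob[OF h Fs] T(1) i by simp
      moreover have "in_hom D (\<mu> n Fs) (FOb H (TOb s T)) (FOb K (TOb s T))"
        using nat_isoD(3)[OF cocone_isoD(1)[OF \<mu>, unfolded nerve_sel], of n Fs] n Fs ob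
        by (simp add: push_cocone_sel fcomp_sel nerve_sel)
      moreover have "in_hom D (\<mu> 0 [T]) (FOb H (TOb s T)) (FOb K (TOb s T))"
        using nat_isoD(3)[OF \<eta>(1) s.t_ob[OF T(2)]] \<eta>(2)[OF T(2)] by simp
      ultimately have "\<mu> n Fs = \<mu> 0 [T]"
        using functorD(5)[OF H] functorD(5)[OF K] s.t_ob[OF T(2)] by (simp add: in_hom_def D.unit_laws)
      then show ?thesis using \<eta>(2)[OF T(2)] ob by simp
    qed
    show "\<exists>\<eta>. nat_iso C D H K \<eta> \<and>
        (\<forall>j\<in>Ob (simplex_upto 2). \<forall>x\<in>Ob (PCat (cyclic_nerve adj) j). \<eta> (FOb (Leg ?L j) x) = \<mu> j x) \<and>
        (\<forall>\<eta>'. nat_iso C D H K \<eta>' \<and>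
          (\<forall>j\<in>Ob (simplex_upto 2). \<forall>x\<in>Ob (PCat (cyclic_nerve adj) j). \<eta>' (FOb (Leg ?L j) x) = \<mu> j x) \<longrightarrow>
          (\<forall>x\<in>Ob C. \<eta>' x = \<eta> x))"
    proof (intro exI[of _ \<eta>] conjI allI impI ballI \<eta>(1))
      show "\<eta> (FOb (Leg ?L j) x) = \<mu> j x"
        if "j \<in> Ob (simplex_upto 2)" "x \<in> Ob (PCat (cyclic_nerve adj) j)" for j x
        using leg that by (simp add: nerve_sel)
    next
      fix \<eta>' x assume e: "nat_iso C D H K \<eta>' \<and>
          (\<forall>j\<in>Ob (simplex_upto 2). \<forall>x\<in>Ob (PCat (cyclic_nerve adj) j). \<eta>' (FOb (Leg ?L j) x) = \<mu> j x)"
        and "x \<in> Ob C"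
      then obtain F where F: "endo F" "TOb s F = x" using surj by blast
      then have "FOb (Leg ?L 0) [F] = x" "cyclic_list adj 0 [F]"
        using s.cocone_of_ob[of 0 "[F]"] pull_hub_0[OF F(1)] by (simp_all add: cyclic_list_0)
      then show "\<eta>' x = \<eta> x" using e leg[of 0 "[F]"] by (auto simp: nerve_sel)
    qed
  qed
qed

lemma biHH_cocone: "is_biHH adj C L \<Longrightarrow> cyclic_cocone C L"
  by (simp add: is_biHH_def pseudo_colimit_def cyclic_cocone_def cyclic_cocone_axioms_def)

text \<open>
  Conversely, the trace of a pseudo-colimit is universal, since cocones and traces have the same
  isomorphisms.
\<close>

lemma biHH_factor:
  fixes C D :: "('c, 'd) cat"
  assumes C: "is_biHH adj C L" and s: "trace D s"
  shows "\<exists>H \<mu>. is_functor C D H \<and> trace_iso D (push_trace H (trace_of C L)) s \<mu>"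
proof -
  interpret s: trace D s by fact
  have cs: "cyclic_cocone D (cocone_of s)" by unfold_locales (rule s.cocone_of_trace)
  obtain H \<mu> where H: "is_functor C D H"
    "cocone_iso (simplex_upto 2) (cyclic_nerve adj) D (push_cocone H L) (cocone_of s) \<mu>"
    using C s.cocone_of_trace s.category_axioms unfolding is_biHH_def pseudo_colimit_def by blast
  note cL = biHH_cocone[OF C]
  have "trace_iso D (push_trace H (trace_of C L)) s (\<lambda>F. \<mu> 0 [F])"
    by (rule trace_iso_cong[OF trace_of_push[OF cL H(1)] s.trace_of_cocone_of
        trace_iso_of_cocone_iso[OF push_cyclic_cocone[OF cL H(1)] cs H(2)]])
  with H(1) show ?thesis by blast
qed

lemma biHH_unique:
  fixes C D :: "('c, 'd) cat"
  assumes C: "is_biHH adj C L" and H: "is_functor C D H" and K: "is_functor C D K"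
    and \<mu>: "trace_iso D (push_trace H (trace_of C L)) (push_trace K (trace_of C L)) \<mu>"
  shows "\<exists>\<eta>. nat_iso C D H K \<eta>"
proof -
  note cL = biHH_cocone[OF C]
  note cH = push_cyclic_cocone[OF cL H] and cK = push_cyclic_cocone[OF cL K]
  have "trace_iso D (trace_of D (push_cocone H L)) (trace_of D (push_cocone K L)) \<mu>"
    by (rule trace_iso_cong[OF same_trace_sym[OF trace_of_push[OF cL H]] same_trace_sym[OF trace_of_push[OF cL K]] \<mu>])
  from cocone_iso_of_trace_iso[OF cH cK this] obtain \<nu> where
    "cocone_iso (simplex_upto 2) (cyclic_nerve adj) D (push_cocone H L) (push_cocone K L) \<nu>" by blast
  then show ?thesis using C H K functorD(2)[OF H] unfolding is_biHH_def pseudo_colimit_def by blast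
qed

section \<open>A trace with values in the coned paracyclic category\<close>

text \<open>
  Objects of the double cone: \<open>None\<close> is terminal, \<open>Some None\<close> is initial and \<open>Some (Some n)\<close> is \<open>[n]\<close>.
\<close>

type_synonym cone_ob = "nat option option"
type_synonym cone_ar = "((nat \<times> (int \<Rightarrow> int) \<times> nat) + nat option) + nat option option"

abbreviation coned :: "(cone_ob, cone_ar) cat" where
  "coned \<equiv> right_cone (left_cone paracyclic)"

text \<open>
  \<open>para_map n m\<close> are the arrows from \<open>[n - 1]\<close> to \<open>[m - 1]\<close>, so that \<open>n\<close> and \<open>m\<close> are the periods.
\<close>

definition para_map :: "nat \<Rightarrow> nat \<Rightarrow> (int \<Rightarrow> int) \<Rightarrow> bool" where
  "para_map n m \<Phi> \<longleftrightarrow> mono \<Phi> \<and> (\<forall>l. \<Phi> (l + int n) = \<Phi> l + int m)"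

text \<open>
  Arrows of the double cone in a uniform format: \<open>\<Phi>\<close> is ignored if \<open>x\<close> or \<open>y\<close> is a cone point. This way
  composition is composition of functions throughout (\<open>coned_cmp\<close>).
\<close>

fun cone_arrow :: "cone_ob \<Rightarrow> cone_ob \<Rightarrow> (int \<Rightarrow> int) \<Rightarrow> cone_ar" where
  "cone_arrow x None \<Phi> = Inr x"
| "cone_arrow (Some None) (Some y) \<Phi> = Inl (Inr y)"
| "cone_arrow (Some (Some n)) (Some (Some m)) \<Phi> = Inl (Inl (n, \<Phi>, m))"
| "cone_arrow _ _ \<Phi> = undefined"

fun cone_map :: "cone_ob \<Rightarrow> cone_ob \<Rightarrow> (int \<Rightarrow> int) \<Rightarrow> bool" where
  "cone_map x None \<Phi> \<longleftrightarrow> True"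
| "cone_map (Some None) (Some y) \<Phi> \<longleftrightarrow> True"
| "cone_map (Some (Some n)) (Some (Some m)) \<Phi> \<longleftrightarrow> para_map (Suc n) (Suc m) \<Phi>"
| "cone_map _ _ \<Phi> \<longleftrightarrow> False"

lemma coned_sel:
  "Ob coned = UNIV"
  "Idt coned x = cone_arrow x x id"
  "Dom coned (Inr x) = x" "Cod coned (Inr x) = None"
  "Dom coned (Inl (Inr y)) = Some None" "Cod coned (Inl (Inr y)) = Some y"
  "Dom coned (Inl (Inl (n, \<Phi>, m))) = Some (Some n)" "Cod coned (Inl (Inl (n, \<Phi>, m))) = Some (Some m)"
proof -
  have u: "insert None (range Some) = (UNIV :: 'a option set)" by (auto simp: UNIV_option_conv)
  show "Ob coned = UNIV"
    by (simp add: right_cone_def left_cone_def op_cat_def paracyclic_def u)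
  show "Idt coned x = cone_arrow x x id"
    by (cases x; cases "the x") (auto simp: right_cone_def left_cone_def op_cat_def paracyclic_def)
qed (simp_all add: right_cone_def left_cone_def op_cat_def paracyclic_def)

lemma coned_ar: "h \<in> Ar coned \<longleftrightarrow> (\<exists>x y \<Phi>. cone_map x y \<Phi> \<and> h = cone_arrow x y \<Phi>)"
proof -
  have u: "insert None (range Some) = (UNIV :: 'a option set)" by (auto simp: UNIV_option_conv)
  have A: "Ar coned = Inl ` (Inl ` {(n, \<Phi>, m). para_map (Suc n) (Suc m) \<Phi>} \<union> range Inr) \<union> range Inr"
    by (simp add: right_cone_def left_cone_def op_cat_def paracyclic_def u para_map_def ac_simps)
  show ?thesis
  proof
    assume "h \<in> Ar coned"
    then consider n \<Phi> m where "h = Inl (Inl (n, \<Phi>, m))" "para_map (Suc n) (Suc m) \<Phi>" | y where "h = Inl (Inr y)"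
      | x where "h = Inr x" unfolding A by auto
    then show "\<exists>x y \<Phi>. cone_map x y \<Phi> \<and> h = cone_arrow x y \<Phi>"
    proof cases
      case 1 then show ?thesis by (intro exI[of _ "Some (Some n)"] exI[of _ "Some (Some m)"] exI[of _ \<Phi>]) simp
    next
      case 2 then show ?thesis by (intro exI[of _ "Some None"] exI[of _ "Some y"] exI[of _ id]) simp
    next
      case 3 then show ?thesis by (intro exI[of _ x] exI[of _ None] exI[of _ id]) simp
    qed
  next
    assume "\<exists>x y \<Phi>. cone_map x y \<Phi> \<and> h = cone_arrow x y \<Phi>"
    then obtain x y \<Phi> where "cone_map x y \<Phi>" "h = cone_arrow x y \<Phi>" by blast
    then show "h \<in> Ar coned" unfolding A by (cases "(x, y, \<Phi>)" rule: cone_arrow.cases) auto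
  qed
qed

lemma cone_arrow_sel: "cone_map x y \<Phi> \<Longrightarrow> Dom coned (cone_arrow x y \<Phi>) = x" "cone_map x y \<Phi> \<Longrightarrow> Cod coned (cone_arrow x y \<Phi>) = y"
  "cone_map x y \<Phi> \<Longrightarrow> cone_arrow x y \<Phi> \<in> Ar coned"
proof -
  assume v: "cone_map x y \<Phi>"
  then show "Dom coned (cone_arrow x y \<Phi>) = x" "Cod coned (cone_arrow x y \<Phi>) = y"
    by (cases "(x, y, \<Phi>)" rule: cone_arrow.cases; simp add: coned_sel)+
  show "cone_arrow x y \<Phi> \<in> Ar coned" using v coned_ar by blast
qed

lemma coned_hom: "in_hom coned h x y \<longleftrightarrow> (\<exists>\<Phi>. cone_map x y \<Phi> \<and> h = cone_arrow x y \<Phi>)"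
  unfolding in_hom_def coned_ar using cone_arrow_sel by metis

lemma cone_map_comp: "cone_map x y \<Phi> \<Longrightarrow> cone_map y z \<Psi> \<Longrightarrow> cone_map x z (\<Psi> \<circ> \<Phi>)"
  by (cases "(x, y, \<Phi>)" rule: cone_arrow.cases; cases "(y, z, \<Psi>)" rule: cone_arrow.cases)
    (auto simp: para_map_def mono_def)

lemma coned_cmp: "cone_map x y \<Phi> \<Longrightarrow> cone_map y z \<Psi> \<Longrightarrow>
    Cmp coned (cone_arrow y z \<Psi>) (cone_arrow x y \<Phi>) = cone_arrow x z (\<Psi> \<circ> \<Phi>)"
  by (cases "(x, y, \<Phi>)" rule: cone_arrow.cases; cases "(y, z, \<Psi>)" rule: cone_arrow.cases)
    (auto simp: right_cone_def left_cone_def op_cat_def paracyclic_def)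

lemma cone_map_id: "cone_map x x id"
  by (cases x rule: option.exhaust; cases "the x") (auto simp: para_map_def mono_def)

lemma cone_arrow_cong: "(\<And>n m. x = Some (Some n) \<Longrightarrow> y = Some (Some m) \<Longrightarrow> \<Phi> = \<Psi>) \<Longrightarrow> cone_arrow x y \<Phi> = cone_arrow x y \<Psi>"
  by (cases "(x, y, \<Phi>)" rule: cone_arrow.cases) auto

lemma category_coned: "category coned"
proof
  fix h assume "h \<in> Ar coned"
  show "Dom coned h \<in> Ob coned" "Cod coned h \<in> Ob coned" by (simp_all add: coned_sel)
next
  fix x :: cone_ob
  show "in_hom coned (Idt coned x) x x" unfolding coned_hom coned_sel using cone_map_id by blast
next
  fix h k and x y z :: cone_ob
  assume "in_hom coned h x y" "in_hom coned k y z"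
  then show "in_hom coned (Cmp coned k h) x z" unfolding coned_hom using coned_cmp cone_map_comp by metis
next
  fix h and x y :: cone_ob
  assume "in_hom coned h x y"
  then obtain \<Phi> where "cone_map x y \<Phi>" "h = cone_arrow x y \<Phi>" unfolding coned_hom by blast
  then show "Cmp coned h (Idt coned x) = h" "Cmp coned (Idt coned y) h = h"
    using coned_cmp[OF cone_map_id] coned_cmp[OF _ cone_map_id] by (simp_all add: coned_sel)
next
  fix h k l and x y z w :: cone_ob
  assume "in_hom coned h x y" "in_hom coned k y z" "in_hom coned l z w"
  then obtain \<Phi> \<Psi> \<Theta> where "cone_map x y \<Phi>" "h = cone_arrow x y \<Phi>" "cone_map y z \<Psi>" "k = cone_arrow y z \<Psi>" "cone_map z w \<Theta>" "l = cone_arrow z w \<Theta>"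
    unfolding coned_hom by blast
  then show "Cmp coned l (Cmp coned k h) = Cmp coned (Cmp coned l k) h"
    using cone_map_comp by (simp add: coned_cmp comp_assoc)
qed

text \<open>
  The lift to the universal cover of a region map between cyclic words with \<open>n\<close> and \<open>m\<close> regions.
\<close>

definition periodic :: "nat \<Rightarrow> nat \<Rightarrow> (nat \<Rightarrow> nat) \<Rightarrow> int \<Rightarrow> int" where
  "periodic n m \<phi> l = int m * (l div int n) + int (\<phi> (nat (l mod int n)))"

lemma periodic_add: "n > 0 \<Longrightarrow> periodic n m \<phi> (l + int n) = periodic n m \<phi> l + int m"
  by (simp add: periodic_def div_add_self2 distrib_left)

lemma periodic_nat: "i < n \<Longrightarrow> periodic n m \<phi> (int i) = int (\<phi> i)"
  by (simp add: periodic_def)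

lemma periodic_mult:
  assumes "\<And>l. \<Phi> (l + int n) = \<Phi> l + int m"
  shows "\<Phi> (l + int n * q) = \<Phi> l + int m * (q :: int)"
proof (induction q rule: int_induct[where k = 0])
  case (step1 i)
  then show ?case using assms[of "l + int n * i"] by (simp add: algebra_simps)
next
  case (step2 i)
  then show ?case using assms[of "l + int n * (i - 1)"] by (simp add: algebra_simps)
qed simp

lemma periodic_unique:
  assumes "n > 0" "\<And>l. \<Phi> (l + int n) = \<Phi> l + int m" "\<And>i. i < n \<Longrightarrow> \<Phi> (int i) = int (\<phi> i)"
  shows "periodic n m \<phi> = \<Phi>"
proof
  fix l
  have r: "\<Phi> (int (nat (l mod int n))) = int (\<phi> (nat (l mod int n)))"
    using assms(1,3) by (simp only: nat_less_iff pos_mod_sign pos_mod_bound of_nat_0_less_iff)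
  have "\<Phi> l = \<Phi> (int (nat (l mod int n)) + int n * (l div int n))" using assms(1) by simp
  also have "\<dots> = int (\<phi> (nat (l mod int n))) + int m * (l div int n)"
    unfolding periodic_mult[of \<Phi> n m, OF assms(2)] r ..
  finally show "periodic n m \<phi> l = \<Phi> l" by (simp add: periodic_def)
qed

lemma periodic_mono:
  assumes "n > 0" "mono \<phi>" "\<And>i. i < n \<Longrightarrow> \<phi> i \<le> m"
  shows "mono (periodic n m \<phi>)"
proof (rule monoI)
  fix k l :: int assume kl: "k \<le> l"
  have r: "nat (x mod int n) < n" for x using assms(1) by (simp add: nat_less_iff)
  consider "k div int n = l div int n" | "k div int n < l div int n"
    using zdiv_mono1[OF kl, of "int n"] assms(1) by fastforce
  then show "periodic n m \<phi> k \<le> periodic n m \<phi> l"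
  proof cases
    case 1
    then have "k mod int n \<le> l mod int n" using kl minus_mult_div_eq_mod[of k "int n"] minus_mult_div_eq_mod[of l "int n"] by simp
    then show ?thesis using 1 assms(2) by (simp add: periodic_def mono_def nat_mono)
  next
    case 2
    have "int m * (k div int n) + int m \<le> int m * (l div int n)"
      using mult_left_mono[of "k div int n + 1" "l div int n" "int m"] 2 by (simp add: algebra_simps)
    moreover have "\<phi> (nat (k mod int n)) \<le> m" using assms(3)[OF r] .
    ultimately show ?thesis by (simp add: periodic_def)
  qed
qed

definition trace_ob :: "adj_cell \<Rightarrow> cone_ob" where
  "trace_ob F = (if gcount F = 0 then (if fst F = Ob0 then Some None else None) else Some (Some (gcount F - 1)))"

text \<open>
  A cyclic word with \<open>n > 0\<close> regions of label \<open>1\<close> becomes \<open>[n - 1]\<close>. Moving \<open>G\<close> to the front of \<open>F * G\<close> increases the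
  index of every region by the number of regions in \<open>G\<close>.
\<close>

definition paracyclic_trace :: "(cone_ob, cone_ar) trace_data" where
  "paracyclic_trace = \<lparr> TOb = trace_ob,
     TAr = (\<lambda>a. let F = Dom adj_two_cells a; G = Cod adj_two_cells a in
       cone_arrow (trace_ob F) (trace_ob G) (periodic (gcount F) (gcount G) (cell_map a))),
     TSw = (\<lambda>F G. cone_arrow (trace_ob (adj_comp F G)) (trace_ob (adj_comp G F)) (\<lambda>l. l + int (gcount G))) \<rparr>"

lemma paracyclic_trace_sel: "TOb paracyclic_trace = trace_ob"
  "hom2 a F G \<Longrightarrow> TAr paracyclic_trace a = cone_arrow (trace_ob F) (trace_ob G) (periodic (gcount F) (gcount G) (cell_map a))"
  "TSw paracyclic_trace F G = cone_arrow (trace_ob (adj_comp F G)) (trace_ob (adj_comp G F)) (\<lambda>l. l + int (gcount G))"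
  by (auto simp: paracyclic_trace_def in_hom_def Let_def)

lemma trace_ob_eq: "trace_ob F = Some (Some n) \<longleftrightarrow> gcount F = Suc n"
  by (auto simp: trace_ob_def)

lemma trace_hom_cases:
  assumes a: "hom2 a F G" and F: "endo F"
  obtains "trace_ob G = None"
    | y where "trace_ob F = Some None" "trace_ob G = Some y"
    | "gcount F > 0" "gcount G > 0"
proof -
  note r = cell_map_region[OF a] and c = hom2_cells[OF a]
  have 1: "gcount G = 0" if "gcount F = 0" "fst F = Ob1"
    using region_mapD(3,4)[OF r] that by simp
  have 2: "gcount F = 0" if "gcount G = 0" "fst F = Ob0"
    using region_mapD(5)[OF r, of 0] that F by (fastforce simp: endo_def)
  show ?thesis
    using 1 2 that c(3) by (cases "fst F"; cases "gcount F = 0"; cases "gcount G = 0") (auto simp: trace_ob_def)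
qed

lemma trace_cone_map:
  assumes a: "hom2 a F G" and F: "endo F"
  shows "cone_map (trace_ob F) (trace_ob G) (periodic (gcount F) (gcount G) (cell_map a))"
proof (cases rule: trace_hom_cases[OF a F])
  case 3
  note r = region_mapD[OF cell_map_region[OF a]]
  have "para_map (gcount F) (gcount G) (periodic (gcount F) (gcount G) (cell_map a))"
    using periodic_add periodic_mono r 3 by (auto simp: para_map_def)
  then show ?thesis using 3 by (simp add: trace_ob_def)
qed simp_all

lemma periodic_le:
  assumes r: "region_map F G \<phi>" and "fst F = Ob1" "i \<le> gcount F" "gcount F > 0"
  shows "periodic (gcount F) (gcount G) \<phi> (int i) = int (\<phi> i)"
proof (cases "i < gcount F")
  case False
  then have "i = gcount F" using assms by simp
  then show ?thesis
    using periodic_add[of "gcount F" "gcount G" \<phi> 0] assms(4) periodic_nat[of 0] region_mapD(3,4)[OF r] assms(2) by simp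
qed (simp add: periodic_nat)

text \<open>
  A value \<open>m\<close> of the first map on the fundamental domain lies in the next period of the second. This
  happens only if the base region has label \<open>1\<close>, and then both maps preserve it.
\<close>

lemma periodic_comp:
  assumes a: "hom2 a F G" and b: "hom2 b G H" and F: "endo F" and n: "gcount F > 0" and m: "gcount G > 0"
  shows "periodic (gcount G) (gcount H) (cell_map b) \<circ> periodic (gcount F) (gcount G) (cell_map a) =
    periodic (gcount F) (gcount H) (cell_map (b \<bullet> a))"
proof (rule periodic_unique[OF n, symmetric])
  fix i assume i: "i < gcount F"
  note r = region_mapD[OF cell_map_region[OF a]]
  have "periodic (gcount G) (gcount H) (cell_map b) (int (cell_map a i)) = int (cell_map b (cell_map a i))"
  proof (cases "cell_map a i < gcount G")
    case False
    then have "fst G = Ob1"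
      using r(5)[OF _ i] F hom2_cells(3)[OF a] by (cases "fst F") (auto simp: endo_def)
    then show ?thesis using periodic_le[OF cell_map_region[OF b]] r(6)[OF i] m by simp
  qed (simp add: periodic_nat)
  then show "(periodic (gcount G) (gcount H) (cell_map b) \<circ> periodic (gcount F) (gcount G) (cell_map a)) (int i) =
      int (cell_map (b \<bullet> a) i)"
    using i by (simp add: periodic_nat cell_map_v[OF a b])
qed (simp add: periodic_add n m)

lemma loop_pair_gcount_0: "loop_pair F G \<Longrightarrow> gcount (adj_comp F G) = 0 \<Longrightarrow> F = adj_unit (fst F) \<and> G = adj_unit (fst F)"
proof -
  assume l: "loop_pair F G" and "gcount (adj_comp F G) = 0"
  then have 0: "gcount F = 0" "gcount G = 0" by simp_all
  have e: "snd F = [] \<and> snd G = []"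
  proof (cases "fst F")
    case Ob1
    then have "snd F = []" using no_g_from_Ob1[of "snd F" "fst F"] 0 l by (cases F) (auto simp: loop_pair_def)
    then have "fst G = Ob1" using l Ob1 by (cases F) (auto simp: loop_pair_def)
    then show ?thesis using no_g_from_Ob1[of "snd G" "fst G"] 0 l \<open>snd F = []\<close> by (cases G) (auto simp: loop_pair_def)
  next
    case Ob0
    then have "snd G = [] \<and> fst G = Ob0"
      using no_g_to_Ob0[of "fst G" "snd G" "fst G"] 0 l by (cases G) (auto simp: loop_pair_def)
    moreover then have "snd F = []"
      using no_g_to_Ob0[of "fst F" "snd F" "fst F"] 0 l by (cases F) (auto simp: loop_pair_def)
    ultimately show ?thesis by simp
  qed
  then obtain X Y where FG: "F = (X, [])" "G = (Y, [])" by (metis prod.collapse)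
  moreover have "adj_tgt F = fst G" using l unfolding loop_pair_def by blast
  ultimately show "F = adj_unit (fst F) \<and> G = adj_unit (fst F)" by (simp add: adj_unit_def)
qed

lemma trace_ob_swap: "loop_pair F G \<Longrightarrow> trace_ob (adj_comp F G) = trace_ob (adj_comp G F)"
proof (cases "gcount (adj_comp F G) = 0")
  case True
  assume "loop_pair F G"
  from loop_pair_gcount_0[OF this True] have "adj_comp F G = adj_comp G F" by metis
  then show ?thesis by simp
next
  case False
  have "gcount (adj_comp G F) = gcount (adj_comp F G)" by simp
  with False show ?thesis by (simp add: trace_ob_def del: gcount_simps)
qed

lemma cone_map_shift: "cone_map x x (\<lambda>l. l + k)"
  by (cases x rule: option.exhaust; cases "the x") (auto simp: para_map_def mono_def)

text \<open>
  Naturality of the swap: \<open>b * a\<close> is \<open>a * b\<close> read from another base point, so the two periodic maps are conjugate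
  by shifts. The cocycle law says that shifts add up.
\<close>

lemma trace_paracyclic: "trace coned paracyclic_trace"
proof -
  interpret K: category coned by (rule category_coned)
  show ?thesis
  proof
    fix F G a assume a: "hom2 a F G" "endo F"
    show "in_hom coned (TAr paracyclic_trace a) (TOb paracyclic_trace F) (TOb paracyclic_trace G)"
      unfolding coned_hom paracyclic_trace_sel(1) paracyclic_trace_sel(2)[OF a(1)] using trace_cone_map[OF a] by blast
  next
    fix F assume F: "endo F"
    then have c: "F \<in> adj_cells" by (simp add: endo_def)
    have "periodic (gcount F) (gcount F) id = id" if "gcount F > 0" by (rule periodic_unique[OF that]) auto
    then show "TAr paracyclic_trace (ide F) = Idt coned (TOb paracyclic_trace F)"
      unfolding paracyclic_trace_sel(1) paracyclic_trace_sel(2)[OF ide_hom[OF c]] coned_sel cell_map_ide[OF c]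
      by (intro cone_arrow_cong) (simp add: trace_ob_eq)
  next
    fix F G H a b assume a: "hom2 a F G" and b: "hom2 b G H" and F: "endo F"
    note G = endo_hom2[OF a F]
    show "TAr paracyclic_trace (b \<bullet> a) = Cmp coned (TAr paracyclic_trace b) (TAr paracyclic_trace a)"
      unfolding paracyclic_trace_sel(2)[OF a] paracyclic_trace_sel(2)[OF b] paracyclic_trace_sel(2)[OF hom2_v[OF a b]]
        coned_cmp[OF trace_cone_map[OF a F] trace_cone_map[OF b G]]
    proof (rule cone_arrow_cong)
      fix n m assume nm: "trace_ob F = Some (Some n)" "trace_ob H = Some (Some m)"
      then obtain k where "trace_ob G = Some (Some k)"
        using trace_cone_map[OF a F] trace_cone_map[OF b G] by (cases "trace_ob G"; cases "the (trace_ob G)") simp_all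
      with nm have "gcount F > 0" "gcount G > 0" by (simp_all add: trace_ob_eq)
      from periodic_comp[OF a b F this] show "periodic (gcount F) (gcount H) (cell_map (b \<bullet> a)) =
        periodic (gcount G) (gcount H) (cell_map b) \<circ> periodic (gcount F) (gcount G) (cell_map a)" by simp
    qed
  next
    fix F G assume l: "loop_pair F G"
    let ?x = "trace_ob (adj_comp F G)"
    have s: "TSw paracyclic_trace F G = cone_arrow ?x ?x (\<lambda>l. l + int (gcount G))"
      using trace_ob_swap[OF l] by (simp add: paracyclic_trace_sel)
    have e: "(\<lambda>l. l - int (gcount G)) \<circ> (\<lambda>l. l + int (gcount G)) = id"
      "(\<lambda>l. l + int (gcount G)) \<circ> (\<lambda>l. l - int (gcount G)) = id" by auto
    have "inverse_pair coned (cone_arrow ?x ?x (\<lambda>l. l + int (gcount G))) (cone_arrow ?x ?x (\<lambda>l. l - int (gcount G)))"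
      using cone_map_shift[of ?x "int (gcount G)"] cone_map_shift[of ?x "- int (gcount G)"] e
      by (simp add: inverse_pair_def cone_arrow_sel coned_cmp coned_sel in_hom_def)
    then show "in_hom coned (TSw paracyclic_trace F G) (TOb paracyclic_trace (adj_comp F G)) (TOb paracyclic_trace (adj_comp G F)) \<and>
        is_iso coned (TSw paracyclic_trace F G)"
      unfolding s is_iso_def paracyclic_trace_sel coned_hom trace_ob_swap[OF l, symmetric]
      using cone_map_shift by blast
  next
    fix F F' G G' a b assume a: "hom2 a F F'" and b: "hom2 b G G'" and l: "loop_pair F G"
    note l' = loop_pair_hom2[OF l a b]
    have t: "adj_tgt F = fst G" "adj_tgt G = fst F" using l by (auto simp: loop_pair_def)
    have ab: "hom2 (a \<star> b) (adj_comp F G) (adj_comp F' G')" and ba: "hom2 (b \<star> a) (adj_comp G F) (adj_comp G' F')"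
      using hom2_h a b t by auto
    note e = endo_comp[OF l] and e2 = endo_comp[OF loop_pair_sym[OF l]]
    let ?n = "gcount (adj_comp F G)" and ?m = "gcount (adj_comp F' G')"
    have c: "gcount (adj_comp G F) = ?n" "gcount (adj_comp G' F') = ?m" by simp_all
    have kv: "cone_map (trace_ob (adj_comp F G)) (trace_ob (adj_comp G F)) (\<lambda>l. l + int (gcount G))"
      "cone_map (trace_ob (adj_comp F' G')) (trace_ob (adj_comp G' F')) (\<lambda>l. l + int (gcount G'))"
      using cone_map_shift trace_ob_swap[OF l] trace_ob_swap[OF l'] by auto
    show "Cmp coned (TAr paracyclic_trace (b \<star> a)) (TSw paracyclic_trace F G) =
        Cmp coned (TSw paracyclic_trace F' G') (TAr paracyclic_trace (a \<star> b))"
      unfolding paracyclic_trace_sel(3) paracyclic_trace_sel(2)[OF ab] paracyclic_trace_sel(2)[OF ba]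
        coned_cmp[OF kv(1) trace_cone_map[OF ba e2]] coned_cmp[OF trace_cone_map[OF ab e] kv(2)]
    proof (rule cone_arrow_cong)
      fix n m assume "trace_ob (adj_comp F G) = Some (Some n)" "trace_ob (adj_comp G' F') = Some (Some m)"
      then have n: "?n > 0" by (simp add: trace_ob_eq)
      let ?Q = "\<lambda>l. periodic ?n ?m (cell_map (a \<star> b)) (l - int (gcount G)) + int (gcount G')"
      have "periodic ?n ?m (cell_map (b \<star> a)) = ?Q"
      proof (rule periodic_unique[OF n])
        fix l
        show "?Q (l + int ?n) = ?Q l + int ?m"
          using periodic_add[OF n, of ?m "cell_map (a \<star> b)" "l - int (gcount G)"] by (simp add: algebra_simps)
      next
        fix i assume i: "i < ?n"
        show "?Q (int i) = int (cell_map (b \<star> a) i)"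
        proof (cases "i < gcount G")
          case True
          then have "periodic ?n ?m (cell_map (a \<star> b)) (int (gcount F + i)) = int (cell_map (a \<star> b) (gcount F + i))"
            by (intro periodic_nat) simp
          moreover have e: "int (gcount F + i) = (int i - int (gcount G)) + int ?n" by simp
          have "periodic ?n ?m (cell_map (a \<star> b)) (int (gcount F + i)) =
              periodic ?n ?m (cell_map (a \<star> b)) (int i - int (gcount G)) + int ?m"
            unfolding e by (rule periodic_add[OF n])
          ultimately have "periodic ?n ?m (cell_map (a \<star> b)) (int i - int (gcount G)) + int ?m = int (cell_map (a \<star> b) (gcount F + i))"
            by linarith
          then show ?thesis using True by (simp add: cell_map_h[OF a b t(1)] cell_map_h[OF b a t(2)] beside_def)
        next
          case False
          then have "int i - int (gcount G) = int (i - gcount G)" "i - gcount G < ?n" "i - gcount G < gcount F"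
            using i by auto
          then show ?thesis using False i periodic_nat[of "i - gcount G" ?n ?m]
            by (simp add: cell_map_h[OF a b t(1)] cell_map_h[OF b a t(2)] beside_def)
        qed
      qed
      then show "periodic (gcount (adj_comp G F)) (gcount (adj_comp G' F')) (cell_map (b \<star> a)) \<circ> (\<lambda>l. l + int (gcount G)) =
        (\<lambda>l. l + int (gcount G')) \<circ> periodic ?n ?m (cell_map (a \<star> b))"
        unfolding c by (simp add: fun_eq_iff)
    qed
  next
    fix F G H assume c: "F \<in> adj_cells" "G \<in> adj_cells" "H \<in> adj_cells" "adj_tgt F = fst G" "adj_tgt G = fst H" "adj_tgt H = fst F"
    have l: "loop_pair (adj_comp H F) G" "loop_pair (adj_comp F G) H"
      using c adj_comp_cell by (auto simp: loop_pair_def)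
    have kv: "cone_map (trace_ob (adj_comp (adj_comp H F) G)) (trace_ob (adj_comp G (adj_comp H F))) (\<lambda>l. l + int (gcount G))"
      "cone_map (trace_ob (adj_comp (adj_comp F G) H)) (trace_ob (adj_comp (adj_comp H F) G)) (\<lambda>l. l + int (gcount H))"
      using cone_map_shift trace_ob_swap[OF l(1)] trace_ob_swap[OF l(2)] by (auto simp: adj_comp_assoc)
    show "Cmp coned (TSw paracyclic_trace (adj_comp H F) G) (TSw paracyclic_trace (adj_comp F G) H) =
        TSw paracyclic_trace F (adj_comp G H)"
      using coned_cmp[OF kv(2,1)] by (simp add: paracyclic_trace_sel adj_comp_assoc o_def add.assoc add.commute[of "int (gcount G)"])
  qed (simp_all add: coned_sel)
qed

section \<open>1-cells of the free adjunction\<close>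

text \<open>
  The words alternate, so these are all of them (\<open>cell_cases\<close>). The parameter is the number of
  letters \<open>g\<close>, except that \<open>gfg n\<close> has one more.
\<close>

definition gfs :: "nat \<Rightarrow> adj_cell" where "gfs n = (Ob1, concat (replicate n [Gg, Gf]))"
definition fgs :: "nat \<Rightarrow> adj_cell" where "fgs n = (Ob0, concat (replicate n [Gf, Gg]))"
definition gfg :: "nat \<Rightarrow> adj_cell" where "gfg n = (Ob1, concat (replicate n [Gg, Gf]) @ [Gg])"
definition fgf :: "nat \<Rightarrow> adj_cell" where "fgf n = (Ob0, concat (replicate n [Gf, Gg]) @ [Gf])"

lemma replicate_shift: "concat (replicate n [x, y]) @ [x] = x # concat (replicate n [y, x])"
  by (induction n) auto

lemma gf_path: "is_path Ob1 (concat (replicate n [Gg, Gf]))" "path_end Ob1 (concat (replicate n [Gg, Gf])) = Ob1"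
  "is_path Ob0 (concat (replicate n [Gf, Gg]))" "path_end Ob0 (concat (replicate n [Gf, Gg])) = Ob0"
  by (induction n) auto

lemma gf_count: "gcount (X, concat (replicate n [Gg, Gf])) = n" "gcount (X, concat (replicate n [Gf, Gg])) = n"
  by (induction n) auto

lemma gf_sel [simp]:
  "gfs n \<in> adj_cells" "fst (gfs n) = Ob1" "adj_tgt (gfs n) = Ob1" "gcount (gfs n) = n"
  "fgs n \<in> adj_cells" "fst (fgs n) = Ob0" "adj_tgt (fgs n) = Ob0" "gcount (fgs n) = n"
  "gfg n \<in> adj_cells" "fst (gfg n) = Ob1" "adj_tgt (gfg n) = Ob0" "gcount (gfg n) = Suc n"
  "fgf n \<in> adj_cells" "fst (fgf n) = Ob0" "adj_tgt (fgf n) = Ob1" "gcount (fgf n) = n"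
  by (simp_all add: gfs_def fgs_def gfg_def fgf_def gf_path gf_count is_path_append path_end_append)

lemma gf_add: "adj_comp (gfs a) (gfs b) = gfs (a + b)" "adj_comp (fgs a) (fgs b) = fgs (a + b)"
  by (simp_all add: gfs_def fgs_def replicate_add)

lemma gf_comp: "adj_comp (gfg a) (fgf b) = gfs (Suc (a + b))" "adj_comp (fgf a) (gfg b) = fgs (Suc (a + b))"
  "adj_comp (gfs a) (gfg b) = gfg (a + b)" "adj_comp (fgf a) (gfs b) = fgf (a + b)"
proof -
  have g: "concat (replicate b [Gf, Gg]) @ [Gf] = Gf # concat (replicate b [Gg, Gf])" for b by (rule replicate_shift)
  have r: "[x, y] @ concat (replicate b [x, y]) = concat (replicate (Suc b) [x, y])" for x y :: adj_gen and b by simp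
  have a: "Suc (a + b) = a + Suc b" by simp
  show "adj_comp (gfg a) (fgf b) = gfs (Suc (a + b))"
    unfolding gfg_def fgf_def gfs_def a adj_comp_pair g replicate_add concat_append by simp
  show "adj_comp (fgf a) (gfg b) = fgs (Suc (a + b))"
    unfolding gfg_def fgf_def fgs_def a adj_comp_pair replicate_add concat_append
    using replicate_shift[of b Gg Gf] by simp
  show "adj_comp (gfs a) (gfg b) = gfg (a + b)" by (simp add: gfs_def gfg_def replicate_add)
  show "adj_comp (fgf a) (gfs b) = fgf (a + b)"
    unfolding fgf_def gfs_def adj_comp_pair replicate_add concat_append using g[of b] by simp
qed

lemma gf_unit: "gfs 0 = adj_unit Ob1" "fgs 0 = adj_unit Ob0" "fgf 0 = cf"
  by (simp_all add: gfs_def fgs_def fgf_def adj_unit_def)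

lemma path_Ob1: "is_path Ob1 w \<Longrightarrow> \<exists>n. (Ob1, w) = gfs n \<or> (Ob1, w) = gfg n"
proof (induction w rule: length_induct)
  case (1 w)
  show ?case
  proof (cases w)
    case Nil
    then show ?thesis by (intro exI[of _ 0]) (simp add: gfs_def)
  next
    case (Cons h w1)
    then have h: "h = Gg" using 1(2) by (cases h) auto
    show ?thesis
    proof (cases w1)
      case Nil
      then show ?thesis using Cons h by (intro exI[of _ 0]) (simp add: gfg_def)
    next
      case (Cons k w2)
      then have k: "k = Gf" "is_path Ob1 w2" using 1(2) \<open>w = h # w1\<close> h by (cases k; simp)+
      have "length w2 < length w" using Cons \<open>w = h # w1\<close> by simp
      with k(2) 1(1) obtain n where "(Ob1, w2) = gfs n \<or> (Ob1, w2) = gfg n" by blast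
      then show ?thesis using Cons \<open>w = h # w1\<close> h k by (intro exI[of _ "Suc n"]) (auto simp: gfs_def gfg_def)
    qed
  qed
qed

lemma cell_cases:
  assumes "F \<in> adj_cells"
  obtains "F = gfs (gcount F)" "fst F = Ob1" "adj_tgt F = Ob1"
    | n where "F = gfg n" "fst F = Ob1" "adj_tgt F = Ob0"
    | "F = fgf (gcount F)" "fst F = Ob0" "adj_tgt F = Ob1"
    | "F = fgs (gcount F)" "fst F = Ob0" "adj_tgt F = Ob0"
proof (cases F)
  case (Pair X w)
  show ?thesis
  proof (cases X)
    case Ob1
    then obtain n where "F = gfs n \<or> F = gfg n" using path_Ob1 assms Pair by auto
    then show ?thesis using that(1,2) by auto
  next
    case Ob0
    show ?thesis
    proof (cases w)
      case Nil
      then have "F = fgs 0" using Pair Ob0 by (simp add: fgs_def)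
      then show ?thesis using that(4) by simp
    next
      case (Cons h w1)
      then have h: "h = Gf" "is_path Ob1 w1" using assms Pair Ob0 by (cases h; simp)+
      then obtain n where n: "(Ob1, w1) = gfs n \<or> (Ob1, w1) = gfg n" using path_Ob1 by blast
      have e: "F = adj_comp (fgf 0) (Ob1, w1)" using Pair Cons h Ob0 by (simp add: fgf_def)
      have "F = fgf n \<or> F = fgs (Suc n)" using n e gf_comp(2)[of 0 n] gf_comp(4)[of 0 n] by auto
      then show ?thesis using that(3,4) by auto
    qed
  qed
qed

lemma endo_cases:
  assumes "endo F"
  obtains "F = gfs (gcount F)" | "F = fgs (gcount F)"
  using assms cell_cases[of F] unfolding endo_def by (metis adj_ob.distinct(1))

lemma endo_source: "endo F \<Longrightarrow> fst F = Ob1 \<Longrightarrow> F = gfs (gcount F)" "endo F \<Longrightarrow> fst F = Ob0 \<Longrightarrow> F = fgs (gcount F)"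
  by (rule endo_cases[of F]; metis gf_sel(2,6) adj_ob.distinct(1))+

lemma endo_gf: "endo (gfs n)" "endo (fgs n)"
  by (simp_all add: endo_def)

lemma loop_gf: "loop_pair (gfs a) (gfs b)" "loop_pair (fgs a) (fgs b)" "loop_pair (gfg a) (fgf b)" "loop_pair (fgf a) (gfg b)"
  by (simp_all add: loop_pair_def)

definition the_cell :: "adj_cell \<Rightarrow> adj_cell \<Rightarrow> (nat \<Rightarrow> nat) \<Rightarrow> adj_tm set" where
  "the_cell F G \<phi> = (THE a. hom2 a F G \<and> cell_map a = \<phi>)"

lemma the_cell:
  assumes "region_map F G \<phi>" "F \<in> adj_cells" "G \<in> adj_cells" "fst F = fst G" "adj_tgt F = adj_tgt G"
  shows "hom2 (the_cell F G \<phi>) F G" "cell_map (the_cell F G \<phi>) = \<phi>"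
proof -
  have "\<exists>!a. hom2 a F G \<and> cell_map a = \<phi>"
    using two_cell_exists[OF assms(2-5,1)] two_cell_eqI by metis
  from theI'[OF this] show "hom2 (the_cell F G \<phi>) F G" "cell_map (the_cell F G \<phi>) = \<phi>"
    unfolding the_cell_def by blast+
qed

lemma the_cell_eq: "hom2 a F G \<Longrightarrow> the_cell F G (cell_map a) = a"
  using the_cell[OF cell_map_region] hom2_cells two_cell_eqI by metis

lemma region_map_from_fgs_0: "region_map (fgs 0) (fgs n) \<phi> \<longleftrightarrow> \<phi> = (\<lambda>i. n + i)"
  by (auto simp: region_map_def mono_def)

lemma region_map_to_gfs_0: "region_map (gfs n) (gfs 0) \<phi> \<longleftrightarrow> \<phi> = (\<lambda>i. i - n)"
proof
  assume r: "region_map (gfs n) (gfs 0) \<phi>"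
  show "\<phi> = (\<lambda>i. i - n)"
  proof
    fix i
    show "\<phi> i = i - n"
      using region_mapD(6)[OF r, of i] region_mapD(2)[OF r, of "i - n"] by (cases "i < n") auto
  qed
qed (auto simp: region_map_def mono_def)

definition unit_cell_n :: "nat \<Rightarrow> adj_tm set" where
  "unit_cell_n n = the_cell (fgs 0) (fgs n) (\<lambda>i. n + i)"

definition counit_cell_n :: "nat \<Rightarrow> adj_tm set" where
  "counit_cell_n n = the_cell (gfs n) (gfs 0) (\<lambda>i. i - n)"

lemma unit_cell_n: "hom2 (unit_cell_n n) (fgs 0) (fgs n)" "hom2 a (fgs 0) (fgs n) \<Longrightarrow> a = unit_cell_n n"
  unfolding unit_cell_n_def
  using the_cell(1)[of "fgs 0" "fgs n" "\<lambda>i. n + i"] the_cell_eq[of a "fgs 0" "fgs n"] cell_map_region[of a "fgs 0" "fgs n"]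
  by (auto simp: region_map_from_fgs_0)

lemma counit_cell_n: "hom2 (counit_cell_n n) (gfs n) (gfs 0)" "hom2 a (gfs n) (gfs 0) \<Longrightarrow> a = counit_cell_n n"
  unfolding counit_cell_n_def
  using the_cell(1)[of "gfs n" "gfs 0" "\<lambda>i. i - n"] the_cell_eq[of a "gfs n" "gfs 0"] cell_map_region[of a "gfs n" "gfs 0"]
  by (auto simp: region_map_to_gfs_0)

text \<open>
  The region map between powers of \<open>g * f\<close> underlying a periodic map that fixes \<open>0\<close>.
\<close>

definition restr :: "nat \<Rightarrow> nat \<Rightarrow> (int \<Rightarrow> int) \<Rightarrow> nat \<Rightarrow> nat" where
  "restr n m \<psi> i = (if i \<le> n then nat (\<psi> (int i)) else m + (i - n))"

lemma restr_region:
  assumes "mono \<psi>" "\<psi> 0 = 0" "\<psi> (int n) = int m"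
  shows "region_map (gfs n) (gfs m) (restr n m \<psi>)"
proof -
  have le: "nat (\<psi> (int i)) \<le> m" if "i \<le> n" for i using monoD[OF assms(1), of "int i" "int n"] that assms(3) by simp
  have "mono (restr n m \<psi>)"
  proof (rule monoI)
    fix i j :: nat assume "i \<le> j"
    then show "restr n m \<psi> i \<le> restr n m \<psi> j"
      using monoD[OF assms(1), of "int i" "int j"] le[of i] by (auto simp: restr_def nat_mono)
  qed
  then show ?thesis using assms(2,3) by (auto simp: region_map_def restr_def)
qed

lemma restr_cell:
  assumes "mono \<psi>" "\<psi> 0 = 0" "\<psi> (int n) = int m"
  shows "hom2 (the_cell (gfs n) (gfs m) (restr n m \<psi>)) (gfs n) (gfs m)"
    "cell_map (the_cell (gfs n) (gfs m) (restr n m \<psi>)) = restr n m \<psi>"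
  using the_cell[OF restr_region[OF assms]] by simp_all

section \<open>Integer powers of an automorphism\<close>

definition zpow :: "('o, 'm) cat \<Rightarrow> 'm \<Rightarrow> int \<Rightarrow> 'm" where
  "zpow C h k = (if 0 \<le> k then (Cmp C h ^^ nat k) (Idt C (Dom C h))
     else (Cmp C (inv_ar C h) ^^ nat (- k)) (Idt C (Dom C h)))"

context category
begin

context
  fixes h x assumes iso: "is_iso C h" and dom: "Dom C h = x" and cod: "Cod C h = x"
begin

lemma zpow_hom: "zpow C h k \<in> Ar C \<and> Dom C (zpow C h k) = x \<and> Cod C (zpow C h k) = x"
proof -
  have x: "x \<in> Ob C" using dom_ob[OF iso_sel(1)[OF iso]] dom by simp
  have "(Cmp C g ^^ n) (Idt C x) \<in> Ar C \<and> Dom C ((Cmp C g ^^ n) (Idt C x)) = x \<and> Cod C ((Cmp C g ^^ n) (Idt C x)) = x"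
    if "g \<in> Ar C" "Dom C g = x" "Cod C g = x" for g n
    by (induction n) (auto simp: idt_sel x cmp_sel that)
  then show ?thesis using iso_sel[OF iso] dom cod by (simp add: zpow_def)
qed

lemma zpow_0: "zpow C h 0 = Idt C x"
  by (simp add: zpow_def dom)

lemma zpow_Suc: "zpow C h (k + 1) = Cmp C h (zpow C h k)"
proof (cases "0 \<le> k")
  case True
  then have "nat (k + 1) = Suc (nat k)" by simp
  then show ?thesis using True by (simp add: zpow_def)
next
  case False
  then have n: "nat (- k) = Suc (nat (- (k + 1)))" by simp
  have "zpow C h k = Cmp C (inv_ar C h) (zpow C h (k + 1))"
  proof (cases "k = -1")
    case True
    then show ?thesis using n by (simp add: zpow_def)
  next
    case F: False
    then have "\<not> 0 \<le> k + 1" using False by simp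
    then show ?thesis using False unfolding zpow_def n by simp
  qed
  then show ?thesis using cancel(2)[OF iso, of "zpow C h (k + 1)"] zpow_hom cod by simp
qed

lemma zpow_1: "zpow C h 1 = h"
  using zpow_Suc[of 0] zpow_0 iso_sel[OF iso] dom by (simp add: unit_laws)

lemma zpow_add: "zpow C h (a + b) = Cmp C (zpow C h a) (zpow C h b)"
proof (induction a rule: int_induct[where k = 0])
  case base
  then show ?case using zpow_0 zpow_hom by (simp add: unit_laws)
next
  case (step1 i)
  have "zpow C h (i + 1 + b) = Cmp C h (Cmp C (zpow C h i) (zpow C h b))"
    using zpow_Suc[of "i + b"] step1 by (simp add: algebra_simps)
  then show ?case using zpow_Suc[of i] zpow_hom iso_sel[OF iso] dom cod by (simp add: assoc)
next
  case (step2 i)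
  have e: "zpow C h i = Cmp C h (zpow C h (i - 1))" "zpow C h (i + b) = Cmp C h (zpow C h (i - 1 + b))"
    using zpow_Suc[of "i - 1"] zpow_Suc[of "i - 1 + b"] by (simp_all add: algebra_simps)
  show ?case
  proof (rule iso_mono[OF iso])
    show "Cmp C h (zpow C h (i - 1 + b)) = Cmp C h (Cmp C (zpow C h (i - 1)) (zpow C h b))"
      using step2(2) zpow_hom iso_sel[OF iso] dom cod unfolding e by (simp add: assoc)
  qed (simp_all add: zpow_hom cmp_sel dom)
qed

lemma zpow_iso: "is_iso C (zpow C h k)"
proof -
  have "inverse_pair C (zpow C h k) (zpow C h (- k))"
    using zpow_add[of k "- k"] zpow_add[of "- k" k] zpow_0 zpow_hom by (simp add: inverse_pair_def in_hom_def)
  then show ?thesis by (auto simp: is_iso_def)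
qed

end

end

section \<open>Paracyclic arrows acting on a trace\<close>

definition based :: "nat \<Rightarrow> nat \<Rightarrow> (int \<Rightarrow> int) \<Rightarrow> bool" where
  "based n m \<psi> \<longleftrightarrow> para_map n m \<psi> \<and> \<psi> 0 = 0"

lemma basedD:
  assumes "based n m \<psi>"
  shows "mono \<psi>" "\<psi> 0 = 0" "\<psi> (l + int n) = \<psi> l + int m" "\<psi> (int n) = int m"
proof -
  show "mono \<psi>" "\<psi> 0 = 0" and p: "\<psi> (l + int n) = \<psi> l + int m" for l
    using assms by (auto simp: based_def para_map_def)
  then show "\<psi> (int n) = int m" using p[of 0] by simp
qed

lemma based_shift: "para_map n m \<Phi> \<Longrightarrow> based n m (\<lambda>l. \<Phi> (l + k) - \<Phi> k)"
proof -
  assume \<Phi>: "para_map n m \<Phi>"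
  have "\<Phi> (l + int n + k) = \<Phi> (l + k) + int m" for l
    using \<Phi>[unfolded para_map_def, THEN conjunct2, rule_format, of "l + k"] by (simp add: algebra_simps)
  with \<Phi> show ?thesis by (simp add: based_def para_map_def mono_def)
qed

lemma based_shift0: "para_map n m \<Phi> \<Longrightarrow> based n m (\<lambda>l. \<Phi> l - \<Phi> 0)"
  using based_shift[of n m \<Phi> 0] by simp

lemma para_map_based: "based n m \<psi> \<Longrightarrow> para_map n m \<psi>"
  by (simp add: based_def)

text \<open>
  The action of paracyclic arrows on a trace. \<open>rot s n\<close> is the swap that the universal trace sends to the
  shift by \<open>1\<close>, and \<open>act0\<close> is the action of maps fixing \<open>0\<close>; a general arrow is a shift after such a map.
\<close>

definition rot :: "('c, 'd) trace_data \<Rightarrow> nat \<Rightarrow> 'd" where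
  "rot s n = TSw s (gfs (n - 1)) (gfs 1)"

definition act0 :: "('c, 'd) trace_data \<Rightarrow> nat \<Rightarrow> nat \<Rightarrow> (int \<Rightarrow> int) \<Rightarrow> 'd" where
  "act0 s n m \<psi> = TAr s (the_cell (gfs n) (gfs m) (restr n m \<psi>))"

definition act :: "('c, 'd) cat \<Rightarrow> ('c, 'd) trace_data \<Rightarrow> nat \<Rightarrow> nat \<Rightarrow> (int \<Rightarrow> int) \<Rightarrow> 'd" where
  "act D s n m \<Phi> = Cmp D (zpow D (rot s m) (\<Phi> 0)) (act0 s n m (\<lambda>l. \<Phi> l - \<Phi> 0))"

text \<open>
  The comparison of a cyclic word with the power of \<open>g * f\<close> with as many regions: the swap that moves the
  last letter \<open>f\<close> of that power to the front, which the universal trace sends to an identity.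
\<close>

definition straighten :: "('c, 'd) cat \<Rightarrow> ('c, 'd) trace_data \<Rightarrow> adj_cell \<Rightarrow> 'd" where
  "straighten D s F = (if fst F = Ob1 \<or> gcount F = 0 then Idt D (TOb s F) else TSw s (gfg (gcount F - 1)) (fgf 0))"

definition act_unit :: "('c, 'd) cat \<Rightarrow> ('c, 'd) trace_data \<Rightarrow> nat \<Rightarrow> 'd" where
  "act_unit D s n = Cmp D (inv_ar D (straighten D s (fgs n))) (TAr s (unit_cell_n n))"

definition act_counit :: "('c, 'd) trace_data \<Rightarrow> nat \<Rightarrow> 'd" where
  "act_counit s n = TAr s (counit_cell_n n)"

context trace
begin

lemma rot_sel:
  assumes "n > 0"
  shows "is_iso D (rot s n)" "rot s n \<in> Ar D" "Dom D (rot s n) = TOb s (gfs n)" "Cod D (rot s n) = TOb s (gfs n)"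
  using sw_sel[OF loop_gf(1)[of "n - 1" 1]] assms by (simp_all add: rot_def gf_add)

lemma rot_pow:
  assumes "n > 0"
  shows "zpow D (rot s n) k \<in> Ar D \<and> Dom D (zpow D (rot s n) k) = TOb s (gfs n) \<and> Cod D (zpow D (rot s n) k) = TOb s (gfs n)"
    "is_iso D (zpow D (rot s n) k)" "zpow D (rot s n) (a + b) = Cmp D (zpow D (rot s n) a) (zpow D (rot s n) b)"
    "zpow D (rot s n) 0 = Idt D (TOb s (gfs n))" "zpow D (rot s n) 1 = rot s n"
proof -
  note r = rot_sel(1)[OF assms] rot_sel(3)[OF assms] rot_sel(4)[OF assms]
  show "zpow D (rot s n) k \<in> Ar D \<and> Dom D (zpow D (rot s n) k) = TOb s (gfs n) \<and> Cod D (zpow D (rot s n) k) = TOb s (gfs n)"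
    "is_iso D (zpow D (rot s n) k)" "zpow D (rot s n) (a + b) = Cmp D (zpow D (rot s n) a) (zpow D (rot s n) b)"
    "zpow D (rot s n) 0 = Idt D (TOb s (gfs n))" "zpow D (rot s n) 1 = rot s n"
    by (rule zpow_hom[OF r] zpow_iso[OF r] zpow_add[OF r] zpow_0[OF r] zpow_1[OF r])+
qed

text \<open>
  Moving \<open>j\<close> copies of \<open>g * f\<close> to the front one after the other.
\<close>

lemma sw_rot: "j \<le> n \<Longrightarrow> n > 0 \<Longrightarrow> TSw s (gfs (n - j)) (gfs j) = zpow D (rot s n) (int j)"
proof (induction j)
  case 0
  then show ?case using sw_unit[OF endo_gf(1), of Ob1 n] rot_pow(4)[of n] by (simp add: gf_unit)
next
  case (Suc j)
  have "Cmp D (TSw s (adj_comp (gfs 1) (gfs (n - Suc j))) (gfs j)) (TSw s (adj_comp (gfs (n - Suc j)) (gfs j)) (gfs 1)) =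
      TSw s (gfs (n - Suc j)) (adj_comp (gfs j) (gfs 1))"
    by (rule t_cocycle) simp_all
  moreover have "n - j = Suc (n - Suc j)" "n - Suc j + j = n - 1" using Suc(2) by auto
  ultimately have "TSw s (gfs (n - Suc j)) (gfs (Suc j)) = Cmp D (TSw s (gfs (n - j)) (gfs j)) (rot s n)"
    by (simp add: gf_add rot_def)
  also have "\<dots> = zpow D (rot s n) (int j + 1)"
    using Suc rot_pow(3)[of n "int j" 1] rot_pow(5)[of n] by simp
  finally show ?case by (simp add: add.commute)
qed

lemma act0_sel:
  assumes "mono \<psi>" "\<psi> 0 = 0" "\<psi> (int n) = int m"
  shows "act0 s n m \<psi> \<in> Ar D" "Dom D (act0 s n m \<psi>) = TOb s (gfs n)" "Cod D (act0 s n m \<psi>) = TOb s (gfs m)"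
  using ar_sel[OF restr_cell(1)[OF assms] endo_gf(1)] by (simp_all add: act0_def)

lemma act0_based:
  assumes "based n m \<psi>"
  shows "act0 s n m \<psi> \<in> Ar D" "Dom D (act0 s n m \<psi>) = TOb s (gfs n)" "Cod D (act0 s n m \<psi>) = TOb s (gfs m)"
  using act0_sel[OF basedD(1,2,4)[OF assms]] .

lemma act0_cell:
  assumes a: "hom2 a (gfs n) (gfs m)" and n: "n > 0"
  shows "act0 s n m (periodic n m (cell_map a)) = TAr s a" "based n m (periodic n m (cell_map a))"
proof -
  note r = cell_map_region[OF a]
  have p: "periodic n m (cell_map a) (int i) = int (cell_map a i)" if "i \<le> n" for i
    using periodic_le[OF r] that n by simp
  have "restr n m (periodic n m (cell_map a)) i = cell_map a i" for i
    using p[of i] region_mapD(2)[OF r, of "i - n"] by (auto simp: restr_def)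
  then have "restr n m (periodic n m (cell_map a)) = cell_map a" by auto
  then show "act0 s n m (periodic n m (cell_map a)) = TAr s a" using the_cell_eq[OF a] by (simp add: act0_def)
  show "based n m (periodic n m (cell_map a))"
    using periodic_add[OF n] periodic_mono[OF n region_mapD(1)[OF r]] region_mapD(6)[OF r] p[of 0] region_mapD(4)[OF r]
    by (simp add: based_def para_map_def)
qed

lemma act0_id: "act0 s n n (\<lambda>l. l) = Idt D (TOb s (gfs n))"
proof -
  have "restr n n (\<lambda>l. l) = cell_map (ide (gfs n))" by (auto simp: restr_def)
  then show ?thesis using the_cell_eq[OF ide_hom, of "gfs n"] t_ide[OF endo_gf(1)] by (simp add: act0_def)
qed

lemma act0_comp:
  assumes \<phi>: "based n m \<phi>" and \<psi>: "based m k \<psi>"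
  shows "act0 s n k (\<psi> \<circ> \<phi>) = Cmp D (act0 s m k \<psi>) (act0 s n m \<phi>)"
proof -
  note f = basedD[OF \<phi>] and p = basedD[OF \<psi>]
  note F = restr_cell[OF f(1,2,4)] and P = restr_cell[OF p(1,2,4)]
  have "restr n k (\<psi> \<circ> \<phi>) i = restr m k \<psi> (restr n m \<phi> i)" for i
  proof (cases "i \<le> n")
    case True
    then have "0 \<le> \<phi> (int i)" "\<phi> (int i) \<le> int m"
      using monoD[OF f(1), of 0 "int i"] monoD[OF f(1), of "int i" "int n"] f(2,4) by auto
    moreover then have "nat (\<phi> (int i)) \<le> m" by simp
    ultimately show ?thesis using True by (simp add: restr_def)
  qed (simp add: restr_def)
  then have "restr n k (\<psi> \<circ> \<phi>) = cell_map (the_cell (gfs m) (gfs k) (restr m k \<psi>) \<bullet> the_cell (gfs n) (gfs m) (restr n m \<phi>))"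
    using cell_map_v[OF F(1) P(1)] F(2) P(2) by auto
  then show ?thesis
    using the_cell_eq[OF hom2_v[OF F(1) P(1)]] t_v[OF F(1) P(1) endo_gf(1)] by (simp add: act0_def)
qed

text \<open>
  Cut \<open>\<psi>\<close> at index \<open>1\<close>: it is a juxtaposition \<open>\<beta> * \<alpha>\<close> with \<open>\<beta>\<close> defined on one copy of \<open>g * f\<close>, the map on the right
  is \<open>\<alpha> * \<beta>\<close>, and the claim is naturality of the swap for \<open>\<alpha>\<close> and \<open>\<beta>\<close>.
\<close>

lemma rotate_1:
  assumes \<psi>: "based n m \<psi>" and n: "n > 0" and m: "m > 0"
  shows "Cmp D (act0 s n m \<psi>) (rot s n) = Cmp D (zpow D (rot s m) (\<psi> 1)) (act0 s n m (\<lambda>l. \<psi> (l + 1) - \<psi> 1))"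
proof -
  note p = basedD[OF \<psi>]
  let ?\<psi>1 = "\<lambda>l. \<psi> (l + 1) - \<psi> 1"
  define j where "j = nat (\<psi> 1)"
  have j: "\<psi> 1 = int j" "j \<le> m"
    using monoD[OF p(1), of 0 1] monoD[OF p(1), of 1 "int n"] p(2,4) n by (auto simp: j_def)
  have mo: "mono ?\<psi>1" using p(1) by (simp add: mono_def)
  have e: "?\<psi>1 (int (n - 1)) = int (m - j)" using p(4) j n by (simp add: of_nat_diff)
  define \<alpha> where "\<alpha> = the_cell (gfs (n - 1)) (gfs (m - j)) (restr (n - 1) (m - j) ?\<psi>1)"
  define \<beta> where "\<beta> = the_cell (gfs 1) (gfs j) (restr 1 j \<psi>)"
  have \<alpha>: "hom2 \<alpha> (gfs (n - 1)) (gfs (m - j))" "cell_map \<alpha> = restr (n - 1) (m - j) ?\<psi>1"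
    unfolding \<alpha>_def by (rule restr_cell[OF mo _ e]; simp)+
  have \<beta>: "hom2 \<beta> (gfs 1) (gfs j)" "cell_map \<beta> = restr 1 j \<psi>"
    unfolding \<beta>_def using restr_cell[OF p(1,2), of 1 j] j by simp_all
  have ba: "hom2 (\<beta> \<star> \<alpha>) (gfs n) (gfs m)" and ab: "hom2 (\<alpha> \<star> \<beta>) (gfs n) (gfs m)"
    using hom2_h[OF \<beta>(1) \<alpha>(1)] hom2_h[OF \<alpha>(1) \<beta>(1)] n j by (simp_all add: gf_add)
  have mon: "int j \<le> \<psi> (int i)" if "i \<ge> 1" for i using monoD[OF p(1), of 1 "int i"] j that by simp
  have "cell_map (\<beta> \<star> \<alpha>) i = restr n m \<psi> i" for i
    using n j(2) mon[of i] p(2) unfolding cell_map_h[OF \<beta>(1) \<alpha>(1), simplified] \<alpha>(2) \<beta>(2)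
    by (cases i) (auto simp: beside_def restr_def j(1) add.commute nat_diff_distrib)
  then have "cell_map (\<beta> \<star> \<alpha>) = restr n m \<psi>" by (rule ext)
  then have 1: "TAr s (\<beta> \<star> \<alpha>) = act0 s n m \<psi>"
    using the_cell_eq[OF ba] by (simp add: act0_def)
  have "cell_map (\<alpha> \<star> \<beta>) i = restr n m ?\<psi>1 i" for i
  proof -
    have b: "cell_map (\<alpha> \<star> \<beta>) i = (if i < n - 1 then nat (?\<psi>1 (int i)) else m - j + restr 1 j \<psi> (i - (n - 1)))"
      unfolding cell_map_h[OF \<alpha>(1) \<beta>(1), simplified] \<alpha>(2) \<beta>(2) by (simp add: beside_def restr_def)
    consider "i < n - 1" | "i = n - 1" | "i = n" | "i > n" by linarith
    then show ?thesis
    proof cases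
      case 1
      then have "i \<le> n" by simp
      with 1 show ?thesis unfolding b by (simp add: restr_def)
    next
      case 2
      then show ?thesis using e p(2) n unfolding b by (simp add: restr_def)
    next
      case 3
      have "?\<psi>1 (int n) = int m" using p(3)[of 1] by (simp add: add.commute)
      then show ?thesis using 3 n j unfolding b by (simp add: restr_def)
    next
      case 4
      then show ?thesis using n j(2) unfolding b by (simp add: restr_def)
    qed
  qed
  then have "cell_map (\<alpha> \<star> \<beta>) = restr n m ?\<psi>1" by (rule ext)
  then have 2: "TAr s (\<alpha> \<star> \<beta>) = act0 s n m ?\<psi>1"
    using the_cell_eq[OF ab] by (simp add: act0_def)
  show ?thesis using t_nat[OF \<alpha>(1) \<beta>(1) loop_gf(1)] 1 2 sw_rot[OF j(2) m] j(1) by (simp add: rot_def)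
qed

lemma rotate_nat:
  assumes "based n m \<psi>" and n: "n > 0" and m: "m > 0"
  shows "Cmp D (act0 s n m \<psi>) (zpow D (rot s n) (int k)) =
    Cmp D (zpow D (rot s m) (\<psi> (int k))) (act0 s n m (\<lambda>l. \<psi> (l + int k) - \<psi> (int k)))"
  using assms(1)
proof (induction k arbitrary: \<psi>)
  case 0
  then show ?case using rot_pow(4) n m act0_based[OF 0] basedD(2)[OF 0] by (simp add: unit_laws)
next
  case (Suc k)
  let ?\<psi>1 = "\<lambda>l. \<psi> (l + 1) - \<psi> 1"
  have b: "based n m ?\<psi>1" by (rule based_shift[OF para_map_based[OF Suc(2)]])
  have b2: "based n m (\<lambda>l. \<psi> (l + int (Suc k)) - \<psi> (int (Suc k)))" by (rule based_shift[OF para_map_based[OF Suc(2)]])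
  note R = rot_sel[OF n] rot_sel[OF m] rot_pow(1,2)[OF n] rot_pow(1,2)[OF m] act0_based[OF Suc(2)] act0_based[OF b] act0_based[OF b2]
  have z: "zpow D (rot s n) (int (Suc k)) = Cmp D (rot s n) (zpow D (rot s n) (int k))"
    using rot_pow(3)[OF n, of 1 "int k"] rot_pow(5)[OF n] by simp
  have "Cmp D (act0 s n m \<psi>) (zpow D (rot s n) (int (Suc k))) =
      Cmp D (zpow D (rot s m) (\<psi> 1)) (Cmp D (act0 s n m ?\<psi>1) (zpow D (rot s n) (int k)))"
    unfolding z by (rule pre[OF rotate_1[OF Suc(2) n m]]) (use R in simp_all)
  also have "\<dots> = Cmp D (zpow D (rot s m) (\<psi> 1)) (Cmp D (zpow D (rot s m) (?\<psi>1 (int k)))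
      (act0 s n m (\<lambda>l. ?\<psi>1 (l + int k) - ?\<psi>1 (int k))))"
    unfolding Suc(1)[OF b] ..
  also have "(\<lambda>l. ?\<psi>1 (l + int k) - ?\<psi>1 (int k)) = (\<lambda>l. \<psi> (l + int (Suc k)) - \<psi> (int (Suc k)))"
    by (simp add: fun_eq_iff add.commute add.left_commute)
  also have "Cmp D (zpow D (rot s m) (\<psi> 1)) (Cmp D (zpow D (rot s m) (?\<psi>1 (int k)))
      (act0 s n m (\<lambda>l. \<psi> (l + int (Suc k)) - \<psi> (int (Suc k))))) =
    Cmp D (zpow D (rot s m) (\<psi> 1 + ?\<psi>1 (int k))) (act0 s n m (\<lambda>l. \<psi> (l + int (Suc k)) - \<psi> (int (Suc k))))"
    unfolding rot_pow(3)[OF m] using R by (simp add: assoc)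
  finally show ?case by (simp add: add.commute)
qed

text \<open>
  For negative \<open>k\<close>, solve the statement for the shifted map and \<open>- k\<close>.
\<close>

lemma rotate:
  assumes \<psi>: "based n m \<psi>" and n: "n > 0" and m: "m > 0"
  shows "Cmp D (act0 s n m \<psi>) (zpow D (rot s n) k) =
    Cmp D (zpow D (rot s m) (\<psi> k)) (act0 s n m (\<lambda>l. \<psi> (l + k) - \<psi> k))"
proof (cases "0 \<le> k")
  case True
  then show ?thesis using rotate_nat[OF assms, of "nat k"] by simp
next
  case False
  let ?\<chi> = "\<lambda>l. \<psi> (l + k) - \<psi> k"
  have b: "based n m ?\<chi>" by (rule based_shift[OF para_map_based[OF \<psi>]])
  have p0: "\<psi> 0 = 0" by (rule basedD(2)[OF \<psi>])
  note R = rot_sel[OF n] rot_sel[OF m] rot_pow(1,2)[OF n] rot_pow(1,2)[OF m] act0_based[OF \<psi>] act0_based[OF b]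
  have "(\<lambda>l. ?\<chi> (l + (- k)) - ?\<chi> (- k)) = \<psi>" "?\<chi> (- k) = - \<psi> k" using p0 by auto
  then have e: "Cmp D (act0 s n m ?\<chi>) (zpow D (rot s n) (- k)) = Cmp D (zpow D (rot s m) (- \<psi> k)) (act0 s n m \<psi>)"
    using rotate_nat[OF b n m, of "nat (- k)"] False by simp
  have inv: "Cmp D (zpow D (rot s n) (- k)) (zpow D (rot s n) k) = Idt D (TOb s (gfs n))"
    "Cmp D (zpow D (rot s m) (\<psi> k)) (zpow D (rot s m) (- \<psi> k)) = Idt D (TOb s (gfs m))"
    using rot_pow(3)[OF n, of "- k" k] rot_pow(3)[OF m, of "\<psi> k" "- \<psi> k"] rot_pow(4)[OF n] rot_pow(4)[OF m] by simp_all
  have "Cmp D (zpow D (rot s m) (\<psi> k)) (act0 s n m ?\<chi>) =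
      Cmp D (zpow D (rot s m) (\<psi> k)) (Cmp D (Cmp D (act0 s n m ?\<chi>) (zpow D (rot s n) (- k))) (zpow D (rot s n) k))"
    using R inv(1) by (simp add: assoc unit_laws)
  also have "\<dots> = Cmp D (Cmp D (zpow D (rot s m) (\<psi> k)) (zpow D (rot s m) (- \<psi> k))) (Cmp D (act0 s n m \<psi>) (zpow D (rot s n) k))"
    unfolding e using R by (simp add: assoc cmp_sel)
  also have "\<dots> = Cmp D (act0 s n m \<psi>) (zpow D (rot s n) k)"
    unfolding inv(2) using R by (simp add: unit_laws cmp_sel)
  finally show ?thesis by simp
qed

lemma act_sel:
  assumes "para_map n m \<Phi>" "m > 0"
  shows "act D s n m \<Phi> \<in> Ar D" "Dom D (act D s n m \<Phi>) = TOb s (gfs n)" "Cod D (act D s n m \<Phi>) = TOb s (gfs m)"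
  using act0_based[OF based_shift0[OF assms(1)]] rot_pow(1)[OF assms(2)] by (simp_all add: act_def cmp_sel)

lemma act_based: "based n m \<psi> \<Longrightarrow> m > 0 \<Longrightarrow> act D s n m \<psi> = act0 s n m \<psi>"
  using act0_based[of n m \<psi>] basedD(2)[of n m \<psi>] rot_pow(4)[of m] by (simp add: act_def unit_laws)

lemma act_shift: "n > 0 \<Longrightarrow> act D s n n (\<lambda>l. l + k) = zpow D (rot s n) k"
  using rot_pow(1)[of n k] act0_id[of n] by (simp add: act_def unit_laws)

text \<open>
  Commute the shift of \<open>\<Phi>\<close> past the map fixing \<open>0\<close> of \<open>\<Psi>\<close>.
\<close>

lemma act_comp:
  assumes \<Phi>: "para_map n m \<Phi>" and \<Psi>: "para_map m k \<Psi>" and n: "n > 0" and m: "m > 0" and k: "k > 0"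
  shows "act D s n k (\<Psi> \<circ> \<Phi>) = Cmp D (act D s m k \<Psi>) (act D s n m \<Phi>)"
proof -
  let ?\<psi> = "\<lambda>l. \<Psi> l - \<Psi> 0" and ?\<phi> = "\<lambda>l. \<Phi> l - \<Phi> 0"
  let ?\<chi> = "\<lambda>l. ?\<psi> (l + \<Phi> 0) - ?\<psi> (\<Phi> 0)"
  note b = based_shift0[OF \<Psi>] based_shift0[OF \<Phi>]
  have b3: "based m k ?\<chi>" by (rule based_shift[OF para_map_based[OF b(1)]])
  note R = rot_sel[OF m] rot_sel[OF k] rot_pow(1,2)[OF m] rot_pow(1,2)[OF k] act0_based[OF b(1)] act0_based[OF b(2)]
    act0_based[OF b3]
  have "Cmp D (act D s m k \<Psi>) (act D s n m \<Phi>) = Cmp D (zpow D (rot s k) (\<Psi> 0))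
      (Cmp D (Cmp D (act0 s m k ?\<psi>) (zpow D (rot s m) (\<Phi> 0))) (act0 s n m ?\<phi>))"
    using R by (simp add: act_def assoc cmp_sel)
  also have "\<dots> = Cmp D (Cmp D (zpow D (rot s k) (\<Psi> 0)) (zpow D (rot s k) (?\<psi> (\<Phi> 0))))
      (Cmp D (act0 s m k ?\<chi>) (act0 s n m ?\<phi>))"
    unfolding rotate[OF b(1) m k] using R by (simp add: assoc cmp_sel)
  also have "\<dots> = Cmp D (zpow D (rot s k) ((\<Psi> \<circ> \<Phi>) 0)) (act0 s n k (?\<chi> \<circ> ?\<phi>))"
    unfolding rot_pow(3)[OF k, symmetric] act0_comp[OF b(2) b3] by simp
  also have "?\<chi> \<circ> ?\<phi> = (\<lambda>l. (\<Psi> \<circ> \<Phi>) l - (\<Psi> \<circ> \<Phi>) 0)" by auto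
  finally show ?thesis by (simp add: act_def)
qed

end

section \<open>Words starting with f, and the cone points\<close>

context trace
begin

lemma straighten_sel:
  assumes "endo F"
  shows "straighten D s F \<in> Ar D" "is_iso D (straighten D s F)" "Cod D (straighten D s F) = TOb s F"
    "Dom D (straighten D s F) = TOb s (if fst F = Ob0 \<and> gcount F = 0 then fgs 0 else gfs (gcount F))"
proof -
  have "straighten D s F \<in> Ar D \<and> is_iso D (straighten D s F) \<and> Cod D (straighten D s F) = TOb s F \<and>
    Dom D (straighten D s F) = TOb s (if fst F = Ob0 \<and> gcount F = 0 then fgs 0 else gfs (gcount F))"
  proof (cases "fst F = Ob1 \<or> gcount F = 0")
    case True
    then have "F = (if fst F = Ob0 \<and> gcount F = 0 then fgs 0 else gfs (gcount F))"
      using endo_source[OF assms] by (cases "fst F") auto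
    then show ?thesis using True t_ob[OF assms] by (simp add: straighten_def idt_sel iso_idt)
  next
    case False
    then obtain n where n: "gcount F = Suc n" using not0_implies_Suc by blast
    have "fst F = Ob0" using False by (cases "fst F") auto
    then have "F = fgs (gcount F)" using endo_source[OF assms] by simp
    then show ?thesis
      using False n sw_sel[OF loop_gf(3)[of n 0]] by (simp add: straighten_def gf_comp)
  qed
  then show "straighten D s F \<in> Ar D" "is_iso D (straighten D s F)" "Cod D (straighten D s F) = TOb s F"
    "Dom D (straighten D s F) = TOb s (if fst F = Ob0 \<and> gcount F = 0 then fgs 0 else gfs (gcount F))" by blast+
qed

lemma straighten_gfs: "straighten D s (gfs n) = Idt D (TOb s (gfs n))"
  and straighten_fgs: "straighten D s (fgs (Suc n)) = TSw s (gfg n) (fgf 0)"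
  by (simp_all add: straighten_def)

lemma straighten_fgs_sel:
  assumes "n > 0"
  shows "straighten D s (fgs n) \<in> Ar D" "is_iso D (straighten D s (fgs n))"
    "Cod D (straighten D s (fgs n)) = TOb s (fgs n)" "Dom D (straighten D s (fgs n)) = TOb s (gfs n)"
  using straighten_sel[OF endo_gf(2)[of n]] assms by simp_all

lemma sw_fgf_gfg: "Cmp D (TSw s (fgf a) (gfg b)) (straighten D s (fgs (Suc (a + b)))) =
    zpow D (rot s (Suc (a + b))) (int (Suc b))"
proof -
  have "Cmp D (TSw s (adj_comp (fgf 0) (gfs a)) (gfg b)) (TSw s (adj_comp (gfs a) (gfg b)) (fgf 0)) =
      TSw s (gfs a) (adj_comp (gfg b) (fgf 0))"
    by (rule t_cocycle) simp_all
  then show ?thesis using sw_rot[of "Suc b" "Suc (a + b)"] by (simp add: gf_comp straighten_fgs)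
qed

text \<open>
  After straightening, every swap is a power of the rotation. For each of the four shapes of \<open>(F, G)\<close> this is
  an instance of the cocycle law, in which the letter \<open>f\<close> is moved separately.
\<close>

lemma swap_straighten:
  assumes l: "loop_pair F G" and n: "gcount (adj_comp F G) = n" "n > 0"
  shows "Cmp D (TSw s F G) (straighten D s (adj_comp F G)) =
    Cmp D (straighten D s (adj_comp G F)) (zpow D (rot s n) (int (gcount G)))"
proof -
  have c: "F \<in> adj_cells" "G \<in> adj_cells" "adj_tgt F = fst G" "adj_tgt G = fst F"
    using l by (simp_all add: loop_pair_def)
  note R = rot_pow(1)[OF n(2)] sw_sel[OF l]
  show ?thesis
  proof (cases rule: cell_cases[OF c(1)])
    case F: 1
    then obtain b where G: "G = gfs b" by (rule_tac cell_cases[OF c(2)]) (use c in auto)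
    obtain a where F: "F = gfs a" using F by blast
    have "n - b = a" "b \<le> n" using n F G by simp_all
    then have "TSw s F G = zpow D (rot s n) (int b)" using sw_rot[of b n] n F G by simp
    moreover have "adj_comp F G = gfs n" "adj_comp G F = gfs n" "gcount G = b"
      using n F G by (auto simp: gf_add add.commute[of b a])
    ultimately show ?thesis using rot_pow(1)[OF n(2), of "int b"] by (simp add: straighten_gfs unit_laws)
  next
    case F: (2 a)
    then obtain b where G: "G = fgf b" by (rule_tac cell_cases[OF c(2)]) (use c in auto)
    have "Cmp D (TSw s (adj_comp (gfs b) (gfg a)) (fgf 0)) (TSw s (adj_comp (gfg a) (fgf 0)) (gfs b)) =
        TSw s (gfg a) (adj_comp (fgf 0) (gfs b))"
      by (rule t_cocycle) simp_all
    moreover have "n = Suc (b + a)" "n - b = Suc a" using n F G by simp_all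
    moreover from this have "TSw s (gfs (Suc a)) (gfs b) = zpow D (rot s n) (int b)"
      using sw_rot[of b n] by simp
    moreover have "adj_comp F G = gfs n" "adj_comp G F = fgs n" "gcount G = b"
      using \<open>n = Suc (b + a)\<close> F G by (simp_all add: gf_comp add.commute[of a b])
    ultimately show ?thesis
      using sw_sel[OF l] F G by (simp add: gf_comp straighten_gfs straighten_fgs unit_laws)
  next
    case 3
    then obtain b where G: "G = gfg b" by (rule_tac cell_cases[OF c(2)]) (use c in auto)
    obtain a where F: "F = fgf a" using 3 by blast
    have N: "n = Suc (a + b)" using n F G by simp
    then have "adj_comp F G = fgs n" "adj_comp G F = gfs n" "gcount G = Suc b"
      using F G by (simp_all add: gf_comp add.commute[of b a])
    then show ?thesis
      using sw_fgf_gfg[of a b] rot_pow(1)[OF n(2), of "int (Suc b)"] F G N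
      by (simp add: straighten_gfs unit_laws del: of_nat_Suc)
  next
    case 4
    then obtain b where G: "G = fgs b" by (rule_tac cell_cases[OF c(2)]) (use c in auto)
    obtain a where F: "F = fgs a" using 4 by blast
    show ?thesis
    proof (cases b)
      case 0
      then show ?thesis
        using F G n sw_unit[OF endo_gf(2), of Ob0 n] straighten_fgs_sel[OF n(2)] rot_pow(4)[OF n(2)]
        by (simp add: gf_unit(2)[symmetric] gf_add unit_laws)
    next
      case (Suc b')
      have g: "adj_comp (gfg b') (fgs a) = gfg (b' + a)" "adj_comp (fgs a) (fgf 0) = fgf a"
      proof -
        have "adj_comp (gfg b') (fgs a) = adj_comp (gfs b') (adj_comp (gfg 0) (fgs a))"
          using gf_comp(3)[of b' 0] by (simp add: adj_comp_assoc[symmetric])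
        also have "adj_comp (gfg 0) (fgs a) = gfg a"
          using replicate_shift[of a Gg Gf] by (simp add: gfg_def fgs_def)
        finally show "adj_comp (gfg b') (fgs a) = gfg (b' + a)" by (simp add: gf_comp)
        show "adj_comp (fgs a) (fgf 0) = fgf a" by (simp add: fgs_def fgf_def)
      qed
      have G': "G = adj_comp (fgf 0) (gfg b')" using G Suc by (simp add: gf_comp)
      have "Cmp D (TSw s (adj_comp (gfg b') (fgs a)) (fgf 0)) (TSw s (adj_comp (fgs a) (fgf 0)) (gfg b')) =
          TSw s (fgs a) (adj_comp (fgf 0) (gfg b'))"
        by (rule t_cocycle) simp_all
      then have e: "TSw s F G = Cmp D (TSw s (gfg (b' + a)) (fgf 0)) (TSw s (fgf a) (gfg b'))"
        using F G' by (simp add: g)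
      have n': "n = Suc (a + b')" using n F G Suc by (simp add: gf_add)
      have "Cmp D (TSw s F G) (straighten D s (fgs n)) =
          Cmp D (TSw s (gfg (b' + a)) (fgf 0)) (Cmp D (TSw s (fgf a) (gfg b')) (straighten D s (fgs n)))"
        unfolding e using sw_sel[OF loop_gf(3)[of "b' + a" 0]] sw_sel[OF loop_gf(4)[of a b']] straighten_fgs_sel[OF n(2)] n'
        by (simp add: assoc gf_comp add.commute)
      also have "\<dots> = Cmp D (straighten D s (fgs n)) (zpow D (rot s n) (int (Suc b')))"
        using sw_fgf_gfg[of a b'] straighten_fgs[of "b' + a"] n' by (simp add: add.commute)
      finally show ?thesis using F G Suc n by (simp add: gf_add add.commute)
    qed
  qed
qed

text \<open>
  For \<open>a\<close> between powers of \<open>f * g\<close> this is an instance of naturality of the swap, after the units at the left end of \<open>a\<close>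
  have been moved to its right end.
\<close>

lemma straighten_nat:
  assumes a: "hom2 a F G" and F: "endo F" and n: "gcount F > 0" and m: "gcount G > 0"
  shows "Cmp D (TAr s a) (straighten D s F) =
    Cmp D (straighten D s G) (act D s (gcount F) (gcount G) (periodic (gcount F) (gcount G) (cell_map a)))"
proof (cases rule: endo_cases[OF F])
  case 1
  then obtain n where F': "F = gfs n" "n > 0" using n by simp
  obtain m where G': "G = gfs m" "m > 0"
    using endo_cases[OF endo_hom2[OF a F]] hom2_cells(3)[OF a] 1 m by (metis gf_sel(2,6) adj_ob.distinct(1))
  have a': "hom2 a (gfs n) (gfs m)" using a F' G' by simp
  show ?thesis
    using act0_cell[OF a' F'(2)] act_based[OF _ G'(2)] ar_sel[OF a' endo_gf(1)] F' G'
    by (simp add: straighten_gfs unit_laws)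
next
  case 2
  then obtain n' where F': "F = fgs (Suc n')" using n by (metis gr0_implies_Suc)
  obtain m' where G': "G = fgs (Suc m')"
    using endo_cases[OF endo_hom2[OF a F]] hom2_cells(3)[OF a] 2 m
    by (metis gf_sel(2,6) adj_ob.distinct(1) gr0_implies_Suc)
  \<comment> \<open>index \<open>0\<close> is fixed: the cell is whiskered by \<open>f\<close>, so naturality of the swap applies\<close>
  have fixed: "Cmp D (TAr s a) (straighten D s (fgs (Suc n'))) =
      Cmp D (straighten D s (fgs (Suc m'))) (act D s (Suc n') (Suc m') (periodic (Suc n') (Suc m') (cell_map a)))"
    if a: "hom2 a (fgs (Suc n')) (fgs (Suc m'))" and 0: "cell_map a 0 = 0" for a
  proof -
    note r = region_mapD[OF cell_map_region[OF a], simplified]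
    have "region_map (gfg n') (gfg m') (cell_map a)" using r 0 by (auto simp: region_map_def)
    note b = the_cell[OF this, simplified]
    let ?b = "the_cell (gfg n') (gfg m') (cell_map a)"
    have f: "hom2 (ide (fgf 0)) (fgf 0) (fgf 0)" by (simp add: ide_hom)
    have fb: "hom2 (ide (fgf 0) \<star> ?b) (fgs (Suc n')) (fgs (Suc m'))" and bf: "hom2 (?b \<star> ide (fgf 0)) (gfs (Suc n')) (gfs (Suc m'))"
      using hom2_h[OF f b(1)] hom2_h[OF b(1) f] by (simp_all add: gf_comp)
    have "cell_map (ide (fgf 0) \<star> ?b) = cell_map a"
      using cell_map_h[OF f b(1)] b(2) by (simp add: beside_def fun_eq_iff)
    then have 1: "ide (fgf 0) \<star> ?b = a" using two_cell_eqI[OF fb a] by simp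
    have "cell_map (?b \<star> ide (fgf 0)) i = cell_map a i" for i
      using cell_map_h[OF b(1) f] b(2) r(2)[of "i - Suc n'"] by (auto simp: beside_def)
    then have "cell_map (?b \<star> ide (fgf 0)) = cell_map a" by auto
    then have 2: "TAr s (?b \<star> ide (fgf 0)) = act D s (Suc n') (Suc m') (periodic (Suc n') (Suc m') (cell_map a))"
      using act0_cell[OF bf] act_based by simp
    show ?thesis using t_nat[OF b(1) f loop_gf(3)] unfolding 1 2 straighten_fgs .
  qed
  let ?n = "Suc n'" and ?m = "Suc m'" and ?\<phi> = "cell_map a"
  have a': "hom2 a (fgs ?n) (fgs ?m)" using a F' G' by simp
  note r = region_mapD[OF cell_map_region[OF a'], simplified]
  define j where "j = ?\<phi> 0"
  have j: "j < ?m" "j \<le> ?\<phi> i" for i using r(5)[of 0] monoD[OF r(1), of 0 i] by (auto simp: j_def)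
  \<comment> \<open>in general the first \<open>j\<close> regions of the target are created by units, and these can be moved to the end\<close>
  have r\<alpha>: "region_map (fgs ?n) (fgs (?m - j)) (\<lambda>i. ?\<phi> i - j)"
    unfolding region_map_def gf_sel
  proof (intro conjI allI impI)
    show "mono (\<lambda>i. ?\<phi> i - j)" using r(1) by (simp add: mono_def diff_le_mono)
    show "?\<phi> (?n + i) - j = ?m - j + i" for i using r(2)[of i] j(1) by simp
    show "?\<phi> i - j < ?m - j" if "i < ?n" for i using r(5)[of i] that j(2)[of i] by simp
  qed simp
  note \<alpha> = the_cell[OF r\<alpha>, simplified]
  let ?\<alpha> = "the_cell (fgs ?n) (fgs (?m - j)) (\<lambda>i. ?\<phi> i - j)"
  note \<beta> = unit_cell_n(1)[of j]
  have \<beta>m: "cell_map (unit_cell_n j) = (\<lambda>i. j + i)"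
    using cell_map_region[OF \<beta>] region_map_from_fgs_0 by simp
  have ba: "hom2 (unit_cell_n j \<star> ?\<alpha>) (fgs ?n) (fgs ?m)" and ab: "hom2 (?\<alpha> \<star> unit_cell_n j) (fgs ?n) (fgs ?m)"
    using hom2_h[OF \<beta> \<alpha>(1)] hom2_h[OF \<alpha>(1) \<beta>] j(1) by (simp_all add: gf_add)
  have "cell_map (unit_cell_n j \<star> ?\<alpha>) = ?\<phi>"
    using cell_map_h[OF \<beta> \<alpha>(1)] \<alpha>(2) j(2) by (auto simp: beside_def)
  then have 1: "unit_cell_n j \<star> ?\<alpha> = a" using two_cell_eqI[OF ba a'] by simp
  have abm: "cell_map (?\<alpha> \<star> unit_cell_n j) i = (if i < ?n then ?\<phi> i - j else ?m + (i - ?n))" for i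
    using cell_map_h[OF \<alpha>(1) \<beta>] \<alpha>(2) \<beta>m j(1) by (simp add: beside_def) arith
  let ?P = "periodic ?n ?m (cell_map (?\<alpha> \<star> unit_cell_n j))"
  have P: "periodic ?n ?m ?\<phi> = (\<lambda>l. ?P l + int j)"
  proof (rule periodic_unique)
    show "?P (int i) + int j = int (?\<phi> i)" if "i < ?n" for i
      using periodic_nat[OF that] abm[of i] that j(2)[of i] by (simp add: of_nat_diff)
  qed (simp_all add: periodic_add del: of_nat_Suc)
  have pP: "para_map ?n ?m ?P"
    using trace_cone_map[OF ab endo_gf(2)] by (simp add: trace_ob_def)
  note t = t_nat[OF \<alpha>(1) \<beta> loop_gf(2)]
  have z: "TSw s (fgs ?n) (fgs 0) = Idt D (TOb s (fgs ?n))" using sw_unit[OF endo_gf(2), of Ob0 ?n] by (simp add: gf_unit)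
  have e: "TAr s a = Cmp D (TSw s (fgs (?m - j)) (fgs j)) (TAr s (?\<alpha> \<star> unit_cell_n j))"
    using t ar_sel[OF a' endo_gf(2)] unfolding 1 z by (simp add: unit_laws)
  have sw: "Cmp D (TSw s (fgs (?m - j)) (fgs j)) (straighten D s (fgs ?m)) = Cmp D (straighten D s (fgs ?m)) (zpow D (rot s ?m) (int j))"
    using swap_straighten[OF loop_gf(2)[of "?m - j" j], of ?m] j(1) by (simp add: gf_add)
  have s1: "in_hom D (TSw s (fgs (?m - j)) (fgs j)) (TOb s (fgs ?m)) (TOb s (fgs ?m))"
    using sw_sel[OF loop_gf(2)[of "?m - j" j]] j(1) by (simp add: gf_add in_hom_def)
  have "periodic ?n ?m (cell_map (?\<alpha> \<star> unit_cell_n j)) 0 = 0"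
    using periodic_nat[of 0 ?n ?m] abm[of 0] by (simp add: j_def)
  then have shift: "act D s ?n ?m (periodic ?n ?m ?\<phi>) = Cmp D (zpow D (rot s ?m) (int j)) (act D s ?n ?m ?P)"
    using pP rot_pow(1,4)[of ?m] act0_based[OF based_shift0[OF pP]] unfolding P act_def by (simp add: unit_laws)
  note S = straighten_fgs_sel[of ?n] straighten_fgs_sel[of ?m]
  have "Cmp D (TAr s a) (straighten D s (fgs ?n)) =
      Cmp D (TSw s (fgs (?m - j)) (fgs j)) (Cmp D (TAr s (?\<alpha> \<star> unit_cell_n j)) (straighten D s (fgs ?n)))"
    unfolding e using s1 ar_sel[OF ab endo_gf(2)] S by (simp add: assoc in_hom_def)
  also have "\<dots> = Cmp D (TSw s (fgs (?m - j)) (fgs j)) (Cmp D (straighten D s (fgs ?m)) (act D s ?n ?m ?P))"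
    using fixed[OF ab] abm[of 0] by (simp add: j_def)
  also have "\<dots> = Cmp D (straighten D s (fgs ?m)) (Cmp D (zpow D (rot s ?m) (int j)) (act D s ?n ?m ?P))"
    by (rule pre[OF sw]) (use s1 S act_sel[OF pP] rot_pow(1)[of ?m] in \<open>simp_all add: in_hom_def\<close>)
  finally show ?thesis unfolding shift[symmetric] using F' G' by simp
qed

lemma act_unit_sel:
  assumes "n > 0"
  shows "act_unit D s n \<in> Ar D" "Dom D (act_unit D s n) = TOb s (fgs 0)" "Cod D (act_unit D s n) = TOb s (gfs n)"
    "Cmp D (straighten D s (fgs n)) (act_unit D s n) = TAr s (unit_cell_n n)"
  using straighten_fgs_sel[OF assms] ar_sel[OF unit_cell_n(1)[of n] endo_gf(2)] by (simp_all add: act_unit_def cats)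

text \<open>
  Rotation invariance: juxtaposing \<open>n - 1\<close> units and one unit gives \<open>n\<close> units in either order, so naturality of the
  swap applies, and the swap of two copies of the unit 1-cell \<open>U\<^sub>0\<close> is an identity.
\<close>

lemma rot_act_unit:
  assumes n: "n > 0"
  shows "Cmp D (zpow D (rot s n) k) (act_unit D s n) = act_unit D s n"
proof -
  obtain n' where n': "n = Suc n'" using n gr0_implies_Suc by blast
  note S = straighten_fgs_sel[OF n] and U = act_unit_sel[OF n] and R = rot_sel[OF n] rot_pow(1)[OF n]
  let ?x = "unit_cell_n n'" and ?y = "unit_cell_n 1"
  have xy: "?x \<star> ?y = unit_cell_n n" "?y \<star> ?x = unit_cell_n n"
    by (rule unit_cell_n(2),
        use hom2_h[OF unit_cell_n(1)[of n'] unit_cell_n(1)[of 1]] hom2_h[OF unit_cell_n(1)[of 1] unit_cell_n(1)[of n']]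
          n' in \<open>simp add: gf_add\<close>)+
  have l: "in_hom D (TSw s (fgs n') (fgs 1)) (TOb s (fgs n)) (TOb s (fgs n))"
    using sw_sel[OF loop_gf(2)[of n' 1]] n' by (simp add: gf_add in_hom_def)
  have "Cmp D (TAr s (unit_cell_n n)) (TSw s (fgs 0) (fgs 0)) = Cmp D (TSw s (fgs n') (fgs 1)) (TAr s (unit_cell_n n))"
    using t_nat[OF unit_cell_n(1)[of n'] unit_cell_n(1)[of 1] loop_gf(2)] xy by simp
  then have e: "Cmp D (TSw s (fgs n') (fgs 1)) (TAr s (unit_cell_n n)) = TAr s (unit_cell_n n)"
    using sw_unit[OF endo_gf(2), of Ob0 0] ar_sel[OF unit_cell_n(1)[of n] endo_gf(2)] by (simp add: gf_unit unit_laws)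
  have sw: "Cmp D (TSw s (fgs n') (fgs 1)) (straighten D s (fgs n)) = Cmp D (straighten D s (fgs n)) (rot s n)"
    using swap_straighten[OF loop_gf(2)[of n' 1], of n] n' rot_pow(5)[OF n] by (simp add: gf_add)
  have one: "Cmp D (rot s n) (act_unit D s n) = act_unit D s n"
  proof (rule iso_mono[OF S(2)])
    have "Cmp D (straighten D s (fgs n)) (Cmp D (rot s n) (act_unit D s n)) =
        Cmp D (TSw s (fgs n') (fgs 1)) (Cmp D (straighten D s (fgs n)) (act_unit D s n))"
      by (rule pre[OF sw[symmetric]]) (use l S U R in \<open>simp_all add: in_hom_def\<close>)
    then show "Cmp D (straighten D s (fgs n)) (Cmp D (rot s n) (act_unit D s n)) =
        Cmp D (straighten D s (fgs n)) (act_unit D s n)" unfolding U(4) e .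
  qed (use S U R in \<open>simp_all add: cmp_sel\<close>)
  show ?thesis
  proof (induction k rule: int_induct[where k = 0])
    case base
    then show ?case using rot_pow(4)[OF n] U by (simp add: unit_laws)
  next
    case (step1 i)
    then show ?case unfolding rot_pow(3)[OF n] rot_pow(5)[OF n] using one R U by (simp add: assoc)
  next
    case (step2 i)
    have "zpow D (rot s n) i = Cmp D (zpow D (rot s n) (i - 1)) (rot s n)"
      using rot_pow(3)[OF n, of "i - 1" 1] rot_pow(5)[OF n] by simp
    then show ?case using step2(2) one R U by (simp add: assoc)
  qed
qed

lemma act0_act_unit:
  assumes \<psi>: "based n m \<psi>" and n: "n > 0" and m: "m > 0"
  shows "Cmp D (act0 s n m \<psi>) (act_unit D s n) = act_unit D s m"
proof -
  \<comment> \<open>first for maps that lift to 2-cells between powers of \<open>f * g\<close>\<close>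
  have lift: "Cmp D (act0 s n m \<psi>) (act_unit D s n) = act_unit D s m" if \<psi>: "based n m \<psi>" and neg: "\<psi> (-1) < 0" for \<psi>
  proof -
    note p = basedD[OF \<psi>]
    have "region_map (fgs n) (fgs m) (restr n m \<psi>)"
    proof -
      have "restr n m \<psi> i < m" if "i < n" for i
        using monoD[OF p(1), of "int i" "-1 + int n"] p(3)[of "-1"] neg that m by (simp add: restr_def)
      then show ?thesis using restr_region[OF p(1,2,4)] by (simp add: region_map_def)
    qed
    note a = the_cell[OF this, simplified]
    let ?a = "the_cell (fgs n) (fgs m) (restr n m \<psi>)"
    have "periodic n m (cell_map ?a) = \<psi>"
    proof (rule periodic_unique[OF n])
      show "\<psi> (int i) = int (cell_map ?a i)" if "i < n" for i
        using a(2) that monoD[OF p(1), of 0 "int i"] p(2) by (simp add: restr_def)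
    qed (rule p(3))
    then have N: "Cmp D (TAr s ?a) (straighten D s (fgs n)) = Cmp D (straighten D s (fgs m)) (act0 s n m \<psi>)"
      using straighten_nat[OF a(1) endo_gf(2)] n m act_based[OF \<psi> m] by simp
    have u: "?a \<bullet> unit_cell_n n = unit_cell_n m" using unit_cell_n(2)[OF hom2_v[OF unit_cell_n(1) a(1)]] .
    note S = straighten_fgs_sel[OF n] straighten_fgs_sel[OF m] and U = act_unit_sel[OF n] act_unit_sel[OF m]
    show ?thesis
    proof (rule iso_mono[OF straighten_fgs_sel(2)[OF m]])
      have "Cmp D (straighten D s (fgs m)) (Cmp D (act0 s n m \<psi>) (act_unit D s n)) =
          Cmp D (TAr s ?a) (Cmp D (straighten D s (fgs n)) (act_unit D s n))"
        by (rule pre[OF N[symmetric]]) (use S U act0_based[OF \<psi>] ar_sel[OF a(1) endo_gf(2)] in simp_all)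
      also have "\<dots> = Cmp D (straighten D s (fgs m)) (act_unit D s m)"
        unfolding U using t_v[OF unit_cell_n(1) a(1) endo_gf(2)] u by simp
      finally show "Cmp D (straighten D s (fgs m)) (Cmp D (act0 s n m \<psi>) (act_unit D s n)) =
          Cmp D (straighten D s (fgs m)) (act_unit D s m)" .
    qed (use S U act0_based[OF \<psi>] in \<open>simp_all add: cmp_sel\<close>)
  qed
  \<comment> \<open>in general, rotate the source so that the fibre of \<open>0\<close> starts at \<open>0\<close>\<close>
  note p = basedD[OF \<psi>]
  define q where "q = (LEAST q. \<psi> (- int q - 1) < 0)"
  have "\<psi> (- int (n - 1) - 1) < 0" using p(3)[of "- int n"] p(2) n m by (simp add: of_nat_diff)
  then have q: "\<psi> (- int q - 1) < 0" unfolding q_def by (rule LeastI)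
  have q0: "\<psi> (- int q) = 0"
  proof (cases q)
    case (Suc q')
    then have "\<not> \<psi> (- int q' - 1) < 0" using not_less_Least[of q' "\<lambda>q. \<psi> (- int q - 1) < 0"] by (simp add: q_def)
    moreover have "- int q = - int q' - 1" using Suc by simp
    ultimately show ?thesis using monoD[OF p(1), of "- int q" 0] p(2) by simp
  qed (use p(2) in simp)
  let ?\<chi> = "\<lambda>l. \<psi> (l + - int q) - \<psi> (- int q)"
  have b: "based n m ?\<chi>" by (rule based_shift[OF para_map_based[OF \<psi>]])
  have "- 1 + - int q = - int q - 1" by simp
  then have "?\<chi> (-1) < 0" using q q0 by (simp only: diff_0_right)
  from lift[OF b this] have L: "Cmp D (act0 s n m ?\<chi>) (act_unit D s n) = act_unit D s m" .
  have "Cmp D (act0 s n m \<psi>) (zpow D (rot s n) (- int q)) = act0 s n m ?\<chi>"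
    using rotate[OF \<psi> n m, of "- int q"] q0 rot_pow(4)[OF m] act0_based[OF b] by (simp add: unit_laws)
  then have "Cmp D (act0 s n m \<psi>) (Cmp D (zpow D (rot s n) (- int q)) (act_unit D s n)) = act_unit D s m"
    using L act0_based[OF \<psi>] rot_pow(1)[OF n, of "- int q"] act_unit_sel[OF n] by (simp add: assoc[symmetric])
  then show ?thesis unfolding rot_act_unit[OF n] .
qed

lemma act_act_unit:
  assumes \<Phi>: "para_map n m \<Phi>" and n: "n > 0" and m: "m > 0"
  shows "Cmp D (act D s n m \<Phi>) (act_unit D s n) = act_unit D s m"
  unfolding act_def
  using act0_act_unit[OF based_shift0[OF \<Phi>] n m] rot_act_unit[OF m] act0_based[OF based_shift0[OF \<Phi>]]
    rot_pow(1)[OF m] act_unit_sel[OF n] by (simp add: assoc)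

lemma act_counit_sel: "act_counit s n \<in> Ar D" "Dom D (act_counit s n) = TOb s (gfs n)" "Cod D (act_counit s n) = TOb s (gfs 0)"
  using ar_sel[OF counit_cell_n(1)[of n] endo_gf(1)] by (simp_all add: act_counit_def)

lemma act_counit_rot:
  assumes n: "n > 0"
  shows "Cmp D (act_counit s n) (zpow D (rot s n) k) = act_counit s n"
proof -
  note U = act_counit_sel[of n] and R = rot_sel[OF n] rot_pow(1)[OF n]
  let ?x = "counit_cell_n (n - 1)" and ?y = "counit_cell_n 1"
  have xy: "?x \<star> ?y = counit_cell_n n" "?y \<star> ?x = counit_cell_n n"
    by (rule counit_cell_n(2),
        use hom2_h[OF counit_cell_n(1)[of "n - 1"] counit_cell_n(1)[of 1]]
          hom2_h[OF counit_cell_n(1)[of 1] counit_cell_n(1)[of "n - 1"]] n in \<open>simp add: gf_add\<close>)+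
  have one: "Cmp D (act_counit s n) (rot s n) = act_counit s n"
    using t_nat[OF counit_cell_n(1)[of "n - 1"] counit_cell_n(1)[of 1] loop_gf(1)] xy
      sw_unit[OF endo_gf(1), of Ob1 0] U by (simp add: gf_unit unit_laws act_counit_def rot_def)
  show ?thesis
  proof (induction k rule: int_induct[where k = 0])
    case base
    then show ?case using rot_pow(4)[OF n] U by (simp add: unit_laws)
  next
    case (step1 i)
    have "Cmp D (act_counit s n) (zpow D (rot s n) (i + 1)) = Cmp D (Cmp D (act_counit s n) (zpow D (rot s n) i)) (rot s n)"
      unfolding rot_pow(3)[OF n] rot_pow(5)[OF n] using R U by (simp add: assoc)
    then show ?case using step1 one by simp
  next
    case (step2 i)
    have z: "zpow D (rot s n) i = Cmp D (rot s n) (zpow D (rot s n) (i - 1))"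
      using rot_pow(3)[OF n, of 1 "i - 1"] rot_pow(5)[OF n] by simp
    have "Cmp D (act_counit s n) (zpow D (rot s n) i) = Cmp D (Cmp D (act_counit s n) (rot s n)) (zpow D (rot s n) (i - 1))"
      unfolding z using R U by (simp add: assoc)
    then show ?case using step2(2) one by simp
  qed
qed

lemma act_counit_act:
  assumes \<Phi>: "para_map n m \<Phi>" and n: "n > 0" and m: "m > 0"
  shows "Cmp D (act_counit s m) (act D s n m \<Phi>) = act_counit s n"
proof -
  let ?\<psi> = "\<lambda>l. \<Phi> l - \<Phi> 0"
  note b = based_shift0[OF \<Phi>]
  note c = restr_cell[OF basedD(1,2,4)[OF b]]
  have "Cmp D (act_counit s m) (act0 s n m ?\<psi>) = act_counit s n"
    using t_v[OF c(1) counit_cell_n(1) endo_gf(1)] counit_cell_n(2)[OF hom2_v[OF c(1) counit_cell_n(1)]]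
    by (simp add: act_counit_def act0_def)
  moreover have "Cmp D (act_counit s m) (act D s n m \<Phi>) =
      Cmp D (Cmp D (act_counit s m) (zpow D (rot s m) (\<Phi> 0))) (act0 s n m ?\<psi>)"
    unfolding act_def using act0_based[OF b] rot_pow(1)[OF m] act_counit_sel by (simp add: assoc)
  ultimately show ?thesis using act_counit_rot[OF m] by simp
qed

text \<open>
  The composite does not depend on \<open>n\<close>, since it is unchanged by any arrow from \<open>[0]\<close> to \<open>[n - 1]\<close>.
\<close>

lemma act_counit_unit:
  assumes n: "n > 0"
  shows "Cmp D (act_counit s n) (act_unit D s n) = Cmp D (act_counit s 1) (act_unit D s 1)"
proof -
  define \<Phi> where "\<Phi> l = int n * l" for l
  have \<Phi>: "para_map 1 n \<Phi>" by (auto simp: para_map_def \<Phi>_def mono_def mult_left_mono distrib_left)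
  have "Cmp D (act_counit s 1) (act_unit D s 1) = Cmp D (act_counit s n) (Cmp D (act D s 1 n \<Phi>) (act_unit D s 1))"
    unfolding act_counit_act[OF \<Phi> zero_less_one n, symmetric]
    using act_counit_sel[of n] act_sel[OF \<Phi> n] act_unit_sel[of 1] by (simp add: assoc)
  then show ?thesis unfolding act_act_unit[OF \<Phi> zero_less_one n] by simp
qed

end

section \<open>The functor defined by a trace\<close>

fun realize_ob :: "('c, 'd) trace_data \<Rightarrow> cone_ob \<Rightarrow> 'c" where
  "realize_ob s None = TOb s (gfs 0)"
| "realize_ob s (Some None) = TOb s (fgs 0)"
| "realize_ob s (Some (Some n)) = TOb s (gfs (Suc n))"

fun realize_ar :: "('c, 'd) cat \<Rightarrow> ('c, 'd) trace_data \<Rightarrow> cone_ob \<Rightarrow> cone_ob \<Rightarrow> (int \<Rightarrow> int) \<Rightarrow> 'd" where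
  "realize_ar D s None None \<Phi> = Idt D (TOb s (gfs 0))"
| "realize_ar D s (Some None) None \<Phi> = Cmp D (act_counit s 1) (act_unit D s 1)"
| "realize_ar D s (Some (Some n)) None \<Phi> = act_counit s (Suc n)"
| "realize_ar D s (Some None) (Some None) \<Phi> = Idt D (TOb s (fgs 0))"
| "realize_ar D s (Some None) (Some (Some m)) \<Phi> = act_unit D s (Suc m)"
| "realize_ar D s (Some (Some n)) (Some (Some m)) \<Phi> = act D s (Suc n) (Suc m) \<Phi>"
| "realize_ar D s _ _ \<Phi> = undefined"

fun underlying_map :: "cone_ar \<Rightarrow> int \<Rightarrow> int" where
  "underlying_map (Inl (Inl (n, \<Phi>, m))) = \<Phi>"
| "underlying_map _ = id"

definition realization :: "('c, 'd) cat \<Rightarrow> ('c, 'd) trace_data \<Rightarrow> (cone_ob, cone_ar, 'c, 'd) fctr" where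
  "realization D s = \<lparr> FOb = realize_ob s, FAr = (\<lambda>h. realize_ar D s (Dom coned h) (Cod coned h) (underlying_map h)) \<rparr>"

lemma realize_ar_cone_arrow: "cone_map x y \<Phi> \<Longrightarrow> FAr (realization D s) (cone_arrow x y \<Phi>) = realize_ar D s x y \<Phi>"
  using cone_arrow_sel[of x y \<Phi>]
  by (cases "(D, s, x, y, \<Phi>)" rule: realize_ar.cases) (simp_all add: realization_def)

context trace
begin

lemma realize_ar_hom: "cone_map x y \<Phi> \<Longrightarrow> in_hom D (realize_ar D s x y \<Phi>) (realize_ob s x) (realize_ob s y)"
  using act_counit_sel act_unit_sel(1-3) act_sel[of _ _ \<Phi>] t_ob[OF endo_gf(1)[of 0]] t_ob[OF endo_gf(2)[of 0]]
  by (cases "(D, s, x, y, \<Phi>)" rule: realize_ar.cases) (simp_all add: in_hom_def idt_sel cmp_sel)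

lemma realize_ar_comp:
  assumes "cone_map x y \<Phi>" "cone_map y z \<Psi>"
  shows "realize_ar D s x z (\<Psi> \<circ> \<Phi>) = Cmp D (realize_ar D s y z \<Psi>) (realize_ar D s x y \<Phi>)"
proof -
  note ob = t_ob[OF endo_gf(1)[of 0]] t_ob[OF endo_gf(2)[of 0]]
  have u: "act_unit D s 1 \<in> Ar D" "Dom D (act_unit D s 1) = TOb s (fgs 0)" "Cod D (act_unit D s 1) = TOb s (gfs 1)"
    using act_unit_sel[of 1] by simp_all
  consider (tt) "y = None" "z = None" | (ii) "x = Some None" "y = Some None"
    | (it) m where "x = Some None" "y = Some (Some m)" "z = None"
    | (im) m k where "x = Some None" "y = Some (Some m)" "z = Some (Some k)" "para_map (Suc m) (Suc k) \<Psi>"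
    | (mt) n m where "x = Some (Some n)" "y = Some (Some m)" "z = None" "para_map (Suc n) (Suc m) \<Phi>"
    | (mm) n m k where "x = Some (Some n)" "y = Some (Some m)" "z = Some (Some k)"
        "para_map (Suc n) (Suc m) \<Phi>" "para_map (Suc m) (Suc k) \<Psi>"
    using assms
    by (cases "(x, y, \<Phi>)" rule: cone_map.cases; cases "(y, z, \<Psi>)" rule: cone_map.cases; cases "the y") auto
  then show ?thesis
  proof cases
    case tt
    then show ?thesis using realize_ar_hom[of x None \<Phi>] realize_ar_hom[of x None "\<Psi> \<circ> \<Phi>"]
      by (cases x; cases "the x") (simp_all add: in_hom_def unit_laws)
  next
    case ii
    then show ?thesis using realize_ar_hom[of "Some None" z \<Psi>] assms
      by (cases z; cases "the z") (simp_all add: in_hom_def unit_laws)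
  next
    case it
    then show ?thesis using act_counit_unit[of "Suc m"] by simp
  next
    case im
    then show ?thesis using act_act_unit[OF im(4)] by simp
  next
    case mt
    then show ?thesis using act_counit_act[OF mt(4)] by simp
  next
    case mm
    then show ?thesis using act_comp[OF mm(4,5)] by simp
  qed
qed

lemma realization_functor: "is_functor coned D (realization D s)"
  unfolding is_functor_def
proof (intro conjI allI impI ballI category_coned category_axioms)
  show "FOb (realization D s) x \<in> Ob D" if "x \<in> Ob coned" for x
    using t_ob[OF endo_gf(1)] t_ob[OF endo_gf(2)]
    by (cases x; cases "the x") (simp_all add: realization_def)
  show "FAr (realization D s) (Idt coned x) = Idt D (FOb (realization D s) x)" for x
    using realize_ar_cone_arrow[OF cone_map_id, of D s x] act_shift[of _ 0] rot_pow(4)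
    by (cases x; cases "the x") (simp_all add: coned_sel realization_def id_def)
next
  fix h x y assume "in_hom coned h x y"
  then obtain \<Phi> where "cone_map x y \<Phi>" "h = cone_arrow x y \<Phi>" unfolding coned_hom by blast
  then show "in_hom D (FAr (realization D s) h) (FOb (realization D s) x) (FOb (realization D s) y)"
    using realize_ar_hom realize_ar_cone_arrow[of x y \<Phi> D s] by (simp add: realization_def)
next
  fix h k x y z assume "in_hom coned h x y" "in_hom coned k y z"
  then obtain \<Phi> \<Psi> where v: "cone_map x y \<Phi>" "h = cone_arrow x y \<Phi>" "cone_map y z \<Psi>" "k = cone_arrow y z \<Psi>"
    unfolding coned_hom by blast
  then show "FAr (realization D s) (Cmp coned k h) = Cmp D (FAr (realization D s) k) (FAr (realization D s) h)"
    using realize_ar_comp[OF v(1,3)] cone_map_comp[OF v(1,3)] by (simp add: coned_cmp realize_ar_cone_arrow)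
qed

lemma realize_trace_ob: "realize_ob s (trace_ob F) = TOb s (if fst F = Ob0 \<and> gcount F = 0 then fgs 0 else gfs (gcount F))"
  by (cases "fst F") (auto simp: trace_ob_def)

text \<open>
  Existence half of universality: every trace is the image of the paracyclic trace under its realization.
\<close>

lemma realization_trace_iso: "trace_iso D (push_trace (realization D s) paracyclic_trace) s (straighten D s)"
  unfolding trace_iso_def push_trace_sel
proof (intro conjI allI impI)
  fix F assume F: "endo F"
  show "in_hom D (straighten D s F) (FOb (realization D s) (TOb paracyclic_trace F)) (TOb s F)"
    "is_iso D (straighten D s F)"
    using straighten_sel[OF F] realize_trace_ob[of F] by (simp_all add: in_hom_def realization_def paracyclic_trace_sel)
next
  fix a F G assume a: "hom2 a F G" and F: "endo F"
  note G = endo_hom2[OF a F]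
  note kv = trace_cone_map[OF a F]
  have "Cmp D (TAr s a) (straighten D s F) = Cmp D (straighten D s G)
      (realize_ar D s (trace_ob F) (trace_ob G) (periodic (gcount F) (gcount G) (cell_map a)))"
  proof (cases rule: trace_hom_cases[OF a F])
    case 1
    then have "gcount G = 0" "fst G = Ob1" by (auto simp: trace_ob_def split: if_splits intro: adj_ob.exhaust)
    then have GF: "G = gfs 0" "F = gfs (gcount F)"
      using endo_source(1)[OF G] endo_source(1)[OF F] hom2_cells(3)[OF a] by auto
    obtain n where n: "F = gfs n" using GF by blast
    have c: "a = counit_cell_n n" using counit_cell_n(2) a GF n by simp
    have "realize_ar D s (trace_ob F) None \<Phi> = TAr s a" for \<Phi>
    proof (cases n)
      case 0
      then have "a = ide (gfs 0)" using counit_cell_n(2)[of _ 0] ide_hom[of "gfs 0"] c by (metis gf_sel(1))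
      then show ?thesis using 0 n t_ide[OF endo_gf(1)] by (simp add: trace_ob_def)
    next
      case (Suc n')
      then show ?thesis using n c by (simp add: trace_ob_def act_counit_def)
    qed
    then show ?thesis
      using n GF 1 ar_sel[OF a F] by (simp add: straighten_gfs unit_laws)
  next
    case (2 y)
    then have F0: "F = fgs 0" and "fst G = Ob0"
      using endo_source(2)[OF F] hom2_cells(3)[OF a] by (auto simp: trace_ob_def split: if_splits)
    then obtain m where m: "G = fgs m" using endo_source(2)[OF G] by blast
    have c: "a = unit_cell_n m" using unit_cell_n(2) a F0 m by simp
    have sF: "straighten D s F = Idt D (TOb s F)" using F0 by (simp add: straighten_def)
    have "TAr s a = Cmp D (straighten D s G) (realize_ar D s (Some None) (trace_ob G) \<Phi>)" for \<Phi>
    proof (cases m)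
      case 0
      then have "a = ide (fgs 0)" using unit_cell_n(2)[of _ 0] ide_hom[of "fgs 0"] c by (metis gf_sel(5))
      then show ?thesis
        using 0 m t_ide[OF endo_gf(2)] t_ob[OF endo_gf(2)[of 0]]
        by (simp add: trace_ob_def straighten_def unit_laws idt_sel)
    next
      case (Suc m')
      then show ?thesis using m c act_unit_sel(4)[of m] by (simp add: trace_ob_def)
    qed
    then show ?thesis using 2 sF ar_sel[OF a F] by (simp add: unit_laws)
  next
    case 3
    then show ?thesis using straighten_nat[OF a F 3] by (simp add: trace_ob_def)
  qed
  then show "Cmp D (TAr s a) (straighten D s F) = Cmp D (straighten D s G) (FAr (realization D s) (TAr paracyclic_trace a))"
    unfolding paracyclic_trace_sel(2)[OF a] realize_ar_cone_arrow[OF kv] .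
next
  fix F G assume l: "loop_pair F G"
  let ?x = "trace_ob (adj_comp F G)"
  have "Cmp D (TSw s F G) (straighten D s (adj_comp F G)) =
      Cmp D (straighten D s (adj_comp G F)) (realize_ar D s ?x ?x (\<lambda>l. l + int (gcount G)))"
  proof (cases "gcount (adj_comp F G) = 0")
    case True
    then obtain X where X: "F = adj_unit X" "G = adj_unit X" using loop_pair_gcount_0[OF l] by blast
    then have e: "endo (adj_unit X)" by (simp add: endo_def)
    have "realize_ar D s ?x ?x \<Phi> = Idt D (TOb s (adj_unit X))" for \<Phi>
      using X by (cases X) (simp_all add: trace_ob_def gf_unit adj_comp_def adj_unit_def)
    moreover have "adj_comp (adj_unit X) (adj_unit X) = adj_unit X" by simp
    moreover have "TSw s (adj_unit X) (adj_unit X) = Idt D (TOb s (adj_unit X))" using sw_unit[OF e] by simp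
    moreover have "straighten D s (adj_unit X) = Idt D (TOb s (adj_unit X))" by (simp add: straighten_def)
    ultimately show ?thesis using X by simp
  next
    case False
    let ?n = "gcount (adj_comp F G)"
    have "realize_ar D s ?x ?x (\<lambda>l. l + int (gcount G)) = zpow D (rot s ?n) (int (gcount G))"
      using act_shift[of ?n "int (gcount G)"] False by (simp add: trace_ob_def del: gcount_simps)
    then show ?thesis using swap_straighten[OF l HOL.refl] False by (simp del: gcount_simps)
  qed
  then show "Cmp D (TSw s F G) (straighten D s (adj_comp F G)) =
      Cmp D (straighten D s (adj_comp G F)) (FAr (realization D s) (TSw paracyclic_trace F G))"
    unfolding paracyclic_trace_sel(3) trace_ob_swap[OF l, symmetric] realize_ar_cone_arrow[OF cone_map_shift] .
qed

end

section \<open>Uniqueness of the functor\<close>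

fun cell_over :: "cone_ob \<Rightarrow> adj_cell" where
  "cell_over None = gfs 0"
| "cell_over (Some None) = fgs 0"
| "cell_over (Some (Some n)) = gfs (Suc n)"

lemma cell_over: "endo (cell_over x)" "trace_ob (cell_over x) = x"
  by (cases x rule: cell_over.cases; simp add: endo_gf trace_ob_def)+

lemma periodic_restr:
  assumes "based n m \<psi>" "n > 0" shows "periodic n m (restr n m \<psi>) = \<psi>"
proof (rule periodic_unique[of n \<psi> m, OF assms(2) basedD(3)[OF assms(1)]])
  show "\<psi> (int i) = int (restr n m \<psi> i)" if "i < n" for i
    using that monoD[OF basedD(1)[OF assms(1)], of 0 "int i"] basedD(2)[OF assms(1)] by (simp add: restr_def)
qed

text \<open>
  Uniqueness half. Every object is a value of the trace, which prescribes \<open>\<eta>\<close>; it is well defined because the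
  straightening swaps become identities. It is natural because 2-cells and swaps generate all arrows: those
  to and from cone points are 2-cells or composites of two, and the others are shifts after 2-cells.
\<close>

lemma paracyclic_trace_unique:
  assumes H: "is_functor coned D H" and K: "is_functor coned D K"
    and \<mu>: "trace_iso D (push_trace H paracyclic_trace) (push_trace K paracyclic_trace) \<mu>"
  shows "\<exists>\<eta>. nat_iso coned D H K \<eta> \<and> (\<forall>F. endo F \<longrightarrow> \<eta> (trace_ob F) = \<mu> F)"
proof -
  interpret C: category coned by (rule category_coned)
  interpret D: category D by (rule functorD(2)[OF H])
  interpret P: trace coned paracyclic_trace by (rule trace_paracyclic)
  define \<eta> where "\<eta> x = \<mu> (cell_over x)" for x
  have m: "\<mu> F \<in> Ar D" "Dom D (\<mu> F) = FOb H (trace_ob F)" "Cod D (\<mu> F) = FOb K (trace_ob F)" "is_iso D (\<mu> F)"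
    if "endo F" for F using trace_isoD(1-4)[OF \<mu> that] by (simp_all add: paracyclic_trace_sel)
  have e: "\<eta> (trace_ob F) = \<mu> F" if F: "endo F" for F
  proof (cases rule: endo_cases[OF F])
    case 1
    then obtain n where "F = gfs n" by blast
    then show ?thesis by (cases n) (simp_all add: \<eta>_def trace_ob_def)
  next
    case 2
    then obtain n where n: "F = fgs n" by blast
    show ?thesis
    proof (cases n)
      case (Suc n')
      let ?x = "Some (Some n')"
      have ob: "FOb H ?x \<in> Ob D" "FOb K ?x \<in> Ob D"
        using functorD(3)[OF H] functorD(3)[OF K] by (simp_all add: coned_sel)
      have "TSw paracyclic_trace (gfg n') (fgf 0) = Idt coned ?x"
        by (simp add: paracyclic_trace_sel coned_sel gf_comp trace_ob_def id_def)
      then have "Cmp D (Idt D (FOb K ?x)) (\<mu> (gfs (Suc n'))) = Cmp D (\<mu> (fgs (Suc n'))) (Idt D (FOb H ?x))"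
        using trace_isoD(6)[OF \<mu> loop_gf(3)[of n' 0]] functorD(5)[OF H, of ?x] functorD(5)[OF K, of ?x]
        by (simp add: gf_comp coned_sel)
      then have "\<mu> (gfs (Suc n')) = \<mu> (fgs (Suc n'))"
        using m[OF endo_gf(1)[of "Suc n'"]] m[OF endo_gf(2)[of "Suc n'"]] by (simp add: trace_ob_def D.unit_laws)
      then show ?thesis using n Suc by (simp add: \<eta>_def trace_ob_def)
    qed (use n in \<open>simp add: \<eta>_def trace_ob_def\<close>)
  qed
  have et: "\<eta> x \<in> Ar D \<and> Dom D (\<eta> x) = FOb H x \<and> Cod D (\<eta> x) = FOb K x \<and> is_iso D (\<eta> x)" for x
    using m[OF cell_over(1)[of x]] by (simp add: \<eta>_def cell_over)
  define natural_at where "natural_at x y \<Phi> \<longleftrightarrow> Cmp D (FAr K (cone_arrow x y \<Phi>)) (\<eta> x) = Cmp D (\<eta> y) (FAr H (cone_arrow x y \<Phi>))" for x y \<Phi>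
  have tp: "FAr L (cone_arrow x y \<Phi>) \<in> Ar D \<and> Dom D (FAr L (cone_arrow x y \<Phi>)) = FOb L x \<and> Cod D (FAr L (cone_arrow x y \<Phi>)) = FOb L y"
    if "is_functor coned D L" "cone_map x y \<Phi>" for L x y \<Phi>
    using functorD(7-9)[OF that(1) cone_arrow_sel(3)[OF that(2)]] cone_arrow_sel[OF that(2)] by simp
  have cmp: "FAr L (cone_arrow x z (\<Psi> \<circ> \<Phi>)) = Cmp D (FAr L (cone_arrow y z \<Psi>)) (FAr L (cone_arrow x y \<Phi>))"
    if "is_functor coned D L" "cone_map x y \<Phi>" "cone_map y z \<Psi>" for L x y z \<Phi> \<Psi>
    using functor_cmp[OF that(1) cone_arrow_sel(3)[OF that(2)] cone_arrow_sel(3)[OF that(3)]] cone_arrow_sel that coned_cmp by simp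
  have nat_comp: "natural_at x z (\<Psi> \<circ> \<Phi>)" if v: "cone_map x y \<Phi>" "cone_map y z \<Psi>" and n: "natural_at x y \<Phi>" "natural_at y z \<Psi>" for x y z \<Phi> \<Psi>
  proof -
    note t = tp[OF H v(1)] tp[OF K v(1)] tp[OF H v(2)] tp[OF K v(2)] et[of x] et[of y] et[of z]
    have "Cmp D (FAr K (cone_arrow y z \<Psi>)) (Cmp D (FAr K (cone_arrow x y \<Phi>)) (\<eta> x)) = Cmp D (\<eta> z) (Cmp D (FAr H (cone_arrow y z \<Psi>)) (FAr H (cone_arrow x y \<Phi>)))"
      using n(1) D.pre[OF n(2)[unfolded natural_at_def], of "FAr H (cone_arrow x y \<Phi>)"] t by (simp add: natural_at_def)
    then show ?thesis unfolding natural_at_def cmp[OF H v] cmp[OF K v] using t by (simp add: D.assoc)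
  qed
  have nat_tr: "natural_at (trace_ob F) (trace_ob G) (periodic (gcount F) (gcount G) (cell_map a))" if a: "hom2 a F G" "endo F" for a F G
    using trace_isoD(5)[OF \<mu> a] e[OF a(2)] e[OF endo_hom2[OF a]] by (simp add: natural_at_def paracyclic_trace_sel(2)[OF a(1)])
  have one: "natural_at (Some (Some n)) (Some (Some n)) (\<lambda>l. l + 1)" for n
    using trace_isoD(6)[OF \<mu> loop_gf(1)[of n 1]] e[OF endo_gf(1)[of "Suc n"]]
    by (simp add: natural_at_def paracyclic_trace_sel(3) gf_add trace_ob_def)
  have nat_rot: "natural_at (Some (Some n)) (Some (Some n)) (\<lambda>l. l + k)" for n k
  proof (induction k rule: int_induct[where k = 0])
    case base
    have p: "periodic (Suc n) (Suc n) id = (\<lambda>l. l)" by (rule periodic_unique) auto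
    show ?case using nat_tr[OF ide_hom[OF gf_sel(1)] endo_gf(1), of "Suc n"] by (simp add: trace_ob_def p)
  next
    case (step1 i)
    have "natural_at (Some (Some n)) (Some (Some n)) ((\<lambda>l. l + 1) \<circ> (\<lambda>l. l + i))"
      using nat_comp[OF cone_map_shift cone_map_shift step1(2) one] .
    then show ?case by (simp add: o_def add.assoc)
  next
    case (step2 i)
    let ?x = "Some (Some n)"
    let ?s = "cone_arrow ?x ?x (\<lambda>l. l + 1)" and ?r = "cone_arrow ?x ?x (\<lambda>l. l + (i - 1))"
    have c: "FAr L (cone_arrow ?x ?x (\<lambda>l. l + i)) = Cmp D (FAr L ?s) (FAr L ?r)" if "is_functor coned D L" for L
      using cmp[OF that cone_map_shift[of ?x "i - 1"] cone_map_shift[of ?x 1]] by (simp add: o_def)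
    have "TSw paracyclic_trace (gfs n) (gfs 1) = ?s" by (simp add: paracyclic_trace_sel(3) gf_add trace_ob_def)
    then have isoK: "is_iso D (FAr K ?s)" using functor_iso(1)[OF K P.sw_sel(4)[OF loop_gf(1)[of n 1]]] by simp
    note t = tp[OF H cone_map_shift, of ?x] tp[OF K cone_map_shift, of ?x] et[of ?x]
    show ?case unfolding natural_at_def
    proof (rule D.iso_mono[OF isoK])
      have "Cmp D (FAr K ?s) (Cmp D (FAr K ?r) (\<eta> ?x)) = Cmp D (\<eta> ?x) (Cmp D (FAr H ?s) (FAr H ?r))"
        using step2(2) t unfolding natural_at_def c[OF H] c[OF K] by (simp add: D.assoc)
      also have "\<dots> = Cmp D (FAr K ?s) (Cmp D (\<eta> ?x) (FAr H ?r))"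
        by (rule D.pre[OF one[unfolded natural_at_def, symmetric]]) (use t in simp_all)
      finally show "Cmp D (FAr K ?s) (Cmp D (FAr K ?r) (\<eta> ?x)) = Cmp D (FAr K ?s) (Cmp D (\<eta> ?x) (FAr H ?r))" .
    qed (use t in \<open>simp_all add: D.cmp_sel\<close>)
  qed
  have nat_unit: "natural_at (Some None) (Some (Some m)) \<Phi>" for m \<Phi>
    using nat_tr[OF unit_cell_n(1)[of "Suc m"] endo_gf(2)] by (simp add: trace_ob_def natural_at_def)
  have nat_counit: "natural_at (Some (Some n)) None \<Phi>" for n \<Phi>
    using nat_tr[OF counit_cell_n(1)[of "Suc n"] endo_gf(1)] by (simp add: trace_ob_def natural_at_def)
  have natural: "natural_at x y \<Phi>" if v: "cone_map x y \<Phi>" for x y \<Phi>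
    using v
  proof -
    consider (1) "x = None" "y = None" | (2) "x = Some None" "y = None" | (3) n where "x = Some (Some n)" "y = None"
      | (4) "x = Some None" "y = Some None" | (5) m where "x = Some None" "y = Some (Some m)"
      | (6) n m where "x = Some (Some n)" "y = Some (Some m)"
      using v by (cases x; cases "the x"; cases y; cases "the y") auto
    then show ?thesis
    proof cases
    case 1
    then show ?thesis using nat_tr[OF ide_hom, of "gfs 0"] endo_gf(1)[of 0] by (simp add: trace_ob_def natural_at_def)
  next
    case 2
    have "natural_at (Some None) None (id \<circ> id)"
      by (rule nat_comp[OF _ _ nat_unit[of 0 id] nat_counit[of 0 id]]) simp_all
    with 2 show ?thesis by (simp add: natural_at_def)
  next
    case 4
    then show ?thesis using nat_tr[OF ide_hom, of "fgs 0"] endo_gf(2)[of 0] by (simp add: trace_ob_def natural_at_def)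
  next
    case (6 n m)
    then have p: "para_map (Suc n) (Suc m) \<Phi>" using v by simp
    note b = based_shift0[OF p]
    note c = restr_cell[OF basedD(1,2,4)[OF b]]
    have "natural_at (Some (Some n)) (Some (Some m)) (\<lambda>l. \<Phi> l - \<Phi> 0)"
      using nat_tr[OF c(1) endo_gf(1)] periodic_restr[OF b] c(2) by (simp add: trace_ob_def)
    from nat_comp[OF _ cone_map_shift this nat_rot, of "\<Phi> 0"]
    have "natural_at (Some (Some n)) (Some (Some m)) ((\<lambda>l. l + \<Phi> 0) \<circ> (\<lambda>l. \<Phi> l - \<Phi> 0))"
      using para_map_based[OF b] by simp
    then show ?thesis using 6 by (simp add: o_def)
    qed (use nat_unit nat_counit in simp_all)
  qed
  have "nat_iso coned D H K \<eta>" unfolding nat_iso_def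
  proof (intro conjI allI impI ballI H K)
    fix x :: cone_ob
    show "in_hom D (\<eta> x) (FOb H x) (FOb K x)" "is_iso D (\<eta> x)" using et by (simp_all add: in_hom_def)
  next
    fix h and x y :: cone_ob assume "in_hom coned h x y"
    then show "Cmp D (FAr K h) (\<eta> x) = Cmp D (\<eta> y) (FAr H h)" using natural unfolding coned_hom natural_at_def by blast
  qed
  with e show ?thesis by blast
qed

section \<open>Transport of categories along injections\<close>

definition transport :: "('o, 'm) cat \<Rightarrow> ('o \<Rightarrow> 'p) \<Rightarrow> ('m \<Rightarrow> 'n) \<Rightarrow> ('p, 'n) cat" where
  "transport C e d = \<lparr> Ob = e ` Ob C, Ar = d ` Ar C,
     Dom = (\<lambda>h. e (Dom C (inv_into (Ar C) d h))), Cod = (\<lambda>h. e (Cod C (inv_into (Ar C) d h))),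
     Idt = (\<lambda>x. d (Idt C (inv_into (Ob C) e x))),
     Cmp = (\<lambda>k h. d (Cmp C (inv_into (Ar C) d k) (inv_into (Ar C) d h))) \<rparr>"

lemma transport:
  assumes C: "category C" and e: "inj_on e (Ob C)" and d: "inj_on d (Ar C)"
  shows "is_functor C (transport C e d) \<lparr> FOb = e, FAr = d \<rparr>"
    "is_functor (transport C e d) C \<lparr> FOb = inv_into (Ob C) e, FAr = inv_into (Ar C) d \<rparr>"
proof -
  interpret category C by fact
  let ?T = "transport C e d"
  have sel: "h \<in> Ar C \<Longrightarrow> Dom ?T (d h) = e (Dom C h)" "h \<in> Ar C \<Longrightarrow> Cod ?T (d h) = e (Cod C h)"
    "x \<in> Ob C \<Longrightarrow> Idt ?T (e x) = d (Idt C x)"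
    "h \<in> Ar C \<Longrightarrow> k \<in> Ar C \<Longrightarrow> Cmp ?T (d k) (d h) = d (Cmp C k h)" for h k x
    using e d by (simp_all add: transport_def)
  have hom: "in_hom ?T h' x' y' \<longleftrightarrow> (\<exists>h x y. in_hom C h x y \<and> h' = d h \<and> x' = e x \<and> y' = e y)" for h' x' y'
    using sel by (auto simp: in_hom_def) (auto simp: transport_def)
  have eq: "e x = e y \<Longrightarrow> in_hom C h z x \<Longrightarrow> in_hom C k y w \<Longrightarrow> x = y" for x y z w h k
    using e by (auto simp: in_hom_def inj_on_def dom_ob cod_ob)
  have ob: "Ob ?T = e ` Ob C" "Ar ?T = d ` Ar C" by (simp_all add: transport_def)
  have T: "category ?T"
  proof
    fix h assume "h \<in> Ar ?T"
    then obtain h0 where "h = d h0" "h0 \<in> Ar C" by (auto simp: ob)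
    then show "Dom ?T h \<in> Ob ?T" "Cod ?T h \<in> Ob ?T" using sel dom_ob cod_ob by (auto simp: ob)
  next
    fix x assume "x \<in> Ob ?T"
    then show "in_hom ?T (Idt ?T x) x x" unfolding hom using sel(3) idt_hom by (fastforce simp: ob)
  next
    fix h k x y z assume "in_hom ?T h x y" "in_hom ?T k y z"
    then obtain h0 k0 x0 y0 y1 z0 where "h = d h0" "k = d k0" "in_hom C h0 x0 y0" "in_hom C k0 y1 z0"
      "x = e x0" "e y0 = e y1" "z = e z0" unfolding hom by metis
    then have "in_hom C (Cmp C k0 h0) x0 z0" "Cmp ?T k h = d (Cmp C k0 h0)"
      using eq cmp_hom sel(4) by (metis, simp add: in_hom_def)
    then show "in_hom ?T (Cmp ?T k h) x z" unfolding hom using \<open>x = e x0\<close> \<open>z = e z0\<close> by blast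
  next
    fix h x y assume "in_hom ?T h x y"
    then obtain h0 x0 y0 where h: "h = d h0" "in_hom C h0 x0 y0" "x = e x0" "y = e y0" unfolding hom by blast
    then have "x0 \<in> Ob C" "y0 \<in> Ob C" "h0 \<in> Ar C" using dom_ob cod_ob by (auto simp: in_hom_def)
    then show "Cmp ?T h (Idt ?T x) = h" "Cmp ?T (Idt ?T y) h = h"
      using h sel cmp_idt[OF h(2)] idt_cmp[OF h(2)] by (simp_all add: idt_sel)
  next
    fix h k l x y z w assume "in_hom ?T h x y" "in_hom ?T k y z" "in_hom ?T l z w"
    then obtain h0 k0 l0 x0 y0 y1 z0 z1 w0 where h: "h = d h0" "k = d k0" "l = d l0"
      "in_hom C h0 x0 y0" "in_hom C k0 y1 z0" "in_hom C l0 z1 w0" "e y0 = e y1" "e z0 = e z1" unfolding hom by metis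
    then have "y0 = y1" "z0 = z1" using eq by blast+
    then show "Cmp ?T l (Cmp ?T k h) = Cmp ?T (Cmp ?T l k) h"
      using h cmp_assoc[of h0 x0 y0 k0 z0 l0 w0] by (simp add: sel cmp_sel in_hom_def)
  qed
  show "is_functor C ?T \<lparr> FOb = e, FAr = d \<rparr>"
    unfolding is_functor_def fctr.simps
    by (intro conjI allI impI ballI C T) (auto simp: ob hom sel in_hom_def)
  have i: "x \<in> Ob C \<Longrightarrow> inv_into (Ob C) e (e x) = x" "h \<in> Ar C \<Longrightarrow> inv_into (Ar C) d (d h) = h" for x h
    using e d by simp_all
  show "is_functor ?T C \<lparr> FOb = inv_into (Ob C) e, FAr = inv_into (Ar C) d \<rparr>"
    unfolding is_functor_def fctr.simps
  proof (intro conjI allI impI ballI C T)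
    fix x assume "x \<in> Ob ?T"
    then show "inv_into (Ob C) e x \<in> Ob C" "inv_into (Ar C) d (Idt ?T x) = Idt C (inv_into (Ob C) e x)"
      using i sel(3) idt_sel by (auto simp: ob)
  next
    fix h x y assume "in_hom ?T h x y"
    then show "in_hom C (inv_into (Ar C) d h) (inv_into (Ob C) e x) (inv_into (Ob C) e y)"
      unfolding hom using i dom_ob cod_ob by (auto simp: in_hom_def)
  next
    fix h k x y z assume "in_hom ?T h x y" "in_hom ?T k y z"
    then obtain h0 k0 x0 y0 y1 z0 where h: "h = d h0" "k = d k0" "in_hom C h0 x0 y0" "in_hom C k0 y1 z0"
      "e y0 = e y1" unfolding hom by metis
    then have "y0 = y1" using eq by blast
    then show "inv_into (Ar C) d (Cmp ?T k h) = Cmp C (inv_into (Ar C) d k) (inv_into (Ar C) d h)"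
      using h i(2) sel(4) by (simp add: in_hom_def cmp_sel)
  qed
qed

text \<open>
  A periodic map is determined by its values on one period.
\<close>

lemma countable_coned: "countable (Ar coned)"
proof -
  define dec where "dec n m xs l = int (Suc m) * (l div int (Suc n)) + xs ! nat (l mod int (Suc n))"
    for n m :: nat and xs :: "int list" and l
  have "cone_arrow x y \<Phi> \<in> range (\<lambda>(x, y, n, m, xs). cone_arrow x y (dec n m xs))" if v: "cone_map x y \<Phi>" for x y \<Phi>
  proof (cases "\<exists>n m. x = Some (Some n) \<and> y = Some (Some m)")
    case True
    then obtain n m where nm: "x = Some (Some n)" "y = Some (Some m)" by blast
    have "\<Phi> = dec n m (map \<Phi> [0..int n])"
    proof
      fix l
      have r: "l mod int (Suc n) = int (nat (l mod int (Suc n)))" "nat (l mod int (Suc n)) < Suc n"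
        by (simp_all add: nat_less_iff del: of_nat_Suc)
      have "\<Phi> l = \<Phi> (l mod int (Suc n) + int (Suc n) * (l div int (Suc n)))" by simp
      also have "\<dots> = \<Phi> (l mod int (Suc n)) + int (Suc m) * (l div int (Suc n))"
        by (rule periodic_mult) (use v nm in \<open>simp add: para_map_def del: of_nat_Suc\<close>)
      also have "\<Phi> (l mod int (Suc n)) = map \<Phi> [0..int n] ! nat (l mod int (Suc n))"
        using r by (simp add: nth_upto del: of_nat_Suc)
      finally show "\<Phi> l = dec n m (map \<Phi> [0..int n]) l" by (simp add: dec_def)
    qed
    then show ?thesis by (intro range_eqI[of _ _ "(x, y, n, m, map \<Phi> [0..int n])"]) simp
  next
    case False
    then have "cone_arrow x y \<Phi> = cone_arrow x y (dec 0 0 [])" by (intro cone_arrow_cong) blast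
    then show ?thesis by (intro range_eqI[of _ _ "(x, y, 0, 0, [])"]) simp
  qed
  then have "Ar coned \<subseteq> range (\<lambda>(x, y, n, m, xs). cone_arrow x y (dec n m xs))" by (auto simp only: coned_ar)
  then show ?thesis by (rule countable_subset) (rule countable_image[OF countableI_type])
qed

lemma push_fcomp: "push_trace H (push_trace E s) = push_trace (fcomp H E) s"
  by (simp add: push_trace_def fcomp_def)

lemma push_fid: "push_trace fid s = s"
  by (simp add: push_trace_def fid_def)

lemma nat_iso_sections:
  assumes E: "is_functor C T E" and E': "is_functor T C E'"
    and sec: "\<And>x. x \<in> Ob T \<Longrightarrow> FOb E (FOb E' x) = x" "\<And>h. h \<in> Ar T \<Longrightarrow> FAr E (FAr E' h) = h"
    and H: "is_functor T D H" and K: "is_functor T D K"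
    and \<eta>: "nat_iso C D (fcomp H E) (fcomp K E) \<eta>"
  shows "nat_iso T D H K (\<lambda>x. \<eta> (FOb E' x))"
  unfolding nat_iso_def
proof (intro conjI allI impI ballI H K)
  fix x assume x: "x \<in> Ob T"
  then show "in_hom D (\<eta> (FOb E' x)) (FOb H x) (FOb K x)" "is_iso D (\<eta> (FOb E' x))"
    using nat_isoD(3,4)[OF \<eta> functorD(3)[OF E' x]] sec(1) by (simp_all add: fcomp_sel)
next
  fix h x y assume h: "in_hom T h x y"
  then have "h \<in> Ar T" by (simp add: in_hom_def)
  then show "Cmp D (FAr K h) (\<eta> (FOb E' x)) = Cmp D (\<eta> (FOb E' y)) (FAr H h)"
    using nat_isoD(5)[OF \<eta> functorD(4)[OF E' h]] sec(2) by (simp add: fcomp_sel)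
qed

text \<open>
  The double cone is countable, so it has a copy in any pair of infinite types, and the copy of the
  paracyclic trace is universal among traces in those types.
\<close>

lemma biHH_model:
  assumes "infinite (UNIV :: 'c set)" and "infinite (UNIV :: 'd set)"
  obtains T :: "('c, 'd) cat" and E E' where
    "is_biHH adj T (cocone_of (push_trace E paracyclic_trace))"
    "is_functor coned T E" "is_functor T coned E'"
    "\<And>x. FOb E' (FOb E x) = x" "\<And>h. h \<in> Ar coned \<Longrightarrow> FAr E' (FAr E h) = h"
proof -
  obtain f :: "nat \<Rightarrow> 'c" where f: "inj f" using infinite_countable_subset[OF assms(1)] by blast
  obtain g :: "nat \<Rightarrow> 'd" where g: "inj g" using infinite_countable_subset[OF assms(2)] by blast
  define e where "e = f \<circ> (to_nat :: cone_ob \<Rightarrow> nat)"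
  define d where "d = g \<circ> to_nat_on (Ar coned)"
  have e: "inj e" using f by (simp add: e_def inj_compose)
  have d: "inj_on d (Ar coned)"
    unfolding d_def by (rule comp_inj_on[OF inj_on_to_nat_on[OF countable_coned] inj_on_subset[OF g subset_UNIV]])
  let ?T = "transport coned e d" and ?E = "\<lparr> FOb = e, FAr = d \<rparr>"
    and ?E' = "\<lparr> FOb = inv_into (Ob coned) e, FAr = inv_into (Ar coned) d \<rparr>"
  note F = transport[OF category_coned inj_on_subset[OF e subset_UNIV] d]
  have ret: "FOb ?E' (FOb ?E x) = x" for x using e by (simp add: coned_sel)
  have ret2: "FAr ?E' (FAr ?E h) = h" if "h \<in> Ar coned" for h using d that by simp
  have T: "Ob ?T = range e" "Ar ?T = d ` Ar coned" by (simp_all add: transport_def coned_sel)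
  have sec: "FOb ?E (FOb ?E' x) = x" if "x \<in> Ob ?T" for x using that e by (auto simp: T coned_sel)
  have sec2: "FAr ?E (FAr ?E' h) = h" if "h \<in> Ar ?T" for h using that d by (auto simp: T)
  have "is_biHH adj ?T (cocone_of (push_trace ?E paracyclic_trace))"
  proof (rule pseudo_colimit_trace[OF trace_push[OF trace_paracyclic F(1)]])
    fix D :: "('c, 'd) cat" and s' assume s': "trace D s'"
    interpret s: trace D s' by fact
    let ?H = "fcomp (realization D s') ?E'"
    have "same_trace (push_trace (realization D s') paracyclic_trace) (push_trace ?H (push_trace ?E paracyclic_trace))"
    proof -
      interpret P: trace coned paracyclic_trace by (rule trace_paracyclic)
      show ?thesis unfolding same_trace_def push_trace_sel fcomp_sel
        using ret ret2 P.ar_sel(1) P.sw_sel(1) by metis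
    qed
    from trace_iso_cong[OF this same_trace_refl s.realization_trace_iso]
    show "\<exists>H \<mu>. is_functor ?T D H \<and> trace_iso D (push_trace H (push_trace ?E paracyclic_trace)) s' \<mu>"
      using functor_fcomp[OF F(2) s.realization_functor] by blast
  next
    fix D :: "('c, 'd) cat" and H K \<mu>
    assume H: "is_functor ?T D H" and K: "is_functor ?T D K"
      and \<mu>: "trace_iso D (push_trace H (push_trace ?E paracyclic_trace)) (push_trace K (push_trace ?E paracyclic_trace)) \<mu>"
    obtain \<eta> where \<eta>: "nat_iso coned D (fcomp H ?E) (fcomp K ?E) \<eta>" "\<And>F. endo F \<Longrightarrow> \<eta> (trace_ob F) = \<mu> F"
      using paracyclic_trace_unique[OF functor_fcomp[OF F(1) H] functor_fcomp[OF F(1) K] \<mu>[unfolded push_fcomp]] by blast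
    have "\<eta> (FOb ?E' (TOb (push_trace ?E paracyclic_trace) F)) = \<mu> F" if "endo F" for F
      using \<eta>(2)[OF that] ret by (simp add: paracyclic_trace_sel)
    with nat_iso_sections[OF F sec sec2 H K \<eta>(1)]
    show "\<exists>\<eta>. nat_iso ?T D H K \<eta> \<and> (\<forall>F. endo F \<longrightarrow> \<eta> (TOb (push_trace ?E paracyclic_trace) F) = \<mu> F)" by blast
  next
    fix x assume "x \<in> Ob ?T"
    then obtain y where "x = e y" by (auto simp: T)
    then show "\<exists>F. endo F \<and> TOb (push_trace ?E paracyclic_trace) F = x"
      using cell_over[of y] by (intro exI[of _ "cell_over y"]) (simp add: paracyclic_trace_sel)
  qed
  then show ?thesis using that[OF _ F ret ret2] by blast
qed

section \<open>Initial and terminal object and the Euler characteristic\<close>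

text \<open>
  Existence of arrows is carried over by \<open>G\<close>, and uniqueness by \<open>H\<close>, which is faithful because of \<open>\<eta>\<close>.
\<close>

lemma equivalence_initial:
  assumes H: "is_functor C K H" and G: "is_functor K C G" and \<eta>: "nat_iso C C fid (fcomp G H) \<eta>"
    and x: "x \<in> Ob C" and z: "initial_ob K z"
    and p: "in_hom K p (FOb H x) z" "is_iso K p" and q: "in_hom C q (FOb G z) x" "is_iso C q"
  shows "initial_ob C x"
  unfolding initial_ob_def
proof (intro conjI ballI x ex_ex1I)
  interpret C: category C by (rule functorD(1)[OF H])
  interpret K: category K by (rule functorD(2)[OF H])
  fix y assume y: "y \<in> Ob C"
  have ey: "in_hom C (\<eta> y) y (FOb G (FOb H y))" "is_iso C (\<eta> y)"
    using nat_isoD(3,4)[OF \<eta> y] by (simp_all add: fid_def fcomp_sel)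
  obtain k where "in_hom K k z (FOb H y)" using z functorD(3)[OF H y] unfolding initial_ob_def by blast
  from functorD(4)[OF G this]
  have "in_hom C (Cmp C (inv_ar C (\<eta> y)) (Cmp C (FAr G k) (inv_ar C q))) x y"
    using ey q by (simp add: in_hom_def C.cats)
  then show "\<exists>h. in_hom C h x y" by blast
next
  interpret C: category C by (rule functorD(1)[OF H])
  interpret K: category K by (rule functorD(2)[OF H])
  fix y h k assume y: "y \<in> Ob C" and h: "in_hom C h x y" and k: "in_hom C k x y"
  note Hh = functorD(4)[OF H h] and Hk = functorD(4)[OF H k]
  have "in_hom K (Cmp K (FAr H h) (inv_ar K p)) z (FOb H y)" "in_hom K (Cmp K (FAr H k) (inv_ar K p)) z (FOb H y)"
    using Hh Hk p by (simp_all add: in_hom_def K.cats)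
  then have "Cmp K (FAr H h) (inv_ar K p) = Cmp K (FAr H k) (inv_ar K p)"
    using z functorD(3)[OF H y] unfolding initial_ob_def by blast
  then have e: "FAr H h = FAr H k"
    using K.iso_epi[OF K.iso_inv[OF p(2)], of "FAr H h" "FAr H k"] Hh Hk p by (simp add: in_hom_def K.iso_sel)
  have "Cmp C (\<eta> y) h = Cmp C (\<eta> y) k"
    using nat_isoD(5)[OF \<eta> h] nat_isoD(5)[OF \<eta> k] e by (simp add: fid_def fcomp_sel)
  then show "h = k"
    using C.iso_mono[OF nat_isoD(4)[OF \<eta> y]] h k nat_isoD(3)[OF \<eta> y] by (simp add: in_hom_def fid_def)
qed

lemma equivalence_terminal:
  assumes H: "is_functor C K H" and G: "is_functor K C G" and \<eta>: "nat_iso C C fid (fcomp G H) \<eta>"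
    and x: "x \<in> Ob C" and z: "terminal_ob K z"
    and p: "in_hom K p (FOb H x) z" "is_iso K p" and q: "in_hom C q (FOb G z) x" "is_iso C q"
  shows "terminal_ob C x"
  unfolding terminal_ob_def
proof (intro conjI ballI x ex_ex1I)
  interpret C: category C by (rule functorD(1)[OF H])
  interpret K: category K by (rule functorD(2)[OF H])
  fix y assume y: "y \<in> Ob C"
  have ey: "in_hom C (\<eta> y) y (FOb G (FOb H y))"
    using nat_isoD(3)[OF \<eta> y] by (simp add: fid_def fcomp_sel)
  obtain k where "in_hom K k (FOb H y) z" using z functorD(3)[OF H y] unfolding terminal_ob_def by blast
  from functorD(4)[OF G this]
  have "in_hom C (Cmp C q (Cmp C (FAr G k) (\<eta> y))) y x"
    using ey q by (simp add: in_hom_def C.cats)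
  then show "\<exists>h. in_hom C h y x" by blast
next
  interpret C: category C by (rule functorD(1)[OF H])
  interpret K: category K by (rule functorD(2)[OF H])
  fix y h k assume y: "y \<in> Ob C" and h: "in_hom C h y x" and k: "in_hom C k y x"
  note Hh = functorD(4)[OF H h] and Hk = functorD(4)[OF H k]
  have "in_hom K (Cmp K p (FAr H h)) (FOb H y) z" "in_hom K (Cmp K p (FAr H k)) (FOb H y) z"
    using Hh Hk p by (simp_all add: in_hom_def K.cats)
  then have "Cmp K p (FAr H h) = Cmp K p (FAr H k)"
    using z functorD(3)[OF H y] unfolding terminal_ob_def by blast
  then have e: "FAr H h = FAr H k"
    using K.iso_mono[OF p(2), of "FAr H h" "FAr H k"] Hh Hk p by (simp add: in_hom_def)
  have "Cmp C (\<eta> x) h = Cmp C (\<eta> x) k"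
    using nat_isoD(5)[OF \<eta> h] nat_isoD(5)[OF \<eta> k] e by (simp add: fid_def fcomp_sel)
  then show "h = k"
    using C.iso_mono[OF nat_isoD(4)[OF \<eta> x]] h k nat_isoD(3)[OF \<eta> x] by (simp add: in_hom_def fid_def)
qed

lemma coned_initial: "initial_ob coned (Some None)"
proof -
  have "\<exists>!h. in_hom coned h (Some None) y" for y
  proof (rule ex_ex1I)
    have "cone_map (Some None) y id" by (cases y) auto
    then show "\<exists>h. in_hom coned h (Some None) y" unfolding coned_hom by blast
    show "h = k" if "in_hom coned h (Some None) y" "in_hom coned k (Some None) y" for h k
      using that unfolding coned_hom by (auto intro!: cone_arrow_cong)
  qed
  then show ?thesis by (simp add: initial_ob_def coned_sel)
qed

lemma coned_terminal: "terminal_ob coned None"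
proof -
  have "\<exists>!h. in_hom coned h x None" for x
  proof (rule ex_ex1I)
    show "\<exists>h. in_hom coned h x None" unfolding coned_hom by (intro exI[of _ "Inr x"] exI[of _ id]) simp
    show "h = k" if "in_hom coned h x None" "in_hom coned k x None" for h k
      using that unfolding coned_hom by (auto intro!: cone_arrow_cong)
  qed
  then show ?thesis by (simp add: terminal_ob_def coned_sel)
qed

lemma universal_euler_char_hom:
  assumes "cyclic_cocone C L"
  shows "in_hom C (universal_euler_char C L) (hh_ob L (adj_unit Ob0)) (hh_ob L (adj_unit Ob1))"
proof -
  interpret cyclic_cocone C L by fact
  interpret t: trace C "trace_of C L" by (rule trace_of_cocone)
  have l: "loop_pair cell_f cell_g" by (simp add: loop_pair_def cell_f_def cell_g_def)
  have e: "endo (Ob0, [])" "endo (Ob1, [Gg, Gf])" by (simp_all add: endo_def)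
  show ?thesis
    using t.ar_sel[OF hom2_u e(1)] t.ar_sel[OF hom2_c e(2)] t.sw_sel[OF l]
    by (simp add: universal_euler_char_def in_hom_def cmp_sel trace_of_def adj_unit_def cell_f_def cell_g_def)
qed

text \<open>
  An arbitrary biHH is compared with the model: realizing its own trace gives a functor from the double
  cone, and its universal property gives one back. Both composites carry the universal traces to themselves
  up to isomorphism, hence are isomorphic to identities.
\<close>

theorem corollary4p27:
  assumes "infinite (UNIV :: 'c set)" and "infinite (UNIV :: 'd set)"
  shows "(\<exists>(C :: ('c, 'd) cat) L. is_biHH adj C L) \<and>
    (\<forall>(C :: ('c, 'd) cat) L. is_biHH adj C L \<longrightarrow>
       equivalent_cats C (right_cone (left_cone paracyclic)) \<and>
       initial_ob C (hh_ob L (adj_unit Ob0)) \<and>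
       terminal_ob C (hh_ob L (adj_unit Ob1)) \<and>
       (\<forall>h. in_hom C h (hh_ob L (adj_unit Ob0)) (hh_ob L (adj_unit Ob1)) \<longleftrightarrow>
          h = universal_euler_char C L))"
proof -
  obtain T :: "('c, 'd) cat" and E E' where T: "is_biHH adj T (cocone_of (push_trace E paracyclic_trace))"
    and E: "is_functor coned T E" and E': "is_functor T coned E'"
    and ret: "\<And>x. FOb E' (FOb E x) = x" "\<And>h. h \<in> Ar coned \<Longrightarrow> FAr E' (FAr E h) = h"
    using biHH_model[OF assms] by blast
  interpret P: trace coned paracyclic_trace by (rule trace_paracyclic)
  have "equivalent_cats C coned \<and> initial_ob C (hh_ob L (adj_unit Ob0)) \<and> terminal_ob C (hh_ob L (adj_unit Ob1))"
    if C: "is_biHH adj C L" for C :: "('c, 'd) cat" and L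
  proof -
    let ?s = "trace_of C L"
    note cL = biHH_cocone[OF C]
    note s = cyclic_cocone.trace_of_cocone[OF cL]
    interpret s: trace C ?s by (rule s)
    let ?G = "realization C ?s"
    note G = s.realization_functor and \<mu> = s.realization_trace_iso
    have "trace T (push_trace E paracyclic_trace)" by (rule trace_push[OF trace_paracyclic E])
    from biHH_factor[OF C this] obtain H0 \<nu>0 where H0: "is_functor C T H0"
      and \<nu>0: "trace_iso T (push_trace H0 ?s) (push_trace E paracyclic_trace) \<nu>0" by blast
    let ?H = "fcomp E' H0"
    note H = functor_fcomp[OF H0 E']
    have same: "same_trace (push_trace E' (push_trace E paracyclic_trace)) paracyclic_trace"
      unfolding same_trace_def push_trace_sel using ret P.ar_sel(1) P.sw_sel(1) by metis
    from trace_iso_push[OF trace_push[OF s H0] trace_push[OF trace_paracyclic E] \<nu>0 E']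
    obtain \<nu> where \<nu>: "trace_iso coned (push_trace ?H ?s) paracyclic_trace \<nu>"
      using trace_iso_cong[OF same_trace_refl same] unfolding push_fcomp by blast
    \<comment> \<open>both composites carry the universal traces to themselves\<close>
    have tGH: "trace C (push_trace (fcomp ?G ?H) ?s)" by (rule trace_push[OF s functor_fcomp[OF H G]])
    have "trace_iso C (push_trace (fcomp ?G ?H) ?s) (push_trace ?G paracyclic_trace) (\<lambda>F. FAr ?G (\<nu> F))"
      using trace_iso_push[OF trace_push[OF s H] trace_paracyclic \<nu> G] unfolding push_fcomp .
    from trace_iso_trans[OF tGH trace_push[OF trace_paracyclic G] s this \<mu>]
    have "trace_iso C (push_trace (fcomp ?G ?H) ?s) ?s (\<lambda>F. Cmp C (straighten C ?s F) (FAr ?G (\<nu> F)))" .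
    from trace_iso_sym[OF tGH s this]
    obtain \<eta> where \<eta>: "nat_iso C C fid (fcomp ?G ?H) \<eta>"
      using biHH_unique[OF C functor_fid[OF s.category_axioms] functor_fcomp[OF H G]] unfolding push_fid by blast
    have tHG: "trace coned (push_trace (fcomp ?H ?G) paracyclic_trace)"
      by (rule trace_push[OF trace_paracyclic functor_fcomp[OF G H]])
    have "trace_iso coned (push_trace (fcomp ?H ?G) paracyclic_trace) (push_trace ?H ?s) (\<lambda>F. FAr ?H (straighten C ?s F))"
      using trace_iso_push[OF trace_push[OF trace_paracyclic G] s \<mu> H] unfolding push_fcomp .
    from trace_iso_trans[OF tHG trace_push[OF s H] trace_paracyclic this \<nu>]
    have "trace_iso coned (push_trace (fcomp ?H ?G) paracyclic_trace) (push_trace fid paracyclic_trace)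
        (\<lambda>F. Cmp coned (\<nu> F) (FAr ?H (straighten C ?s F)))" unfolding push_fid .
    from paracyclic_trace_unique[OF functor_fcomp[OF G H] functor_fid[OF category_coned] this]
    obtain \<epsilon> where \<epsilon>: "nat_iso coned coned (fcomp ?H ?G) fid \<epsilon>" by blast
    have "equivalent_cats C coned" unfolding equivalent_cats_def using H G \<eta> \<epsilon> by blast
    moreover have "initial_ob C (TOb ?s (fgs 0))"
    proof (rule equivalence_initial[OF H G \<eta> s.t_ob[OF endo_gf(2)] coned_initial])
      show "in_hom coned (\<nu> (fgs 0)) (FOb ?H (TOb ?s (fgs 0))) (Some None)" "is_iso coned (\<nu> (fgs 0))"
        using trace_isoD(1-4)[OF \<nu> endo_gf(2)[of 0]] by (simp_all add: in_hom_def paracyclic_trace_sel trace_ob_def)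
      show "in_hom C (straighten C ?s (fgs 0)) (FOb ?G (Some None)) (TOb ?s (fgs 0))" "is_iso C (straighten C ?s (fgs 0))"
        using trace_isoD(1-4)[OF \<mu> endo_gf(2)[of 0]] by (simp_all add: in_hom_def paracyclic_trace_sel trace_ob_def)
    qed
    moreover have "terminal_ob C (TOb ?s (gfs 0))"
    proof (rule equivalence_terminal[OF H G \<eta> s.t_ob[OF endo_gf(1)] coned_terminal])
      show "in_hom coned (\<nu> (gfs 0)) (FOb ?H (TOb ?s (gfs 0))) None" "is_iso coned (\<nu> (gfs 0))"
        using trace_isoD(1-4)[OF \<nu> endo_gf(1)[of 0]] by (simp_all add: in_hom_def paracyclic_trace_sel trace_ob_def)
      show "in_hom C (straighten C ?s (gfs 0)) (FOb ?G None) (TOb ?s (gfs 0))" "is_iso C (straighten C ?s (gfs 0))"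
        using trace_isoD(1-4)[OF \<mu> endo_gf(1)[of 0]] by (simp_all add: in_hom_def paracyclic_trace_sel trace_ob_def)
    qed
    ultimately show ?thesis by (simp add: trace_of_def gf_unit)
  qed
  moreover have "in_hom C h (hh_ob L (adj_unit Ob0)) (hh_ob L (adj_unit Ob1)) \<longleftrightarrow> h = universal_euler_char C L"
    if C: "is_biHH adj C L" and i: "initial_ob C (hh_ob L (adj_unit Ob0))" and t: "terminal_ob C (hh_ob L (adj_unit Ob1))"
    for C :: "('c, 'd) cat" and L h
    using universal_euler_char_hom[OF biHH_cocone[OF C]] i t unfolding initial_ob_def terminal_ob_def by blast
  ultimately show ?thesis using T by blast
qed

end
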